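(* Let $\alpha>0$, let $\nu_*$ be a probability measure on $[\alpha,\infty[$, and let $Q_0^{\nu_*}$ be the probability measure on $(\Omega,\mathcal{F}_\infty)$ such that $Q_0^{\nu_*}(\Gamma_t)=E_0[1_{\Gamma_t}M_t^{\nu_*}]$ for all $t\ge0$, $\Gamma_t\in\mathcal{F}_t$, where $$M_t^{\nu_*}=\int_{X_t^*}^\infty\Big(1-\frac{|X_t|}{a}\Big)e^{L_t^0/a}\,\nu_*(da).$$ 1. Under $Q_0^{\nu_*}$, $L_\infty^0$ is infinite, $X_\infty^*$ is a finite random variable, and the distribution of $X_\infty^*$ is $\nu_*$. 2. For any $t>0$, under $Q_0^{\nu_*}$, $|X_t|<X_\infty^*$. 3. Let $(\mathcal{G}_t)$ be the smallest filtration satisfying the usual conditions such that for any $t\ge0$, $\mathcal{G}_t$ contains $\mathcal{F}_t\vee\sigma(X_\infty^* )$. Then there exists a $(Q_0^{\nu_*},(\mathcal{G}_t))$-Brownian motion $(\widetilde{B}_t)_{t\ge0}$ started at $0$ such that $$X_t=\widetilde{B}_t-\int_0^t\frac{\mathrm{sgn}(X_s)}{X_\infty^*-|X_s|}\,ds.$$ Moreover $$X_\infty^*-|X_t|=X_\infty^*+\widehat{B}_t+\int_0^t\frac{ds}{X_\infty^*-|X_s|}-L_t^0,$$ where $(\widehat{B}_t)_{t\ge0}$ is the $(Q_0^{\nu_*},(\mathcal{G}_t))$-Brownian motion $\widehat{B}_t=-\int_0^t\mathrm{sgn}(X_s)\,d\widetilde{B}_s$.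
   Context: $\Omega=\mathcal{C}(\mathbb{R}_+,\mathbb{R})$ is the canonical space, $(X_t)_{t\ge0}$ the coordinate process, $\mathcal{F}_t=\sigma(X_s;0\le s\le t)$, $\mathcal{F}_\infty=\sigma(X_s;s\ge0)$; $P_0$ is the Wiener measure started at $0$, with expectation $E_0$. $X_t^*=\sup_{0\le u\le t}|X_u|$, $X_\infty^*=\sup_{u\ge0}|X_u|$. $(L_t^0)$ is the local time at $0$ of $(X_t)$, normalized so that $|X_t|-L_t^0$ is a $P_0$-martingale; $L_\infty^0=\lim_{t\to\infty}L_t^0$. The process $(M_t^{\nu_*})$ is a $P_0$-martingale with $M_0^{\nu_*}=1$. *)

theory Defs
  imports "HOL-Probability.Probability"
begin

section \<open>Canonical space\<close>

type_synonym path = "real \<Rightarrow> real"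

text \<open>Paths are \<^const>\<open>extensional\<close> on \<open>{0..}\<close>, so that each continuous function on the half-line
  is represented exactly once.\<close>

definition path_space :: "path set" where
  "path_space = {\<omega> \<in> extensional {0..}. continuous_on {0..} \<omega>}"

definition coord :: "real \<Rightarrow> path \<Rightarrow> real" where
  "coord t \<omega> = \<omega> t"

text \<open>Time is indexed by \<^typ>\<open>real\<close>; indices \<open>t < 0\<close> are meaningless everywhere below.\<close>

definition canon_filt :: "real \<Rightarrow> path measure" where
  "canon_filt t = sigma path_space
     {coord s -` A \<inter> path_space | s A. s \<in> {0..t} \<and> A \<in> sets borel}"

definition canon_alg :: "path measure" where
  "canon_alg = sigma path_space
     {coord s -` A \<inter> path_space | s A. s \<in> {0..} \<and> A \<in> sets borel}"

definition run_max :: "real \<Rightarrow> path \<Rightarrow> real" where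
  "run_max t \<omega> = (SUP u\<in>{0..t}. \<bar>coord u \<omega>\<bar>)"

definition total_max :: "path \<Rightarrow> ereal" where
  "total_max \<omega> = (SUP u\<in>{0..}. ereal \<bar>coord u \<omega>\<bar>)"

section \<open>Processes with respect to a filtration\<close>

definition martingale_wrt ::
  "'a measure \<Rightarrow> (real \<Rightarrow> 'a measure) \<Rightarrow> (real \<Rightarrow> 'a \<Rightarrow> real) \<Rightarrow> bool" where
  "martingale_wrt P G Y \<longleftrightarrow>
     prob_space P \<and> filtration (space P) G \<and> (\<forall>t\<ge>0. subalgebra P (G t)) \<and>
     (\<forall>t\<ge>0. Y t \<in> borel_measurable (G t) \<and> integrable P (Y t)) \<and>
     (\<forall>s t. 0 \<le> s \<longrightarrow> s \<le> t \<longrightarrow> (AE \<omega> in P. real_cond_exp P (G s) (Y t) \<omega> = Y s \<omega>))"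

definition brownian_motion_wrt ::
  "'a measure \<Rightarrow> (real \<Rightarrow> 'a measure) \<Rightarrow> (real \<Rightarrow> 'a \<Rightarrow> real) \<Rightarrow> bool" where
  "brownian_motion_wrt P G B \<longleftrightarrow>
     prob_space P \<and> filtration (space P) G \<and> (\<forall>t\<ge>0. subalgebra P (G t)) \<and>
     (\<forall>t\<ge>0. B t \<in> borel_measurable (G t)) \<and>
     (\<forall>\<omega>\<in>space P. continuous_on {0..} (\<lambda>t. B t \<omega>)) \<and>
     (AE \<omega> in P. B 0 \<omega> = 0) \<and>
     (\<forall>s t. 0 \<le> s \<longrightarrow> s < t \<longrightarrow>
        distributed P lborel (\<lambda>\<omega>. B t \<omega> - B s \<omega>) (normal_density 0 (sqrt (t - s))) \<and>
        prob_space.indep_set P (sets (G s))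
          {(\<lambda>\<omega>. B t \<omega> - B s \<omega>) -` A \<inter> space P | A. A \<in> sets borel})"

text \<open>The usual conditions on the completion of \<open>P\<close>: right-continuity, and every \<open>G t\<close> contains
  all subsets of \<open>P\<close>-null sets. The \<open>G t\<close> are therefore sub-\<open>\<sigma>\<close>-algebras of
  \<^term>\<open>completion P\<close>, in general not of \<open>P\<close>.\<close>

definition usual_conditions :: "'a measure \<Rightarrow> (real \<Rightarrow> 'a measure) \<Rightarrow> bool" where
  "usual_conditions P G \<longleftrightarrow>
     filtration (space P) G \<and>
     (\<forall>t\<ge>0. subalgebra (completion P) (G t) \<and> null_sets (completion P) \<subseteq> sets (G t) \<and>
        (\<Inter>s\<in>{t<..}. sets (G s)) = sets (G t))"

definition is_enlarged_filtration ::
  "path measure \<Rightarrow> (real \<Rightarrow> path measure) \<Rightarrow> bool" where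
  "is_enlarged_filtration Q G \<longleftrightarrow>
     (let admissible = (\<lambda>H. usual_conditions Q H \<and>
            (\<forall>t\<ge>0. sigma_sets path_space
               (sets (canon_filt t) \<union> sets (vimage_algebra path_space total_max borel))
                 \<subseteq> sets (H t)))
      in admissible G \<and> (\<forall>H. admissible H \<longrightarrow> (\<forall>t\<ge>0. sets (G t) \<subseteq> sets (H t))))"

section \<open>Stochastic integral\<close>

text \<open>The simple process with data \<open>(n, \<tau>, \<xi>)\<close> is
  \<open>\<Sum>i<n. \<xi> i \<cdot> 1\<^bsub>(\<tau> i, \<tau> (i + 1)]\<^esub>\<close>.\<close>

definition simple_data ::
  "(real \<Rightarrow> 'a measure) \<Rightarrow> nat \<Rightarrow> (nat \<Rightarrow> real) \<Rightarrow> (nat \<Rightarrow> 'a \<Rightarrow> real) \<Rightarrow> bool" where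
  "simple_data G n \<tau> \<xi> \<longleftrightarrow>
     0 \<le> \<tau> 0 \<and> (\<forall>i<n. \<tau> i \<le> \<tau> (Suc i)) \<and>
     (\<forall>i<n. \<xi> i \<in> borel_measurable (G (\<tau> i)) \<and>
        (\<exists>C. \<forall>\<omega>\<in>space (G (\<tau> i)). \<bar>\<xi> i \<omega>\<bar> \<le> C))"

definition simple_process ::
  "nat \<Rightarrow> (nat \<Rightarrow> real) \<Rightarrow> (nat \<Rightarrow> 'a \<Rightarrow> real) \<Rightarrow> real \<Rightarrow> 'a \<Rightarrow> real" where
  "simple_process n \<tau> \<xi> s \<omega> = (\<Sum>i<n. \<xi> i \<omega> * indicator {\<tau> i<..\<tau> (Suc i)} s)"

definition simple_integral ::
  "(real \<Rightarrow> 'a \<Rightarrow> real) \<Rightarrow> nat \<Rightarrow> (nat \<Rightarrow> real) \<Rightarrow> (nat \<Rightarrow> 'a \<Rightarrow> real) \<Rightarrow> real \<Rightarrow> 'a \<Rightarrow> real" where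
  "simple_integral B n \<tau> \<xi> t \<omega> =
     (\<Sum>i<n. \<xi> i \<omega> * (B (min t (\<tau> (Suc i))) \<omega> - B (min t (\<tau> i)) \<omega>))"

text \<open>\<open>is_ito_integral P G B H I\<close>: for progressively measurable \<open>H\<close>, square-integrable on every
  bounded time interval, \<open>I\<close> is a continuous version of the stochastic integral of \<open>H\<close> against the
  Brownian motion \<open>B\<close>. As usual it is the \<open>L\<^sup>2\<close>-limit of integrals of simple processes;
  \<open>I\<close> is unique up to indistinguishability.\<close>

definition is_ito_integral ::
  "'a measure \<Rightarrow> (real \<Rightarrow> 'a measure) \<Rightarrow> (real \<Rightarrow> 'a \<Rightarrow> real) \<Rightarrow> (real \<Rightarrow> 'a \<Rightarrow> real) \<Rightarrow>
     (real \<Rightarrow> 'a \<Rightarrow> real) \<Rightarrow> bool" where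
  "is_ito_integral P G B H I \<longleftrightarrow>
     brownian_motion_wrt P G B \<and>
     (\<forall>t\<ge>0. (\<lambda>(s, \<omega>). H s \<omega>) \<in> borel_measurable (restrict_space borel {0..t} \<Otimes>\<^sub>M G t)) \<and>
     (\<forall>t\<ge>0. (\<integral>\<^sup>+\<omega>. (\<integral>\<^sup>+s\<in>{0..t}. ennreal ((H s \<omega>)\<^sup>2) \<partial>lborel) \<partial>P) < \<infinity>) \<and>
     (\<forall>t\<ge>0. I t \<in> borel_measurable (G t)) \<and>
     (\<forall>\<omega>\<in>space P. continuous_on {0..} (\<lambda>t. I t \<omega>)) \<and>
     (\<exists>n \<tau> \<xi>. (\<forall>k. simple_data G (n k) (\<tau> k) (\<xi> k)) \<and>
        (\<forall>t\<ge>0.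
           (\<lambda>k. \<integral>\<^sup>+\<omega>. (\<integral>\<^sup>+s\<in>{0..t}.
                  ennreal ((simple_process (n k) (\<tau> k) (\<xi> k) s \<omega> - H s \<omega>)\<^sup>2) \<partial>lborel) \<partial>P)
             \<longlonglongrightarrow> 0 \<and>
           (\<lambda>k. \<integral>\<^sup>+\<omega>. ennreal ((simple_integral B (n k) (\<tau> k) (\<xi> k) t \<omega> - I t \<omega>)\<^sup>2) \<partial>P)
             \<longlonglongrightarrow> 0))"

section \<open>Wiener measure, local time at zero and the density process\<close>

definition is_wiener_measure :: "path measure \<Rightarrow> bool" where
  "is_wiener_measure P \<longleftrightarrow>
     sets P = sets canon_alg \<and> brownian_motion_wrt P canon_filt coord"

text \<open>Local time at \<open>0\<close> as occupation density: it is determined up to a multiplicative constant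
  \<open>c\<close> by the third clause, and the constant is fixed by the martingale normalization in the fourth.
  Adaptedness is to the raw (uncompleted) filtration: measures that are absolutely continuous with
  respect to \<open>P\<close> on every \<^term>\<open>canon_filt t\<close> may be singular to \<open>P\<close> on \<^const>\<open>canon_alg\<close>, so
  modifying \<open>L\<close> on arbitrary \<open>P\<close>-null sets is not harmless.\<close>

definition is_local_time_0 :: "path measure \<Rightarrow> (real \<Rightarrow> path \<Rightarrow> real) \<Rightarrow> bool" where
  "is_local_time_0 P L \<longleftrightarrow>
     (\<forall>t\<ge>0. L t \<in> borel_measurable (canon_filt t)) \<and>
     (AE \<omega> in P. L 0 \<omega> = 0 \<and> continuous_on {0..} (\<lambda>t. L t \<omega>) \<and>
        mono_on {0..} (\<lambda>t. L t \<omega>)) \<and>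
     (\<exists>c>0. AE \<omega> in P. \<forall>t\<ge>0.
        ((\<lambda>\<epsilon>. c / \<epsilon> * measure lborel {s \<in> {0..t}. \<bar>coord s \<omega>\<bar> \<le> \<epsilon>}) \<longlongrightarrow> L t \<omega>) (at_right 0)) \<and>
     martingale_wrt P canon_filt (\<lambda>t \<omega>. \<bar>coord t \<omega>\<bar> - L t \<omega>)"

definition density_process ::
  "(real \<Rightarrow> path \<Rightarrow> real) \<Rightarrow> real measure \<Rightarrow> real \<Rightarrow> path \<Rightarrow> real" where
  "density_process L \<nu> t \<omega> =
     (LINT a:{run_max t \<omega>..}|\<nu>. (1 - \<bar>coord t \<omega>\<bar> / a) * exp (L t \<omega> / a))"

end

theory Submission
  imports Defs
begin

text \<open>For a level \<open>a\<close> put \<open>M a t = (1 - \<bar>X\<^sub>t\<bar> / a) exp (L\<^sub>t / a)\<close> while the running maximum is below \<open>a\<close>, and 0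
  afterwards. Then \<open>Q\<close> is on every \<open>\<F> t\<close> the mixture over \<open>\<nu>\<close> of the measures \<open>M a t \<cdot> P0\<close>. Each \<open>M a\<close> has mass at
  most 1, and the mixture has mass 1, so \<open>M a\<close> is a martingale for almost every \<open>a\<close>; the total maximum of the
  \<open>a\<close>-component is \<open>a\<close> because the part of \<open>M a\<close> carried by paths staying below \<open>c < a\<close> dies out.

  No stochastic calculus is needed. On a uniform grid, the exponential density with drift kernel
  \<open>- sgn x / (a - \<bar>x\<bar>)\<close> satisfies an exact Girsanov identity; a second-order expansion of \<open>ln (a - \<bar>x\<bar>)\<close>
  and an \<open>L\<^sup>2\<close> version of Tanaka's formula (from the occupation density and the martingale \<open>\<bar>X\<bar> - L\<close>)
  identify its limit with \<open>M a\<close>. The error in the limit is controlled by the lost mass, which is zero.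
  This yields the conditional characteristic function of the increments of \<open>Bt\<close> given the past and the
  total maximum. For the second Brownian motion, integrals of \<open>\<plusminus>1\<close>-valued simple processes against a
  Brownian motion are again Brownian motions, and they converge to \<open>\<bar>X\<bar> - L\<close> plus the rate integral.\<close>

text \<open>What holds \<open>P0\<close>-almost surely cannot be used under \<open>Q\<close> as it
  stands: the two measures are related only on each \<open>\<F> t\<close>, and on the whole
  \<open>canon_alg\<close> they are singular, because Brownian paths are unbounded. Null events are
  therefore first pushed down to a finite horizon, which is possible because \<open>L\<close> is
  adapted to the raw filtration. The second obstacle is that the drift kernel explodes at |x| = a.
  It is cut off at some b < a, which makes it bounded; all limits are taken on the event that the
  running maximum stays below b, and b rises to a only after the exact discrete identity has been
  turned into an inequality. Conditioning on the total maximum is done without conditional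
  expectations. The pair (path up to t, total maximum) has under \<open>Q\<close> an explicit
  density with respect to the product of \<open>P0\<close> and \<nu>, and every event of the
  enlarged filtration just before s+ is, up to a null set, an event about this pair. A level a can
  then be frozen, and the random total maximum is substituted for it at the end.\<close>

abbreviation \<F> :: "real \<Rightarrow> path measure" where "\<F> \<equiv> canon_filt"

lemma continuous_on_atLeast_of_compacts:
  fixes f :: "real \<Rightarrow> real"
  assumes "\<And>T. 0 \<le> T \<Longrightarrow> continuous_on {0..T} f"
  shows "continuous_on {0..} f"
proof -
  have "continuous (at x within {0..}) f" if x: "0 \<le> x" for x
  proof -
    have "continuous (at x within {0..x+1}) f"
      using assms[of "x+1"] x by (auto simp: continuous_on_eq_continuous_within)
    moreover have "at x within {0..} = at x within {0..x+1}"
      by (rule at_within_nhd[of x "{..<x+1}"]) auto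
    ultimately show ?thesis by simp
  qed
  then show ?thesis by (auto simp: continuous_on_eq_continuous_within)
qed

section \<open>The canonical space\<close>

lemma space_canon_filt [simp]: "space (\<F> t) = path_space"
  unfolding canon_filt_def by (rule space_measure_of) auto

lemma space_canon_alg [simp]: "space canon_alg = path_space"
  unfolding canon_alg_def by (rule space_measure_of) auto

lemma sets_canon_filt:
  "sets (\<F> t) = sigma_sets path_space
     {coord s -` A \<inter> path_space | s A. s \<in> {0..t} \<and> A \<in> sets borel}"
  unfolding canon_filt_def by (rule sets_measure_of) auto

lemma sets_canon_alg:
  "sets canon_alg = sigma_sets path_space
     {coord s -` A \<inter> path_space | s A. s \<in> {0..} \<and> A \<in> sets borel}"
  unfolding canon_alg_def by (rule sets_measure_of) auto

lemma canon_filt_mono: "s \<le> t \<Longrightarrow> sets (\<F> s) \<subseteq> sets (\<F> t)"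
  unfolding sets_canon_filt by (rule sigma_sets_mono') force

lemma canon_filt_subset_alg: "sets (\<F> t) \<subseteq> sets canon_alg"
  unfolding sets_canon_filt sets_canon_alg by (rule sigma_sets_mono') auto

lemma measurable_canon_filt_mono:
  "s \<le> t \<Longrightarrow> f \<in> measurable (\<F> s) N \<Longrightarrow> f \<in> measurable (\<F> t) N"
  using canon_filt_mono[of s t] by (auto simp: measurable_def)

lemma measurable_canon_filt_alg:
  "f \<in> measurable (\<F> s) N \<Longrightarrow> f \<in> measurable canon_alg N"
  using canon_filt_subset_alg[of s] by (auto simp: measurable_def)

lemma measurable_coord_filt: "0 \<le> s \<Longrightarrow> s \<le> t \<Longrightarrow> coord s \<in> borel_measurable (\<F> t)"
  by (rule measurableI) (auto simp: sets_canon_filt)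

lemma measurable_coord_alg [measurable]: "0 \<le> s \<Longrightarrow> coord s \<in> borel_measurable canon_alg"
  by (rule measurable_canon_filt_alg[OF measurable_coord_filt[of s s]]) auto

lemma path_continuous: "w \<in> path_space \<Longrightarrow> continuous_on {0..} (\<lambda>t. coord t w)"
  unfolding path_space_def coord_def by auto

lemma measurable_canon_alg_into:
  assumes "\<And>x. x \<in> space M \<Longrightarrow> f x \<in> path_space"
    and "\<And>s. 0 \<le> s \<Longrightarrow> (\<lambda>x. coord s (f x)) \<in> borel_measurable M"
  shows "f \<in> measurable M canon_alg"
proof (rule measurable_sigma_sets[OF sets_canon_alg])
  show "f \<in> space M \<rightarrow> path_space" using assms(1) by auto
  fix y assume "y \<in> {coord s -` A \<inter> path_space |s A. s \<in> {0..} \<and> A \<in> sets borel}"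
  then obtain s A where y: "y = coord s -` A \<inter> path_space" "0 \<le> s" "A \<in> sets borel" by auto
  have "f -` y \<inter> space M = (\<lambda>x. coord s (f x)) -` A \<inter> space M"
    using assms(1) y by auto
  then show "f -` y \<inter> space M \<in> sets M"
    using measurable_sets[OF assms(2)[OF y(2)] y(3)] by simp
qed auto

text \<open>Induction over the generated \<sigma>-algebra: no generator can tell apart two paths
  that agree on [0, t]. This will allow \<open>L\<close> to be evaluated on one path in place of
  another when almost sure statements move from \<open>P0\<close> to \<open>Q\<close>.\<close>

lemma canon_filt_sets_cong:
  assumes "A \<in> sets (\<F> t)" "w \<in> path_space" "w' \<in> path_space"
    and eq: "\<And>s. 0 \<le> s \<Longrightarrow> s \<le> t \<Longrightarrow> coord s w = coord s w'"
  shows "w \<in> A \<longleftrightarrow> w' \<in> A"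
  using assms(1)[unfolded sets_canon_filt]
proof induction
  case (Basic a)
  then show ?case using assms(2,3) eq by auto
next
  case (Compl a)
  then show ?case using assms(2,3) by auto
qed auto

lemma canon_filt_measurable_cong:
  fixes f :: "path \<Rightarrow> real"
  assumes f: "f \<in> borel_measurable (\<F> t)" and "w \<in> path_space" "w' \<in> path_space"
    and eq: "\<And>s. 0 \<le> s \<Longrightarrow> s \<le> t \<Longrightarrow> coord s w = coord s w'"
  shows "f w = f w'"
proof -
  have "f -` {f w} \<inter> space (\<F> t) \<in> sets (\<F> t)"
    by (rule measurable_sets[OF f]) auto
  from canon_filt_sets_cong[OF this assms(2,3) eq] assms(2,3) show ?thesis by auto
qed

text \<open>The path is the pointwise limit of its values at the times floor((k+1) s) / (k+1), of
  which there are countably many. Clamping time to [0, t] makes the map total in s while keeping it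
  within \<open>\<F> t\<close>.\<close>

lemma measurable_coord_joint:
  fixes t :: real
  assumes "0 \<le> t"
  shows "(\<lambda>(s, w). coord (max 0 (min s t)) w) \<in> borel_measurable (borel \<Otimes>\<^sub>M \<F> t)"
proof (rule borel_measurable_LIMSEQ_real)
  let ?c = "\<lambda>s. max 0 (min s t)"
  define F where "F k = (\<lambda>(s, w). coord (max 0 (min (of_int \<lfloor>real (Suc k) * ?c s\<rfloor> / real (Suc k)) t)) w)" for k
  show "F k \<in> borel_measurable (borel \<Otimes>\<^sub>M \<F> t)" for k
  proof -
    have "(\<lambda>p. (\<lambda>i p. coord (max 0 (min (of_int i / real (Suc k)) t)) (snd p)) (\<lfloor>real (Suc k) * ?c (fst p)\<rfloor>) p)
        \<in> borel_measurable (borel \<Otimes>\<^sub>M \<F> t)"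
    proof (rule measurable_compose_countable[where g="\<lambda>p. \<lfloor>real (Suc k) * ?c (fst p)\<rfloor>"
          and f="\<lambda>i p. coord (max 0 (min (of_int i / real (Suc k)) t)) (snd p)"])
      fix i :: int
      have "coord (max 0 (min (of_int i / real (Suc k)) t)) \<in> borel_measurable (\<F> t)"
        by (rule measurable_coord_filt) (use assms in auto)
      then show "(\<lambda>p. coord (max 0 (min (of_int i / real (Suc k)) t)) (snd p)) \<in> borel_measurable (borel \<Otimes>\<^sub>M \<F> t)"
        by (rule measurable_compose[OF measurable_snd])
    next
      show "(\<lambda>p. \<lfloor>real (Suc k) * ?c (fst p)\<rfloor>) \<in> measurable (borel \<Otimes>\<^sub>M \<F> t) (count_space UNIV)"
        by measurable
    qed
    then show ?thesis unfolding F_def by (simp add: case_prod_beta')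
  qed
  fix p :: "real \<times> path" assume "p \<in> space (borel \<Otimes>\<^sub>M \<F> t)"
  then obtain s w where p: "p = (s, w)" "w \<in> path_space" by (auto simp: space_pair_measure)
  have "(\<lambda>k. of_int \<lfloor>real (Suc k) * ?c s\<rfloor> / real (Suc k)) \<longlonglongrightarrow> ?c s"
  proof (rule tendsto_sandwich[of "\<lambda>k. ?c s - 1 / real (Suc k)" _ _ "\<lambda>k. ?c s"])
    show "\<forall>\<^sub>F k in sequentially. ?c s - 1 / real (Suc k) \<le> of_int \<lfloor>real (Suc k) * ?c s\<rfloor> / real (Suc k)"
    proof (rule always_eventually, rule allI)
      fix k
      have "real (Suc k) * ?c s - 1 \<le> of_int \<lfloor>real (Suc k) * ?c s\<rfloor>" by linarith
      then have "(real (Suc k) * ?c s - 1) / real (Suc k) \<le> of_int \<lfloor>real (Suc k) * ?c s\<rfloor> / real (Suc k)"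
        by (rule divide_right_mono) simp
      then show "?c s - 1 / real (Suc k) \<le> of_int \<lfloor>real (Suc k) * ?c s\<rfloor> / real (Suc k)"
        by (simp add: diff_divide_distrib)
    qed
    show "\<forall>\<^sub>F k in sequentially. of_int \<lfloor>real (Suc k) * ?c s\<rfloor> / real (Suc k) \<le> ?c s"
    proof (rule always_eventually, rule allI)
      fix k
      have "of_int \<lfloor>real (Suc k) * ?c s\<rfloor> \<le> real (Suc k) * ?c s" by linarith
      then have "of_int \<lfloor>real (Suc k) * ?c s\<rfloor> / real (Suc k) \<le> (real (Suc k) * ?c s) / real (Suc k)"
        by (rule divide_right_mono) simp
      then show "of_int \<lfloor>real (Suc k) * ?c s\<rfloor> / real (Suc k) \<le> ?c s" by simp
    qed
    have "(\<lambda>k. 1 / real (Suc k)) \<longlonglongrightarrow> 0" using LIMSEQ_inverse_real_of_nat by (simp add: inverse_eq_divide)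
    from tendsto_diff[OF tendsto_const[of "?c s"] this]
    show "(\<lambda>k. ?c s - 1 / real (Suc k)) \<longlonglongrightarrow> ?c s" by simp
  qed auto
  then have *: "(\<lambda>k. max 0 (min (of_int \<lfloor>real (Suc k) * ?c s\<rfloor> / real (Suc k)) t)) \<longlonglongrightarrow> max 0 (min (?c s) t)"
    by (intro tendsto_max tendsto_min tendsto_const)
  have "(\<lambda>k. coord (max 0 (min (of_int \<lfloor>real (Suc k) * ?c s\<rfloor> / real (Suc k)) t)) w) \<longlonglongrightarrow> coord (max 0 (min (?c s) t)) w"
    by (rule continuous_on_tendsto_compose[OF path_continuous[OF p(2)] *]) auto
  moreover have "max 0 (min (?c s) t) = ?c s" using assms by auto
  ultimately show "(\<lambda>k. F k p) \<longlonglongrightarrow> (case p of (s, w) \<Rightarrow> coord (?c s) w)"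
    unfolding F_def p by simp
qed

section \<open>Running and total maximum\<close>

lemma run_max_bdd: "w \<in> path_space \<Longrightarrow> bdd_above ((\<lambda>u. \<bar>coord u w\<bar>) ` {0..t})"
proof -
  assume "w \<in> path_space"
  then have "continuous_on {0..t} (\<lambda>u. \<bar>coord u w\<bar>)"
    by (intro continuous_on_rabs continuous_on_subset[OF path_continuous]) auto
  from compact_continuous_image[OF this] have "compact ((\<lambda>u. \<bar>coord u w\<bar>) ` {0..t})" by auto
  then show ?thesis by (meson bounded_imp_bdd_above compact_imp_bounded)
qed

lemma abs_coord_le_run_max: "w \<in> path_space \<Longrightarrow> 0 \<le> u \<Longrightarrow> u \<le> t \<Longrightarrow> \<bar>coord u w\<bar> \<le> run_max t w"
  unfolding run_max_def by (rule cSUP_upper) (auto intro: run_max_bdd)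

lemma run_max_le_iff: "w \<in> path_space \<Longrightarrow> 0 \<le> t \<Longrightarrow> run_max t w \<le> c \<longleftrightarrow> (\<forall>u\<in>{0..t}. \<bar>coord u w\<bar> \<le> c)"
  unfolding run_max_def by (subst cSUP_le_iff) (auto intro: run_max_bdd)

lemma run_max_mono: "w \<in> path_space \<Longrightarrow> 0 \<le> s \<Longrightarrow> s \<le> t \<Longrightarrow> run_max s w \<le> run_max t w"
  by (subst run_max_le_iff) (auto intro: abs_coord_le_run_max)

lemma run_max_attained:
  assumes "w \<in> path_space" "0 \<le> t"
  shows "\<exists>u\<in>{0..t}. run_max t w = \<bar>coord u w\<bar>"
proof -
  have "continuous_on {0..t} (\<lambda>u. \<bar>coord u w\<bar>)"
    using assms by (intro continuous_on_rabs continuous_on_subset[OF path_continuous]) auto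
  from continuous_attains_sup[OF _ _ this] assms(2)
  obtain u where u: "u \<in> {0..t}" "\<And>v. v \<in> {0..t} \<Longrightarrow> \<bar>coord v w\<bar> \<le> \<bar>coord u w\<bar>" by auto
  then have "run_max t w = \<bar>coord u w\<bar>"
    using assms abs_coord_le_run_max[of w u t] run_max_le_iff[of w t "\<bar>coord u w\<bar>"] by (auto intro!: antisym)
  with u show ?thesis by auto
qed

text \<open>Rational multiples of t instead of rational times: they are countable and dense in
  [0, t], and they contain the endpoint t even when t is irrational.\<close>

lemma continuous_le_on_rat_multiples:
  fixes f :: "real \<Rightarrow> real"
  assumes f: "continuous_on {0..t} f" and "0 \<le> t"
    and le: "\<And>q::rat. of_rat q \<in> {0..1::real} \<Longrightarrow> f (of_rat q * t) \<le> c" and u: "u \<in> {0..t}"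
  shows "f u \<le> c"
proof (cases "t = 0")
  case True
  then show ?thesis using le[of 0] u by auto
next
  case False
  with \<open>0 \<le> t\<close> have t: "0 < t" by auto
  define D where "D = {0..1} \<inter> range (of_rat :: rat \<Rightarrow> real)"
  have cl: "{0..1::real} \<subseteq> closure D"
  proof
    fix x :: real assume x: "x \<in> {0..1}"
    show "x \<in> closure D" unfolding closure_approachable
    proof (intro allI impI)
      fix e :: real assume e: "0 < e"
      define a where "a = max 0 (x - e/2)" define b where "b = min 1 (x + e/2)"
      have "a < b" using x e by (auto simp: a_def b_def)
      from of_rat_dense[OF this] obtain q where "a < of_rat q" "of_rat q < b" by auto
      then show "\<exists>y\<in>D. dist y x < e" using x e
        by (intro bexI[of _ "of_rat q"]) (auto simp: a_def b_def D_def dist_real_def)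
    qed
  qed
  have c1: "continuous_on {0..1} (\<lambda>x. f (x * t))"
    by (rule continuous_on_compose2[OF f]) (use t in \<open>auto intro!: continuous_intros simp: mult_left_le_one_le\<close>)
  have cD: "closure D = {0..1}"
    using cl closure_minimal[of D "{0..1}"] by (auto simp: D_def)
  have "u / t \<in> {0..1}" using u t by auto
  then have "f ((u/t) * t) \<le> c"
    by (intro continuous_le_on_closure[of D "\<lambda>x. f (x * t)" "u/t" c])
      (use c1 cD le in \<open>auto simp: D_def\<close>)
  then show ?thesis using t by auto
qed

text \<open>A general continuous f is wanted because there are two uses: \<open>abs\<close> for the
  running maximum, and x |-> \<sigma> x for the one-sided maxima in
  \<open>run_max_ne_const\<close>.\<close>

lemma measurable_SUP_coord:
  assumes f: "continuous_on UNIV f" and t: "0 \<le> t"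
  shows "(\<lambda>w. SUP u\<in>{0..t}. f (coord u w) :: real) \<in> borel_measurable (\<F> t)"
proof (rule borel_measurableI_le)
  fix c :: real
  have cont: "continuous_on {0..t} (\<lambda>u. f (coord u w))" if "w \<in> path_space" for w
    by (rule continuous_on_compose2[OF f]) (use that in \<open>auto intro: continuous_on_subset[OF path_continuous]\<close>)
  have bdd: "bdd_above ((\<lambda>u. f (coord u w)) ` {0..t})" if "w \<in> path_space" for w
    using compact_continuous_image[OF cont[OF that]] by (meson bounded_imp_bdd_above compact_Icc compact_imp_bounded)
  have "{w \<in> space (\<F> t). (SUP u\<in>{0..t}. f (coord u w)) \<le> c} =
     {w \<in> space (\<F> t). \<forall>q::rat. of_rat q \<in> {0..1::real} \<longrightarrow> f (coord (of_rat q * t) w) \<le> c}"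
  proof safe
    fix w and q :: rat assume "w \<in> space (\<F> t)" "(SUP u\<in>{0..t}. f (coord u w)) \<le> c" "of_rat q \<in> {0..1::real}"
    then show "f (coord (of_rat q * t) w) \<le> c"
      using cSUP_upper[OF _ bdd, of "of_rat q * t" w] t by (auto simp: mult_left_le_one_le)
  next
    fix w assume w: "w \<in> space (\<F> t)"
      and *: "\<forall>q::rat. of_rat q \<in> {0..1::real} \<longrightarrow> f (coord (of_rat q * t) w) \<le> c"
    from w have "continuous_on {0..t} (\<lambda>u. f (coord u w))" by (intro cont) auto
    from continuous_le_on_rat_multiples[OF this t] * show "(SUP u\<in>{0..t}. f (coord u w)) \<le> c"
      using t by (intro cSUP_least) auto
  qed
  also have "\<dots> \<in> sets (\<F> t)"
  proof (rule sets.sets_Collect_countable_All)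
    fix q :: rat
    show "{w \<in> space (\<F> t). of_rat q \<in> {0..1::real} \<longrightarrow> f (coord (of_rat q * t) w) \<le> c} \<in> sets (\<F> t)"
    proof (cases "of_rat q \<in> {0..1::real}")
      case True
      then have [measurable]: "coord (of_rat q * t) \<in> borel_measurable (\<F> t)"
        using t by (intro measurable_coord_filt) (auto simp: mult_left_le_one_le)
      have [measurable]: "f \<in> borel_measurable borel" using f by (rule borel_measurable_continuous_onI)
      show ?thesis by measurable
    qed (use sets.top[of "\<F> t"] in auto)
  qed
  finally show "{w \<in> space (\<F> t). (SUP u\<in>{0..t}. f (coord u w)) \<le> c} \<in> sets (\<F> t)" .
qed

lemma measurable_run_max: "0 \<le> t \<Longrightarrow> run_max t \<in> borel_measurable (\<F> t)"
  using measurable_SUP_coord[of abs t] by (simp add: run_max_def[abs_def] continuous_intros)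

lemma total_max_le_iff: "w \<in> path_space \<Longrightarrow> total_max w \<le> ereal c \<longleftrightarrow> (\<forall>n::nat. run_max (real n) w \<le> c)"
proof -
  assume w: "w \<in> path_space"
  have "total_max w \<le> ereal c \<longleftrightarrow> (\<forall>u\<in>{0..}. \<bar>coord u w\<bar> \<le> c)"
    unfolding total_max_def by (auto simp: SUP_le_iff)
  also have "\<dots> \<longleftrightarrow> (\<forall>n::nat. run_max (real n) w \<le> c)"
  proof safe
    fix u assume "\<forall>n. run_max (real n) w \<le> c" "0 \<le> (u::real)"
    moreover obtain n where "u \<le> real n" using real_arch_simple by blast
    ultimately show "\<bar>coord u w\<bar> \<le> c" using abs_coord_le_run_max[OF w, of u "real n"] by (meson order_trans)
  qed (auto simp: run_max_le_iff[OF w])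
  finally show ?thesis .
qed

lemma total_max_eq_SUP: "w \<in> path_space \<Longrightarrow> total_max w = (SUP n::nat. ereal (run_max (real n) w))"
proof (rule antisym)
  assume w: "w \<in> path_space"
  show "total_max w \<le> (SUP n. ereal (run_max (real n) w))"
    unfolding total_max_def
  proof (rule SUP_least)
    fix u :: real assume "u \<in> {0..}"
    moreover obtain n where "u \<le> real n" using real_arch_simple by blast
    ultimately show "ereal \<bar>coord u w\<bar> \<le> (SUP n. ereal (run_max (real n) w))"
      using abs_coord_le_run_max[OF w, of u "real n"] by (intro SUP_upper2[of n]) auto
  qed
  show "(SUP n. ereal (run_max (real n) w)) \<le> total_max w"
  proof (rule SUP_least)
    fix n :: nat
    obtain u where "u \<in> {0..real n}" "run_max (real n) w = \<bar>coord u w\<bar>"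
      using run_max_attained[OF w, of "real n"] by auto
    then show "ereal (run_max (real n) w) \<le> total_max w"
      unfolding total_max_def by (intro SUP_upper2[of u]) auto
  qed
qed

lemma measurable_total_max [measurable]: "total_max \<in> borel_measurable canon_alg"
proof -
  have [measurable]: "run_max (real n) \<in> borel_measurable canon_alg" for n
    by (rule measurable_canon_filt_alg[OF measurable_run_max]) simp
  have "(\<lambda>w. SUP n::nat. ereal (run_max (real n) w)) \<in> borel_measurable canon_alg"
    by measurable
  then show ?thesis by (subst measurable_cong[OF total_max_eq_SUP]) auto
qed

section \<open>Centred Gaussian measures\<close>

definition gauss :: "real \<Rightarrow> real measure" where
  "gauss h = density lborel (\<lambda>x. ennreal (normal_density 0 (sqrt h) x))"

lemma sets_gauss [simp, measurable_cong]: "sets (gauss h) = sets borel"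
  and space_gauss [simp]: "space (gauss h) = UNIV"
  by (simp_all add: gauss_def)

lemma prob_space_gauss: "0 < h \<Longrightarrow> prob_space (gauss h)"
  unfolding gauss_def by (rule prob_space_normal_density) simp

lemma integral_gauss:
  fixes f :: "real \<Rightarrow> 'b::{banach, second_countable_topology}"
  assumes "f \<in> borel_measurable borel"
  shows "(\<integral>x. f x \<partial>gauss h) = (\<integral>x. normal_density 0 (sqrt h) x *\<^sub>R f x \<partial>lborel)"
  unfolding gauss_def using assms by (intro integral_density) auto

lemma integrable_gauss:
  fixes f :: "real \<Rightarrow> 'b::{banach, second_countable_topology}"
  assumes "f \<in> borel_measurable borel"
  shows "integrable (gauss h) f \<longleftrightarrow> integrable lborel (\<lambda>x. normal_density 0 (sqrt h) x *\<^sub>R f x)"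
  unfolding gauss_def using assms by (intro integrable_density) auto

lemma gauss_power_integrable: "0 < h \<Longrightarrow> integrable (gauss h) (\<lambda>x. x ^ k)"
  using integrable_normal_moment[of "sqrt h" 0 k] by (subst integrable_gauss) auto

lemma gauss_mean: "0 < h \<Longrightarrow> (\<integral>x. x \<partial>gauss h) = 0"
  using integral_normal_moment_odd[of "sqrt h" 0 0] by (subst integral_gauss) auto

lemma gauss_power2: "0 < h \<Longrightarrow> (\<integral>x. x\<^sup>2 \<partial>gauss h) = h"
  using integral_normal_moment_even[of "sqrt h" 0 1] by (subst integral_gauss) (auto simp: power2_eq_square)

lemma gauss_power4: "0 < h \<Longrightarrow> (\<integral>x. x^4 \<partial>gauss h) = 3 * h\<^sup>2"
  using integral_normal_moment_even[of "sqrt h" 0 2]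
  by (subst integral_gauss) (auto simp: fact_numeral power_divide field_simps eval_nat_numeral)

lemma gauss_abs_power3:
  assumes "0 < h"
  shows "integrable (gauss h) (\<lambda>x. \<bar>x\<bar>^3)" "(\<integral>x. \<bar>x\<bar>^3 \<partial>gauss h) \<le> 2 * h * sqrt h"
proof -
  have eq: "sqrt h ^ (2 * 1 + 1) = h * sqrt h" using assms by (simp add: eval_nat_numeral)
  show "integrable (gauss h) (\<lambda>x. \<bar>x\<bar>^3)"
    using integrable_normal_moment_abs[of "sqrt h" 0 3] assms by (subst integrable_gauss) auto
  have "(\<integral>x. \<bar>x\<bar>^3 \<partial>gauss h) = 2 * (h * sqrt h) * sqrt (2 / pi)"
    using integral_normal_moment_abs_odd[of "sqrt h" 0 1] assms eq
    by (subst integral_gauss) (auto simp: eval_nat_numeral)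
  also have "\<dots> \<le> 2 * (h * sqrt h) * 1"
    using assms pi_gt3 by (intro mult_left_mono) (auto simp: real_sqrt_le_1_iff)
  finally show "(\<integral>x. \<bar>x\<bar>^3 \<partial>gauss h) \<le> 2 * h * sqrt h" by simp
qed

text \<open>The density is at most 1 / sqrt(2 pi h), the interval has length 2 e, and 2 <= sqrt(2
  pi). The bound is uniform in the centre c, so it can be used conditionally on the past.\<close>

lemma gauss_small_ball:
  assumes "0 < h" "0 \<le> e"
  shows "emeasure (gauss h) {x. \<bar>c + x\<bar> \<le> e} \<le> ennreal (e / sqrt h)"
proof -
  have eq: "{x. \<bar>c + x\<bar> \<le> e} = {-c-e..-c+e}" by (auto simp: abs_le_iff)
  have "emeasure (gauss h) {x. \<bar>c + x\<bar> \<le> e} = (\<integral>\<^sup>+x. ennreal (normal_density 0 (sqrt h) x) * indicator {-c-e..-c+e} x \<partial>lborel)"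
    unfolding eq gauss_def by (subst emeasure_density) auto
  also have "\<dots> \<le> (\<integral>\<^sup>+x. ennreal (1 / sqrt (2 * pi * h)) * indicator {-c-e..-c+e} x \<partial>lborel)"
    using assms by (intro nn_integral_mono mult_right_mono ennreal_leI)
      (auto simp: normal_density_def real_sqrt_mult intro!: divide_right_mono mult_left_le)
  also have "\<dots> = ennreal (1 / sqrt (2 * pi * h)) * ennreal (2 * e)"
    using assms by (subst nn_integral_cmult_indicator) auto
  also have "\<dots> = ennreal (2 * e / (sqrt (2 * pi) * sqrt h))"
    using assms by (subst ennreal_mult[symmetric]) (auto simp: real_sqrt_mult)
  also have "\<dots> \<le> ennreal (e / sqrt h)"
  proof (rule ennreal_leI)
    have "2 = sqrt 4" by simp
    also have "\<dots> \<le> sqrt (2 * pi)" using pi_gt3 by (subst real_sqrt_le_iff) simp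
    finally have "2 \<le> sqrt (2 * pi)" .
    then have "2 / sqrt (2 * pi) \<le> 1" by simp
    then have "(2 / sqrt (2 * pi)) * (e / sqrt h) \<le> 1 * (e / sqrt h)"
      using assms by (intro mult_right_mono) auto
    then show "2 * e / (sqrt (2 * pi) * sqrt h) \<le> e / sqrt h" by simp
  qed
  finally show ?thesis .
qed

text \<open>Exponential tilting turns \<^term>\<open>gauss h\<close> into the normal law with mean \<open>- k h\<close>, so the
  combined integrand has the characteristic function of a centred normal law exactly.\<close>

lemma normal_density_tilt:
  assumes "0 < h"
  shows "normal_density 0 (sqrt h) x * exp (- k * x - k\<^sup>2 * h / 2) = normal_density (- k * h) (sqrt h) x"
proof -
  have "- x\<^sup>2 / (2 * h) + (- k * x - k\<^sup>2 * h / 2) = - (x + k * h)\<^sup>2 / (2 * h)"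
    using assms by (simp add: field_simps power2_eq_square)
  then have "exp (- x\<^sup>2 / (2 * h)) * exp (- k * x - k\<^sup>2 * h / 2) = exp (- (x + k * h)\<^sup>2 / (2 * h))"
    by (metis exp_add)
  then show ?thesis
    using assms by (simp add: normal_density_def)
qed

lemma gauss_tilt_integrable:
  assumes "0 < h"
  shows "integrable (gauss h) (\<lambda>x. exp (- k * x - k\<^sup>2 * h / 2))"
    and "(\<integral>x. exp (- k * x - k\<^sup>2 * h / 2) \<partial>gauss h) = 1"
  using assms normal_density_tilt[OF assms, of _ k]
  by (simp_all add: integrable_gauss integral_gauss)

lemma gauss_tilt_char:
  assumes "0 < h"
  shows "(CLINT x|gauss h. iexp (u * (x + k * h)) * of_real (exp (- k * x - k\<^sup>2 * h / 2)))
     = of_real (exp (- u\<^sup>2 * h / 2))"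
proof -
  let ?s = "sqrt h"
  have s: "0 < ?s" "?s \<noteq> 0" using assms by auto
  have "(CLINT x|gauss h. iexp (u * (x + k * h)) * of_real (exp (- k * x - k\<^sup>2 * h / 2))) =
     (\<integral>x. normal_density (- k * h) ?s x *\<^sub>R iexp (u * (x + k * h)) \<partial>lborel)"
  proof (subst integral_gauss)
    have "normal_density 0 ?s x *\<^sub>R (iexp (u * (x + k * h)) * complex_of_real (exp (- k * x - k\<^sup>2 * h / 2)))
      = (normal_density 0 ?s x * exp (- k * x - k\<^sup>2 * h / 2)) *\<^sub>R iexp (u * (x + k * h))" for x
      by (simp add: scaleR_conv_of_real)
    then show "(CLINT x|lborel. normal_density 0 ?s x *\<^sub>R (iexp (u * (x + k * h)) * complex_of_real (exp (- k * x - k\<^sup>2 * h / 2))))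
      = (CLINT x|lborel. normal_density (- k * h) ?s x *\<^sub>R iexp (u * (x + k * h)))"
      unfolding normal_density_tilt[OF assms] by simp
  qed measurable
  \<comment> \<open>The substitution x = - k h + sqrt h y reduces the integral to the characteristic
    function of the standard normal law.\<close>
  also have "\<dots> = \<bar>?s\<bar> *\<^sub>R (\<integral>y. normal_density (- k * h) ?s (- k * h + ?s * y) *\<^sub>R iexp (u * ((- k * h + ?s * y) + k * h)) \<partial>lborel)"
    by (rule lborel_integral_real_affine) (use s in auto)
  also have "\<dots> = (\<integral>y. std_normal_density y *\<^sub>R iexp (u * ?s * y) \<partial>lborel)"
  proof -
    have "?s * normal_density (- k * h) ?s (- k * h + ?s * y) = std_normal_density y" for y
      using assms by (simp add: normal_density_def power_mult_distrib real_sqrt_mult)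
    then show ?thesis using s by (simp add: scaleR_scaleR[symmetric] integral_scaleR_right[symmetric] mult.assoc del: integral_scaleR_right scaleR_scaleR) (simp add: scaleR_scaleR)
  qed
  also have "\<dots> = char std_normal_distribution (u * ?s)"
    unfolding char_def by (subst integral_density) (auto simp: mult.assoc)
  also have "\<dots> = of_real (exp (- u\<^sup>2 * h / 2))"
    unfolding char_std_normal_distribution using assms by (simp add: power_mult_distrib)
  finally show ?thesis .
qed

lemma gauss_char: "0 < h \<Longrightarrow> (CLINT x|gauss h. iexp (u * x)) = of_real (exp (- u\<^sup>2 * h / 2))"
  using gauss_tilt_char[of h u 0] by simp

text \<open>Exhibits the set function on the right as a genuine measure in A, so that uniqueness
  theorems for measures can be applied to it.\<close>

lemma emeasure_distr_density_indicator:
  assumes X [measurable]: "X \<in> measurable M N" and [measurable]: "\<Gamma> \<in> sets M" and A: "A \<in> sets N"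
  shows "emeasure (distr (density M (indicator \<Gamma>)) N X) A = emeasure M (\<Gamma> \<inter> (X -` A \<inter> space M))"
proof -
  have [measurable]: "X -` A \<inter> space M \<in> sets M" by (rule measurable_sets[OF X A])
  have "emeasure (distr (density M (indicator \<Gamma>)) N X) A = emeasure (density M (indicator \<Gamma>)) (X -` A \<inter> space M)"
    using A by (subst emeasure_distr) auto
  also have "\<dots> = (\<integral>\<^sup>+x. indicator (\<Gamma> \<inter> (X -` A \<inter> space M)) x \<partial>M)"
    by (subst emeasure_density, measurable, intro nn_integral_cong) (auto split: split_indicator)
  also have "\<dots> = emeasure M (\<Gamma> \<inter> (X -` A \<inter> space M))" by (rule nn_integral_indicator) measurable
  finally show ?thesis .
qed

section \<open>Freezing the past of a Brownian motion\<close>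

text \<open>Instantiated with \<open>P0\<close> and the raw canonical filtration, later with
  \<open>completion Q\<close> and the enlarged filtration, and also with auxiliary processes
  obtained by flipping signs.\<close>

locale brownian =
  fixes P :: "'a measure" and G :: "real \<Rightarrow> 'a measure" and B :: "real \<Rightarrow> 'a \<Rightarrow> real"
  assumes bm: "brownian_motion_wrt P G B"

sublocale brownian \<subseteq> prob_space P
  using bm by (simp add: brownian_motion_wrt_def)

context brownian
begin

lemma filt: "filtration (space P) G"
  using bm by (simp add: brownian_motion_wrt_def)

lemma space_G [simp]: "space (G t) = space P"
  using filtration.space_F[OF filt] .

lemma sets_G_mono: "s \<le> t \<Longrightarrow> sets (G s) \<subseteq> sets (G t)"
  using filtration.sets_F_mono[OF filt] .

lemma sets_G_subset: "0 \<le> t \<Longrightarrow> sets (G t) \<subseteq> sets P"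
  using bm by (simp add: brownian_motion_wrt_def subalgebra_def)

lemma subalgebra_G: "0 \<le> t \<Longrightarrow> subalgebra P (G t)"
  using bm by (simp add: brownian_motion_wrt_def)

lemma measurable_G_mono: "s \<le> t \<Longrightarrow> f \<in> measurable (G s) N \<Longrightarrow> f \<in> measurable (G t) N"
  using sets_G_mono[of s t] by (auto simp: measurable_def)

lemma measurable_G_P: "0 \<le> s \<Longrightarrow> f \<in> measurable (G s) N \<Longrightarrow> f \<in> measurable P N"
  using sets_G_subset[of s] by (auto simp: measurable_def)

lemma B_measurable_G: "0 \<le> s \<Longrightarrow> s \<le> t \<Longrightarrow> B s \<in> borel_measurable (G t)"
  using bm by (auto simp: brownian_motion_wrt_def intro: measurable_G_mono)

lemma B_measurable [measurable]: "0 \<le> t \<Longrightarrow> B t \<in> borel_measurable P"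
  by (rule measurable_G_P[OF _ B_measurable_G]) auto

lemma B_continuous: "w \<in> space P \<Longrightarrow> continuous_on {0..} (\<lambda>t. B t w)"
  using bm by (simp add: brownian_motion_wrt_def)

lemma B_zero: "AE w in P. B 0 w = 0"
  using bm by (simp add: brownian_motion_wrt_def)

lemma distr_increment:
  assumes "0 \<le> s" "s < t"
  shows "distr P borel (\<lambda>w. B t w - B s w) = gauss (t - s)"
proof -
  have "distributed P lborel (\<lambda>w. B t w - B s w) (normal_density 0 (sqrt (t - s)))"
    using bm assms by (simp add: brownian_motion_wrt_def)
  then have "distr P lborel (\<lambda>w. B t w - B s w) = gauss (t - s)"
    unfolding gauss_def by (rule distributed_distr_eq_density)
  moreover have "distr P lborel (\<lambda>w. B t w - B s w) = distr P borel (\<lambda>w. B t w - B s w)"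
    by (rule distr_cong) auto
  ultimately show ?thesis by simp
qed

lemma indep_increment:
  assumes "0 \<le> s" "s < t" "A \<in> sets (G s)" "C \<in> sets borel"
  shows "emeasure P (A \<inter> ((\<lambda>w. B t w - B s w) -` C \<inter> space P)) = emeasure P A * emeasure (gauss (t - s)) C"
proof -
  have "indep_set (sets (G s)) {(\<lambda>w. B t w - B s w) -` A \<inter> space P | A. A \<in> sets borel}"
    using bm assms by (simp add: brownian_motion_wrt_def)
  then have "prob (A \<inter> ((\<lambda>w. B t w - B s w) -` C \<inter> space P)) = prob A * prob ((\<lambda>w. B t w - B s w) -` C \<inter> space P)"
    by (rule indep_setD) (use assms in auto)
  then have "emeasure P (A \<inter> ((\<lambda>w. B t w - B s w) -` C \<inter> space P)) = emeasure P A * emeasure P ((\<lambda>w. B t w - B s w) -` C \<inter> space P)"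
    by (simp add: emeasure_eq_measure ennreal_mult)
  also have "emeasure P ((\<lambda>w. B t w - B s w) -` C \<inter> space P) = emeasure (gauss (t - s)) C"
    unfolding distr_increment[OF assms(1,2), symmetric]
    by (rule emeasure_distr[symmetric]) (use assms in auto)
  finally show ?thesis .
qed

text \<open>The restriction of P to the \<sigma>-algebra G s, as an image under the identity.
  Products with it live on G s times borel, where independence of G s and the increment can be
  expressed.\<close>

definition restr :: "real \<Rightarrow> 'a measure" where "restr s = distr P (G s) (\<lambda>w. w)"

lemma id_measurable_G: "0 \<le> s \<Longrightarrow> (\<lambda>w. w) \<in> measurable P (G s)"
  by (rule measurable_G_P[of s]) auto

lemma sets_restr [simp, measurable_cong]: "sets (restr s) = sets (G s)"
  by (simp add: restr_def)

lemma space_restr [simp]: "space (restr s) = space P"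
  by (simp add: restr_def)

lemma prob_space_restr: "0 \<le> s \<Longrightarrow> prob_space (restr s)"
  unfolding restr_def by (rule prob_space_distr[OF id_measurable_G])

lemma emeasure_restr: "0 \<le> s \<Longrightarrow> A \<in> sets (G s) \<Longrightarrow> emeasure (restr s) A = emeasure P A"
  unfolding restr_def using sets.sets_into_space[of A "G s"]
  by (subst emeasure_distr[OF id_measurable_G]) (auto intro!: arg_cong[where f="emeasure P"])

lemma AE_restr: "0 \<le> s \<Longrightarrow> {x \<in> space P. \<Phi> x} \<in> sets (G s) \<Longrightarrow> (AE x in restr s. \<Phi> x) \<longleftrightarrow> (AE x in P. \<Phi> x)"
  unfolding restr_def by (subst AE_distr_iff[OF id_measurable_G]) auto

lemma increment_pair_measurable:
  assumes "0 \<le> s" "s < t"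
  shows "(\<lambda>w. (w, B t w - B s w)) \<in> measurable P (G s \<Otimes>\<^sub>M borel)"
  using assms id_measurable_G[of s] by (intro measurable_Pair borel_measurable_diff) auto

text \<open>Independence of the increment from G s is equality of the two measures on measurable
  rectangles, and rectangles determine a product measure.\<close>

lemma freeze:
  assumes st: "0 \<le> s" "s < t"
  shows "distr P (G s \<Otimes>\<^sub>M borel) (\<lambda>w. (w, B t w - B s w)) = restr s \<Otimes>\<^sub>M gauss (t - s)"
proof (rule pair_measure_eqI[symmetric])
  interpret R: prob_space "restr s" using st by (intro prob_space_restr)
  interpret N: prob_space "gauss (t - s)" using st by (intro prob_space_gauss) auto
  show "sigma_finite_measure (restr s)" "sigma_finite_measure (gauss (t - s))" by unfold_locales
  show "sets (restr s \<Otimes>\<^sub>M gauss (t - s)) = sets (distr P (G s \<Otimes>\<^sub>M borel) (\<lambda>w. (w, B t w - B s w)))"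
    by (simp cong: sets_pair_measure_cong)
  fix A C assume A: "A \<in> sets (restr s)" and C: "C \<in> sets (gauss (t - s))"
  have "emeasure (distr P (G s \<Otimes>\<^sub>M borel) (\<lambda>w. (w, B t w - B s w))) (A \<times> C) =
     emeasure P ((\<lambda>w. (w, B t w - B s w)) -` (A \<times> C) \<inter> space P)"
    using A C by (intro emeasure_distr increment_pair_measurable st) auto
  also have "(\<lambda>w. (w, B t w - B s w)) -` (A \<times> C) \<inter> space P = A \<inter> ((\<lambda>w. B t w - B s w) -` C \<inter> space P)"
    by auto
  also have "emeasure P \<dots> = emeasure (restr s) A * emeasure (gauss (t - s)) C"
    using A C st by (subst indep_increment) (auto simp: emeasure_restr)
  finally show "emeasure (restr s) A * emeasure (gauss (t - s)) C =
     emeasure (distr P (G s \<Otimes>\<^sub>M borel) (\<lambda>w. (w, B t w - B s w))) (A \<times> C)" by simp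
qed

text \<open>This replaces conditional expectations given G s: the past w is held fixed and only the
  Gaussian increment is integrated.\<close>

lemma freeze_nn_integral:
  assumes st: "0 \<le> s" "s < t" and f: "f \<in> borel_measurable (G s \<Otimes>\<^sub>M borel)"
  shows "(\<integral>\<^sup>+w. f (w, B t w - B s w) \<partial>P) = (\<integral>\<^sup>+w. (\<integral>\<^sup>+x. f (w, x) \<partial>gauss (t - s)) \<partial>P)"
proof -
  interpret N: prob_space "gauss (t - s)" using st by (intro prob_space_gauss) auto
  have f': "f \<in> borel_measurable (restr s \<Otimes>\<^sub>M gauss (t - s))"
    using f by (simp cong: measurable_cong_sets sets_pair_measure_cong)
  have m: "(\<lambda>w. \<integral>\<^sup>+x. f (w, x) \<partial>gauss (t - s)) \<in> borel_measurable (G s)"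
    using N.borel_measurable_nn_integral_fst[of f "G s"] f by (simp cong: measurable_cong_sets sets_pair_measure_cong)
  have "(\<integral>\<^sup>+w. f (w, B t w - B s w) \<partial>P) = (\<integral>\<^sup>+p. f p \<partial>distr P (G s \<Otimes>\<^sub>M borel) (\<lambda>w. (w, B t w - B s w)))"
    by (rule nn_integral_distr[symmetric]) (use f st in \<open>auto intro: increment_pair_measurable\<close>)
  also have "\<dots> = (\<integral>\<^sup>+w. (\<integral>\<^sup>+x. f (w, x) \<partial>gauss (t - s)) \<partial>restr s)"
    unfolding freeze[OF st] by (rule N.nn_integral_fst[symmetric]) (rule f')
  also have "\<dots> = (\<integral>\<^sup>+w. (\<integral>\<^sup>+x. f (w, x) \<partial>gauss (t - s)) \<partial>P)"
    unfolding restr_def by (rule nn_integral_distr[OF id_measurable_G]) (use m st in auto)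
  finally show ?thesis .
qed

lemma freeze_integral:
  fixes f :: "_ \<Rightarrow> 'b::{banach, second_countable_topology}"
  assumes st: "0 \<le> s" "s < t" and f: "f \<in> borel_measurable (G s \<Otimes>\<^sub>M borel)"
    and int: "integrable P (\<lambda>w. f (w, B t w - B s w))"
  shows "(\<integral>w. f (w, B t w - B s w) \<partial>P) = (\<integral>w. (\<integral>x. f (w, x) \<partial>gauss (t - s)) \<partial>P)"
proof -
  interpret N: prob_space "gauss (t - s)" using st by (intro prob_space_gauss) auto
  interpret R: prob_space "restr s" using st by (intro prob_space_restr)
  interpret pair_sigma_finite "restr s" "gauss (t - s)" by unfold_locales
  have i: "integrable (restr s \<Otimes>\<^sub>M gauss (t - s)) f"
    unfolding freeze[OF st, symmetric]
    by (subst integrable_distr_eq[OF increment_pair_measurable[OF st] f]) (rule int)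
  have m: "(\<lambda>w. \<integral>x. f (w, x) \<partial>gauss (t - s)) \<in> borel_measurable (G s)"
    using N.borel_measurable_lebesgue_integral[of "\<lambda>w x. f (w, x)" "G s"] f by (simp cong: measurable_cong_sets sets_pair_measure_cong)
  have "(\<integral>w. f (w, B t w - B s w) \<partial>P) = (\<integral>p. f p \<partial>distr P (G s \<Otimes>\<^sub>M borel) (\<lambda>w. (w, B t w - B s w)))"
    by (rule integral_distr[symmetric]) (use f st in \<open>auto intro: increment_pair_measurable\<close>)
  also have "\<dots> = (\<integral>w. (\<integral>x. f (w, x) \<partial>gauss (t - s)) \<partial>restr s)"
    unfolding freeze[OF st] by (rule integral_fst'[symmetric]) (rule i)
  also have "\<dots> = (\<integral>w. (\<integral>x. f (w, x) \<partial>gauss (t - s)) \<partial>P)"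
    unfolding restr_def by (rule integral_distr[OF id_measurable_G]) (use m st in auto)
  finally show ?thesis .
qed

text \<open>Integrability of the product is part of the conclusion: under the product law it follows
  from integrability of the two factors.\<close>

lemma freeze_mult:
  fixes f :: "'a \<Rightarrow> 'b::{banach, real_normed_field, second_countable_topology}"
  assumes st: "0 \<le> s" "s < t" and f: "f \<in> borel_measurable (G s)" "integrable P f"
    and g: "integrable (gauss (t - s)) g"
  shows "integrable P (\<lambda>w. f w * g (B t w - B s w))"
    and "(\<integral>w. f w * g (B t w - B s w) \<partial>P) = (\<integral>w. f w \<partial>P) * (\<integral>x. g x \<partial>gauss (t - s))"
proof -
  interpret N: prob_space "gauss (t - s)" using st by (intro prob_space_gauss) auto
  interpret R: prob_space "restr s" using st by (intro prob_space_restr)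
  interpret pair_sigma_finite "restr s" "gauss (t - s)" by unfold_locales
  have [measurable]: "f \<in> borel_measurable (G s)" "g \<in> borel_measurable borel"
    using f g borel_measurable_integrable[OF g] by auto
  have m: "(\<lambda>p. f (fst p) * g (snd p)) \<in> borel_measurable (G s \<Otimes>\<^sub>M borel)" by measurable
  have "integrable (restr s) f"
    unfolding restr_def using st f by (subst integrable_distr_eq[OF id_measurable_G]) auto
  then have "integrable (restr s \<Otimes>\<^sub>M gauss (t - s)) (\<lambda>(x, y). f x * g y)"
    using g f by (intro Fubini_integrable) (auto simp: integrable_mult_left abs_mult norm_mult)
  then have "integrable (distr P (G s \<Otimes>\<^sub>M borel) (\<lambda>w. (w, B t w - B s w))) (\<lambda>p. f (fst p) * g (snd p))"
    unfolding freeze[OF st] by (simp add: case_prod_beta')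
  then show i: "integrable P (\<lambda>w. f w * g (B t w - B s w))"
    by (subst (asm) integrable_distr_eq[OF increment_pair_measurable[OF st] m]) simp
  have "(\<integral>w. f w * g (B t w - B s w) \<partial>P) = (\<integral>w. (\<integral>x. f w * g x \<partial>gauss (t - s)) \<partial>P)"
    using freeze_integral[OF st m] i by simp
  also have "\<dots> = (\<integral>w. f w \<partial>P) * (\<integral>x. g x \<partial>gauss (t - s))"
    using f g by simp
  finally show "(\<integral>w. f w * g (B t w - B s w) \<partial>P) = (\<integral>w. f w \<partial>P) * (\<integral>x. g x \<partial>gauss (t - s))" .
qed

lemma increment_integrable:
  fixes g :: "real \<Rightarrow> 'b::{banach, second_countable_topology}"
  assumes st: "0 \<le> s" "s < t" and g: "integrable (gauss (t - s)) g"
  shows "integrable P (\<lambda>w. g (B t w - B s w))"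
    and "(\<integral>w. g (B t w - B s w) \<partial>P) = (\<integral>x. g x \<partial>gauss (t - s))"
proof -
  have m: "(\<lambda>w. B t w - B s w) \<in> measurable P borel"
    using st by (intro borel_measurable_diff B_measurable) auto
  have [measurable]: "g \<in> borel_measurable borel" using borel_measurable_integrable[OF g] by auto
  show "integrable P (\<lambda>w. g (B t w - B s w))"
    using g unfolding distr_increment[OF st, symmetric] by (subst (asm) integrable_distr_eq[OF m]) auto
  show "(\<integral>w. g (B t w - B s w) \<partial>P) = (\<integral>x. g x \<partial>gauss (t - s))"
    unfolding distr_increment[OF st, symmetric] by (subst integral_distr[OF m]) auto
qed

end

section \<open>Independence of past and future increments under Wiener measure\<close>

locale wiener =
  fixes P0 :: "path measure"
  assumes wiener: "is_wiener_measure P0"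

sublocale wiener \<subseteq> brownian P0 \<F> coord
  using wiener by unfold_locales (simp add: is_wiener_measure_def)

definition increments :: "real \<Rightarrow> path \<Rightarrow> path" where
  "increments n w = (\<lambda>r. if 0 \<le> r then w (n + r) - w n else undefined)"

text \<open>Subtracting z 0 makes the result continuous for every path z, not only for those
  starting at 0. Negative arguments give \<open>undefined\<close> because paths are
  extensional.\<close>

definition glue :: "real \<Rightarrow> path \<Rightarrow> path \<Rightarrow> path" where
  "glue n x z = (\<lambda>r. if r < 0 then undefined else if r \<le> n then x r else x n + (z (r - n) - z 0))"

lemma increments_in_path_space: "0 \<le> n \<Longrightarrow> w \<in> path_space \<Longrightarrow> increments n w \<in> path_space"
proof -
  assume n: "0 \<le> n" and w: "w \<in> path_space"
  have "continuous_on {0..} (\<lambda>r. coord (n + r) w - coord n w)"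
    by (intro continuous_intros continuous_on_compose2[OF path_continuous[OF w]]) (use n in auto)
  then have "continuous_on {0..} (increments n w)"
    by (subst continuous_on_cong[OF refl, where g="\<lambda>r. coord (n + r) w - coord n w"])
      (auto simp: increments_def coord_def)
  then show ?thesis by (auto simp: path_space_def increments_def extensional_def)
qed

lemma coord_increments [simp]: "0 \<le> r \<Longrightarrow> coord r (increments n w) = coord (n + r) w - coord n w"
  by (simp add: coord_def increments_def)

lemma coord_glue:
  "0 \<le> r \<Longrightarrow> coord r (glue n x z) = (if r \<le> n then coord r x else coord n x + (coord (r - n) z - coord 0 z))"
  by (simp add: coord_def glue_def)

lemma glue_increments: "0 \<le> n \<Longrightarrow> w \<in> path_space \<Longrightarrow> glue n w (increments n w) = w"
  by (rule ext) (auto simp: glue_def increments_def path_space_def extensional_def)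

lemma glue_in_path_space:
  assumes n: "0 \<le> n" and x: "x \<in> path_space" and z: "z \<in> path_space"
  shows "glue n x z \<in> path_space"
proof -
  have "continuous_on ({0..n} \<union> {n..}) (\<lambda>r. if r \<le> n then coord r x else coord n x + (coord (r - n) z - coord 0 z))"
  proof (rule continuous_on_If)
    show "continuous_on {0..n} (\<lambda>r. coord r x)"
      using path_continuous[OF x] by (rule continuous_on_subset) auto
    show "continuous_on {n..} (\<lambda>r. coord n x + (coord (r - n) z - coord 0 z))"
      by (intro continuous_intros continuous_on_compose2[OF path_continuous[OF z]]) (use n in auto)
  qed (use n in auto)
  moreover have "{0..n} \<union> {n..} = {0..}" using n by auto
  ultimately have "continuous_on {0..} (glue n x z)"
    by (subst continuous_on_cong[OF refl, where g="\<lambda>r. if r \<le> n then coord r x else coord n x + (coord (r - n) z - coord 0 z)"])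
      (auto simp: coord_glue[unfolded coord_def] coord_def)
  then show ?thesis by (auto simp: path_space_def glue_def extensional_def)
qed

lemma measurable_glue:
  assumes n: "0 \<le> n"
  shows "(\<lambda>(x, z). glue n x z) \<in> measurable (\<F> n \<Otimes>\<^sub>M canon_alg) canon_alg"
proof (rule measurable_canon_alg_into)
  fix p assume "p \<in> space (\<F> n \<Otimes>\<^sub>M canon_alg)"
  then show "(case p of (x, z) \<Rightarrow> glue n x z) \<in> path_space"
    using n by (auto simp: space_pair_measure glue_in_path_space)
next
  fix s :: real assume s: "0 \<le> s"
  have [measurable]: "coord n \<in> borel_measurable (\<F> n)" by (rule measurable_coord_filt) (use n in auto)
  show "(\<lambda>p. coord s (case p of (x, z) \<Rightarrow> glue n x z)) \<in> borel_measurable (\<F> n \<Otimes>\<^sub>M canon_alg)"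
  proof (cases "s \<le> n")
    case True
    then have [measurable]: "coord s \<in> borel_measurable (\<F> n)" using s by (intro measurable_coord_filt)
    show ?thesis using True s by (simp add: case_prod_beta' coord_glue)
  next
    case False
    then show ?thesis using s by (simp add: case_prod_beta' coord_glue)
  qed
qed

text \<open>The defining generators of \<open>canon_alg\<close> involve a single time each and are
  not closed under intersection; finite-dimensional cylinders are.\<close>

definition cylinders :: "path set set" where
  "cylinders = {{w \<in> path_space. \<forall>r\<in>J. coord r w \<in> A r} | J A. finite J \<and> J \<subseteq> {0..} \<and> (\<forall>r. A r \<in> sets borel)}"

lemma Int_stable_cylinders: "Int_stable cylinders"
proof (rule Int_stableI)
  fix a b assume "a \<in> cylinders" "b \<in> cylinders"
  then obtain J A K C where a: "a = {w \<in> path_space. \<forall>r\<in>J. coord r w \<in> A r}" "finite J" "J \<subseteq> {0..}" "\<forall>r. A r \<in> sets borel"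
    and b: "b = {w \<in> path_space. \<forall>r\<in>K. coord r w \<in> C r}" "finite K" "K \<subseteq> {0..}" "\<forall>r. C r \<in> sets borel"
    unfolding cylinders_def by auto
  have "a \<inter> b = {w \<in> path_space. \<forall>r\<in>J \<union> K. coord r w \<in> (if r \<in> J then A r else UNIV) \<inter> (if r \<in> K then C r else UNIV)}"
    unfolding a b by auto
  then show "a \<inter> b \<in> cylinders"
    unfolding cylinders_def using a b
    by (intro CollectI exI[of _ "J \<union> K"] exI[of _ "\<lambda>r. (if r \<in> J then A r else UNIV) \<inter> (if r \<in> K then C r else UNIV)"]) auto
qed

lemma cylinders_subset: "cylinders \<subseteq> Pow path_space"
  unfolding cylinders_def by auto

lemma sets_canon_alg_cylinders: "sets canon_alg = sigma_sets path_space cylinders"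
proof (rule antisym)
  show "sets canon_alg \<subseteq> sigma_sets path_space cylinders"
    unfolding sets_canon_alg
  proof (rule sigma_sets_mono', rule subsetI)
    fix y assume "y \<in> {coord s -` A \<inter> path_space |s A. s \<in> {0..} \<and> A \<in> sets borel}"
    then obtain s A where y: "y = coord s -` A \<inter> path_space" "0 \<le> s" "A \<in> sets borel" by auto
    then show "y \<in> cylinders" unfolding cylinders_def
      by (intro CollectI exI[of _ "{s}"] exI[of _ "\<lambda>_. A"]) auto
  qed
  show "sigma_sets path_space cylinders \<subseteq> sets canon_alg"
  proof -
    have "cylinders \<subseteq> sets canon_alg"
    proof
      fix y assume "y \<in> cylinders"
      then obtain J A where y: "y = {w \<in> space canon_alg. \<forall>r\<in>J. coord r w \<in> A r}" "finite J" "J \<subseteq> {0..}" "\<forall>r. A r \<in> sets borel"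
        unfolding cylinders_def by auto
      show "y \<in> sets canon_alg"
        unfolding y
      proof (rule sets.sets_Collect_finite_All[OF _ y(2)])
        fix r assume "r \<in> J"
        then have [measurable]: "coord r \<in> borel_measurable canon_alg" using y(3) by (intro measurable_coord_alg) auto
        have [measurable]: "A r \<in> sets borel" using y by auto
        show "{w \<in> space canon_alg. coord r w \<in> A r} \<in> sets canon_alg" by measurable
      qed
    qed
    from sets.sigma_sets_subset[OF this] show ?thesis by simp
  qed
qed

context wiener
begin

lemma sets_P0 [simp, measurable_cong]: "sets P0 = sets canon_alg"
  using wiener by (simp add: is_wiener_measure_def)

lemma space_P0 [simp]: "space P0 = path_space"
  using sets_eq_imp_space_eq[OF sets_P0] by simp

lemma measurable_increments: "0 \<le> n \<Longrightarrow> increments n \<in> measurable P0 canon_alg"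
  by (rule measurable_canon_alg_into) (auto intro: increments_in_path_space)

text \<open>Independence phrased as: the integral depends on \<Gamma> only through its probability.
  The induction integrates out the increment up to the largest time and merges the resulting
  function into the factor at the time before it; this changes f, which is therefore quantified
  inside.\<close>

lemma past_future_cylinder:
  assumes n: "0 \<le> n" and J: "finite J" "J \<subseteq> {0..}"
  shows "\<forall>f. (\<forall>r. f r \<in> borel_measurable borel) \<longrightarrow> (\<exists>c. \<forall>\<Gamma>\<in>sets (\<F> n).
    (\<integral>\<^sup>+w. indicator \<Gamma> w * (\<Prod>r\<in>J. f r (coord (n + r) w - coord n w) :: ennreal) \<partial>P0) = emeasure P0 \<Gamma> * c)"
  using J
proof (induction J rule: finite_linorder_max_induct)
  case empty
  have "emeasure P0 \<Gamma> = (\<integral>\<^sup>+w. indicator \<Gamma> w \<partial>P0)" if "\<Gamma> \<in> sets (\<F> n)" for \<Gamma>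
    using that sets_G_subset[OF n] by (subst nn_integral_indicator) auto
  then show ?case by (auto intro!: exI[of _ 1])
next
  case (insert b A)
  \<comment> \<open>The time before b. If there is none, m = 0 and the increment from n to n + m
    vanishes, so the integrated function reduces to the constant g 0.\<close>
  define m where "m = (if A = {} then 0 else Max A)"
  have "A \<noteq> {} \<Longrightarrow> Max A \<in> A" using insert by (intro Max_in) auto
  moreover from this have "A \<noteq> {} \<Longrightarrow> 0 \<le> Max A" using insert.prems by auto
  ultimately have m: "0 \<le> m" "m < b \<or> A = {} \<and> m \<le> b" "A \<noteq> {} \<Longrightarrow> m \<in> A" "\<And>r. r \<in> A \<Longrightarrow> r \<le> m"
    using insert by (auto simp: m_def)
  show ?case
  proof (intro allI impI)
    fix f :: "real \<Rightarrow> real \<Rightarrow> ennreal"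
    assume f: "\<forall>r. f r \<in> borel_measurable borel"
    have [measurable]: "f r \<in> borel_measurable borel" for r using f by auto
    define V where "V r w = coord (n + r) w - coord n w" for r w
    \<comment> \<open>The case m = b arises only when both are 0; no increment is left to integrate,
      and a Gaussian law of variance 0 is avoided.\<close>
    define g where "g v = (if m < b then \<integral>\<^sup>+x. f b (v + x) \<partial>gauss (b - m) else f b v)" for v
    have gm [measurable]: "g \<in> borel_measurable borel"
    proof (cases "m < b")
      case True
      then interpret N: prob_space "gauss (b - m)" by (intro prob_space_gauss) auto
      have "(\<lambda>v. \<integral>\<^sup>+x. f b (v + x) \<partial>gauss (b - m)) \<in> borel_measurable borel"
        by (rule N.borel_measurable_nn_integral) measurable
      then show ?thesis using True by (simp add: g_def[abs_def])
    qed (auto simp: g_def[abs_def])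
    have Vm: "V r \<in> borel_measurable (\<F> (n + m))" if "r \<in> A \<or> r = m" for r
      using that m n insert.prems unfolding V_def
      by (intro borel_measurable_diff measurable_coord_filt) auto
    have step: "(\<integral>\<^sup>+w. indicator D w * (\<Prod>r\<in>insert b A. f r (V r w)) \<partial>P0) =
       (\<integral>\<^sup>+w. indicator D w * ((\<Prod>r\<in>A. f r (V r w)) * g (V m w)) \<partial>P0)"
      if D: "D \<in> sets (\<F> n)" for D
    proof (cases "m < b")
      case True
      have [measurable]: "D \<in> sets (\<F> (n + m))" using canon_filt_mono[of n "n + m"] D m by auto
      have [measurable]: "V m \<in> borel_measurable (\<F> (n + m))" using Vm by auto
      have [measurable]: "(\<lambda>w. \<Prod>r\<in>A. f r (V r w)) \<in> borel_measurable (\<F> (n + m))"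
        by (rule borel_measurable_prod_ennreal) (use Vm in \<open>auto intro: measurable_compose[OF _ f[rule_format]]\<close>)
      let ?F = "\<lambda>(w, x). indicator D w * ((\<Prod>r\<in>A. f r (V r w)) * f b (V m w + x))"
      have F: "?F \<in> borel_measurable (\<F> (n + m) \<Otimes>\<^sub>M borel)" by measurable
      have "(\<integral>\<^sup>+w. indicator D w * (\<Prod>r\<in>insert b A. f r (V r w)) \<partial>P0) = (\<integral>\<^sup>+w. ?F (w, coord (n + b) w - coord (n + m) w) \<partial>P0)"
        using insert.hyps by (intro nn_integral_cong) (auto simp: V_def mult_ac)
      also have "\<dots> = (\<integral>\<^sup>+w. (\<integral>\<^sup>+x. ?F (w, x) \<partial>gauss (b - m)) \<partial>P0)"
        using freeze_nn_integral[OF _ _ F, of "n + b"] n m True by simp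
      also have "\<dots> = (\<integral>\<^sup>+w. indicator D w * ((\<Prod>r\<in>A. f r (V r w)) * g (V m w)) \<partial>P0)"
        using True by (intro nn_integral_cong) (simp add: g_def nn_integral_cmult)
      finally show ?thesis .
    next
      case False
      then have "A = {}" "m = b" using m by auto
      then show ?thesis using False by (simp add: g_def)
    qed
    show "\<exists>c. \<forall>\<Gamma>\<in>sets (\<F> n). (\<integral>\<^sup>+w. indicator \<Gamma> w * (\<Prod>r\<in>insert b A. f r (coord (n + r) w - coord n w)) \<partial>P0) = emeasure P0 \<Gamma> * c"
      unfolding V_def[symmetric]
    proof (cases "A = {}")
      case True
      then have "V m w = 0" for w by (simp add: m_def V_def)
      then have "(\<integral>\<^sup>+w. indicator D w * (\<Prod>r\<in>insert b A. f r (V r w)) \<partial>P0) = emeasure P0 D * g 0"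
        if D: "D \<in> sets (\<F> n)" for D
        unfolding step[OF D] using True D sets_G_subset[OF n]
        by (simp add: nn_integral_multc) (subst nn_integral_multc; auto)
      then show "\<exists>c. \<forall>\<Gamma>\<in>sets (\<F> n). (\<integral>\<^sup>+w. indicator \<Gamma> w * (\<Prod>r\<in>insert b A. f r (V r w)) \<partial>P0) = emeasure P0 \<Gamma> * c" by blast
    next
      case False
      define f' where "f' = f(m := \<lambda>v. f m v * g v)"
      have f': "\<forall>r. f' r \<in> borel_measurable borel" by (auto simp: f'_def)
      have prod: "(\<Prod>r\<in>A. f r (V r w)) * g (V m w) = (\<Prod>r\<in>A. f' r (V r w))" for w
      proof -
        have "(\<Prod>r\<in>A. f' r (V r w)) = f' m (V m w) * (\<Prod>r\<in>A - {m}. f' r (V r w))"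
          using insert.hyps m(3)[OF False] by (intro prod.remove) auto
        also have "(\<Prod>r\<in>A - {m}. f' r (V r w)) = (\<Prod>r\<in>A - {m}. f r (V r w))"
          by (intro prod.cong) (auto simp: f'_def)
        also have "f' m (V m w) = f m (V m w) * g (V m w)" by (simp add: f'_def)
        also have "f m (V m w) * g (V m w) * (\<Prod>r\<in>A - {m}. f r (V r w)) = (\<Prod>r\<in>A. f r (V r w)) * g (V m w)"
          using prod.remove[OF _ m(3)[OF False], of "\<lambda>r. f r (V r w)"] insert.hyps by (simp add: mult_ac)
        finally show ?thesis by simp
      qed
      have "\<exists>c. \<forall>\<Gamma>\<in>sets (\<F> n). (\<integral>\<^sup>+w. indicator \<Gamma> w * (\<Prod>r\<in>A. f' r (V r w)) \<partial>P0) = emeasure P0 \<Gamma> * c"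
        using insert.IH insert.prems f' unfolding V_def by auto
      then show "\<exists>c. \<forall>\<Gamma>\<in>sets (\<F> n). (\<integral>\<^sup>+w. indicator \<Gamma> w * (\<Prod>r\<in>insert b A. f r (V r w)) \<partial>P0) = emeasure P0 \<Gamma> * c"
        by (simp add: step prod)
    qed
  qed
qed

lemma past_future:
  assumes n: "0 \<le> n" and \<Gamma>: "\<Gamma> \<in> sets (\<F> n)" and D: "D \<in> sets canon_alg"
  shows "emeasure P0 (\<Gamma> \<inter> (increments n -` D \<inter> path_space)) = emeasure P0 \<Gamma> * emeasure P0 (increments n -` D \<inter> path_space)"
proof -
  note [measurable] = measurable_increments[OF n]
  have \<Gamma>' [measurable]: "\<Gamma> \<in> sets P0" using \<Gamma> sets_G_subset[OF n] by auto
  define M1 where "M1 = distr (density P0 (indicator \<Gamma>)) canon_alg (increments n)"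
  define M2 where "M2 = distr (density P0 (\<lambda>_. emeasure P0 \<Gamma>)) canon_alg (increments n)"
  have m': "increments n \<in> measurable (density P0 f) canon_alg" for f by simp
  have e1: "emeasure M1 A = emeasure P0 (\<Gamma> \<inter> (increments n -` A \<inter> path_space))" if "A \<in> sets canon_alg" for A
    unfolding M1_def using emeasure_distr_density_indicator[OF measurable_increments[OF n] \<Gamma>' that] by simp
  have e2: "emeasure M2 A = emeasure P0 \<Gamma> * emeasure P0 (increments n -` A \<inter> path_space)" if [measurable]: "A \<in> sets canon_alg" for A
  proof -
    have [measurable]: "increments n -` A \<inter> path_space \<in> sets P0" using measurable_sets[OF measurable_increments[OF n] that] by simp
    have "emeasure M2 A = emeasure (density P0 (\<lambda>_. emeasure P0 \<Gamma>)) (increments n -` A \<inter> path_space)"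
      unfolding M2_def by (subst emeasure_distr[OF m' that]) simp
    also have "\<dots> = (\<integral>\<^sup>+w. emeasure P0 \<Gamma> * indicator (increments n -` A \<inter> path_space) w \<partial>P0)"
      by (rule emeasure_density) measurable
    also have "\<dots> = emeasure P0 \<Gamma> * emeasure P0 (increments n -` A \<inter> path_space)"
      by (rule nn_integral_cmult_indicator) measurable
    finally show ?thesis .
  qed
  have "M1 = M2"
  proof (rule measure_eqI_generator_eq[OF Int_stable_cylinders cylinders_subset])
    show "sets M1 = sigma_sets path_space cylinders" "sets M2 = sigma_sets path_space cylinders"
      by (simp_all add: M1_def M2_def sets_canon_alg_cylinders)
    show "range (\<lambda>_::nat. path_space) \<subseteq> cylinders" unfolding cylinders_def by auto
    show "emeasure M1 path_space \<noteq> \<infinity>" using e1[of path_space] sets.top[of canon_alg] by simp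
    fix X assume X: "X \<in> cylinders"
    then obtain J A where X': "X = {w \<in> path_space. \<forall>r\<in>J. coord r w \<in> A r}" "finite J" "J \<subseteq> {0..}" "\<forall>r. A r \<in> sets borel"
      unfolding cylinders_def by auto
    have Xs [measurable]: "X \<in> sets canon_alg" using X sets_canon_alg_cylinders by auto
    have iXs [measurable]: "increments n -` X \<inter> path_space \<in> sets P0" using measurable_sets[OF measurable_increments[OF n] Xs] by simp
    have ind: "indicator (increments n -` X \<inter> path_space) w = (\<Prod>r\<in>J. indicator (A r) (coord (n + r) w - coord n w) :: ennreal)" if "w \<in> path_space" for w
    proof (cases "\<forall>r\<in>J. coord (n + r) w - coord n w \<in> A r")
      case True
      then have "increments n w \<in> X" using that X' increments_in_path_space[OF n that] by auto
      then have "w \<in> increments n -` X \<inter> path_space" using that by auto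
      moreover have "(\<Prod>r\<in>J. indicator (A r) (coord (n + r) w - coord n w) :: ennreal) = 1"
        by (rule prod.neutral) (use True in auto)
      ultimately show ?thesis by (simp only: indicator_simps)
    next
      case False
      then obtain r where r: "r \<in> J" "coord (n + r) w - coord n w \<notin> A r" by auto
      then have "(\<Prod>r\<in>J. indicator (A r) (coord (n + r) w - coord n w) :: ennreal) = 0"
        using X' by (intro prod_zero bexI[of _ r]) auto
      moreover have "coord r (increments n w) \<notin> A r" using r X'(3) by (subst coord_increments) auto
      with r X' have "increments n w \<notin> X" by blast
      ultimately show ?thesis by simp
    qed
    obtain c where c: "\<And>D. D \<in> sets (\<F> n) \<Longrightarrow>
        (\<integral>\<^sup>+w. indicator D w * (\<Prod>r\<in>J. indicator (A r) (coord (n + r) w - coord n w) :: ennreal) \<partial>P0) = emeasure P0 D * c"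
      using past_future_cylinder[OF n X'(2,3), rule_format, of "\<lambda>r. indicator (A r)"] X'(4) by auto
    have "emeasure P0 (D \<inter> (increments n -` X \<inter> path_space)) = emeasure P0 D * c" if D: "D \<in> sets (\<F> n)" for D
    proof -
      have [measurable]: "D \<in> sets P0" using D sets_G_subset[OF n] by auto
      have "emeasure P0 (D \<inter> (increments n -` X \<inter> path_space)) = (\<integral>\<^sup>+w. indicator (D \<inter> (increments n -` X \<inter> path_space)) w \<partial>P0)"
        by (rule nn_integral_indicator[symmetric]) measurable
      also have "\<dots> = emeasure P0 D * c"
        unfolding c[OF D, symmetric] by (intro nn_integral_cong) (auto simp: ind[symmetric] split: split_indicator)
      finally show ?thesis .
    qed
    \<comment> \<open>Taking the whole space for D identifies c as the probability of the cylinder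
      event.\<close>
    from this[OF \<Gamma>] this[OF sets.top] show "emeasure M1 X = emeasure M2 X"
      using emeasure_space_1 by (simp add: e1[OF Xs] e2[OF Xs] Int_absorb1)
  qed auto
  with e1[OF D] e2[OF D] show ?thesis by simp
qed

text \<open>The rectangle argument of \<open>freeze\<close>, now with the entire future in place of
  one increment.\<close>

lemma glue_law:
  assumes n: "0 \<le> n"
  shows "distr P0 (\<F> n \<Otimes>\<^sub>M canon_alg) (\<lambda>w. (w, increments n w)) = restr n \<Otimes>\<^sub>M distr P0 canon_alg (increments n)"
proof (rule pair_measure_eqI[symmetric])
  interpret R: prob_space "restr n" using n by (intro prob_space_restr)
  interpret N: prob_space "distr P0 canon_alg (increments n)" by (rule prob_space_distr[OF measurable_increments[OF n]])
  show "sigma_finite_measure (restr n)" "sigma_finite_measure (distr P0 canon_alg (increments n))" by unfold_locales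
  show "sets (restr n \<Otimes>\<^sub>M distr P0 canon_alg (increments n)) = sets (distr P0 (\<F> n \<Otimes>\<^sub>M canon_alg) (\<lambda>w. (w, increments n w)))"
    by (simp cong: sets_pair_measure_cong)
  have m: "(\<lambda>w. (w, increments n w)) \<in> measurable P0 (\<F> n \<Otimes>\<^sub>M canon_alg)"
    using id_measurable_G[OF n] measurable_increments[OF n] by (rule measurable_Pair)
  fix A C assume A: "A \<in> sets (restr n)" and C: "C \<in> sets (distr P0 canon_alg (increments n))"
  have "emeasure (distr P0 (\<F> n \<Otimes>\<^sub>M canon_alg) (\<lambda>w. (w, increments n w))) (A \<times> C) =
     emeasure P0 ((\<lambda>w. (w, increments n w)) -` (A \<times> C) \<inter> space P0)"
    using A C by (intro emeasure_distr m) auto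
  also have "(\<lambda>w. (w, increments n w)) -` (A \<times> C) \<inter> space P0 = A \<inter> (increments n -` C \<inter> path_space)"
    by auto
  also have "emeasure P0 \<dots> = emeasure (restr n) A * emeasure (distr P0 canon_alg (increments n)) C"
    using A C n by (subst past_future) (auto simp: emeasure_restr emeasure_distr[OF measurable_increments[OF n]])
  finally show "emeasure (restr n) A * emeasure (distr P0 canon_alg (increments n)) C =
     emeasure (distr P0 (\<F> n \<Otimes>\<^sub>M canon_alg) (\<lambda>w. (w, increments n w))) (A \<times> C)" by simp
qed

text \<open>A null event of the whole \<open>\<sigma>\<close>-algebra that only involves the path up to time \<open>n\<close> is already
  null at time \<open>n\<close>: by Fubini it stays null when the future increments are replaced by a fixed one.\<close>

lemma null_at_time:
  assumes n: "0 \<le> n" and ae: "AE w in P0. \<Phi> w"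
    and dep: "\<And>w w'. w \<in> path_space \<Longrightarrow> w' \<in> path_space \<Longrightarrow>
      (\<And>r. 0 \<le> r \<Longrightarrow> r \<le> n \<Longrightarrow> coord r w = coord r w') \<Longrightarrow> \<Phi> w \<Longrightarrow> \<Phi> w'"
  shows "\<exists>N\<in>sets (\<F> n). emeasure P0 N = 0 \<and> (\<forall>w\<in>path_space. w \<notin> N \<longrightarrow> \<Phi> w)"
proof -
  from ae obtain N where N: "N \<in> sets P0" "emeasure P0 N = 0" "{w \<in> space P0. \<not> \<Phi> w} \<subseteq> N"
    by (auto elim!: AE_E)
  let ?D = "distr P0 canon_alg (increments n)"
  interpret R: prob_space "restr n" using n by (intro prob_space_restr)
  interpret D: prob_space ?D by (rule prob_space_distr[OF measurable_increments[OF n]])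
  interpret pair_sigma_finite "restr n" ?D by unfold_locales
  have m: "(\<lambda>w. (w, increments n w)) \<in> measurable P0 (\<F> n \<Otimes>\<^sub>M canon_alg)"
    using id_measurable_G[OF n] measurable_increments[OF n] by (rule measurable_Pair)
  \<comment> \<open>Pairs of a past and a future whose gluing falls into the null set. A path glued
    with its own future is the path itself, so this set is null for the product law.\<close>
  define E where "E = (\<lambda>(x, z). glue n x z) -` N \<inter> space (\<F> n \<Otimes>\<^sub>M canon_alg)"
  have E: "E \<in> sets (\<F> n \<Otimes>\<^sub>M canon_alg)"
    unfolding E_def by (rule measurable_sets[OF measurable_glue[OF n]]) (use N in auto)
  have E': "E \<in> sets (restr n \<Otimes>\<^sub>M ?D)" using E by (simp cong: sets_pair_measure_cong)
  have "{p \<in> space (restr n \<Otimes>\<^sub>M ?D). p \<notin> E} = space (restr n \<Otimes>\<^sub>M ?D) - E" by auto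
  then have Ec: "{p \<in> space (restr n \<Otimes>\<^sub>M ?D). p \<notin> E} \<in> sets (restr n \<Otimes>\<^sub>M ?D)"
    using sets.compl_sets[OF E'] by (simp only:)
  have "emeasure (restr n \<Otimes>\<^sub>M ?D) E = emeasure P0 ((\<lambda>w. (w, increments n w)) -` E \<inter> space P0)"
    unfolding glue_law[OF n, symmetric] by (rule emeasure_distr[OF m E])
  also have "(\<lambda>w. (w, increments n w)) -` E \<inter> space P0 \<subseteq> N"
    using n by (auto simp: E_def glue_increments)
  then have "emeasure P0 ((\<lambda>w. (w, increments n w)) -` E \<inter> space P0) = 0"
    using emeasure_mono[OF _ N(1)] N(2) by (metis le_zero_eq)
  finally have "AE p in restr n \<Otimes>\<^sub>M ?D. p \<notin> E"
    using E' by (intro AE_I[of _ _ E]) auto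
  then have "AE x in restr n. AE z in ?D. (x, z) \<notin> E" by (rule AE_pair)
  then have "AE z in ?D. AE x in restr n. (x, z) \<notin> E"
    using AE_commute[of "\<lambda>x z. (x, z) \<notin> E"] Ec by simp
  \<comment> \<open>One fixed future z is enough: for almost every past, its gluing with z avoids
    the null set.\<close>
  then obtain z where z: "z \<in> space ?D" "AE x in restr n. (x, z) \<notin> E"
    using AE_space[of ?D] D.ae_filter_bot eventually_happens'[of "ae_filter ?D" "\<lambda>z. z \<in> space ?D \<and> (AE x in restr n. (x, z) \<notin> E)"]
    by (auto simp: eventually_conj)
  have zE: "(\<lambda>x. (x, z)) -` E \<inter> space (restr n) \<in> sets (restr n)"
    by (rule measurable_sets[OF measurable_Pair2' E']) (use z in auto)
  show ?thesis
  proof (intro bexI conjI ballI impI)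
    show "(\<lambda>x. (x, z)) -` E \<inter> space (restr n) \<in> sets (\<F> n)" using zE by simp
    have "emeasure (restr n) ((\<lambda>x. (x, z)) -` E \<inter> space (restr n)) = 0"
      using z(2) zE by (subst (asm) AE_iff_measurable[OF zE]) auto
    then show "emeasure P0 ((\<lambda>x. (x, z)) -` E \<inter> space (restr n)) = 0"
      using emeasure_restr[OF n, of "(\<lambda>x. (x, z)) -` E \<inter> space (restr n)"] zE by simp
    fix w assume w: "w \<in> path_space" "w \<notin> (\<lambda>x. (x, z)) -` E \<inter> space (restr n)"
    then have g: "glue n w z \<in> path_space" "glue n w z \<notin> N"
      using z(1) n by (auto simp: E_def space_pair_measure glue_in_path_space)
    then have "\<Phi> (glue n w z)" using N(3) by auto
    then show "\<Phi> w" by (rule dep[OF g(1) w(1), rotated]) (simp add: coord_glue)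
  qed
qed

section \<open>Absence of atoms for positions and running maxima\<close>

lemma coord_ne_const: "0 < t \<Longrightarrow> AE w in P0. coord t w \<noteq> c"
proof -
  assume t: "0 < t"
  \<comment> \<open>The small-ball bound with radius 0 says that a Gaussian law has no
    atoms.\<close>
  have "emeasure (gauss t) {x. \<bar>- c + x\<bar> \<le> 0} \<le> ennreal (0 / sqrt t)"
    by (rule gauss_small_ball) (use t in auto)
  moreover have "{x. \<bar>- c + x\<bar> \<le> 0} = {c}" by auto
  ultimately have "emeasure (gauss t) {c} = 0" by simp
  then have "AE x in gauss t. x \<noteq> c" by (intro AE_I[of _ _ "{c}"]) auto
  moreover have "distr P0 borel (\<lambda>w. coord t w - coord 0 w) = gauss t"
    using distr_increment[of 0 t] t by simp
  ultimately have "AE x in distr P0 borel (\<lambda>w. coord t w - coord 0 w). x \<noteq> c"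
    by (simp only:)
  then have "AE w in P0. coord t w - coord 0 w \<noteq> c"
    by (subst (asm) AE_distr_iff) (use t in auto)
  with B_zero show ?thesis by eventually_elim auto
qed

text \<open>The maximum of \<sigma> X over [d, t] is \<sigma> X_d plus a functional of the
  independent increments after d. Since X_d has no atoms, neither has the sum. As a > 0, the level
  is not attained at time 0, so any time at which it is attained lies beyond d = t / (k + 1) for
  some k, and countably many d and two signs suffice.\<close>

lemma run_max_ne_const:
  assumes t: "0 < t" and a: "0 < a"
  shows "AE w in P0. run_max t w \<noteq> a"
proof -
  have *: "AE w in P0. \<sigma> * coord d w + (SUP r\<in>{0..t - d}. \<sigma> * coord r (increments d w)) \<noteq> a"
    if \<sigma>: "\<sigma> = 1 \<or> \<sigma> = -1" and d: "0 < d" "d \<le> t" for \<sigma> d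
  proof -
    have "0 \<le> d" using d by simp
    let ?D = "distr P0 canon_alg (increments d)"
    interpret R: prob_space "restr d" using d by (intro prob_space_restr) auto
    interpret D: prob_space ?D by (rule prob_space_distr[OF measurable_increments]) (use d in auto)
    interpret pair_sigma_finite "restr d" ?D by unfold_locales
    have m: "(\<lambda>w. (w, increments d w)) \<in> measurable P0 (\<F> d \<Otimes>\<^sub>M canon_alg)"
      by (rule measurable_Pair[OF id_measurable_G measurable_increments]) (use d in auto)
    have [measurable]: "coord d \<in> borel_measurable (\<F> d)" by (rule measurable_coord_filt) (use d in auto)
    have [measurable]: "(\<lambda>z. SUP r\<in>{0..t - d}. \<sigma> * coord r z) \<in> borel_measurable canon_alg"
      by (rule measurable_canon_filt_alg[OF measurable_SUP_coord]) (use d in \<open>auto intro!: continuous_intros\<close>)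
    define E where "E = {p \<in> space (\<F> d \<Otimes>\<^sub>M canon_alg). \<sigma> * coord d (fst p) + (SUP r\<in>{0..t - d}. \<sigma> * coord r (snd p)) \<noteq> a}"
    have E: "E \<in> sets (\<F> d \<Otimes>\<^sub>M canon_alg)" unfolding E_def by measurable
    have E': "E \<in> sets (restr d \<Otimes>\<^sub>M ?D)" using E by (simp cong: sets_pair_measure_cong)
    have "{p \<in> space (restr d \<Otimes>\<^sub>M ?D). p \<in> E} = E" using sets.sets_into_space[OF E'] by auto
    then have Ec: "{p \<in> space (restr d \<Otimes>\<^sub>M ?D). p \<in> E} \<in> sets (restr d \<Otimes>\<^sub>M ?D)"
      using E' by (simp only:)
    have "AE z in ?D. AE x in restr d. (x, z) \<in> E"
    proof (rule AE_I2)
      fix z assume z: "z \<in> space ?D"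
      have "AE x in P0. coord d x \<noteq> \<sigma> * (a - (SUP r\<in>{0..t - d}. \<sigma> * coord r z))"
        using d by (intro coord_ne_const)
      moreover have "{x \<in> space (\<F> d). coord d x \<noteq> \<sigma> * (a - (SUP r\<in>{0..t - d}. \<sigma> * coord r z))} \<in> sets (\<F> d)"
        by measurable
      ultimately have "AE x in restr d. coord d x \<noteq> \<sigma> * (a - (SUP r\<in>{0..t - d}. \<sigma> * coord r z))"
        using d by (subst AE_restr) auto
      then show "AE x in restr d. (x, z) \<in> E"
        using AE_space by eventually_elim (use z \<sigma> in \<open>auto simp: E_def space_pair_measure\<close>)
    qed
    then have "AE p in restr d \<Otimes>\<^sub>M ?D. p \<in> E"
      using AE_commute[of "\<lambda>x z. (x, z) \<in> E"] Ec by (intro AE_pair_measure) auto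
    then have "AE p in distr P0 (\<F> d \<Otimes>\<^sub>M canon_alg) (\<lambda>w. (w, increments d w)). p \<in> E"
      by (simp only: glue_law[OF \<open>0 \<le> d\<close>])
    then have "AE w in P0. (w, increments d w) \<in> E"
      by (subst (asm) AE_distr_iff[OF m]) (use E in auto)
    then show ?thesis by eventually_elim (auto simp: E_def)
  qed
  define S where "S k \<sigma> w = \<sigma> * coord (t / Suc k) w + (SUP r\<in>{0..t - t / Suc k}. \<sigma> * coord r (increments (t / Suc k) w))" for k \<sigma> w
  have "AE w in P0. \<forall>\<sigma>\<in>{1, -1}. S k \<sigma> w \<noteq> a" for k :: nat
  proof -
    have d: "0 < t / Suc k" "t / Suc k \<le> t" using t by (auto simp: divide_le_eq mult_left_mono)
    have "AE w in P0. S k 1 w \<noteq> a" "AE w in P0. S k (-1) w \<noteq> a"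
      unfolding S_def by (rule *[OF _ d]; simp)+
    then show ?thesis by eventually_elim auto
  qed
  then have "AE w in P0. \<forall>k. \<forall>\<sigma>\<in>{1, -1}. S k \<sigma> w \<noteq> a"
    unfolding AE_all_countable by blast
  with B_zero AE_space show ?thesis
  proof eventually_elim
    case (elim w)
    then have w: "w \<in> path_space" by simp
    show ?case
    proof
      assume eq: "run_max t w = a"
      obtain u where u: "u \<in> {0..t}" "a = \<bar>coord u w\<bar>" using run_max_attained[OF w, of t] t eq by auto
      with elim a have "u \<noteq> 0" by auto
      with u have u0: "0 < u" by auto
      then obtain k :: nat where k: "t / u < real k" using reals_Archimedean2 by blast
      define d where "d = t / Suc k"
      have d: "0 < d" "d \<le> u" "d \<le> t" using t u0 k u by (auto simp: d_def field_simps)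
      define \<sigma> :: real where "\<sigma> = (if 0 \<le> coord u w then 1 else -1)"
      have \<sigma>: "\<sigma> \<in> {1, -1}" "\<sigma> * coord u w = a" "\<And>x. \<sigma> * x \<le> \<bar>x\<bar>" using u by (auto simp: \<sigma>_def)
      have "(SUP r\<in>{0..t - d}. \<sigma> * coord r (increments d w)) = a - \<sigma> * coord d w"
      proof (rule cSup_eq_maximum)
        show "a - \<sigma> * coord d w \<in> (\<lambda>r. \<sigma> * coord r (increments d w)) ` {0..t - d}"
          using \<sigma> u d by (intro image_eqI[of _ _ "u - d"]) (auto simp: algebra_simps)
        fix y assume "y \<in> (\<lambda>r. \<sigma> * coord r (increments d w)) ` {0..t - d}"
        then obtain r where r: "0 \<le> r" "r \<le> t - d" "y = \<sigma> * coord (d + r) w - \<sigma> * coord d w" by (auto simp: algebra_simps)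
        have "\<sigma> * coord (d + r) w \<le> a"
          using \<sigma>(3)[of "coord (d + r) w"] abs_coord_le_run_max[OF w, of "d + r" t] r d eq by auto
        then show "y \<le> a - \<sigma> * coord d w" using r by simp
      qed
      then have "S k \<sigma> w = a" by (simp add: S_def d_def)
      with elim(3) \<sigma>(1) show False by blast
    qed
  qed
qed

end

section \<open>Discrete Tanaka formula\<close>

text \<open>Unlike \<^const>\<open>sgn\<close>, this sign never vanishes, so integrating it keeps Gaussian increments Gaussian.\<close>

definition sg :: "real \<Rightarrow> real" where "sg x = (if 0 \<le> x then 1 else - 1)"

lemma sg_measurable [measurable]: "sg \<in> borel_measurable borel"
  unfolding sg_def[abs_def] by measurable

lemma sg_abs [simp]: "\<bar>sg x\<bar> = 1" and sg_power2 [simp]: "(sg x)\<^sup>2 = 1" and sg_mult_self: "sg x * x = \<bar>x\<bar>"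
  by (auto simp: sg_def)

lemma sg_eq_sgn: "x \<noteq> 0 \<Longrightarrow> sg x = sgn x"
  by (auto simp: sg_def sgn_if)

lemma abs_diff_same_sign: "0 < x * y \<Longrightarrow> \<bar>y\<bar> = \<bar>x\<bar> + sg x * (y - x)"
  by (auto simp: sg_def zero_less_mult_iff)

lemma abs_le_diff_of_sign_change:
  fixes x y :: real
  assumes "x * y \<le> 0"
  shows "\<bar>x\<bar> \<le> \<bar>y - x\<bar>" "\<bar>y\<bar> \<le> \<bar>y - x\<bar>"
  using assms by (auto simp: mult_le_0_iff)

text \<open>The singular case p = a is included: the antiderivative 2 sqrt(x - a) is continuous up
  to the endpoint, and differentiability in the interior is enough.\<close>

lemma nn_integral_inverse_sqrt:
  assumes "a \<le> p" "p \<le> q"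
  shows "(\<integral>\<^sup>+x. ennreal (1 / sqrt (x - a)) * indicator {p<..q} x \<partial>lborel) = ennreal (2 * (sqrt (q - a) - sqrt (p - a)))"
proof -
  have "((\<lambda>x. 1 / sqrt (x - a)) has_integral (2 * sqrt (q - a) - 2 * sqrt (p - a))) {p..q}"
  proof (rule fundamental_theorem_of_calculus_interior)
    show "continuous_on {p..q} (\<lambda>x. 2 * sqrt (x - a))" by (intro continuous_intros)
    fix x assume "x \<in> {p<..<q}"
    then have "0 < x - a" using assms by auto
    then have "((\<lambda>x. 2 * sqrt (x - a)) has_real_derivative 1 / sqrt (x - a)) (at x)"
      by (auto intro!: derivative_eq_intros simp: field_simps)
    then show "((\<lambda>x. 2 * sqrt (x - a)) has_vector_derivative 1 / sqrt (x - a)) (at x)"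
      by (simp add: has_real_derivative_iff_has_vector_derivative)
  qed fact
  then have "(\<integral>\<^sup>+x. ennreal (1 / sqrt (x - a)) * indicator {p..q} x \<partial>lborel) = ennreal (2 * sqrt (q - a) - 2 * sqrt (p - a))"
    by (intro nn_integral_has_integral_lebesgue') (use assms in auto)
  moreover have "(\<integral>\<^sup>+x. ennreal (1 / sqrt (x - a)) * indicator {p..q} x \<partial>lborel) = (\<integral>\<^sup>+x. ennreal (1 / sqrt (x - a)) * indicator {p<..q} x \<partial>lborel)"
    by (rule nn_integral_cong_AE, rule AE_I[of _ _ "{p}"]) (auto split: split_indicator)
  ultimately show ?thesis by (simp add: algebra_simps)
qed

text \<open>Extends a bound known for ordered pairs of times to all pairs: the kernel with exchanged
  arguments is added, and Tonelli gives both terms the same integral.\<close>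

lemma nn_integral_symmetrize:
  fixes K :: "real \<Rightarrow> real \<Rightarrow> ennreal"
  assumes K: "(\<lambda>z. K (fst z) (snd z)) \<in> borel_measurable (borel \<Otimes>\<^sub>M borel)"
  shows "(\<integral>\<^sup>+s. (\<integral>\<^sup>+r. c * K s r + c * K r s \<partial>lborel) \<partial>lborel) = 2 * c * (\<integral>\<^sup>+s. (\<integral>\<^sup>+r. K s r \<partial>lborel) \<partial>lborel)"
proof -
  have Kst: "case_prod K \<in> borel_measurable (lborel \<Otimes>\<^sub>M lborel)"
    using K by (simp add: split_beta' cong: measurable_cong_sets sets_pair_measure_cong)
  have Ksw: "case_prod (\<lambda>s r. K r s) \<in> borel_measurable (lborel \<Otimes>\<^sub>M lborel)"
    using measurable_compose[OF measurable_pair_swap' Kst] by (simp add: split_beta')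
  have K1: "(\<lambda>r. K s r) \<in> borel_measurable lborel" "(\<lambda>r. K r s) \<in> borel_measurable lborel" for s
    using measurable_compose[OF measurable_Pair1' Kst, of s] measurable_compose[OF measurable_Pair1' Ksw, of s] by auto
  note K2 = lborel.borel_measurable_nn_integral[OF Kst] lborel.borel_measurable_nn_integral[OF Ksw]
  have c: "(\<lambda>x. c * g x) \<in> borel_measurable lborel" if "g \<in> borel_measurable lborel" for g :: "real \<Rightarrow> ennreal"
    using that by measurable
  have "(\<integral>\<^sup>+r. c * K s r + c * K r s \<partial>lborel) = c * (\<integral>\<^sup>+r. K s r \<partial>lborel) + c * (\<integral>\<^sup>+r. K r s \<partial>lborel)" for s
    by (simp only: nn_integral_add[OF c[OF K1(1)] c[OF K1(2)]] nn_integral_cmult[OF K1(1)] nn_integral_cmult[OF K1(2)])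
  then have "(\<integral>\<^sup>+s. (\<integral>\<^sup>+r. c * K s r + c * K r s \<partial>lborel) \<partial>lborel) = c * (\<integral>\<^sup>+s. (\<integral>\<^sup>+r. K s r \<partial>lborel) \<partial>lborel) + c * (\<integral>\<^sup>+s. (\<integral>\<^sup>+r. K r s \<partial>lborel) \<partial>lborel)"
    by (simp only: nn_integral_add[OF c[OF K2(1)] c[OF K2(2)]] nn_integral_cmult[OF K2(1)] nn_integral_cmult[OF K2(2)])
  also have "(\<integral>\<^sup>+s. (\<integral>\<^sup>+r. K r s \<partial>lborel) \<partial>lborel) = (\<integral>\<^sup>+s. (\<integral>\<^sup>+r. K s r \<partial>lborel) \<partial>lborel)"
    by (rule lborel_pair.Fubini'[OF Kst])
  finally show ?thesis by (simp only: mult_2 distrib_right)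
qed

lemma integrable_mult_of_squares:
  fixes f g :: "'a \<Rightarrow> real"
  assumes [measurable]: "f \<in> borel_measurable M" "g \<in> borel_measurable M"
    and "integrable M (\<lambda>x. (f x)\<^sup>2)" "integrable M (\<lambda>x. (g x)\<^sup>2)"
  shows "integrable M (\<lambda>x. f x * g x)"
proof (rule Bochner_Integration.integrable_bound)
  show "integrable M (\<lambda>x. (f x)\<^sup>2 + (g x)\<^sup>2)" using assms by auto
  have "norm (f x * g x) \<le> norm ((f x)\<^sup>2 + (g x)\<^sup>2)" for x
  proof -
    have "2 * \<bar>f x * g x\<bar> \<le> (f x)\<^sup>2 + (g x)\<^sup>2"
      using sum_squares_bound[of "\<bar>f x\<bar>" "\<bar>g x\<bar>"] by (simp add: abs_mult)
    moreover have "0 \<le> \<bar>f x * g x\<bar>" by simp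
    ultimately show ?thesis by auto
  qed
  then show "AE x in M. norm (f x * g x) \<le> norm ((f x)\<^sup>2 + (g x)\<^sup>2)" by simp
qed measurable

lemma integrable_square_diff:
  fixes f g :: "'a \<Rightarrow> real"
  assumes "f \<in> borel_measurable M" "g \<in> borel_measurable M"
    and "integrable M (\<lambda>x. (f x)\<^sup>2)" "integrable M (\<lambda>x. (g x)\<^sup>2)"
  shows "integrable M (\<lambda>x. (f x - g x)\<^sup>2)"
  using assms integrable_mult_of_squares[OF assms] by (simp add: power2_diff mult.assoc)

text \<open>Pythagoras for martingale differences. Orthogonality is asked for only when the partial
  sum is square integrable, which the induction has established by the time it is used.\<close>

lemma integral_square_sum_orthogonal:
  fixes D :: "nat \<Rightarrow> 'a \<Rightarrow> real"
  assumes m: "\<And>i. i < n \<Longrightarrow> D i \<in> borel_measurable M"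
    and sq: "\<And>i. i < n \<Longrightarrow> integrable M (\<lambda>x. (D i x)\<^sup>2)"
    and orth: "\<And>i. i < n \<Longrightarrow> integrable M (\<lambda>x. (\<Sum>j<i. D j x)\<^sup>2) \<Longrightarrow> (\<integral>x. (\<Sum>j<i. D j x) * D i x \<partial>M) = 0"
  shows "integrable M (\<lambda>x. (\<Sum>i<n. D i x)\<^sup>2) \<and> (\<integral>x. (\<Sum>i<n. D i x)\<^sup>2 \<partial>M) = (\<Sum>i<n. \<integral>x. (D i x)\<^sup>2 \<partial>M)"
proof -
  have "k \<le> n \<Longrightarrow> integrable M (\<lambda>x. (\<Sum>i<k. D i x)\<^sup>2) \<and> (\<integral>x. (\<Sum>i<k. D i x)\<^sup>2 \<partial>M) = (\<Sum>i<k. \<integral>x. (D i x)\<^sup>2 \<partial>M)" for k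
  proof (induction k)
    case (Suc k)
    then have IH: "integrable M (\<lambda>x. (\<Sum>i<k. D i x)\<^sup>2)" "(\<integral>x. (\<Sum>i<k. D i x)\<^sup>2 \<partial>M) = (\<Sum>i<k. \<integral>x. (D i x)\<^sup>2 \<partial>M)" by auto
    have k: "k < n" using Suc by auto
    have [measurable]: "(\<lambda>x. \<Sum>i<k. D i x) \<in> borel_measurable M" "D k \<in> borel_measurable M"
      using m k by auto
    have p: "integrable M (\<lambda>x. (\<Sum>i<k. D i x) * D k x)"
      by (rule integrable_mult_of_squares) (use IH sq[OF k] in auto)
    have eq: "(\<Sum>i<Suc k. D i x)\<^sup>2 = (\<Sum>i<k. D i x)\<^sup>2 + (D k x)\<^sup>2 + 2 * ((\<Sum>i<k. D i x) * D k x)" for x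
      by (simp add: power2_sum)
    show ?case
      unfolding eq using IH sq[OF k] p orth[OF k IH(1)] by simp
  qed simp
  then show ?thesis by simp
qed

definition grid :: "real \<Rightarrow> real \<Rightarrow> nat \<Rightarrow> nat \<Rightarrow> real" where
  "grid s t n i = s + (t - s) * real i / real n"

lemma grid_0 [simp]: "grid s t n 0 = s" and grid_n [simp]: "0 < n \<Longrightarrow> grid s t n n = t"
  by (simp_all add: grid_def)

lemma grid_diff: "grid s t n (Suc i) - grid s t n i = (t - s) / real n"
  by (simp add: grid_def add_divide_distrib ring_distribs diff_divide_distrib)

lemma grid_mono: "s \<le> t \<Longrightarrow> i \<le> j \<Longrightarrow> grid s t n i \<le> grid s t n j"
  by (simp add: grid_def divide_right_mono mult_left_mono)

lemma grid_ge: "s \<le> t \<Longrightarrow> s \<le> grid s t n i"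
  using grid_mono[of s t 0 i n] by simp

lemma grid_le: "s \<le> t \<Longrightarrow> 0 < n \<Longrightarrow> i \<le> n \<Longrightarrow> grid s t n i \<le> t"
  using grid_mono[of s t i n n] by simp

lemma grid_less: "s < t \<Longrightarrow> 0 < n \<Longrightarrow> grid s t n i < grid s t n (Suc i)"
  using grid_diff[of s t n i] by (metis diff_gt_0_iff_gt divide_pos_pos of_nat_0_less_iff)

text \<open>By the inequality of the means, 1 / sqrt m <= 2 sqrt m - 2 sqrt(m - 1), and the right
  side telescopes.\<close>

lemma sum_inverse_sqrt_le: "(\<Sum>i\<in>{1..<n}. 1 / sqrt (real i)) \<le> 2 * sqrt (real n)"
proof -
  have "(\<Sum>i\<in>{1..n}. 1 / sqrt (real i)) \<le> 2 * sqrt (real n)"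
  proof (induction n)
    case (Suc n)
    let ?m = "real (Suc n)"
    have "2 * (sqrt ?m * sqrt (real n)) \<le> (sqrt ?m)\<^sup>2 + (sqrt (real n))\<^sup>2"
      using sum_squares_bound[of "sqrt ?m" "sqrt (real n)"] by (simp add: mult.assoc)
    then have "1 \<le> 2 * (sqrt ?m * sqrt ?m) - 2 * (sqrt ?m * sqrt (real n))" by simp
    also have "\<dots> = (2 * sqrt ?m - 2 * sqrt (real n)) * sqrt ?m" by (simp add: algebra_simps)
    finally have "1 / sqrt ?m \<le> 2 * sqrt ?m - 2 * sqrt (real n)"
      by (subst pos_divide_le_eq) auto
    then show ?case using Suc by simp
  qed simp
  moreover have "(\<Sum>i\<in>{1..<n}. 1 / sqrt (real i)) \<le> (\<Sum>i\<in>{1..n}. 1 / sqrt (real i))"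
    by (rule sum_mono2) auto
  ultimately show ?thesis by simp
qed

section \<open>Small-ball and sign-change estimates\<close>

context brownian
begin

lemma small_ball:
  assumes "0 < p" "0 \<le> e"
  shows "emeasure P {w \<in> space P. \<bar>B p w\<bar> \<le> e} \<le> ennreal (e / sqrt p)"
proof -
  have "emeasure P {w \<in> space P. \<bar>B p w\<bar> \<le> e} = emeasure P {w \<in> space P. \<bar>0 + (B p w - B 0 w)\<bar> \<le> e}"
    using assms by (intro emeasure_eq_AE) (use B_zero in \<open>auto elim: eventually_mono\<close>)
  also have "\<dots> = emeasure (distr P borel (\<lambda>w. B p w - B 0 w)) {x. \<bar>0 + x\<bar> \<le> e}"
    using assms by (subst emeasure_distr) (auto intro!: arg_cong[where f="emeasure P"])
  also have "\<dots> = emeasure (gauss p) {x. \<bar>0 + x\<bar> \<le> e}"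
    using distr_increment[of 0 p] assms by simp
  also have "\<dots> \<le> ennreal (e / sqrt p)"
    by (rule gauss_small_ball) (use assms in auto)
  finally show ?thesis .
qed

text \<open>Freezing at time p gives the factor e / sqrt(q - p) for the second condition whatever
  the position at p is, because the Gaussian bound is uniform in the centre; the first condition
  gives e / sqrt p.\<close>

lemma small_ball_two_times:
  assumes p: "0 < p" "p < q" and e: "0 \<le> e"
  shows "emeasure P {w \<in> space P. \<bar>B p w\<bar> \<le> e \<and> \<bar>B q w\<bar> \<le> e} \<le> ennreal (e\<^sup>2 / (sqrt p * sqrt (q - p)))"
proof -
  have [measurable]: "B p \<in> borel_measurable (G p)" "B q \<in> borel_measurable P" "B p \<in> borel_measurable P"
    using p by (auto intro: B_measurable_G)
  let ?F = "\<lambda>(w, x). indicator {y. \<bar>y\<bar> \<le> e} (B p w) * indicator {y. \<bar>y\<bar> \<le> e} (B p w + x) :: ennreal"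
  have F: "?F \<in> borel_measurable (G p \<Otimes>\<^sub>M borel)" by measurable
  have "emeasure P {w \<in> space P. \<bar>B p w\<bar> \<le> e \<and> \<bar>B q w\<bar> \<le> e} = (\<integral>\<^sup>+w. indicator {w \<in> space P. \<bar>B p w\<bar> \<le> e \<and> \<bar>B q w\<bar> \<le> e} w \<partial>P)"
    by (rule nn_integral_indicator[symmetric]) measurable
  also have "\<dots> = (\<integral>\<^sup>+w. ?F (w, B q w - B p w) \<partial>P)"
    by (intro nn_integral_cong) (auto split: split_indicator)
  also have "\<dots> = (\<integral>\<^sup>+w. (\<integral>\<^sup>+x. ?F (w, x) \<partial>gauss (q - p)) \<partial>P)"
    using p by (intro freeze_nn_integral[OF _ _ F]) auto
  also have "\<dots> \<le> (\<integral>\<^sup>+w. indicator {w \<in> space P. \<bar>B p w\<bar> \<le> e} w * ennreal (e / sqrt (q - p)) \<partial>P)"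
  proof (intro nn_integral_mono)
    fix w assume w: "w \<in> space P"
    have "(\<integral>\<^sup>+x. ?F (w, x) \<partial>gauss (q - p)) = (\<integral>\<^sup>+x. indicator {w \<in> space P. \<bar>B p w\<bar> \<le> e} w * indicator {x. \<bar>B p w + x\<bar> \<le> e} x \<partial>gauss (q - p))"
      using w by (intro nn_integral_cong) (auto split: split_indicator)
    also have "\<dots> = indicator {w \<in> space P. \<bar>B p w\<bar> \<le> e} w * (\<integral>\<^sup>+x. indicator {x. \<bar>B p w + x\<bar> \<le> e} x \<partial>gauss (q - p))"
      by (rule nn_integral_cmult) simp
    also have "(\<integral>\<^sup>+x. indicator {x. \<bar>B p w + x\<bar> \<le> e} x \<partial>gauss (q - p)) = emeasure (gauss (q - p)) {x. \<bar>B p w + x\<bar> \<le> e}"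
      by (rule nn_integral_indicator) simp
    also have "indicator {w \<in> space P. \<bar>B p w\<bar> \<le> e} w * emeasure (gauss (q - p)) {x. \<bar>B p w + x\<bar> \<le> e}
        \<le> indicator {w \<in> space P. \<bar>B p w\<bar> \<le> e} w * ennreal (e / sqrt (q - p))"
      by (intro mult_left_mono gauss_small_ball) (use p e in auto)
    finally show "(\<integral>\<^sup>+x. ?F (w, x) \<partial>gauss (q - p)) \<le> indicator {w \<in> space P. \<bar>B p w\<bar> \<le> e} w * ennreal (e / sqrt (q - p))" .
  qed
  also have "\<dots> = emeasure P {w \<in> space P. \<bar>B p w\<bar> \<le> e} * ennreal (e / sqrt (q - p))"
    by (subst nn_integral_multc) auto
  also have "\<dots> \<le> ennreal (e / sqrt p) * ennreal (e / sqrt (q - p))"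
    by (intro mult_right_mono small_ball) (use p e in auto)
  also have "\<dots> = ennreal (e\<^sup>2 / (sqrt p * sqrt (q - p)))"
    using p e by (subst ennreal_mult[symmetric]) (auto simp: power2_eq_square)
  finally show ?thesis .
qed

text \<open>A sign change forces the modulus of B p to be at most that of the increment x.
  Integrating first over the past, with x fixed, costs a probability of at most |x| / sqrt p and
  leaves the third absolute moment of the increment: a gain of sqrt(q - p) / sqrt p over the plain
  second moment.\<close>

lemma sign_change_square:
  assumes p: "0 < p" "p < q"
  shows "(\<integral>\<^sup>+w. ennreal ((B q w - B p w)\<^sup>2) * indicator {w. B p w * B q w \<le> 0} w \<partial>P)
     \<le> ennreal (2 * (q - p) * sqrt (q - p) / sqrt p)"
proof -
  have [measurable]: "B p \<in> borel_measurable (G p)" "B q \<in> borel_measurable P" "B p \<in> borel_measurable P"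
    using p by (auto intro: B_measurable_G)
  interpret N: prob_space "gauss (q - p)" using p by (intro prob_space_gauss) auto
  interpret pair_sigma_finite P "gauss (q - p)" by unfold_locales
  let ?F = "\<lambda>(w, x). ennreal (x\<^sup>2) * indicator {(w, x). \<bar>B p w\<bar> \<le> \<bar>x\<bar>} (w, x) :: ennreal"
  have F: "?F \<in> borel_measurable (G p \<Otimes>\<^sub>M borel)" by measurable
  have F': "?F \<in> borel_measurable (P \<Otimes>\<^sub>M gauss (q - p))" by measurable
  have "(\<integral>\<^sup>+w. ennreal ((B q w - B p w)\<^sup>2) * indicator {w. B p w * B q w \<le> 0} w \<partial>P)
     \<le> (\<integral>\<^sup>+w. ?F (w, B q w - B p w) \<partial>P)"
    using abs_le_diff_of_sign_change(1) by (intro nn_integral_mono) (auto split: split_indicator)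
  also have "\<dots> = (\<integral>\<^sup>+w. (\<integral>\<^sup>+x. ?F (w, x) \<partial>gauss (q - p)) \<partial>P)"
    using p by (intro freeze_nn_integral[OF _ _ F]) auto
  also have "\<dots> = (\<integral>\<^sup>+x. (\<integral>\<^sup>+w. ?F (w, x) \<partial>P) \<partial>gauss (q - p))"
    using Fubini[OF F'] by simp
  also have "\<dots> \<le> (\<integral>\<^sup>+x. ennreal (\<bar>x\<bar>^3 / sqrt p) \<partial>gauss (q - p))"
  proof (intro nn_integral_mono)
    fix x :: real
    have "(\<integral>\<^sup>+w. ?F (w, x) \<partial>P) = ennreal (x\<^sup>2) * (\<integral>\<^sup>+w. indicator {w \<in> space P. \<bar>B p w\<bar> \<le> \<bar>x\<bar>} w \<partial>P)"
      by (subst nn_integral_cmult[symmetric]) (auto intro!: nn_integral_cong split: split_indicator)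
    also have "(\<integral>\<^sup>+w. indicator {w \<in> space P. \<bar>B p w\<bar> \<le> \<bar>x\<bar>} w \<partial>P) = emeasure P {w \<in> space P. \<bar>B p w\<bar> \<le> \<bar>x\<bar>}"
      by (rule nn_integral_indicator) measurable
    also have "ennreal (x\<^sup>2) * emeasure P {w \<in> space P. \<bar>B p w\<bar> \<le> \<bar>x\<bar>} \<le> ennreal (x\<^sup>2) * ennreal (\<bar>x\<bar> / sqrt p)"
      by (intro mult_left_mono small_ball) (use p in auto)
    also have "ennreal (x\<^sup>2) * ennreal (\<bar>x\<bar> / sqrt p) = ennreal (\<bar>x\<bar>^3 / sqrt p)"
      using p by (subst ennreal_mult[symmetric]) (auto simp: power3_eq_cube power2_eq_square abs_mult_self_eq)
    finally show "(\<integral>\<^sup>+w. ?F (w, x) \<partial>P) \<le> ennreal (\<bar>x\<bar>^3 / sqrt p)" .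
  qed
  also have "\<dots> = ennreal (\<integral>x. \<bar>x\<bar>^3 / sqrt p \<partial>gauss (q - p))"
    using p gauss_abs_power3[of "q - p"] by (intro nn_integral_eq_integral) auto
  also have "\<dots> \<le> ennreal (2 * (q - p) * sqrt (q - p) / sqrt p)"
    using p gauss_abs_power3[of "q - p"] by (intro ennreal_leI) (simp add: divide_right_mono)
  finally show ?thesis .
qed

lemma increment_square:
  assumes "0 \<le> p" "p < q"
  shows "integrable P (\<lambda>w. (B q w - B p w)\<^sup>2)" "(\<integral>w. (B q w - B p w)\<^sup>2 \<partial>P) = q - p"
  using increment_integrable[OF assms, of "\<lambda>x. x\<^sup>2"] gauss_power_integrable[of "q - p" 2] gauss_power2[of "q - p"] assms
  by auto

end

section \<open>Increments of the local time in L^2\<close>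

locale local_time = wiener +
  fixes L :: "real \<Rightarrow> path \<Rightarrow> real"
  assumes local_time: "is_local_time_0 P0 L"
begin

lemma L_measurable_filt: "0 \<le> s \<Longrightarrow> s \<le> t \<Longrightarrow> L s \<in> borel_measurable (\<F> t)"
  using local_time by (auto simp: is_local_time_0_def intro: measurable_canon_filt_mono)

lemma L_measurable [measurable]: "0 \<le> s \<Longrightarrow> L s \<in> borel_measurable canon_alg"
  by (rule measurable_canon_filt_alg[OF L_measurable_filt[of s s]]) auto

lemma L_regular: "AE w in P0. L 0 w = 0 \<and> continuous_on {0..} (\<lambda>t. L t w) \<and> mono_on {0..} (\<lambda>t. L t w)"
  using local_time by (simp add: is_local_time_0_def)

text \<open>Tanaka's formula will identify the increments of this martingale as stochastic integrals
  of \<open>sg\<close> of the path against the path.\<close>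

definition \<beta> :: "real \<Rightarrow> path \<Rightarrow> real" where "\<beta> t w = \<bar>coord t w\<bar> - L t w"

lemma \<beta>_martingale: "martingale_wrt P0 \<F> \<beta>"
  using local_time by (simp add: is_local_time_0_def \<beta>_def[abs_def])

lemma \<beta>_measurable_filt: "0 \<le> s \<Longrightarrow> s \<le> t \<Longrightarrow> \<beta> s \<in> borel_measurable (\<F> t)"
  unfolding \<beta>_def[abs_def]
  by (intro borel_measurable_diff borel_measurable_abs measurable_coord_filt L_measurable_filt)

lemma \<beta>_measurable [measurable]: "0 \<le> s \<Longrightarrow> \<beta> s \<in> borel_measurable canon_alg"
  by (rule measurable_canon_filt_alg[OF \<beta>_measurable_filt[of s s]]) auto

lemma \<beta>_orthogonal:
  assumes st: "0 \<le> s" "s \<le> t" and f: "f \<in> borel_measurable (\<F> s)"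
    and int: "integrable P0 (\<lambda>w. f w * (\<beta> t w - \<beta> s w))"
  shows "(\<integral>w. f w * (\<beta> t w - \<beta> s w) \<partial>P0) = 0"
proof -
  interpret F: finite_measure_subalgebra P0 "\<F> s"
    by unfold_locales (rule subalgebra_G[OF st(1)])
  have i: "integrable P0 (\<beta> r)" if "0 \<le> r" for r
    using \<beta>_martingale that by (simp add: martingale_wrt_def)
  have "AE w in P0. real_cond_exp P0 (\<F> s) (\<lambda>w. \<beta> t w - \<beta> s w) w =
     real_cond_exp P0 (\<F> s) (\<beta> t) w - real_cond_exp P0 (\<F> s) (\<beta> s) w"
    using st by (intro F.real_cond_exp_diff i) auto
  moreover have "AE w in P0. real_cond_exp P0 (\<F> s) (\<beta> t) w = \<beta> s w"
    using \<beta>_martingale st by (simp add: martingale_wrt_def)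
  moreover have "AE w in P0. real_cond_exp P0 (\<F> s) (\<beta> s) w = \<beta> s w"
    using st by (intro F.real_cond_exp_F_meas i \<beta>_measurable_filt) auto
  ultimately have z: "AE w in P0. real_cond_exp P0 (\<F> s) (\<lambda>w. \<beta> t w - \<beta> s w) w = 0"
    by eventually_elim auto
  have "(\<integral>w. f w * (\<beta> t w - \<beta> s w) \<partial>P0) = (\<integral>w. f w * real_cond_exp P0 (\<F> s) (\<lambda>w. \<beta> t w - \<beta> s w) w \<partial>P0)"
    using st by (intro F.real_cond_exp_intg(2)[symmetric] int f) auto
  also have "\<dots> = (\<integral>w. 0 \<partial>P0)"
    by (rule integral_cong_AE) (use z F.subalg f in \<open>auto intro: measurable_from_subalg elim: eventually_mono\<close>)
  finally show ?thesis by simp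
qed

text \<open>The time spent within e of 0 during (p, q]. For p >= 0 the clamped time equals r on this
  interval; it makes the integrand jointly measurable on the whole line.\<close>

definition occ :: "real \<Rightarrow> real \<Rightarrow> real \<Rightarrow> path \<Rightarrow> ennreal" where
  "occ e p q w = (\<integral>\<^sup>+r. indicator {p<..q} r * indicator {x. \<bar>x\<bar> \<le> e} (coord (max 0 (min r q)) w) \<partial>lborel)"

lemma joint_measurable_P0:
  assumes "0 \<le> q"
  shows "(\<lambda>(r, w). coord (max 0 (min r q)) w) \<in> borel_measurable (borel \<Otimes>\<^sub>M P0)"
proof -
  have "(\<lambda>(r, w). (r, w)) \<in> measurable (borel \<Otimes>\<^sub>M P0) (borel \<Otimes>\<^sub>M \<F> q)"
    unfolding split_beta' using id_measurable_G[OF assms]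
    by (intro measurable_Pair measurable_fst measurable_compose[OF measurable_snd]) auto
  from measurable_compose[OF this measurable_coord_joint[OF assms]] show ?thesis
    by (simp add: split_beta')
qed

text \<open>The squared occupation time is a double time integral of the probability of being close
  to 0 at both times, and \<open>small_ball_two_times\<close> bounds this by an integrable kernel
  times e^2. The power e^2 cancels the normalisation (c / e)^2 of the local time. The constant 8 is
  made of three factors 2: one from symmetrising the two times, two from integrating inverse square
  roots.\<close>

lemma occ_second_moment:
  assumes pq: "0 \<le> p" "p < q" and e: "0 \<le> e"
  shows "(\<integral>\<^sup>+w. (occ e p q w)\<^sup>2 \<partial>P0) \<le> ennreal (8 * e\<^sup>2 * sqrt (q - p) * (sqrt q - sqrt p))"
proof -
  have q: "0 \<le> q" using pq by simp
  interpret LP: pair_sigma_finite lborel P0 by unfold_locales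
  define c where "c r w = coord (max 0 (min r q)) w" for r w
  have c [measurable]: "(\<lambda>z. c (fst z) (snd z)) \<in> borel_measurable (borel \<Otimes>\<^sub>M P0)"
    using joint_measurable_P0[OF q] by (simp add: c_def split_beta')
  define f where "f r w = (indicator {p<..q} r * indicator {x. \<bar>x\<bar> \<le> e} (c r w) :: ennreal)" for r w
  have f [measurable]: "(\<lambda>z. f (fst z) (snd z)) \<in> borel_measurable (borel \<Otimes>\<^sub>M P0)"
    unfolding f_def by measurable
  have f1 [measurable]: "(\<lambda>r. f r w) \<in> borel_measurable borel" if "w \<in> space P0" for w
    using measurable_compose[OF measurable_Pair2'[OF that, of borel] f] by simp
  define K where "K s r = ennreal (1 / sqrt (s - 0)) * indicator {p<..q} s * (ennreal (1 / sqrt (r - s)) * indicator {s<..q} r)" for s r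
  have K [measurable]: "(\<lambda>z. K (fst z) (snd z)) \<in> borel_measurable (borel \<Otimes>\<^sub>M borel)"
  proof -
    \<comment> \<open>The indicator of an interval moving with s becomes the indicator of a fixed
      subset of the plane, for joint measurability.\<close>
    have *: "indicator {fst z<..q} (snd z) = (indicator {z. fst z < snd z \<and> snd z \<le> q} z :: ennreal)" for z :: "real \<times> real"
      by (auto split: split_indicator)
    show ?thesis unfolding K_def * by measurable
  qed
  have two: "(\<integral>\<^sup>+w. f s w * f r w \<partial>P0) \<le> ennreal (e\<^sup>2) * K s r" if sr: "s < r" for s r
  proof (cases "p < s \<and> r \<le> q")
    case True
    then have "(\<integral>\<^sup>+w. f s w * f r w \<partial>P0) = (\<integral>\<^sup>+w. indicator {w \<in> space P0. \<bar>coord s w\<bar> \<le> e \<and> \<bar>coord r w\<bar> \<le> e} w \<partial>P0)"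
      using sr pq by (intro nn_integral_cong) (auto simp: f_def c_def max_def min_def split: split_indicator)
    also have "\<dots> = emeasure P0 {w \<in> space P0. \<bar>coord s w\<bar> \<le> e \<and> \<bar>coord r w\<bar> \<le> e}"
    proof (rule nn_integral_indicator)
      have [measurable]: "coord s \<in> borel_measurable P0" "coord r \<in> borel_measurable P0"
        using True pq sr by (auto intro: B_measurable)
      show "{w \<in> space P0. \<bar>coord s w\<bar> \<le> e \<and> \<bar>coord r w\<bar> \<le> e} \<in> sets P0" by measurable
    qed
    also have "\<dots> \<le> ennreal (e\<^sup>2 / (sqrt s * sqrt (r - s)))"
      by (rule small_ball_two_times) (use True pq sr e in auto)
    also have "\<dots> = ennreal (e\<^sup>2) * K s r"
      using True sr pq by (auto simp: K_def ennreal_mult[symmetric])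
    finally show ?thesis .
  next
    case False
    then have "(\<integral>\<^sup>+w. f s w * f r w \<partial>P0) = (\<integral>\<^sup>+w. 0 \<partial>P0)"
      using sr by (intro nn_integral_cong) (auto simp: f_def split: split_indicator)
    then show ?thesis by simp
  qed
  have KI: "(\<integral>\<^sup>+s. (\<integral>\<^sup>+r. K s r \<partial>lborel) \<partial>lborel) \<le> ennreal (4 * sqrt (q - p) * (sqrt q - sqrt p))"
  proof -
    have "(\<integral>\<^sup>+r. K s r \<partial>lborel) \<le> ennreal (1 / sqrt (s - 0)) * indicator {p<..q} s * ennreal (2 * sqrt (q - p))" for s
    proof (cases "p < s \<and> s \<le> q")
      case True
      have "(\<integral>\<^sup>+r. K s r \<partial>lborel) = ennreal (1 / sqrt (s - 0)) * indicator {p<..q} s * (\<integral>\<^sup>+r. ennreal (1 / sqrt (r - s)) * indicator {s<..q} r \<partial>lborel)"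
        unfolding K_def by (rule nn_integral_cmult) measurable
      also have "(\<integral>\<^sup>+r. ennreal (1 / sqrt (r - s)) * indicator {s<..q} r \<partial>lborel) = ennreal (2 * (sqrt (q - s) - sqrt (s - s)))"
        by (rule nn_integral_inverse_sqrt) (use True in auto)
      also have "ennreal (1 / sqrt (s - 0)) * indicator {p<..q} s * ennreal (2 * (sqrt (q - s) - sqrt (s - s)))
          \<le> ennreal (1 / sqrt (s - 0)) * indicator {p<..q} s * ennreal (2 * sqrt (q - p))"
        using True by (intro mult_left_mono ennreal_leI) auto
      finally show ?thesis .
    qed (auto simp: K_def split: split_indicator)
    then have "(\<integral>\<^sup>+s. (\<integral>\<^sup>+r. K s r \<partial>lborel) \<partial>lborel) \<le> (\<integral>\<^sup>+s. ennreal (1 / sqrt (s - 0)) * indicator {p<..q} s * ennreal (2 * sqrt (q - p)) \<partial>lborel)"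
      by (rule nn_integral_mono)
    also have "\<dots> = ennreal (2 * (sqrt (q - 0) - sqrt (p - 0))) * ennreal (2 * sqrt (q - p))"
      by (subst nn_integral_multc) (use pq nn_integral_inverse_sqrt[of 0 p q] in auto)
    also have "\<dots> = ennreal (4 * sqrt (q - p) * (sqrt q - sqrt p))"
      using pq by (subst ennreal_mult[symmetric]) (auto simp: algebra_simps)
    finally show ?thesis .
  qed
  have occ: "occ e p q w = (\<integral>\<^sup>+r. f r w \<partial>lborel)" for w
    by (simp add: occ_def f_def c_def)
  have "(\<integral>\<^sup>+w. (occ e p q w)\<^sup>2 \<partial>P0) = (\<integral>\<^sup>+w. (\<integral>\<^sup>+s. (\<integral>\<^sup>+r. f s w * f r w \<partial>lborel) \<partial>lborel) \<partial>P0)"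
    unfolding occ power2_eq_square
    by (intro nn_integral_cong) (simp add: nn_integral_cmult nn_integral_multc f1)
  also have "\<dots> = (\<integral>\<^sup>+s. (\<integral>\<^sup>+w. (\<integral>\<^sup>+r. f s w * f r w \<partial>lborel) \<partial>P0) \<partial>lborel)"
  proof (rule LP.Fubini')
    have "(\<lambda>z. \<integral>\<^sup>+r. f (fst z) (snd z) * f r (snd z) \<partial>lborel) \<in> borel_measurable (borel \<Otimes>\<^sub>M P0)"
    proof (rule lborel.borel_measurable_nn_integral)
      have "(\<lambda>x. (snd x, snd (fst x))) \<in> measurable ((borel \<Otimes>\<^sub>M P0) \<Otimes>\<^sub>M lborel) (borel \<Otimes>\<^sub>M P0)" by measurable
      from measurable_compose[OF this f]
      have [measurable]: "(\<lambda>x. f (snd x) (snd (fst x))) \<in> borel_measurable ((borel \<Otimes>\<^sub>M P0) \<Otimes>\<^sub>M lborel)" by simp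
      have "(\<lambda>x. f (fst (fst x)) (snd (fst x)) * f (snd x) (snd (fst x))) \<in> borel_measurable ((borel \<Otimes>\<^sub>M P0) \<Otimes>\<^sub>M lborel)"
        using measurable_compose[OF measurable_fst f] by measurable
      then show "(\<lambda>(z, r). f (fst z) (snd z) * f r (snd z)) \<in> borel_measurable ((borel \<Otimes>\<^sub>M P0) \<Otimes>\<^sub>M lborel)"
        by (simp add: split_beta')
    qed
    then show "(\<lambda>(s, w). \<integral>\<^sup>+r. f s w * f r w \<partial>lborel) \<in> borel_measurable (lborel \<Otimes>\<^sub>M P0)"
      by (simp add: split_beta')
  qed
  also have "\<dots> = (\<integral>\<^sup>+s. (\<integral>\<^sup>+r. (\<integral>\<^sup>+w. f s w * f r w \<partial>P0) \<partial>lborel) \<partial>lborel)"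
  proof (intro nn_integral_cong LP.Fubini')
    fix s :: real
    have [measurable]: "f s \<in> borel_measurable P0"
      using measurable_compose[OF measurable_Pair1' f, of s] by (simp add: measurable_Pair1')
    have "(\<lambda>z. f s (snd z) * f (fst z) (snd z)) \<in> borel_measurable (lborel \<Otimes>\<^sub>M P0)" by measurable
    then show "(\<lambda>(r, w). f s w * f r w) \<in> borel_measurable (lborel \<Otimes>\<^sub>M P0)" by (simp add: split_beta')
  qed
  also have "\<dots> \<le> (\<integral>\<^sup>+s. (\<integral>\<^sup>+r. ennreal (e\<^sup>2) * K s r + ennreal (e\<^sup>2) * K r s \<partial>lborel) \<partial>lborel)"
  proof (rule nn_integral_mono, rule nn_integral_mono_AE)
    fix s :: real
    \<comment> \<open>The two-time bound says nothing on the diagonal, which is null.\<close>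
    have "AE r in lborel. r \<noteq> s" by (rule AE_lborel_singleton)
    then show "AE r in lborel. (\<integral>\<^sup>+w. f s w * f r w \<partial>P0) \<le> ennreal (e\<^sup>2) * K s r + ennreal (e\<^sup>2) * K r s"
    proof eventually_elim
      case (elim r)
      show ?case
      proof (cases "s < r")
        case True
        then show ?thesis using two[OF True] by (simp add: add_increasing2)
      next
        case False
        then have "r < s" using elim by auto
        from two[OF this] show ?thesis by (simp add: mult.commute add_increasing)
      qed
    qed
  qed
  also have "\<dots> = 2 * ennreal (e\<^sup>2) * (\<integral>\<^sup>+s. (\<integral>\<^sup>+r. K s r \<partial>lborel) \<partial>lborel)"
    by (rule nn_integral_symmetrize[OF K])
  also have "2 * ennreal (e\<^sup>2) = ennreal (2 * e\<^sup>2)" by (simp add: ennreal_mult)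
  also have "ennreal (2 * e\<^sup>2) * (\<integral>\<^sup>+s. (\<integral>\<^sup>+r. K s r \<partial>lborel) \<partial>lborel) \<le> ennreal (2 * e\<^sup>2) * ennreal (4 * sqrt (q - p) * (sqrt q - sqrt p))"
    by (intro mult_left_mono KI) auto
  also have "\<dots> = ennreal (8 * e\<^sup>2 * sqrt (q - p) * (sqrt q - sqrt p))"
    using pq by (subst ennreal_mult[symmetric]) (auto simp: algebra_simps)
  finally show ?thesis .
qed


lemma occ_measurable: "0 \<le> q \<Longrightarrow> occ e p q \<in> borel_measurable P0"
proof -
  assume q: "0 \<le> q"
  have c [measurable]: "(\<lambda>z. coord (max 0 (min (fst z) q)) (snd z)) \<in> borel_measurable (borel \<Otimes>\<^sub>M P0)"
    using joint_measurable_P0[OF q] by (simp add: split_beta')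
  have "(\<lambda>z. coord (max 0 (min (snd z) q)) (fst z)) \<in> borel_measurable (P0 \<Otimes>\<^sub>M lborel)"
    using measurable_compose[OF measurable_pair_swap' c] by (simp add: split_beta' cong: measurable_cong_sets sets_pair_measure_cong)
  note [measurable] = this
  show ?thesis unfolding occ_def[abs_def] by (rule lborel.borel_measurable_nn_integral) measurable
qed

lemma occ_eq_measure:
  assumes w: "w \<in> path_space" and pq: "0 \<le> p" "p < q"
  shows "occ e p q w = ennreal (measure lborel {s \<in> {0..q}. \<bar>coord s w\<bar> \<le> e} - measure lborel {s \<in> {0..p}. \<bar>coord s w\<bar> \<le> e})"
    and "measure lborel {s \<in> {0..p}. \<bar>coord s w\<bar> \<le> e} \<le> measure lborel {s \<in> {0..q}. \<bar>coord s w\<bar> \<le> e}"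
proof -
  define A where "A r = {s \<in> {0..r}. \<bar>coord s w\<bar> \<le> e}" for r
  have A: "A r \<in> sets lborel" "emeasure lborel (A r) \<noteq> \<infinity>" for r
  proof -
    have "closed (A r)" unfolding A_def
      by (intro continuous_on_closed_Collect_le continuous_intros continuous_on_subset[OF path_continuous[OF w]]) auto
    then show "A r \<in> sets lborel" by simp
    have "emeasure lborel (A r) \<le> emeasure lborel {0..r}" by (rule emeasure_mono) (auto simp: A_def)
    also have "\<dots> < \<infinity>" by (cases "0 \<le> r") auto
    finally show "emeasure lborel (A r) \<noteq> \<infinity>" by simp
  qed
  have sub: "A p \<subseteq> A q" using pq by (auto simp: A_def)
  have "occ e p q w = (\<integral>\<^sup>+r. indicator (A q - A p) r \<partial>lborel)"
    unfolding occ_def by (intro nn_integral_cong) (use pq in \<open>auto simp: A_def max_def min_def split: split_indicator\<close>)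
  also have "\<dots> = emeasure lborel (A q - A p)" by (rule nn_integral_indicator) (use A in auto)
  also have "\<dots> = ennreal (measure lborel (A q - A p))"
    using A by (intro emeasure_eq_ennreal_measure) (metis Diff_subset emeasure_mono infinity_ennreal_def top.extremum_uniqueI)
  also have "measure lborel (A q - A p) = measure lborel (A q) - measure lborel (A p)"
    using A sub by (intro measure_Diff) auto
  finally show "occ e p q w = ennreal (measure lborel {s \<in> {0..q}. \<bar>coord s w\<bar> \<le> e} - measure lborel {s \<in> {0..p}. \<bar>coord s w\<bar> \<le> e})"
    by (simp add: A_def)
  have "measure lborel (A p) \<le> measure lborel (A q)"
    using A sub by (intro measure_mono_fmeasurable fmeasurableI) (auto simp: less_top)
  then show "measure lborel {s \<in> {0..p}. \<bar>coord s w\<bar> \<le> e} \<le> measure lborel {s \<in> {0..q}. \<bar>coord s w\<bar> \<le> e}"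
    by (simp add: A_def)
qed

text \<open>Fatou along e = 1 / (k + 1): after scaling by c / e the occupation bound does not depend
  on e. The form sqrt(q - p) (sqrt q - sqrt p) absorbs the singularity at time 0, and its second
  factor telescopes along a uniform grid while the first one tends to 0.\<close>

lemma L_increment_second_moment:
  obtains C where "0 \<le> C" "\<And>p q. 0 \<le> p \<Longrightarrow> p < q \<Longrightarrow>
    (\<integral>\<^sup>+w. ennreal ((L q w - L p w)\<^sup>2) \<partial>P0) \<le> ennreal (C * sqrt (q - p) * (sqrt q - sqrt p))"
proof -
  obtain c where c: "0 < c" and lim: "AE w in P0. \<forall>t\<ge>0.
      ((\<lambda>\<epsilon>. c / \<epsilon> * measure lborel {s \<in> {0..t}. \<bar>coord s w\<bar> \<le> \<epsilon>}) \<longlongrightarrow> L t w) (at_right 0)"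
    using local_time by (auto simp: is_local_time_0_def)
  define e where "e k = 1 / real (Suc k)" for k
  have e: "0 < e k" for k by (simp add: e_def)
  have "e \<longlonglongrightarrow> 0" unfolding e_def[abs_def] using LIMSEQ_inverse_real_of_nat by (simp add: inverse_eq_divide)
  then have fe: "filterlim e (at_right 0) sequentially"
    by (rule tendsto_imp_filterlim_at_right) (use e in auto)
  show ?thesis
  proof (rule that[of "8 * c\<^sup>2"])
    fix p q :: real assume pq: "0 \<le> p" "p < q"
    have "(\<integral>\<^sup>+w. ennreal ((L q w - L p w)\<^sup>2) \<partial>P0) = (\<integral>\<^sup>+w. liminf (\<lambda>k. ennreal ((c / e k)\<^sup>2) * (occ (e k) p q w)\<^sup>2) \<partial>P0)"
    proof (rule nn_integral_cong_AE)
      show "AE w in P0. ennreal ((L q w - L p w)\<^sup>2) = liminf (\<lambda>k. ennreal ((c / e k)\<^sup>2) * (occ (e k) p q w)\<^sup>2)"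
        using lim AE_space
      proof eventually_elim
        case (elim w)
        then have w: "w \<in> path_space" by simp
        define m where "m r k = measure lborel {s \<in> {0..r}. \<bar>coord s w\<bar> \<le> e k}" for r k
        have l: "(\<lambda>k. c / e k * m r k) \<longlonglongrightarrow> L r w" if "0 \<le> r" for r
          unfolding m_def by (rule filterlim_compose[OF _ fe]) (use elim that in auto)
        have "(\<lambda>k. ennreal ((c / e k * m q k - c / e k * m p k)\<^sup>2)) \<longlonglongrightarrow> ennreal ((L q w - L p w)\<^sup>2)"
          by (intro tendsto_ennrealI tendsto_power tendsto_diff l) (use pq in auto)
        moreover have eq: "ennreal ((c / e k * m q k - c / e k * m p k)\<^sup>2) = ennreal ((c / e k)\<^sup>2) * (occ (e k) p q w)\<^sup>2" for k
        proof -
          have "c / e k * m q k - c / e k * m p k = c / e k * (m q k - m p k)" by (simp add: algebra_simps)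
          moreover have "m p k \<le> m q k" unfolding m_def by (rule occ_eq_measure(2)[OF w pq])
          ultimately show ?thesis
            unfolding occ_eq_measure(1)[OF w pq] m_def[symmetric]
            by (simp add: ennreal_power ennreal_mult[symmetric] power_mult_distrib power_divide)
        qed
        ultimately have "(\<lambda>k. ennreal ((c / e k)\<^sup>2) * (occ (e k) p q w)\<^sup>2) \<longlonglongrightarrow> ennreal ((L q w - L p w)\<^sup>2)"
          by (simp only: eq)
        from lim_imp_Liminf[OF _ this] show ?case by simp
      qed
    qed
    also have "\<dots> \<le> liminf (\<lambda>k. \<integral>\<^sup>+w. ennreal ((c / e k)\<^sup>2) * (occ (e k) p q w)\<^sup>2 \<partial>P0)"
      by (rule nn_integral_liminf) (use occ_measurable[of q] pq in \<open>auto intro!: borel_measurable_times_ennreal borel_measurable_power_ennreal simp del: sets_P0\<close>)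
    also have "\<dots> \<le> ennreal (8 * c\<^sup>2 * sqrt (q - p) * (sqrt q - sqrt p))"
    proof -
      have "(\<integral>\<^sup>+w. ennreal ((c / e k)\<^sup>2) * (occ (e k) p q w)\<^sup>2 \<partial>P0) \<le> ennreal (8 * c\<^sup>2 * sqrt (q - p) * (sqrt q - sqrt p))" for k
      proof -
        have [measurable]: "occ (e k) p q \<in> borel_measurable P0" using occ_measurable pq by simp
        have "(\<integral>\<^sup>+w. ennreal ((c / e k)\<^sup>2) * (occ (e k) p q w)\<^sup>2 \<partial>P0) = ennreal ((c / e k)\<^sup>2) * (\<integral>\<^sup>+w. (occ (e k) p q w)\<^sup>2 \<partial>P0)"
          by (rule nn_integral_cmult) measurable
        also have "\<dots> \<le> ennreal ((c / e k)\<^sup>2) * ennreal (8 * (e k)\<^sup>2 * sqrt (q - p) * (sqrt q - sqrt p))"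
          using pq e[of k] by (intro mult_left_mono occ_second_moment) auto
        also have "\<dots> = ennreal (8 * c\<^sup>2 * sqrt (q - p) * (sqrt q - sqrt p))"
          using pq e[of k] by (subst ennreal_mult[symmetric]) (auto simp: power_divide)
        finally show ?thesis .
      qed
      then show ?thesis by (intro Liminf_le) auto
    qed
    finally show "(\<integral>\<^sup>+w. ennreal ((L q w - L p w)\<^sup>2) \<partial>P0) \<le> ennreal (8 * c\<^sup>2 * sqrt (q - p) * (sqrt q - sqrt p))" .
  qed simp
qed

end

section \<open>Error sums over uniform grids\<close>

context brownian
begin

text \<open>Replacing the increment of |B| by sg(B p) times the increment of B is exact unless B p
  and B q have a product <= 0; up to a factor this term dominates the squared error.\<close>

definition sc :: "real \<Rightarrow> real \<Rightarrow> 'a \<Rightarrow> real" where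
  "sc p q w = (B q w - B p w)\<^sup>2 * indicator {w. B p w * B q w \<le> 0} w"

lemma sc_measurable [measurable]: "0 \<le> p \<Longrightarrow> p \<le> q \<Longrightarrow> sc p q \<in> borel_measurable P"
proof -
  assume pq: "0 \<le> p" "p \<le> q"
  then have [measurable]: "B p \<in> borel_measurable P" "B q \<in> borel_measurable P" by auto
  have "sc p q = (\<lambda>w. (B q w - B p w)\<^sup>2 * (if B p w * B q w \<le> 0 then 1 else 0))"
    by (auto simp: sc_def fun_eq_iff)
  then show ?thesis by simp
qed

lemma sc_nonneg: "0 \<le> sc p q w" by (simp add: sc_def)

lemma sc_le: "sc p q w \<le> (B q w - B p w)\<^sup>2"
  by (simp add: sc_def split: split_indicator)

lemma sc_integrable: "0 \<le> p \<Longrightarrow> p < q \<Longrightarrow> integrable P (sc p q)"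
  by (rule Bochner_Integration.integrable_bound[OF increment_square(1)[of p q]])
     (use sc_le[of p q] sc_nonneg[of p q] in auto)

lemma sc_integral_le: "0 \<le> p \<Longrightarrow> p < q \<Longrightarrow> (\<integral>w. sc p q w \<partial>P) \<le> q - p"
proof -
  assume pq: "0 \<le> p" "p < q"
  have "(\<integral>w. sc p q w \<partial>P) \<le> (\<integral>w. (B q w - B p w)\<^sup>2 \<partial>P)"
    by (rule integral_mono[OF sc_integrable[OF pq] increment_square(1)[OF pq]]) (rule sc_le)
  then show ?thesis using increment_square(2)[OF pq] by simp
qed

lemma sc_integral_le':
  assumes "0 < p" "p < q"
  shows "(\<integral>w. sc p q w \<partial>P) \<le> 2 * (q - p) * sqrt (q - p) / sqrt p"
proof -
  have "ennreal (\<integral>w. sc p q w \<partial>P) = (\<integral>\<^sup>+w. ennreal (sc p q w) \<partial>P)"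
    using assms by (intro nn_integral_eq_integral[symmetric] sc_integrable) (auto simp: sc_nonneg)
  also have "\<dots> = (\<integral>\<^sup>+w. ennreal ((B q w - B p w)\<^sup>2) * indicator {w. B p w * B q w \<le> 0} w \<partial>P)"
    by (intro nn_integral_cong) (auto simp: sc_def split: split_indicator)
  also have "\<dots> \<le> ennreal (2 * (q - p) * sqrt (q - p) / sqrt p)"
    by (rule sign_change_square[OF assms])
  finally show ?thesis using assms by (subst (asm) ennreal_le_iff) auto
qed

text \<open>Let h be the mesh. On the first cell only the plain second moment h is available,
  because the bound with 1 / sqrt p degenerates at p = 0. Grid point i is at least i h, which gives
  2 h / sqrt i on cell i, hence a total of order n^(-1/2).\<close>

lemma sc_sum_le:
  assumes st: "0 \<le> s" "s < t" and n: "0 < n"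
  shows "(\<Sum>i<n. \<integral>w. sc (grid s t n i) (grid s t n (Suc i)) w \<partial>P) \<le> (t - s) / real n + 4 * (t - s) / sqrt (real n)"
proof -
  define h where "h = (t - s) / real n"
  have h: "0 < h" using st n by (simp add: h_def)
  note g = grid_diff[of s t n, folded h_def] grid_less[OF st(2) n] grid_ge[of s t n]
  let ?S = "\<lambda>i. \<integral>w. sc (grid s t n i) (grid s t n (Suc i)) w \<partial>P"
  have i: "?S i \<le> 2 * h * (1 / sqrt (real i))" if "i \<in> {1..<n}" for i
  proof -
    have gi: "real i * h \<le> grid s t n i" using st by (simp add: grid_def h_def mult.commute)
    have hi: "0 < real i * h" using that h by simp
    have "?S i \<le> 2 * (grid s t n (Suc i) - grid s t n i) * sqrt (grid s t n (Suc i) - grid s t n i) / sqrt (grid s t n i)"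
      by (rule sc_integral_le') (use g hi gi in auto)
    also have "\<dots> = 2 * h * sqrt h / sqrt (grid s t n i)" unfolding g(1) ..
    also have "\<dots> \<le> 2 * h * sqrt h / sqrt (real i * h)"
      using gi hi h by (intro divide_left_mono mult_pos_pos) auto
    also have "\<dots> = 2 * h * (1 / sqrt (real i))" using h by (simp add: real_sqrt_mult)
    finally show ?thesis .
  qed
  have "(\<Sum>i<n. ?S i) = ?S 0 + (\<Sum>i\<in>{1..<n}. ?S i)"
    using n by (simp add: lessThan_atLeast0 sum.atLeast_Suc_lessThan)
  also have "\<dots> \<le> h + (\<Sum>i\<in>{1..<n}. 2 * h * (1 / sqrt (real i)))"
    using sc_integral_le[of "grid s t n 0" "grid s t n (Suc 0)"] g(1)[of 0] g(2)[of 0] st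
    by (intro add_mono sum_mono i) auto
  also have "\<dots> \<le> h + 2 * h * (2 * sqrt (real n))"
    unfolding sum_distrib_left[symmetric] using h sum_inverse_sqrt_le[of n] by (intro add_left_mono mult_left_mono) auto
  also have "\<dots> = h + 4 * (h * sqrt (real n))" by simp
  also have "h * sqrt (real n) = (t - s) / sqrt (real n)"
    using n real_div_sqrt[of "real n"] by (simp add: h_def field_simps)
  also have "h + 4 * ((t - s) / sqrt (real n)) = (t - s) / real n + 4 * (t - s) / sqrt (real n)"
    unfolding h_def by simp
  finally show ?thesis .
qed

lemma tendsto_const_div_Suc: "(\<lambda>n. c / real (Suc n)) \<longlonglongrightarrow> 0"
  using tendsto_mult_right_zero[OF LIMSEQ_inverse_real_of_nat, of c] by (simp add: divide_inverse)

lemma tendsto_const_div_sqrt_Suc: "(\<lambda>n. c / sqrt (real (Suc n))) \<longlonglongrightarrow> 0"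
proof -
  have "(\<lambda>n. sqrt (inverse (real (Suc n)))) \<longlonglongrightarrow> sqrt 0"
    by (intro tendsto_real_sqrt LIMSEQ_inverse_real_of_nat)
  then show ?thesis
    using tendsto_mult_right_zero[of "\<lambda>n. sqrt (inverse (real (Suc n)))" _ c] by (simp add: divide_inverse real_sqrt_inverse)
qed

lemma sc_sum_tendsto:
  assumes st: "0 \<le> s" "s < t"
  shows "(\<lambda>n. \<Sum>i<Suc n. \<integral>w. sc (grid s t (Suc n) i) (grid s t (Suc n) (Suc i)) w \<partial>P) \<longlonglongrightarrow> 0"
proof (rule tendsto_sandwich[OF _ _ tendsto_const])
  show "\<forall>\<^sub>F n in sequentially. 0 \<le> (\<Sum>i<Suc n. \<integral>w. sc (grid s t (Suc n) i) (grid s t (Suc n) (Suc i)) w \<partial>P)"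
    by (intro always_eventually allI sum_nonneg integral_nonneg) (simp add: sc_nonneg)
  show "\<forall>\<^sub>F n in sequentially. (\<Sum>i<Suc n. \<integral>w. sc (grid s t (Suc n) i) (grid s t (Suc n) (Suc i)) w \<partial>P)
      \<le> (t - s) / real (Suc n) + 4 * (t - s) / sqrt (real (Suc n))"
    by (intro always_eventually allI sc_sum_le st) simp
  show "(\<lambda>n. (t - s) / real (Suc n) + 4 * (t - s) / sqrt (real (Suc n))) \<longlonglongrightarrow> 0"
    using tendsto_add[OF tendsto_const_div_Suc tendsto_const_div_sqrt_Suc] by simp
qed

text \<open>A third absolute moment is of order h^(3/2), so n cells of length (t - s) / n contribute
  order n^(-1/2).\<close>

lemma cubic_sum_tendsto:
  assumes st: "0 \<le> s" "s < t"
  shows "(\<lambda>n. \<Sum>i<Suc n. \<integral>w. \<bar>B (grid s t (Suc n) (Suc i)) w - B (grid s t (Suc n) i) w\<bar>^3 \<partial>P) \<longlonglongrightarrow> 0"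
proof (rule tendsto_sandwich[OF _ _ tendsto_const])
  let ?S = "\<lambda>n i. \<integral>w. \<bar>B (grid s t (Suc n) (Suc i)) w - B (grid s t (Suc n) i) w\<bar>^3 \<partial>P"
  show "\<forall>\<^sub>F n in sequentially. 0 \<le> (\<Sum>i<Suc n. ?S n i)"
    by (intro always_eventually allI sum_nonneg integral_nonneg) simp
  show "\<forall>\<^sub>F n in sequentially. (\<Sum>i<Suc n. ?S n i) \<le> 2 * (t - s) * sqrt (t - s) / sqrt (real (Suc n))"
  proof (intro always_eventually allI)
    fix n
    define h where "h = (t - s) / real (Suc n)"
    have h: "0 < h" using st by (simp add: h_def)
    have "?S n i \<le> 2 * h * sqrt h" for i
    proof -
      have "?S n i = (\<integral>x. \<bar>x\<bar>^3 \<partial>gauss (grid s t (Suc n) (Suc i) - grid s t (Suc n) i))"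
        using st grid_less[OF st(2), of "Suc n" i] grid_ge[of s t "Suc n" i]
        by (intro increment_integrable gauss_abs_power3) auto
      also have "\<dots> = (\<integral>x. \<bar>x\<bar>^3 \<partial>gauss h)" unfolding grid_diff h_def ..
      also have "\<dots> \<le> 2 * h * sqrt h" by (rule gauss_abs_power3(2)[OF h])
      finally show ?thesis .
    qed
    then have "(\<Sum>i<Suc n. ?S n i) \<le> real (Suc n) * (2 * h * sqrt h)"
      using sum_bounded_above[of "{..<Suc n}" "?S n" "2 * h * sqrt h"] by simp
    also have "\<dots> = 2 * (t - s) * sqrt (t - s) / sqrt (real (Suc n))"
      by (simp add: h_def real_sqrt_divide del: of_nat_Suc)
    finally show "(\<Sum>i<Suc n. ?S n i) \<le> 2 * (t - s) * sqrt (t - s) / sqrt (real (Suc n))" .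
  qed
qed (rule tendsto_const_div_sqrt_Suc)

lemma increment_cubic_integrable:
  assumes "0 \<le> p" "p < q"
  shows "integrable P (\<lambda>w. \<bar>B q w - B p w\<bar>^3)"
  using assms by (intro increment_integrable gauss_abs_power3) auto

text \<open>With k(B) frozen at the left endpoint the summands are centred, hence orthogonal, and
  each has second moment at most 2 K^4 h^2, where 2 h^2 is the variance of the square of a centred
  normal variable of variance h. The sum of n such terms is of order 1 / n.\<close>

lemma quadratic_variation:
  assumes st: "0 \<le> s" "s < t" and k: "k \<in> borel_measurable borel" "\<And>x. \<bar>k x\<bar> \<le> K"
  defines "QV \<equiv> \<lambda>n w. \<Sum>i<Suc n. (k (B (grid s t (Suc n) i) w))\<^sup>2 *
    ((B (grid s t (Suc n) (Suc i)) w - B (grid s t (Suc n) i) w)\<^sup>2 - (t - s) / real (Suc n))"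
  shows "integrable P (\<lambda>w. (QV n w)\<^sup>2)" and "(\<lambda>n. \<integral>w. (QV n w)\<^sup>2 \<partial>P) \<longlonglongrightarrow> 0"
proof -
  have K: "0 \<le> K" using k(2)[of 0] by simp
  have main: "integrable P (\<lambda>w. (QV n w)\<^sup>2) \<and> (\<integral>w. (QV n w)\<^sup>2 \<partial>P) \<le> 2 * K^4 * (t - s)\<^sup>2 / real (Suc n)" for n
  proof -
    define h where "h = (t - s) / real (Suc n)"
    have h: "0 < h" using st by (simp add: h_def)
    define p where "p = grid s t (Suc n)"
    have p: "0 \<le> p i" "p i < p (Suc i)" "p (Suc i) - p i = h" "i \<le> j \<Longrightarrow> p i \<le> p j" for i j
      using st grid_less[OF st(2), of "Suc n" i] grid_ge[of s t "Suc n" i] grid_mono[of s t i j "Suc n"] grid_diff[of s t "Suc n" i]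
      by (auto simp: p_def h_def)
    define D where "D i w = (k (B (p i) w))\<^sup>2 * ((B (p (Suc i)) w - B (p i) w)\<^sup>2 - h)" for i w
    have km: "(\<lambda>w. k (B (p i) w)) \<in> borel_measurable (G (p i))" for i
      by (rule measurable_compose[OF B_measurable_G k(1)]) (use p in auto)
    have Dm: "D i \<in> borel_measurable (G (p (Suc i)))" for i
      unfolding D_def using p(1,2)[of i] p(4)[of i "Suc i"]
      by (intro borel_measurable_times borel_measurable_power borel_measurable_diff measurable_G_mono[OF _ km] B_measurable_G borel_measurable_const) auto
    have g4: "integrable (gauss h) (\<lambda>x. (x\<^sup>2 - h)\<^sup>2)" "(\<integral>x. (x\<^sup>2 - h)\<^sup>2 \<partial>gauss h) = 2 * h\<^sup>2"
      and g2: "integrable (gauss h) (\<lambda>x. x\<^sup>2 - h)" "(\<integral>x. x\<^sup>2 - h \<partial>gauss h) = 0"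
    proof -
      interpret N: prob_space "gauss h" by (rule prob_space_gauss[OF h])
      have i: "integrable (gauss h) (\<lambda>x. x^4)" "integrable (gauss h) (\<lambda>x. x\<^sup>2)" using h by (auto intro: gauss_power_integrable)
      have eq: "(x\<^sup>2 - h)\<^sup>2 = x^4 - 2 * h * x\<^sup>2 + h\<^sup>2" for x :: real by (simp add: power2_eq_square eval_nat_numeral algebra_simps)
      show "integrable (gauss h) (\<lambda>x. (x\<^sup>2 - h)\<^sup>2)" unfolding eq using i by auto
      show "(\<integral>x. (x\<^sup>2 - h)\<^sup>2 \<partial>gauss h) = 2 * h\<^sup>2"
        unfolding eq using i gauss_power4[OF h] gauss_power2[OF h] N.prob_space by (simp add: power2_eq_square)
      show "integrable (gauss h) (\<lambda>x. x\<^sup>2 - h)" using i by auto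
      show "(\<integral>x. x\<^sup>2 - h \<partial>gauss h) = 0" using i gauss_power2[OF h] N.prob_space by simp
    qed
    have k4: "integrable P (\<lambda>w. (k (B (p i) w))^4)" "(\<integral>w. (k (B (p i) w))^4 \<partial>P) \<le> K^4" for i
    proof -
      have b: "(k x)^4 \<le> K^4" for x using power_mono[OF k(2)[of x], of 4] by simp
      show i: "integrable P (\<lambda>w. (k (B (p i) w))^4)"
        using measurable_G_P[OF p(1) km[of i]] b by (intro integrable_const_bound[of _ "K^4"]) auto
      have "(\<integral>w. (k (B (p i) w))^4 \<partial>P) \<le> (\<integral>w. K^4 \<partial>P)" using i b by (intro integral_mono) auto
      then show "(\<integral>w. (k (B (p i) w))^4 \<partial>P) \<le> K^4" using prob_space by simp
    qed
    have Dsq: "integrable P (\<lambda>w. (D i w)\<^sup>2)" "(\<integral>w. (D i w)\<^sup>2 \<partial>P) \<le> 2 * K^4 * h\<^sup>2" for i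
    proof -
      have eq: "(D i w)\<^sup>2 = (k (B (p i) w))^4 * (((B (p (Suc i)) w - B (p i) w)\<^sup>2 - h)\<^sup>2)" for w
        by (simp add: D_def power_mult_distrib power_mult[symmetric])
      note F = freeze_mult[OF p(1,2) _ k4(1)[of i], where g="\<lambda>x. (x\<^sup>2 - h)\<^sup>2", unfolded p(3), OF _ g4(1)]
      show "integrable P (\<lambda>w. (D i w)\<^sup>2)" unfolding eq using km by (intro F) auto
      have "(\<integral>w. (D i w)\<^sup>2 \<partial>P) = (\<integral>w. (k (B (p i) w))^4 \<partial>P) * (2 * h\<^sup>2)"
        unfolding eq g4(2)[symmetric] using km by (intro F) auto
      also have "\<dots> \<le> K^4 * (2 * h\<^sup>2)" by (intro mult_right_mono k4) auto
      finally show "(\<integral>w. (D i w)\<^sup>2 \<partial>P) \<le> 2 * K^4 * h\<^sup>2" by simp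
    qed
    have sumD: "integrable P (\<lambda>w. (\<Sum>i<Suc n. D i w)\<^sup>2) \<and> (\<integral>w. (\<Sum>i<Suc n. D i w)\<^sup>2 \<partial>P) = (\<Sum>i<Suc n. \<integral>w. (D i w)\<^sup>2 \<partial>P)"
    proof (rule integral_square_sum_orthogonal)
      show "D i \<in> borel_measurable P" for i by (rule measurable_G_P[OF p(1) Dm])
      show "integrable P (\<lambda>w. (D i w)\<^sup>2)" for i by (rule Dsq)
      fix i assume sq: "integrable P (\<lambda>w. (\<Sum>j<i. D j w)\<^sup>2)"
      have m [measurable]: "(\<lambda>w. \<Sum>j<i. D j w) \<in> borel_measurable (G (p i))"
        by (intro borel_measurable_sum measurable_G_mono[OF _ Dm] p) auto
      have [measurable]: "(\<lambda>w. k (B (p i) w)) \<in> borel_measurable (G (p i))" by (rule km)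
      have m' [measurable]: "(\<lambda>w. (\<Sum>j<i. D j w) * (k (B (p i) w))\<^sup>2) \<in> borel_measurable (G (p i))" by measurable
      have i1: "integrable P (\<lambda>w. \<Sum>j<i. D j w)"
        by (rule square_integrable_imp_integrable[OF measurable_G_P[OF p(1) m] sq])
      have "integrable P (\<lambda>w. (\<Sum>j<i. D j w) * (k (B (p i) w))\<^sup>2)"
      proof (rule Bochner_Integration.integrable_bound)
        show "integrable P (\<lambda>w. (\<Sum>j<i. D j w) * K\<^sup>2)" using i1 by simp
        show "AE w in P. norm ((\<Sum>j<i. D j w) * (k (B (p i) w))\<^sup>2) \<le> norm ((\<Sum>j<i. D j w) * K\<^sup>2)"
        proof (rule AE_I2)
          fix w
          have "(k (B (p i) w))\<^sup>2 \<le> K\<^sup>2" using power_mono[OF k(2)[of "B (p i) w"], of 2] by simp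
          then show "norm ((\<Sum>j<i. D j w) * (k (B (p i) w))\<^sup>2) \<le> norm ((\<Sum>j<i. D j w) * K\<^sup>2)"
            by (auto simp: abs_mult intro!: mult_left_mono)
        qed
      qed (rule measurable_G_P[OF p(1) m'])
      from freeze_mult(2)[OF p(1,2) m' this, where g="\<lambda>x. x\<^sup>2 - h", unfolded p(3), OF g2(1)]
      show "(\<integral>w. (\<Sum>j<i. D j w) * D i w \<partial>P) = 0"
        unfolding g2(2) by (simp add: D_def mult.assoc)
    qed
    have QV: "QV n w = (\<Sum>i<Suc n. D i w)" for w by (simp add: QV_def D_def p_def h_def)
    have "(\<Sum>i<Suc n. \<integral>w. (D i w)\<^sup>2 \<partial>P) \<le> real (Suc n) * (2 * K^4 * h\<^sup>2)"
      using sum_bounded_above[of "{..<Suc n}" "\<lambda>i. \<integral>w. (D i w)\<^sup>2 \<partial>P" "2 * K^4 * h\<^sup>2"] Dsq(2) by simp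
    also have "\<dots> = 2 * K^4 * (t - s)\<^sup>2 / real (Suc n)"
      by (simp add: h_def power2_eq_square del: of_nat_Suc)
    finally show ?thesis using sumD unfolding QV by simp
  qed
  then show "integrable P (\<lambda>w. (QV n w)\<^sup>2)" by blast
  show "(\<lambda>n. \<integral>w. (QV n w)\<^sup>2 \<partial>P) \<longlonglongrightarrow> 0"
  proof (rule tendsto_sandwich[OF _ _ tendsto_const])
    show "\<forall>\<^sub>F n in sequentially. (\<integral>w. (QV n w)\<^sup>2 \<partial>P) \<le> 2 * K^4 * (t - s)\<^sup>2 / real (Suc n)"
      using main by (intro always_eventually allI) blast
    show "(\<lambda>n. 2 * K^4 * (t - s)\<^sup>2 / real (Suc n)) \<longlonglongrightarrow> 0" by (rule tendsto_const_div_Suc)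
  qed simp
qed

end

section \<open>Tanaka's formula along grids\<close>

context local_time
begin

text \<open>The error of Tanaka's formula over one cell, with the sign taken at the left endpoint.
  Both of its parts are martingale differences.\<close>

definition tk :: "real \<Rightarrow> real \<Rightarrow> path \<Rightarrow> real" where
  "tk p q w = (\<beta> q w - \<beta> p w) - sg (coord p w) * (coord q w - coord p w)"

lemma tk_measurable_filt: "0 \<le> p \<Longrightarrow> p \<le> q \<Longrightarrow> q \<le> r \<Longrightarrow> tk p q \<in> borel_measurable (\<F> r)"
  unfolding tk_def[abs_def]
  by (intro borel_measurable_diff borel_measurable_times \<beta>_measurable_filt measurable_coord_filt
      measurable_compose[OF measurable_coord_filt sg_measurable]) auto

lemma L_square_integrable:
  assumes pq: "0 \<le> p" "p < q"
  shows "integrable P0 (\<lambda>w. (L q w - L p w)\<^sup>2)"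
proof -
  obtain C where C: "0 \<le> C" "\<And>p q. 0 \<le> p \<Longrightarrow> p < q \<Longrightarrow>
    (\<integral>\<^sup>+w. ennreal ((L q w - L p w)\<^sup>2) \<partial>P0) \<le> ennreal (C * sqrt (q - p) * (sqrt q - sqrt p))"
    using L_increment_second_moment by blast
  have [measurable]: "L p \<in> borel_measurable P0" "L q \<in> borel_measurable P0" using pq by (auto cong: measurable_cong_sets)
  show ?thesis using C(2)[OF pq] by (intro integrableI_bounded) (auto simp: le_less_trans)
qed

lemma \<beta>_square_integrable:
  assumes pq: "0 \<le> p" "p < q"
  shows "integrable P0 (\<lambda>w. (\<beta> q w - \<beta> p w)\<^sup>2)"
proof -
  have [measurable]: "coord p \<in> borel_measurable P0" "coord q \<in> borel_measurable P0"
     "L p \<in> borel_measurable P0" "L q \<in> borel_measurable P0" using pq by (auto cong: measurable_cong_sets)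
  have "integrable P0 (\<lambda>w. (\<bar>coord q w\<bar> - \<bar>coord p w\<bar>)\<^sup>2)"
    by (rule Bochner_Integration.integrable_bound[OF increment_square(1)[OF pq]])
       (auto intro!: AE_I2 simp: abs_le_square_iff[symmetric])
  then have "integrable P0 (\<lambda>w. ((\<bar>coord q w\<bar> - \<bar>coord p w\<bar>) - (L q w - L p w))\<^sup>2)"
    by (rule integrable_square_diff[OF _ _ _ L_square_integrable[OF pq], rotated 2]) measurable
  then show ?thesis by (simp add: \<beta>_def algebra_simps)
qed

lemma tk_square:
  assumes pq: "0 \<le> p" "p < q"
  shows "integrable P0 (\<lambda>w. (tk p q w)\<^sup>2)"
    and "(\<integral>w. (tk p q w)\<^sup>2 \<partial>P0) \<le> 8 * (\<integral>w. sc p q w \<partial>P0) + 2 * (\<integral>w. (L q w - L p w)\<^sup>2 \<partial>P0)"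
proof -
  have m: "tk p q \<in> borel_measurable P0"
    by (rule measurable_G_P[of q]) (use pq in \<open>auto intro: tk_measurable_filt\<close>)
  have le: "(tk p q w)\<^sup>2 \<le> 8 * sc p q w + 2 * (L q w - L p w)\<^sup>2" for w
  proof -
    \<comment> \<open>The part of the error due to |X| alone: it vanishes unless the sign changes
      and is at most twice the increment otherwise, so its square is at most 4
      \<open>sc\<close>.\<close>
    define a where "a = \<bar>coord q w\<bar> - \<bar>coord p w\<bar> - sg (coord p w) * (coord q w - coord p w)"
    have "a\<^sup>2 \<le> 4 * sc p q w"
    proof (cases "0 < coord p w * coord q w")
      case True
      then have "a = 0" unfolding a_def using abs_diff_same_sign by simp
      then show ?thesis using sc_nonneg by simp
    next
      case False
      have "\<bar>a\<bar> \<le> \<bar>\<bar>coord q w\<bar> - \<bar>coord p w\<bar>\<bar> + \<bar>sg (coord p w) * (coord q w - coord p w)\<bar>"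
        unfolding a_def by (rule abs_triangle_ineq4)
      also have "\<dots> \<le> \<bar>coord q w - coord p w\<bar> + \<bar>coord q w - coord p w\<bar>"
        by (intro add_mono abs_triangle_ineq3) (simp add: abs_mult)
      finally have "\<bar>a\<bar> \<le> \<bar>2 * (coord q w - coord p w)\<bar>" unfolding abs_mult by simp
      then have "a\<^sup>2 \<le> 2\<^sup>2 * (coord q w - coord p w)\<^sup>2" by (simp only: abs_le_square_iff power_mult_distrib)
      then show ?thesis using False by (simp add: sc_def)
    qed
    moreover have "tk p q w = a - (L q w - L p w)" by (simp add: tk_def a_def \<beta>_def)
    moreover have "(a - (L q w - L p w))\<^sup>2 \<le> 2 * a\<^sup>2 + 2 * (L q w - L p w)\<^sup>2"
    proof -
      have "(a - d)\<^sup>2 \<le> 2 * a\<^sup>2 + 2 * d\<^sup>2" for d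
        using zero_le_power2[of "a + d"] by (simp add: power2_diff power2_sum)
      then show ?thesis .
    qed
    ultimately show ?thesis by simp
  qed
  have i: "integrable P0 (\<lambda>w. 8 * sc p q w + 2 * (L q w - L p w)\<^sup>2)"
    using sc_integrable[OF pq] L_square_integrable[OF pq] by auto
  show i2: "integrable P0 (\<lambda>w. (tk p q w)\<^sup>2)"
    by (rule Bochner_Integration.integrable_bound[OF i]) (use m le in \<open>auto simp: sc_nonneg\<close>)
  have "(\<integral>w. (tk p q w)\<^sup>2 \<partial>P0) \<le> (\<integral>w. 8 * sc p q w + 2 * (L q w - L p w)\<^sup>2 \<partial>P0)"
    using i i2 le by (intro integral_mono) auto
  then show "(\<integral>w. (tk p q w)\<^sup>2 \<partial>P0) \<le> 8 * (\<integral>w. sc p q w \<partial>P0) + 2 * (\<integral>w. (L q w - L p w)\<^sup>2 \<partial>P0)"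
    using sc_integrable[OF pq] L_square_integrable[OF pq] by simp
qed

text \<open>The \<beta> part vanishes by the martingale property, the other one because the
  increment is centred and independent of \<open>\<F> p\<close>.\<close>

lemma tk_orthogonal:
  assumes pq: "0 \<le> p" "p < q" and f: "f \<in> borel_measurable (\<F> p)" and sq: "integrable P0 (\<lambda>w. (f w)\<^sup>2)"
  shows "(\<integral>w. f w * tk p q w \<partial>P0) = 0"
proof -
  have fm: "f \<in> borel_measurable P0" by (rule measurable_G_P[OF pq(1) f])
  have [measurable]: "\<beta> p \<in> borel_measurable P0" "\<beta> q \<in> borel_measurable P0" using pq by (auto cong: measurable_cong_sets)
  have [measurable]: "coord p \<in> borel_measurable (\<F> p)" by (rule measurable_coord_filt) (use pq in auto)
  have i1: "integrable P0 (\<lambda>w. f w * (\<beta> q w - \<beta> p w))"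
    by (rule integrable_mult_of_squares[OF fm _ sq \<beta>_square_integrable[OF pq]]) measurable
  have fs: "(\<lambda>w. f w * sg (coord p w)) \<in> borel_measurable (\<F> p)" using f by measurable
  have "integrable P0 f" by (rule square_integrable_imp_integrable[OF fm sq])
  then have fi: "integrable P0 (\<lambda>w. f w * sg (coord p w))"
    by (rule Bochner_Integration.integrable_bound) (use measurable_G_P[OF pq(1) fs] in \<open>auto simp: abs_mult\<close>)
  have g: "integrable (gauss (q - p)) (\<lambda>x. x)" "(\<integral>x. x \<partial>gauss (q - p)) = 0"
    using gauss_power_integrable[of "q - p" 1] gauss_mean[of "q - p"] pq by auto
  note F = freeze_mult[OF pq fs fi g(1)]
  have "(\<integral>w. f w * tk p q w \<partial>P0) = (\<integral>w. f w * (\<beta> q w - \<beta> p w) - f w * sg (coord p w) * (coord q w - coord p w) \<partial>P0)"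
    by (intro Bochner_Integration.integral_cong) (auto simp: tk_def algebra_simps)
  also have "\<dots> = 0"
    using i1 F g \<beta>_orthogonal[OF pq(1) _ f i1] pq by simp
  finally show ?thesis .
qed

lemma tk_sum_telescope:
  assumes "0 < n"
  shows "(\<Sum>i<n. tk (grid s t n i) (grid s t n (Suc i)) w) = (\<beta> t w - \<beta> s w) -
    (\<Sum>i<n. sg (coord (grid s t n i) w) * (coord (grid s t n (Suc i)) w - coord (grid s t n i) w))"
proof -
  have "(\<Sum>i<n. \<beta> (grid s t n (Suc i)) w - \<beta> (grid s t n i) w) = \<beta> t w - \<beta> s w"
    by (subst sum_lessThan_telescope) (use assms in simp)
  then show ?thesis unfolding tk_def by (subst sum_subtractf) simp
qed

text \<open>The one-step errors are orthogonal, so only their second moments add up. Sign changes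
  contribute \<open>sc_sum_tendsto\<close>; the local time contributes the square root of the mesh
  times a telescoping sum of square roots.\<close>

theorem tanaka:
  assumes st: "0 \<le> s" "s < t"
  defines "T \<equiv> \<lambda>n w. \<Sum>i<Suc n. tk (grid s t (Suc n) i) (grid s t (Suc n) (Suc i)) w"
  shows "integrable P0 (\<lambda>w. (T n w)\<^sup>2)" and "(\<lambda>n. \<integral>w. (T n w)\<^sup>2 \<partial>P0) \<longlonglongrightarrow> 0"
proof -
  obtain C where C: "0 \<le> C" "\<And>p q. 0 \<le> p \<Longrightarrow> p < q \<Longrightarrow>
    (\<integral>\<^sup>+w. ennreal ((L q w - L p w)\<^sup>2) \<partial>P0) \<le> ennreal (C * sqrt (q - p) * (sqrt q - sqrt p))"
    using L_increment_second_moment by blast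
  let ?g = "\<lambda>n. grid s t (Suc n)"
  let ?U = "\<lambda>n. 8 * (\<Sum>i<Suc n. \<integral>w. sc (?g n i) (?g n (Suc i)) w \<partial>P0) + 2 * (C * sqrt (t - s) * (sqrt t - sqrt s) / sqrt (real (Suc n)))"
  have g: "0 \<le> ?g n i" "?g n i < ?g n (Suc i)" "i \<le> j \<Longrightarrow> ?g n i \<le> ?g n j" for n i j
    using st grid_less[OF st(2), of "Suc n" i] grid_ge[of s t "Suc n" i] grid_mono[of s t i j "Suc n"] by auto
  have main: "integrable P0 (\<lambda>w. (T n w)\<^sup>2) \<and> (\<integral>w. (T n w)\<^sup>2 \<partial>P0) \<le> ?U n" for n
  proof -
    have *: "integrable P0 (\<lambda>w. (T n w)\<^sup>2) \<and> (\<integral>w. (T n w)\<^sup>2 \<partial>P0) = (\<Sum>i<Suc n. \<integral>w. (tk (?g n i) (?g n (Suc i)) w)\<^sup>2 \<partial>P0)"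
      unfolding T_def
    proof (rule integral_square_sum_orthogonal)
      show "tk (?g n i) (?g n (Suc i)) \<in> borel_measurable P0" for i
        by (rule measurable_G_P[OF g(1) tk_measurable_filt[OF g(1) _ order_refl]]) (simp add: g(2) less_imp_le)
      show "integrable P0 (\<lambda>w. (tk (?g n i) (?g n (Suc i)) w)\<^sup>2)" for i by (rule tk_square[OF g(1,2)])
      fix i assume sq: "integrable P0 (\<lambda>w. (\<Sum>j<i. tk (?g n j) (?g n (Suc j)) w)\<^sup>2)"
      show "(\<integral>w. (\<Sum>j<i. tk (?g n j) (?g n (Suc j)) w) * tk (?g n i) (?g n (Suc i)) w \<partial>P0) = 0"
        by (rule tk_orthogonal[OF g(1,2) _ sq])
           (intro borel_measurable_sum tk_measurable_filt g(1) g(3) less_imp_le[OF g(2)], auto)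
    qed
    have Lsq: "(\<integral>w. (L (?g n (Suc i)) w - L (?g n i) w)\<^sup>2 \<partial>P0) \<le> C * sqrt (t - s) / sqrt (real (Suc n)) * (sqrt (?g n (Suc i)) - sqrt (?g n i))" for i
    proof -
      have "ennreal (\<integral>w. (L (?g n (Suc i)) w - L (?g n i) w)\<^sup>2 \<partial>P0) = (\<integral>\<^sup>+w. ennreal ((L (?g n (Suc i)) w - L (?g n i) w)\<^sup>2) \<partial>P0)"
        by (rule nn_integral_eq_integral[symmetric]) (use L_square_integrable[OF g(1,2)] in auto)
      also have "\<dots> \<le> ennreal (C * sqrt (?g n (Suc i) - ?g n i) * (sqrt (?g n (Suc i)) - sqrt (?g n i)))"
        by (rule C(2)[OF g(1,2)])
      also have "sqrt (?g n (Suc i) - ?g n i) = sqrt (t - s) / sqrt (real (Suc n))"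
        unfolding grid_diff real_sqrt_divide ..
      finally show ?thesis
        using g(2)[of n i] C(1) st by (subst (asm) ennreal_le_iff) (auto intro!: mult_nonneg_nonneg divide_nonneg_nonneg)
    qed
    have tele: "(\<Sum>i<Suc n. sqrt (?g n (Suc i)) - sqrt (?g n i)) = sqrt t - sqrt s"
      by (subst sum_lessThan_telescope) simp
    have "(\<Sum>i<Suc n. \<integral>w. (tk (?g n i) (?g n (Suc i)) w)\<^sup>2 \<partial>P0) \<le>
       (\<Sum>i<Suc n. 8 * (\<integral>w. sc (?g n i) (?g n (Suc i)) w \<partial>P0) + 2 * (C * sqrt (t - s) / sqrt (real (Suc n)) * (sqrt (?g n (Suc i)) - sqrt (?g n i))))"
      by (intro sum_mono order_trans[OF tk_square(2)[OF g(1,2)]] add_left_mono mult_left_mono Lsq) auto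
    also have "\<dots> = ?U n"
      unfolding sum.distrib sum_distrib_left[symmetric] tele by simp
    finally show ?thesis using * by simp
  qed
  then show "integrable P0 (\<lambda>w. (T n w)\<^sup>2)" by blast
  show "(\<lambda>n. \<integral>w. (T n w)\<^sup>2 \<partial>P0) \<longlonglongrightarrow> 0"
  proof (rule tendsto_sandwich[OF _ _ tendsto_const])
    show "\<forall>\<^sub>F n in sequentially. (\<integral>w. (T n w)\<^sup>2 \<partial>P0) \<le> ?U n"
      using main by (intro always_eventually allI) blast
    show "?U \<longlonglongrightarrow> 0"
      using tendsto_add[OF tendsto_mult_right_zero[OF sc_sum_tendsto[OF st], of 8]
          tendsto_mult_right_zero[OF tendsto_const_div_sqrt_Suc, of 2 "C * sqrt (t - s) * (sqrt t - sqrt s)"]] by simp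
  qed auto
qed

end

section \<open>Discrete Girsanov transformation\<close>

context brownian
begin

text \<open>Logarithm of the discrete Girsanov density that introduces the drift - k, stopped after
  m of the n cells so that induction on m is possible.\<close>

definition dens_sum :: "(real \<Rightarrow> real) \<Rightarrow> real \<Rightarrow> real \<Rightarrow> nat \<Rightarrow> nat \<Rightarrow> 'a \<Rightarrow> real" where
  "dens_sum k s t n m w = (\<Sum>i<m. - k (B (grid s t n i) w) * (B (grid s t n (Suc i)) w - B (grid s t n i) w)
     - (k (B (grid s t n i) w))\<^sup>2 * ((t - s) / real n) / 2)"

text \<open>The increments with the drift - k compensated; weighted by the exponential of
  \<open>dens_sum\<close>, this is a sum of independent centred normal variables.\<close>

definition drift_sum :: "(real \<Rightarrow> real) \<Rightarrow> real \<Rightarrow> real \<Rightarrow> nat \<Rightarrow> nat \<Rightarrow> 'a \<Rightarrow> real" where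
  "drift_sum k s t n m w = (\<Sum>i<m. (B (grid s t n (Suc i)) w - B (grid s t n i) w)
     + k (B (grid s t n i) w) * ((t - s) / real n))"

context
  fixes k :: "real \<Rightarrow> real" and K s t :: real and n :: nat
  assumes k: "k \<in> borel_measurable borel" "\<And>x. \<bar>k x\<bar> \<le> K" and st: "0 \<le> s" "s < t" and n: "0 < n"
begin

lemma grid_facts:
  "0 \<le> grid s t n i" "grid s t n i < grid s t n (Suc i)" "s \<le> grid s t n i"
  "i \<le> j \<Longrightarrow> grid s t n i \<le> grid s t n j" "grid s t n (Suc i) - grid s t n i = (t - s) / real n" "0 < (t - s) / real n"
  using st n grid_less[OF st(2) n, of i] grid_ge[of s t n i] grid_mono[of s t i j n] grid_diff[of s t n i] by auto

lemma k_measurable_G: "(\<lambda>w. k (B (grid s t n i) w)) \<in> borel_measurable (G (grid s t n i))"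
  by (rule measurable_compose[OF B_measurable_G k(1)]) (use grid_facts in auto)

lemma dens_sum_measurable: "dens_sum k s t n m \<in> borel_measurable (G (grid s t n m))"
proof -
  have "(\<lambda>w. - k (B (grid s t n i) w) * (B (grid s t n (Suc i)) w - B (grid s t n i) w)
     - (k (B (grid s t n i) w))\<^sup>2 * ((t - s) / real n) / 2) \<in> borel_measurable (G (grid s t n m))" if "i < m" for i
  proof -
    have le: "grid s t n i \<le> grid s t n m" "grid s t n (Suc i) \<le> grid s t n m" using that by (auto intro!: grid_facts)
    have [measurable]: "(\<lambda>w. k (B (grid s t n i) w)) \<in> borel_measurable (G (grid s t n m))"
      "B (grid s t n i) \<in> borel_measurable (G (grid s t n m))" "B (grid s t n (Suc i)) \<in> borel_measurable (G (grid s t n m))"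
      by (rule measurable_G_mono[OF le(1) k_measurable_G], (rule B_measurable_G, use le grid_facts in auto)+)
    show ?thesis by measurable
  qed
  then show ?thesis unfolding dens_sum_def[abs_def] by (intro borel_measurable_sum) auto
qed

lemma drift_sum_measurable: "drift_sum k s t n m \<in> borel_measurable (G (grid s t n m))"
proof -
  have "(\<lambda>w. (B (grid s t n (Suc i)) w - B (grid s t n i) w)
     + k (B (grid s t n i) w) * ((t - s) / real n)) \<in> borel_measurable (G (grid s t n m))" if "i < m" for i
  proof -
    have le: "grid s t n i \<le> grid s t n m" "grid s t n (Suc i) \<le> grid s t n m" using that by (auto intro!: grid_facts)
    have [measurable]: "(\<lambda>w. k (B (grid s t n i) w)) \<in> borel_measurable (G (grid s t n m))"
      "B (grid s t n i) \<in> borel_measurable (G (grid s t n m))" "B (grid s t n (Suc i)) \<in> borel_measurable (G (grid s t n m))"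
      by (rule measurable_G_mono[OF le(1) k_measurable_G], (rule B_measurable_G, use le grid_facts in auto)+)
    show ?thesis by measurable
  qed
  then show ?thesis unfolding drift_sum_def[abs_def] by (intro borel_measurable_sum) auto
qed

text \<open>Exact for every grid: k is sampled at the left endpoint, so freezing turns it into a
  constant and \<open>gauss_tilt_char\<close> applies to each cell. The weight W stands for
  conditioning on G s.\<close>

lemma discrete_girsanov:
  fixes W :: "'a \<Rightarrow> complex"
  assumes W: "W \<in> borel_measurable (G s)" "integrable P W"
  shows "integrable P (\<lambda>w. W w * (iexp (u * drift_sum k s t n m w) * of_real (exp (dens_sum k s t n m w)))) \<and>
    (CLINT w|P. W w * (iexp (u * drift_sum k s t n m w) * of_real (exp (dens_sum k s t n m w)))) =
    of_real (exp (- u\<^sup>2 * (real m * ((t - s) / real n)) / 2)) * (CLINT w|P. W w)"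
proof (induction m)
  case 0
  then show ?case using W by (simp add: drift_sum_def dens_sum_def)
next
  case (Suc m)
  define h where "h = (t - s) / real n"
  have h: "0 < h" unfolding h_def by (rule grid_facts)
  let ?p = "grid s t n m" let ?q = "grid s t n (Suc m)"
  have qp: "?q - ?p = h" unfolding h_def by (rule grid_facts)
  define V where "V w = W w * (iexp (u * drift_sum k s t n m w) * of_real (exp (dens_sum k s t n m w)))" for w
  define \<kappa> where "\<kappa> w = k (B ?p w)" for w
  have [measurable]: "W \<in> borel_measurable (G ?p)" "drift_sum k s t n m \<in> borel_measurable (G ?p)"
    "dens_sum k s t n m \<in> borel_measurable (G ?p)" "\<kappa> \<in> borel_measurable (G ?p)"
    using k_measurable_G[of m] measurable_G_mono[OF _ W(1), of ?p] grid_facts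
    by (auto simp: \<kappa>_def[abs_def] intro: drift_sum_measurable dens_sum_measurable)
  have Vm [measurable]: "V \<in> borel_measurable (G ?p)" unfolding V_def by measurable
  have Vi: "integrable P V" and Ve: "(CLINT w|P. V w) = of_real (exp (- u\<^sup>2 * (real m * h) / 2)) * (CLINT w|P. W w)"
    using Suc unfolding V_def h_def by auto
  define F where "F z = V (fst z) * (iexp (u * (snd z + \<kappa> (fst z) * h)) * of_real (exp (- \<kappa> (fst z) * snd z - (\<kappa> (fst z))\<^sup>2 * h / 2)))" for z
  have Fm [measurable]: "F \<in> borel_measurable (G ?p \<Otimes>\<^sub>M borel)" unfolding F_def by measurable
  have eq: "W w * (iexp (u * drift_sum k s t n (Suc m) w) * of_real (exp (dens_sum k s t n (Suc m) w))) = F (w, B ?q w - B ?p w)" for w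
  proof -
    have 1: "iexp (u * drift_sum k s t n (Suc m) w) = iexp (u * drift_sum k s t n m w) * iexp (u * ((B ?q w - B ?p w) + \<kappa> w * h))"
      unfolding exp_add[symmetric] by (simp add: drift_sum_def \<kappa>_def h_def algebra_simps)
    have 2: "exp (dens_sum k s t n (Suc m) w) = exp (dens_sum k s t n m w) * exp (- \<kappa> w * (B ?q w - B ?p w) - (\<kappa> w)\<^sup>2 * h / 2)"
      unfolding exp_add[symmetric] by (simp add: dens_sum_def \<kappa>_def h_def)
    show ?thesis unfolding 1 2 F_def V_def by (simp add: mult_ac)
  qed
  have int: "integrable P (\<lambda>w. F (w, B ?q w - B ?p w))"
  proof (rule integrableI_bounded)
    show "(\<lambda>w. F (w, B ?q w - B ?p w)) \<in> borel_measurable P"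
      using measurable_compose[OF increment_pair_measurable[OF grid_facts(1,2)] Fm] by simp
    \<comment> \<open>Integrability passes from m to m + 1 because the density factor of one cell
      has Gaussian integral 1 and the character has modulus 1.\<close>
    have "(\<integral>\<^sup>+w. ennreal (norm (F (w, B ?q w - B ?p w))) \<partial>P) = (\<integral>\<^sup>+w. (\<integral>\<^sup>+x. ennreal (norm (F (w, x))) \<partial>gauss (?q - ?p)) \<partial>P)"
      by (rule freeze_nn_integral[OF grid_facts(1,2), where f="\<lambda>z. ennreal (norm (F z))"]) measurable
    also have "\<dots> = (\<integral>\<^sup>+w. ennreal (norm (V w)) \<partial>P)"
    proof (rule nn_integral_cong)
      fix w
      have "(\<integral>\<^sup>+x. ennreal (norm (F (w, x))) \<partial>gauss (?q - ?p)) = (\<integral>\<^sup>+x. ennreal (norm (V w)) * ennreal (exp (- \<kappa> w * x - (\<kappa> w)\<^sup>2 * h / 2)) \<partial>gauss h)"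
        unfolding qp by (intro nn_integral_cong) (simp add: F_def norm_mult ennreal_mult del: exp_diff)
      also have "\<dots> = ennreal (norm (V w)) * (\<integral>\<^sup>+x. ennreal (exp (- \<kappa> w * x - (\<kappa> w)\<^sup>2 * h / 2)) \<partial>gauss h)"
        by (rule nn_integral_cmult) measurable
      also have "(\<integral>\<^sup>+x. ennreal (exp (- \<kappa> w * x - (\<kappa> w)\<^sup>2 * h / 2)) \<partial>gauss h) = 1"
        using gauss_tilt_integrable[OF h, of "\<kappa> w"] by (subst nn_integral_eq_integral) auto
      finally show "(\<integral>\<^sup>+x. ennreal (norm (F (w, x))) \<partial>gauss (?q - ?p)) = ennreal (norm (V w))" by simp
    qed
    also have "\<dots> < \<infinity>" using Vi by (simp add: integrable_iff_bounded)
    finally show "(\<integral>\<^sup>+w. ennreal (norm (F (w, B ?q w - B ?p w))) \<partial>P) < \<infinity>" .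
  qed
  have "(CLINT w|P. F (w, B ?q w - B ?p w)) = (CLINT w|P. (CLINT x|gauss h. F (w, x)))"
    using freeze_integral[OF grid_facts(1,2) Fm int] unfolding qp .
  also have "\<dots> = (CLINT w|P. V w * of_real (exp (- u\<^sup>2 * h / 2)))"
    unfolding F_def fst_conv snd_conv by (subst integral_mult_right_zero) (simp only: gauss_tilt_char[OF h])
  also have "\<dots> = of_real (exp (- u\<^sup>2 * (real m * h) / 2)) * (CLINT w|P. W w) * of_real (exp (- u\<^sup>2 * h / 2))"
    unfolding integral_mult_left_zero Ve ..
  also have "\<dots> = of_real (exp (- u\<^sup>2 * (real (Suc m) * h) / 2)) * (CLINT w|P. W w)"
  proof -
    have "exp (- u\<^sup>2 * (real (Suc m) * h) / 2) = exp (- u\<^sup>2 * (real m * h) / 2) * exp (- u\<^sup>2 * h / 2)"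
      unfolding exp_add[symmetric] by (simp add: field_simps)
    then show ?thesis by (simp only: of_real_mult mult_ac)
  qed
  finally show ?case using int unfolding eq h_def by simp
qed

end

text \<open>The square of the density is the density for the doubled kernel, up to a bounded factor.\<close>

lemma discrete_girsanov_square:
  assumes k: "k \<in> borel_measurable borel" "\<And>x. \<bar>k x\<bar> \<le> K" and st: "0 \<le> s" "s < t" and n: "0 < n"
    and W: "W \<in> borel_measurable (G s)"
  shows "(\<integral>\<^sup>+w. ennreal ((W w * exp (dens_sum k s t n m w))\<^sup>2) \<partial>P) \<le>
    ennreal (exp (K\<^sup>2 * (real m * ((t - s) / real n)))) * (\<integral>\<^sup>+w. ennreal ((W w)\<^sup>2) \<partial>P)"
proof (cases "integrable P (\<lambda>w. (W w)\<^sup>2)")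
  case True
  define h where "h = (t - s) / real n"
  define E where "E w = exp (dens_sum (\<lambda>x. 2 * k x) s t n m w)" for w
  have h: "0 \<le> h" using st by (simp add: h_def)
  have k2: "(\<lambda>x. 2 * k x) \<in> borel_measurable borel" "\<bar>2 * k x\<bar> \<le> 2 * K" for x
    using k(1) k(2)[of x] by auto
  have W2: "(\<lambda>w. complex_of_real ((W w)\<^sup>2)) \<in> borel_measurable (G s)" "integrable P (\<lambda>w. complex_of_real ((W w)\<^sup>2))"
    using W True by (measurable, simp only: complex_of_real_integrable_eq)
  have "complex_integrable P (\<lambda>w. of_real ((W w)\<^sup>2 * E w))" "(CLINT w|P. of_real ((W w)\<^sup>2 * E w)) = (CLINT w|P. of_real ((W w)\<^sup>2))"
    using discrete_girsanov[OF k2 st n W2, of 0 m] unfolding E_def by simp_all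
  then have WE: "integrable P (\<lambda>w. (W w)\<^sup>2 * E w)" "(\<integral>w. (W w)\<^sup>2 * E w \<partial>P) = (\<integral>w. (W w)\<^sup>2 \<partial>P)"
    by (simp_all only: complex_of_real_integrable_eq integral_complex_of_real of_real_eq_iff)
  have "(W w * exp (dens_sum k s t n m w))\<^sup>2 \<le> exp (K\<^sup>2 * (real m * h)) * ((W w)\<^sup>2 * E w)" for w
  proof -
    have "2 * dens_sum k s t n m w = dens_sum (\<lambda>x. 2 * k x) s t n m w + (\<Sum>i<m. (k (B (grid s t n i) w))\<^sup>2 * h)"
      unfolding dens_sum_def h_def[symmetric] sum_distrib_left sum.distrib[symmetric]
      by (intro sum.cong refl) (simp add: power_mult_distrib algebra_simps)
    also have "(\<Sum>i<m. (k (B (grid s t n i) w))\<^sup>2 * h) \<le> (\<Sum>i<m. K\<^sup>2 * h)"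
      using h k(2) by (intro sum_mono mult_right_mono) (auto simp: abs_le_square_iff[symmetric] intro: order_trans[OF _ abs_ge_self])
    finally have "exp (2 * dens_sum k s t n m w) \<le> exp (dens_sum (\<lambda>x. 2 * k x) s t n m w + K\<^sup>2 * (real m * h))"
      by (simp add: mult_ac)
    then have "(W w)\<^sup>2 * exp (2 * dens_sum k s t n m w) \<le> (W w)\<^sup>2 * (exp (K\<^sup>2 * (real m * h)) * E w)"
      unfolding E_def exp_add by (intro mult_left_mono) (simp_all only: mult.commute zero_le_power2)
    then show ?thesis by (simp only: power_mult_distrib exp_double[symmetric] mult.left_commute)
  qed
  then have "(\<integral>\<^sup>+w. ennreal ((W w * exp (dens_sum k s t n m w))\<^sup>2) \<partial>P) \<le> (\<integral>\<^sup>+w. ennreal (exp (K\<^sup>2 * (real m * h)) * ((W w)\<^sup>2 * E w)) \<partial>P)"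
    by (intro nn_integral_mono ennreal_leI)
  also have "\<dots> = ennreal (exp (K\<^sup>2 * (real m * h)) * (\<integral>w. (W w)\<^sup>2 \<partial>P))"
    unfolding WE(2)[symmetric] using WE(1) by (subst nn_integral_eq_integral) (auto simp: E_def)
  also have "\<dots> = ennreal (exp (K\<^sup>2 * (real m * h))) * (\<integral>\<^sup>+w. ennreal ((W w)\<^sup>2) \<partial>P)"
    using True by (subst nn_integral_eq_integral) (auto simp: ennreal_mult)
  finally show ?thesis unfolding h_def .
next
  case False
  have "(\<lambda>w. (W w)\<^sup>2) \<in> borel_measurable P" using measurable_G_P[OF st(1) W] by measurable
  with False have "(\<integral>\<^sup>+w. ennreal ((W w)\<^sup>2) \<partial>P) = \<infinity>" by (simp add: integrable_iff_bounded not_less top_unique)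
  then show ?thesis by (simp add: ennreal_mult_top)
qed

end

section \<open>Logarithmic expansion and Riemann sums\<close>

text \<open>The derivative of the remainder is - x^2 / (1 - x), whose modulus is at most 2 z^2
  between - |z| and |z|; integrate from 0.\<close>

lemma ln_one_minus_expansion:
  fixes z :: real
  assumes "\<bar>z\<bar> \<le> 1 / 2"
  shows "\<bar>ln (1 - z) + z + z\<^sup>2 / 2\<bar> \<le> 2 * \<bar>z\<bar>^3"
proof -
  let ?g = "\<lambda>z::real. ln (1 - z) + z + z\<^sup>2 / 2"
  have "norm (?g z - ?g 0) \<le> (2 * z\<^sup>2) * norm (z - 0)"
  proof (rule field_differentiable_bound[of "{- \<bar>z\<bar>..\<bar>z\<bar>}" ?g "\<lambda>x. - x\<^sup>2 / (1 - x)"])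
    fix x assume x: "x \<in> {- \<bar>z\<bar>..\<bar>z\<bar>}"
    then have x1: "\<bar>x\<bar> \<le> \<bar>z\<bar>" "\<bar>x\<bar> \<le> 1/2" using assms by auto
    then have "0 < 1 - x" by auto
    then have "(?g has_real_derivative - x\<^sup>2 / (1 - x)) (at x)"
      by (auto intro!: derivative_eq_intros simp: field_simps power2_eq_square)
    then show "(?g has_field_derivative - x\<^sup>2 / (1 - x)) (at x within {- \<bar>z\<bar>..\<bar>z\<bar>})"
      by (rule has_field_derivative_at_within)
    have "x\<^sup>2 / (1 - x) \<le> z\<^sup>2 / (1 / 2)"
      using x1 by (intro frac_le) (auto simp: abs_le_square_iff[symmetric])
    then show "norm (- x\<^sup>2 / (1 - x)) \<le> 2 * z\<^sup>2" using \<open>0 < 1 - x\<close> by (simp add: abs_divide)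
  qed auto
  then show ?thesis by (simp add: power2_eq_square power3_eq_cube abs_mult mult_ac)
qed

text \<open>An Ito expansion of ln(a - |x|) with the kink at 0 accounted for by the last term, whose
  sum over a grid yields the local time divided by a. Without a sign change that term is 0 and the
  claim is the expansion of ln(1 - \<kappa> \<delta>). With one, |x| and |y| are both at most
  |\<delta>|, every part is of order \<delta>^2, and this is paid for by the indicator term.\<close>

lemma log_expansion:
  fixes x y a b :: real
  assumes ab: "0 < b" "b < a" and xy: "\<bar>x\<bar> \<le> b" "\<bar>y\<bar> \<le> b" and d: "\<bar>y - x\<bar> \<le> (a - b) / 2"
  defines "\<kappa> \<equiv> sg x / (a - \<bar>x\<bar>)" and "C \<equiv> 2 / (a - b)^3 + 2 / (a * (a - b)) + 1 / (a - b)\<^sup>2"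
  shows "\<bar>ln (a - \<bar>y\<bar>) - ln (a - \<bar>x\<bar>) + \<kappa> * (y - x) + \<kappa>\<^sup>2 * (y - x)\<^sup>2 / 2 + (\<bar>y\<bar> - \<bar>x\<bar> - sg x * (y - x)) / a\<bar>
    \<le> C * (\<bar>y - x\<bar>^3 + (y - x)\<^sup>2 * indicator {z. x * z \<le> 0} y)"
proof -
  define \<delta> where "\<delta> = y - x"
  have pos: "0 < a - \<bar>x\<bar>" "0 < a - \<bar>y\<bar>" "0 < a" "0 < a - b" using ab xy by auto
  have k: "\<bar>\<kappa>\<bar> \<le> 1 / (a - b)"
    unfolding \<kappa>_def abs_divide sg_abs using pos xy by (intro divide_left_mono) auto
  have C: "2 / (a - b)^3 \<le> C" "0 \<le> C" "2 / (a * (a - b)) + 1 / (a - b)\<^sup>2 \<le> C"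
    using pos by (auto simp: C_def)
  show ?thesis
  proof (cases "0 < x * y")
    case True
    have eq: "\<bar>y\<bar> = \<bar>x\<bar> + sg x * \<delta>" unfolding \<delta>_def by (rule abs_diff_same_sign[OF True])
    have "a - \<bar>y\<bar> = (a - \<bar>x\<bar>) * (1 - \<kappa> * \<delta>)" unfolding eq \<kappa>_def using pos by (simp add: field_simps)
    moreover from this have "0 < 1 - \<kappa> * \<delta>" using pos by (metis zero_less_mult_pos)
    ultimately have ln: "ln (a - \<bar>y\<bar>) - ln (a - \<bar>x\<bar>) = ln (1 - \<kappa> * \<delta>)" using pos by (simp add: ln_mult)
    have kd: "\<bar>\<kappa> * \<delta>\<bar> \<le> \<bar>\<delta>\<bar> / (a - b)"
      unfolding abs_mult using mult_right_mono[OF k, of "\<bar>\<delta>\<bar>"] by simp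
    also have "\<dots> \<le> 1 / 2" using d pos by (simp add: \<delta>_def field_simps)
    finally have "\<bar>ln (1 - \<kappa> * \<delta>) + \<kappa> * \<delta> + (\<kappa> * \<delta>)\<^sup>2 / 2\<bar> \<le> 2 * \<bar>\<kappa> * \<delta>\<bar>^3"
      by (rule ln_one_minus_expansion)
    also have "\<dots> \<le> 2 * (\<bar>\<delta>\<bar> / (a - b))^3" using kd by (intro mult_left_mono power_mono) auto
    also have "\<dots> = 2 / (a - b)^3 * \<bar>\<delta>\<bar>^3" by (simp add: power_divide)
    also have "\<dots> \<le> C * \<bar>\<delta>\<bar>^3" using C by (intro mult_right_mono) auto
    also have "\<dots> \<le> C * (\<bar>\<delta>\<bar>^3 + \<delta>\<^sup>2 * indicator {z. x * z \<le> 0} y)"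
      using C by (intro mult_left_mono) auto
    finally have main: "\<bar>ln (1 - \<kappa> * \<delta>) + \<kappa> * \<delta> + (\<kappa> * \<delta>)\<^sup>2 / 2\<bar> \<le> C * (\<bar>\<delta>\<bar>^3 + \<delta>\<^sup>2 * indicator {z. x * z \<le> 0} y)" .
    have e0: "\<bar>y\<bar> - \<bar>x\<bar> - sg x * \<delta> = 0" using eq by simp
    show ?thesis unfolding \<delta>_def[symmetric] ln e0 using main by (simp add: power_mult_distrib)
  next
    case False
    have le: "\<bar>x\<bar> \<le> \<bar>\<delta>\<bar>" "\<bar>y\<bar> \<le> \<bar>\<delta>\<bar>" unfolding \<delta>_def using abs_le_diff_of_sign_change[of x y] False by auto
    \<comment> \<open>Adding v / a removes the first-order term at v = 0: the derivative - v / (a (a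
      - v)) is of the order of \<delta> in the range considered.\<close>
    let ?\<phi> = "\<lambda>v::real. ln (a - v) + v / a"
    have "norm (?\<phi> \<bar>y\<bar> - ?\<phi> \<bar>x\<bar>) \<le> (\<bar>\<delta>\<bar> / (a * (a - b))) * norm (\<bar>y\<bar> - \<bar>x\<bar>)"
    proof (rule field_differentiable_bound[of "{0..min b \<bar>\<delta>\<bar>}" ?\<phi> "\<lambda>v. - v / (a * (a - v))"])
      fix v assume v: "v \<in> {0..min b \<bar>\<delta>\<bar>}"
      then have v1: "0 \<le> v" "v \<le> b" "v \<le> \<bar>\<delta>\<bar>" "0 < a - v" using ab by auto
      have "(?\<phi> has_real_derivative - v / (a * (a - v))) (at v)"
        using v1 pos by (auto intro!: derivative_eq_intros simp: field_simps)
      then show "(?\<phi> has_field_derivative - v / (a * (a - v))) (at v within {0..min b \<bar>\<delta>\<bar>})"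
        by (rule has_field_derivative_at_within)
      have "v / (a * (a - v)) \<le> \<bar>\<delta>\<bar> / (a * (a - b))"
        using v1 pos by (intro frac_le mult_left_mono) auto
      then show "norm (- v / (a * (a - v))) \<le> \<bar>\<delta>\<bar> / (a * (a - b))" using v1 pos by (simp add: abs_mult)
    qed (use le xy in auto)
    also have "\<dots> \<le> (\<bar>\<delta>\<bar> / (a * (a - b))) * \<bar>\<delta>\<bar>"
      using pos abs_triangle_ineq3[of y x] by (intro mult_left_mono) (auto simp: \<delta>_def)
    finally have t1: "\<bar>?\<phi> \<bar>y\<bar> - ?\<phi> \<bar>x\<bar>\<bar> \<le> 1 / (a * (a - b)) * \<delta>\<^sup>2" by (simp add: power2_eq_square)
    have t2: "\<bar>\<kappa> * \<delta> - sg x * \<delta> / a\<bar> \<le> 1 / (a * (a - b)) * \<delta>\<^sup>2"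
    proof -
      have "\<kappa> * \<delta> - sg x * \<delta> / a = sg x * (\<delta> * (\<bar>x\<bar> / (a * (a - \<bar>x\<bar>))))"
        unfolding \<kappa>_def using pos by (simp add: field_simps)
      then have "\<bar>\<kappa> * \<delta> - sg x * \<delta> / a\<bar> = \<bar>\<delta>\<bar> * (\<bar>x\<bar> / (a * (a - \<bar>x\<bar>)))"
        using pos by (simp add: abs_mult)
      also have "\<dots> \<le> \<bar>\<delta>\<bar> * (\<bar>\<delta>\<bar> / (a * (a - b)))"
        using pos xy le by (intro mult_left_mono frac_le) auto
      finally show ?thesis by (simp add: power2_eq_square)
    qed
    have t3: "\<bar>\<kappa>\<^sup>2 * \<delta>\<^sup>2 / 2\<bar> \<le> 1 / (a - b)\<^sup>2 * \<delta>\<^sup>2"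
    proof -
      have "\<kappa>\<^sup>2 \<le> (1 / (a - b))\<^sup>2" using power_mono[OF k, of 2] by simp
      then have "\<kappa>\<^sup>2 * \<delta>\<^sup>2 \<le> 1 / (a - b)\<^sup>2 * \<delta>\<^sup>2" by (intro mult_right_mono) (auto simp: power_divide)
      moreover have "0 \<le> \<kappa>\<^sup>2 * \<delta>\<^sup>2" by simp
      ultimately show ?thesis by (subst abs_of_nonneg) (simp, linarith)
    qed
    have "ln (a - \<bar>y\<bar>) - ln (a - \<bar>x\<bar>) + \<kappa> * \<delta> + \<kappa>\<^sup>2 * \<delta>\<^sup>2 / 2 + (\<bar>y\<bar> - \<bar>x\<bar> - sg x * \<delta>) / a
       = (?\<phi> \<bar>y\<bar> - ?\<phi> \<bar>x\<bar>) + (\<kappa> * \<delta> - sg x * \<delta> / a) + \<kappa>\<^sup>2 * \<delta>\<^sup>2 / 2"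
      by (simp add: diff_divide_distrib)
    also have "\<bar>\<dots>\<bar> \<le> 1 / (a * (a - b)) * \<delta>\<^sup>2 + 1 / (a * (a - b)) * \<delta>\<^sup>2 + 1 / (a - b)\<^sup>2 * \<delta>\<^sup>2"
    proof -
      have "\<bar>p + q + r\<bar> \<le> P + Q + R" if "\<bar>p\<bar> \<le> P" "\<bar>q\<bar> \<le> Q" "\<bar>r\<bar> \<le> R" for p q r P Q R :: real
        using that by linarith
      from this[OF t1 t2 t3] show ?thesis .
    qed
    also have "\<dots> = (2 / (a * (a - b)) + 1 / (a - b)\<^sup>2) * \<delta>\<^sup>2" by (simp add: algebra_simps)
    also have "\<dots> \<le> C * \<delta>\<^sup>2" using C by (intro mult_right_mono) auto
    also have "\<dots> \<le> C * (\<bar>\<delta>\<bar>^3 + \<delta>\<^sup>2 * indicator {z. x * z \<le> 0} y)"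
      using C False by (intro mult_left_mono) auto
    finally show ?thesis unfolding \<delta>_def .
  qed
qed

text \<open>Dominated convergence for the left-endpoint step functions; the cells are half-open so
  that each r lies in exactly one. Continuity is demanded at almost every time only, since the
  intended integrands jump at zeros of the path.\<close>

lemma riemann_sum_tendsto:
  fixes g :: "real \<Rightarrow> real"
  assumes st: "s < t" and bound: "\<And>r. r \<in> {s..t} \<Longrightarrow> \<bar>g r\<bar> \<le> K"
    and meas: "(\<lambda>r. indicator {s..<t} r * g r) \<in> borel_measurable borel"
    and cont: "AE r in lborel. r \<in> {s..<t} \<longrightarrow> (\<forall>p. (\<forall>n. p n \<in> {s..t}) \<longrightarrow> p \<longlonglongrightarrow> r \<longrightarrow> (\<lambda>n. g (p n)) \<longlonglongrightarrow> g r)"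
  shows "(\<lambda>n. \<Sum>i<Suc n. g (grid s t (Suc n) i) * ((t - s) / real (Suc n))) \<longlonglongrightarrow> (LINT r:{s..<t}|lborel. g r)"
proof -
  define F where "F n r = (\<Sum>i<Suc n. g (grid s t (Suc n) i) * indicator {grid s t (Suc n) i..<grid s t (Suc n) (Suc i)} r)" for n r
  have ind: "\<exists>i<Suc n. r \<in> {grid s t (Suc n) i..<grid s t (Suc n) (Suc i)} \<and> F n r = g (grid s t (Suc n) i)" if r: "r \<in> {s..<t}" for n r
  proof -
    let ?p = "grid s t (Suc n)"
    define A where "A = {i. i \<le> n \<and> ?p i \<le> r}"
    have A: "finite A" "0 \<in> A" using r by (auto simp: A_def)
    define i where "i = Max A"
    have i: "i \<in> A" unfolding i_def using A by (intro Max_in) auto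
    have up: "r < ?p (Suc i)"
    proof (rule ccontr)
      assume "\<not> r < ?p (Suc i)"
      then have "?p (Suc i) \<le> r" by simp
      moreover from this have "Suc i \<le> n" using i r grid_n[of "Suc n" s t] by (cases "i = n") (auto simp: A_def)
      ultimately have "Suc i \<in> A" by (simp add: A_def)
      then show False using Max_ge[OF A(1), of "Suc i"] by (simp add: i_def)
    qed
    have uniq: "j = i" if "r \<in> {?p j..<?p (Suc j)}" for j
    proof (rule ccontr)
      assume "j \<noteq> i"
      then consider "Suc j \<le> i" | "Suc i \<le> j" by linarith
      then show False
      proof cases
        case 1
        then have "?p (Suc j) \<le> ?p i" using st by (intro grid_mono) auto
        then show False using that i by (auto simp: A_def)
      next
        case 2
        then have "?p (Suc i) \<le> ?p j" using st by (intro grid_mono) auto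
        then show False using that up by auto
      qed
    qed
    have "F n r = (\<Sum>j<Suc n. if j = i then g (?p i) else 0)"
      unfolding F_def using uniq i up by (intro sum.cong) (auto simp: A_def split: split_indicator)
    also have "\<dots> = g (?p i)" using i by (simp add: A_def)
    finally show ?thesis using i up by (intro exI[of _ i]) (auto simp: A_def)
  qed
  have out: "F n r = 0" if "r \<notin> {s..<t}" for n r
  proof -
    have "r \<notin> {grid s t (Suc n) i..<grid s t (Suc n) (Suc i)}" if i: "i < Suc n" for i
      using \<open>r \<notin> {s..<t}\<close> grid_ge[of s t "Suc n" i] grid_le[of s t "Suc n" "Suc i"] st i by auto
    then show ?thesis unfolding F_def by (intro sum.neutral) auto
  qed
  have ii: "integrable lborel (indicat_real {grid s t (Suc n) i..<grid s t (Suc n) (Suc i)})" for n i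
    using grid_less[OF st, of "Suc n" i] by (intro integrable_real_indicator) (auto simp: less_imp_le)
  have eq: "(\<Sum>i<Suc n. g (grid s t (Suc n) i) * ((t - s) / real (Suc n))) = (\<integral>r. F n r \<partial>lborel)" for n
  proof -
    have "(\<integral>r. F n r \<partial>lborel) = (\<Sum>i<Suc n. \<integral>r. g (grid s t (Suc n) i) * indicator {grid s t (Suc n) i..<grid s t (Suc n) (Suc i)} r \<partial>lborel)"
      unfolding F_def using ii by (intro Bochner_Integration.integral_sum) auto
    also have "\<dots> = (\<Sum>i<Suc n. g (grid s t (Suc n) i) * ((t - s) / real (Suc n)))"
      using grid_less[OF st, of "Suc n"] ii by (intro sum.cong) (auto simp: grid_diff less_imp_le)
    finally show ?thesis by simp
  qed
  have "(\<lambda>n. \<integral>r. F n r \<partial>lborel) \<longlonglongrightarrow> (\<integral>r. indicator {s..<t} r * g r \<partial>lborel)"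
  proof (rule integral_dominated_convergence[where w="\<lambda>r. K * indicator {s..<t} r"])
    show "(\<lambda>r. indicator {s..<t} r * g r) \<in> borel_measurable lborel" using meas by simp
    show "F n \<in> borel_measurable lborel" for n unfolding F_def[abs_def] by measurable
    show "integrable lborel (\<lambda>r. K * indicator {s..<t} r)" using st by auto
    show "AE r in lborel. norm (F n r) \<le> K * indicator {s..<t} r" for n
    proof (rule AE_I2)
      fix r
      show "norm (F n r) \<le> K * indicator {s..<t} r"
      proof (cases "r \<in> {s..<t}")
        case True
        from ind[OF this, of n] obtain i where "i < Suc n" "F n r = g (grid s t (Suc n) i)" by blast
        then show ?thesis using True bound[of "grid s t (Suc n) i"] st grid_ge[of s t "Suc n" i] grid_le[of s t "Suc n" i] by auto
      qed (simp add: out)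
    qed
    show "AE r in lborel. (\<lambda>n. F n r) \<longlonglongrightarrow> indicator {s..<t} r * g r"
      using cont
    proof eventually_elim
      case (elim r)
      show ?case
      proof (cases "r \<in> {s..<t}")
        case True
        from ind[OF this] have "\<forall>n. \<exists>i<Suc n. r \<in> {grid s t (Suc n) i..<grid s t (Suc n) (Suc i)} \<and> F n r = g (grid s t (Suc n) i)" by blast
        then obtain i where i: "\<And>n. i n < Suc n" "\<And>n. r \<in> {grid s t (Suc n) (i n)..<grid s t (Suc n) (Suc (i n))}"
          "\<And>n. F n r = g (grid s t (Suc n) (i n))" by metis
        have "(\<lambda>n. grid s t (Suc n) (i n)) \<longlonglongrightarrow> r"
        proof (rule tendsto_sandwich[of "\<lambda>n. r - (t - s) / real (Suc n)" _ _ "\<lambda>_. r"])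
          show "\<forall>\<^sub>F n in sequentially. r - (t - s) / real (Suc n) \<le> grid s t (Suc n) (i n)"
            using i(2) grid_diff[of s t] by (intro always_eventually allI) (smt (verit) atLeastLessThan_iff)
          have "(\<lambda>n. (t - s) / real (Suc n)) \<longlonglongrightarrow> 0"
            using tendsto_mult_right_zero[OF LIMSEQ_inverse_real_of_nat, of "t - s"] by (simp add: divide_inverse)
          from tendsto_diff[OF tendsto_const[of r] this] show "(\<lambda>n. r - (t - s) / real (Suc n)) \<longlonglongrightarrow> r" by simp
        qed (use i(2) in auto)
        moreover have "grid s t (Suc n) (i n) \<in> {s..t}" for n
          using st grid_ge[of s t "Suc n" "i n"] grid_le[of s t "Suc n" "i n"] i(1)[of n] by auto
        ultimately show ?thesis using elim True i(3) by (auto simp: i(3))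
      qed (simp add: out)
    qed
  qed
  then show ?thesis unfolding eq set_lebesgue_integral_def by simp
qed

text \<open>The L^2 bound supplies uniform integrability: with d = g n - f, |d| <= min |d| R + d^2 /
  R. The first term converges by domination for fixed R, the second has integral at most 4 C /
  R.\<close>

lemma (in prob_space) L1_convergence_of_L2_bounded:
  fixes g :: "nat \<Rightarrow> 'a \<Rightarrow> real"
  assumes [measurable]: "\<And>n. g n \<in> borel_measurable M" "f \<in> borel_measurable M"
    and bound: "\<And>n. (\<integral>\<^sup>+x. ennreal ((g n x)\<^sup>2) \<partial>M) \<le> ennreal C" and C: "0 \<le> C"
    and lim: "AE x in M. (\<lambda>n. g n x) \<longlonglongrightarrow> f x"
  shows "integrable M f" "(\<lambda>n. \<integral>x. \<bar>g n x - f x\<bar> \<partial>M) \<longlonglongrightarrow> 0" "\<And>n. integrable M (g n)"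
    "integrable M (\<lambda>x. (f x)\<^sup>2)" "\<And>n. integrable M (\<lambda>x. (g n x)\<^sup>2)"
proof -
  have gi: "integrable M (\<lambda>x. (g n x)\<^sup>2)" for n
    using bound[of n] by (intro integrableI_bounded) (auto simp: le_less_trans)
  have "(\<integral>\<^sup>+x. ennreal ((f x)\<^sup>2) \<partial>M) = (\<integral>\<^sup>+x. liminf (\<lambda>n. ennreal ((g n x)\<^sup>2)) \<partial>M)"
    using lim
  proof (intro nn_integral_cong_AE, eventually_elim)
    case (elim x)
    then have "(\<lambda>n. ennreal ((g n x)\<^sup>2)) \<longlonglongrightarrow> ennreal ((f x)\<^sup>2)" by (intro tendsto_ennrealI tendsto_power)
    from lim_imp_Liminf[OF _ this] show ?case by simp
  qed
  also have "\<dots> \<le> liminf (\<lambda>n. \<integral>\<^sup>+x. ennreal ((g n x)\<^sup>2) \<partial>M)" by (rule nn_integral_liminf) measurable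
  also have "\<dots> \<le> ennreal C" using bound by (intro Liminf_le) auto
  finally have fb: "(\<integral>\<^sup>+x. ennreal ((f x)\<^sup>2) \<partial>M) \<le> ennreal C" .
  then show fi: "integrable M (\<lambda>x. (f x)\<^sup>2)"
    by (intro integrableI_bounded) (auto simp: le_less_trans)
  show f1: "integrable M f" by (rule square_integrable_imp_integrable[OF _ fi]) measurable
  show g1: "integrable M (g n)" for n by (rule square_integrable_imp_integrable[OF _ gi]) measurable
  show "integrable M (\<lambda>x. (g n x)\<^sup>2)" for n by (rule gi)
  have intC: "(\<integral>x. (g n x)\<^sup>2 \<partial>M) \<le> C" "(\<integral>x. (f x)\<^sup>2 \<partial>M) \<le> C" for n
    using bound[of n] fb gi[of n] fi C by (auto simp: nn_integral_eq_integral)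
  define d where "d n x = g n x - f x" for n x
  have dm [measurable]: "d n \<in> borel_measurable M" for n unfolding d_def[abs_def] by measurable
  have d2: "integrable M (\<lambda>x. (d n x)\<^sup>2)" for n
    unfolding d_def by (rule integrable_square_diff) (use gi fi in auto)
  have d2C: "(\<integral>x. (d n x)\<^sup>2 \<partial>M) \<le> 4 * C" for n
  proof -
    have "(\<integral>x. (d n x)\<^sup>2 \<partial>M) \<le> (\<integral>x. 2 * (g n x)\<^sup>2 + 2 * (f x)\<^sup>2 \<partial>M)"
    proof (rule integral_mono)
      fix x
      show "(d n x)\<^sup>2 \<le> 2 * (g n x)\<^sup>2 + 2 * (f x)\<^sup>2"
        using zero_le_power2[of "g n x + f x"] by (simp add: d_def power2_diff power2_sum)
    qed (use d2 gi fi in auto)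
    also have "\<dots> = 2 * (\<integral>x. (g n x)\<^sup>2 \<partial>M) + 2 * (\<integral>x. (f x)\<^sup>2 \<partial>M)" using gi fi by simp
    finally show ?thesis using intC(1)[of n] intC(2) by linarith
  qed
  have dlim: "(\<lambda>n. \<integral>x. min \<bar>d n x\<bar> R \<partial>M) \<longlonglongrightarrow> 0" if R: "0 < R" for R
  proof -
    have "(\<lambda>n. \<integral>x. min \<bar>d n x\<bar> R \<partial>M) \<longlonglongrightarrow> (\<integral>x. 0 \<partial>M)"
    proof (rule integral_dominated_convergence[where w="\<lambda>_. R"])
      show "AE x in M. (\<lambda>n. min \<bar>d n x\<bar> R) \<longlonglongrightarrow> 0"
        using lim
      proof eventually_elim
        case (elim x)
        then have "(\<lambda>n. d n x) \<longlonglongrightarrow> 0" unfolding d_def by (simp add: LIM_zero_iff)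
        then have "(\<lambda>n. min \<bar>d n x\<bar> R) \<longlonglongrightarrow> min 0 R"
          by (intro tendsto_min tendsto_const tendsto_rabs_zero)
        then show ?case using R by (simp add: min_def)
      qed
    qed (use R in auto)
    then show ?thesis by simp
  qed
  have split: "(\<integral>x. \<bar>d n x\<bar> \<partial>M) \<le> (\<integral>x. min \<bar>d n x\<bar> R \<partial>M) + 4 * C / R" if R: "0 < R" for n R
  proof -
    have mi: "integrable M (\<lambda>x. min \<bar>d n x\<bar> R)"
      by (rule integrable_const_bound[of _ R]) (use R in auto)
    have "(\<integral>x. \<bar>d n x\<bar> \<partial>M) \<le> (\<integral>x. min \<bar>d n x\<bar> R + (d n x)\<^sup>2 / R \<partial>M)"
    proof (rule integral_mono)
      show "integrable M (\<lambda>x. \<bar>d n x\<bar>)" unfolding d_def using f1 g1 by auto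
      show "integrable M (\<lambda>x. min \<bar>d n x\<bar> R + (d n x)\<^sup>2 / R)" using mi d2 by auto
      fix x
      show "\<bar>d n x\<bar> \<le> min \<bar>d n x\<bar> R + (d n x)\<^sup>2 / R"
      proof (cases "\<bar>d n x\<bar> \<le> R")
        case False
        then have "\<bar>d n x\<bar> * R \<le> \<bar>d n x\<bar> * \<bar>d n x\<bar>" by (intro mult_left_mono) auto
        then have "\<bar>d n x\<bar> \<le> (d n x)\<^sup>2 / R" using R by (simp add: field_simps power2_eq_square)
        then show ?thesis using R by auto
      qed (use R in auto)
    qed
    also have "\<dots> = (\<integral>x. min \<bar>d n x\<bar> R \<partial>M) + (\<integral>x. (d n x)\<^sup>2 \<partial>M) / R" using mi d2 by simp
    also have "\<dots> \<le> (\<integral>x. min \<bar>d n x\<bar> R \<partial>M) + 4 * C / R"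
      using d2C[of n] R by (intro add_left_mono divide_right_mono) auto
    finally show ?thesis .
  qed
  have "(\<lambda>n. \<integral>x. \<bar>d n x\<bar> \<partial>M) \<longlonglongrightarrow> 0"
  proof (rule LIMSEQ_I)
    fix e :: real assume e: "0 < e"
    \<comment> \<open>Chosen so that 4 C / R <= e / 2; the added 1 keeps R positive when C =
      0.\<close>
    define R where "R = 8 * C / e + 1"
    have R: "0 < R" using C e by (simp add: R_def add_nonneg_pos)
    have "4 * C / R \<le> e / 2"
    proof -
      have "8 * C \<le> R * e" using e by (simp add: R_def field_simps)
      then show ?thesis using R by (simp add: field_simps)
    qed
    obtain N where N: "\<And>n. n \<ge> N \<Longrightarrow> \<bar>\<integral>x. min \<bar>d n x\<bar> R \<partial>M\<bar> < e / 2"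
      using LIMSEQ_D[OF dlim[OF R], of "e/2"] e by auto
    show "\<exists>no. \<forall>n\<ge>no. norm ((\<integral>x. \<bar>d n x\<bar> \<partial>M) - 0) < e"
    proof (intro exI allI impI)
      fix n assume "N \<le> n"
      then have "(\<integral>x. \<bar>d n x\<bar> \<partial>M) < e"
        using split[OF R, of n] N[of n] \<open>4 * C / R \<le> e / 2\<close> by linarith
      moreover have "0 \<le> (\<integral>x. \<bar>d n x\<bar> \<partial>M)" by (rule Bochner_Integration.integral_nonneg) simp
      ultimately show "norm ((\<integral>x. \<bar>d n x\<bar> \<partial>M) - 0) < e" by simp
    qed
  qed
  then show "(\<lambda>n. \<integral>x. \<bar>g n x - f x\<bar> \<partial>M) \<longlonglongrightarrow> 0" by (simp add: d_def)
qed

section \<open>The martingales indexed by the level\<close>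

text \<open>The singular kernel with its denominator bounded below by a - b: bounded everywhere, and
  unchanged as long as the path stays within b.\<close>

definition kap :: "real \<Rightarrow> real \<Rightarrow> real \<Rightarrow> real" where
  "kap a b x = sg x / max (a - \<bar>x\<bar>) (a - b)"

lemma kap_measurable [measurable]: "kap a b \<in> borel_measurable borel"
  unfolding kap_def[abs_def] by measurable

lemma kap_bound: "b < a \<Longrightarrow> \<bar>kap a b x\<bar> \<le> 1 / (a - b)"
  unfolding kap_def abs_divide sg_abs by (intro divide_left_mono) (auto simp: max_def)

lemma kap_eq: "\<bar>x\<bar> \<le> b \<Longrightarrow> kap a b x = sg x / (a - \<bar>x\<bar>)"
  by (simp add: kap_def max_def)

lemma isCont_kap:
  assumes "b < a" "x \<noteq> 0"
  shows "isCont (kap a b) x"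
proof -
  have "isCont (\<lambda>y. sgn y / max (a - \<bar>y\<bar>) (a - b)) x"
    using assms by (intro continuous_intros isCont_sgn) auto
  moreover have "\<forall>\<^sub>F y in nhds x. y \<in> - {0}"
    by (rule eventually_nhds_in_open) (use assms in auto)
  then have "\<forall>\<^sub>F y in nhds x. sgn y / max (a - \<bar>y\<bar>) (a - b) = kap a b y"
    by eventually_elim (simp add: kap_def sg_eq_sgn)
  ultimately show ?thesis using isCont_cong by force
qed

text \<open>Under the component of level a, adding this to X gives a Brownian motion. The kernel is
  the singular one, with the theorem's \<open>sgn\<close>; it differs from \<open>sg\<close> only at
  zeros of the path.\<close>

definition drift :: "real \<Rightarrow> real \<Rightarrow> real \<Rightarrow> path \<Rightarrow> real" where
  "drift a s t w = (LINT r:{s..t}|lborel. sgn (coord r w) / (a - \<bar>coord r w\<bar>))"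

lemma measurable_coord_joint':
  assumes "0 \<le> t"
  shows "(\<lambda>z. coord (max 0 (min (snd z) t)) (fst (fst z))) \<in> borel_measurable ((\<F> t \<Otimes>\<^sub>M borel) \<Otimes>\<^sub>M lborel)"
proof -
  have "(\<lambda>z. (snd z, fst (fst z))) \<in> measurable ((\<F> t \<Otimes>\<^sub>M borel) \<Otimes>\<^sub>M lborel) (borel \<Otimes>\<^sub>M \<F> t)"
    by measurable
  from measurable_compose[OF this measurable_coord_joint[OF assms]] show ?thesis by (simp add: split_beta')
qed

text \<open>Joint in the path and the level, because the random total maximum will be substituted
  for the level.\<close>

lemma path_integral_measurable:
  fixes g :: "real \<Rightarrow> real \<Rightarrow> real"
  assumes st: "0 \<le> s" "s \<le> t" and g: "(\<lambda>z. g (fst z) (snd z)) \<in> borel_measurable (borel \<Otimes>\<^sub>M borel)"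
  shows "(\<lambda>z. LINT r:{s..t}|lborel. g (snd z) (coord r (fst z))) \<in> borel_measurable (\<F> t \<Otimes>\<^sub>M borel)"
proof -
  have [measurable]: "(\<lambda>z. coord (max 0 (min (snd z) t)) (fst (fst z))) \<in> borel_measurable ((\<F> t \<Otimes>\<^sub>M borel) \<Otimes>\<^sub>M lborel)"
    using st by (intro measurable_coord_joint') auto
  have "(\<lambda>z. (snd (fst z), coord (max 0 (min (snd z) t)) (fst (fst z)))) \<in> measurable ((\<F> t \<Otimes>\<^sub>M borel) \<Otimes>\<^sub>M lborel) (borel \<Otimes>\<^sub>M borel)"
    by measurable
  from measurable_compose[OF this g]
  have [measurable]: "(\<lambda>z. g (snd (fst z)) (coord (max 0 (min (snd z) t)) (fst (fst z)))) \<in> borel_measurable ((\<F> t \<Otimes>\<^sub>M borel) \<Otimes>\<^sub>M lborel)"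
    by simp
  have "(LINT r:{s..t}|lborel. g (snd z) (coord r (fst z))) = (\<integral>r. indicator {s..t} r *\<^sub>R g (snd z) (coord (max 0 (min r t)) (fst z)) \<partial>lborel)" for z
    unfolding set_lebesgue_integral_def
    using st by (intro Bochner_Integration.integral_cong) (auto simp: max_def min_def split: split_indicator)
  then show ?thesis
    by (simp only:) (rule lborel.borel_measurable_lebesgue_integral, simp add: split_beta')
qed

lemma drift_measurable:
  "0 \<le> s \<Longrightarrow> s \<le> t \<Longrightarrow> (\<lambda>z. drift (snd z) s t (fst z)) \<in> borel_measurable (\<F> t \<Otimes>\<^sub>M borel)"
  unfolding drift_def by (rule path_integral_measurable) auto

text \<open>Paths take the value \<open>undefined\<close> at negative times; reading them at max 0 r
  gives a function continuous on the whole line.\<close>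

lemma path_measurable:
  assumes "w \<in> path_space"
  shows "(\<lambda>r. coord (max 0 r) w) \<in> borel_measurable borel"
  by (intro borel_measurable_continuous_onI continuous_on_compose2[OF path_continuous[OF assms]] continuous_intros) auto

lemma path_oscillation:
  assumes w: "w \<in> path_space" and st: "0 \<le> s" "s < t" and e: "0 < e"
  shows "\<exists>N. \<forall>n\<ge>N. \<forall>i<Suc n. \<bar>coord (grid s t (Suc n) (Suc i)) w - coord (grid s t (Suc n) i) w\<bar> \<le> e"
proof -
  have "uniformly_continuous_on {s..t} (\<lambda>r. coord r w)"
    using st by (intro compact_uniformly_continuous continuous_on_subset[OF path_continuous[OF w]]) auto
  then obtain d where d: "0 < d" "\<And>x y. x \<in> {s..t} \<Longrightarrow> y \<in> {s..t} \<Longrightarrow> dist y x < d \<Longrightarrow> dist (coord y w) (coord x w) < e"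
    using e unfolding uniformly_continuous_on_def by metis
  obtain N :: nat where N: "(t - s) / d < real N" using reals_Archimedean2 by blast
  show ?thesis
  proof (intro exI[of _ N] allI impI)
    fix n i assume ni: "N \<le> n" "i < Suc n"
    let ?p = "grid s t (Suc n)"
    have "(t - s) / d < real (Suc n)" using N ni by simp
    then have "(t - s) / real (Suc n) < d" using d st by (simp add: field_simps)
    then have "?p (Suc i) - ?p i < d" unfolding grid_diff .
    moreover have "?p i < ?p (Suc i)" using st by (intro grid_less) auto
    moreover have "?p i \<in> {s..t}" "?p (Suc i) \<in> {s..t}"
      using st ni grid_ge[of s t "Suc n" i] grid_ge[of s t "Suc n" "Suc i"] grid_le[of s t "Suc n" i] grid_le[of s t "Suc n" "Suc i"] by auto
    ultimately have "dist (coord (?p (Suc i)) w) (coord (?p i) w) < e"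
      by (intro d(2)) (auto simp: dist_real_def)
    then show "\<bar>coord (?p (Suc i)) w - coord (?p i) w\<bar> \<le> e" by (simp add: dist_real_def)
  qed
qed

text \<open>Fubini in time and path, since X_r has no atom at 0 for each r > 0. Bounded time windows
  are used because joint measurability is available there.\<close>

lemma (in wiener) zero_set_null: "AE w in P0. AE r in lborel. 0 < r \<longrightarrow> coord r w \<noteq> 0"
proof -
  interpret LP: pair_sigma_finite lborel P0 by unfold_locales
  have "AE w in P0. AE r in lborel. r \<in> {0<..real n} \<longrightarrow> coord r w \<noteq> 0" for n :: nat
  proof -
    have c [measurable]: "(\<lambda>z. coord (max 0 (min (fst z) (real n))) (snd z)) \<in> borel_measurable (borel \<Otimes>\<^sub>M P0)"
    proof -
      have "(\<lambda>(r, w). (r, w)) \<in> measurable (borel \<Otimes>\<^sub>M P0) (borel \<Otimes>\<^sub>M \<F> (real n))"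
        unfolding split_beta' using id_measurable_G[of "real n"]
        by (intro measurable_Pair measurable_fst measurable_compose[OF measurable_snd]) auto
      from measurable_compose[OF this measurable_coord_joint[of "real n"]] show ?thesis
        by (simp add: split_beta')
    qed
    have m: "{z \<in> space (lborel \<Otimes>\<^sub>M P0). fst z \<in> {0<..real n} \<longrightarrow> coord (max 0 (min (fst z) (real n))) (snd z) \<noteq> 0} \<in> sets (lborel \<Otimes>\<^sub>M P0)"
      by measurable
    have "AE r in lborel. AE w in P0. r \<in> {0<..real n} \<longrightarrow> coord (max 0 (min r (real n))) w \<noteq> 0"
    proof (rule AE_I2)
      fix r
      show "AE w in P0. r \<in> {0<..real n} \<longrightarrow> coord (max 0 (min r (real n))) w \<noteq> 0"
      proof (cases "r \<in> {0<..real n}")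
        case True
        then have "AE w in P0. coord r w \<noteq> 0" by (intro coord_ne_const) auto
        with True show ?thesis by (auto simp: max_def min_def)
      next
        case False
        then show ?thesis by (intro AE_I2) blast
      qed
    qed
    then have "AE w in P0. AE r in lborel. r \<in> {0<..real n} \<longrightarrow> coord (max 0 (min r (real n))) w \<noteq> 0"
      using LP.AE_commute[of "\<lambda>r w. r \<in> {0<..real n} \<longrightarrow> coord (max 0 (min r (real n))) w \<noteq> 0", OF m] by simp
    then show ?thesis
      by eventually_elim (auto elim!: eventually_mono simp: max_def min_def)
  qed
  then have "AE w in P0. \<forall>n::nat. AE r in lborel. r \<in> {0<..real n} \<longrightarrow> coord r w \<noteq> 0"
    unfolding AE_all_countable by blast
  then show ?thesis
  proof eventually_elim
    case (elim w)
    then have "AE r in lborel. \<forall>n::nat. r \<in> {0<..real n} \<longrightarrow> coord r w \<noteq> 0" unfolding AE_all_countable by blast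
    then show ?case
    proof eventually_elim
      case (elim r)
      obtain n :: nat where "r \<le> real n" using real_arch_simple by blast
      with elim show ?case by auto
    qed
  qed
qed

text \<open>The cut-off kernel is discontinuous only at 0, and the times at which the path is 0 form
  a null set. Off the same set, and within b, it agrees with the integrand of
  \<open>drift\<close>.\<close>

lemma drift_riemann:
  assumes w: "w \<in> path_space" and st: "0 \<le> s" "s < t" and ab: "b < a"
    and le: "\<And>r. r \<in> {s..t} \<Longrightarrow> \<bar>coord r w\<bar> \<le> b" and nz: "AE r in lborel. 0 < r \<longrightarrow> coord r w \<noteq> 0"
  shows "(\<lambda>n. \<Sum>i<Suc n. kap a b (coord (grid s t (Suc n) i) w) * ((t - s) / real (Suc n))) \<longlonglongrightarrow> drift a s t w"
proof -
  have [measurable]: "(\<lambda>r. coord (max 0 r) w) \<in> borel_measurable borel" by (rule path_measurable[OF w])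
  have "(\<lambda>n. \<Sum>i<Suc n. kap a b (coord (grid s t (Suc n) i) w) * ((t - s) / real (Suc n))) \<longlonglongrightarrow> (LINT r:{s..<t}|lborel. kap a b (coord r w))"
  proof (rule riemann_sum_tendsto[OF st(2)])
    show "\<bar>kap a b (coord r w)\<bar> \<le> 1 / (a - b)" for r by (rule kap_bound[OF ab])
    have "(\<lambda>r. indicator {s..<t} r * kap a b (coord (max 0 r) w)) \<in> borel_measurable borel" by measurable
    also have "(\<lambda>r. indicator {s..<t} r * kap a b (coord (max 0 r) w)) = (\<lambda>r. indicator {s..<t} r * kap a b (coord r w))"
      using st by (auto simp: fun_eq_iff max_def split: split_indicator)
    finally show "(\<lambda>r. indicator {s..<t} r * kap a b (coord r w)) \<in> borel_measurable borel" .
    have "AE r in lborel. r \<noteq> (0::real)" by (rule AE_lborel_singleton)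
    with nz show "AE r in lborel. r \<in> {s..<t} \<longrightarrow> (\<forall>p. (\<forall>n. p n \<in> {s..t}) \<longrightarrow> p \<longlonglongrightarrow> r \<longrightarrow> (\<lambda>n. kap a b (coord (p n) w)) \<longlonglongrightarrow> kap a b (coord r w))"
    proof eventually_elim
      case (elim r)
      show ?case
      proof (intro impI allI)
        fix p :: "nat \<Rightarrow> real" assume r: "r \<in> {s..<t}" and p: "\<forall>n. p n \<in> {s..t}" "p \<longlonglongrightarrow> r"
        have "(\<lambda>n. coord (p n) w) \<longlonglongrightarrow> coord r w"
        proof (rule continuous_on_tendsto_compose[OF path_continuous[OF w] p(2)])
          show "\<forall>\<^sub>F n in sequentially. p n \<in> {0..}" using p st by (auto intro!: always_eventually) (meson order_trans)
        qed (use r st in auto)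
        moreover have "isCont (kap a b) (coord r w)" using elim r st by (intro isCont_kap ab) auto
        ultimately show "(\<lambda>n. kap a b (coord (p n) w)) \<longlonglongrightarrow> kap a b (coord r w)"
          by (rule isCont_tendsto_compose[rotated])
      qed
    qed
  qed
  also have "(LINT r:{s..<t}|lborel. kap a b (coord r w)) = (LINT r:{s..t}|lborel. sgn (coord r w) / (a - \<bar>coord r w\<bar>))"
  proof -
    have "(LINT r|lborel. indicator {s..<t} r *\<^sub>R kap a b (coord (max 0 r) w)) = (LINT r|lborel. indicator {s..t} r *\<^sub>R (sgn (coord (max 0 r) w) / (a - \<bar>coord (max 0 r) w\<bar>)))"
    proof (rule integral_cong_AE)
      have "AE r in lborel. r \<noteq> (0::real)" "AE r in lborel. r \<noteq> t" by (rule AE_lborel_singleton)+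
      with nz show "AE r in lborel. indicator {s..<t} r *\<^sub>R kap a b (coord (max 0 r) w) = indicator {s..t} r *\<^sub>R (sgn (coord (max 0 r) w) / (a - \<bar>coord (max 0 r) w\<bar>))"
      proof eventually_elim
        case (elim r)
        show ?case
        proof (cases "r \<in> {s..<t}")
          case True
          then have "0 < r" using elim st by auto
          then show ?thesis using True elim le[of r] by (simp add: kap_eq sg_eq_sgn)
        qed (use elim in \<open>auto split: split_indicator\<close>)
      qed
    qed measurable
    moreover have "indicator {s..<t} r *\<^sub>R kap a b (coord (max 0 r) w) = indicator {s..<t} r *\<^sub>R kap a b (coord r w)"
      "indicator {s..t} r *\<^sub>R (sgn (coord (max 0 r) w) / (a - \<bar>coord (max 0 r) w\<bar>)) = indicator {s..t} r *\<^sub>R (sgn (coord r w) / (a - \<bar>coord r w\<bar>))" for r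
      using st by (auto simp: max_def split: split_indicator)
    ultimately show ?thesis unfolding set_lebesgue_integral_def by (simp only:)
  qed
  finally show ?thesis unfolding drift_def .
qed

section \<open>Limit of the discrete Girsanov densities\<close>

context local_time
begin

definition Y :: "real \<Rightarrow> real \<Rightarrow> path \<Rightarrow> real" where
  "Y a t w = (1 - \<bar>coord t w\<bar> / a) * exp (L t w / a)"

lemma Y_measurable_filt: "0 \<le> s \<Longrightarrow> s \<le> t \<Longrightarrow> Y a s \<in> borel_measurable (\<F> t)"
proof -
  assume "0 \<le> s" "s \<le> t"
  then have [measurable]: "coord s \<in> borel_measurable (\<F> t)" "L s \<in> borel_measurable (\<F> t)"
    by (auto intro: measurable_coord_filt L_measurable_filt)
  show ?thesis unfolding Y_def[abs_def] by measurable
qed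

text \<open>Convergence is claimed only where the running maximum is below b, since there the
  cut-off kernel is the true one; r selects a subsequence.\<close>

abbreviation girsanov_conv :: "real \<Rightarrow> real \<Rightarrow> real \<Rightarrow> real \<Rightarrow> (nat \<Rightarrow> nat) \<Rightarrow> path \<Rightarrow> bool" where
  "girsanov_conv a b s t r w \<equiv> run_max t w < b \<longrightarrow>
      (\<lambda>n. Y a s w * exp (dens_sum (kap a b) s t (Suc (r n)) (Suc (r n)) w)) \<longlonglongrightarrow> Y a t w \<and>
      (\<lambda>n. drift_sum (kap a b) s t (Suc (r n)) (Suc (r n)) w) \<longlonglongrightarrow> coord t w - coord s w + drift a s t w"

text \<open>Four error sums have to vanish: Tanaka, quadratic variation, cubic increments, sign
  changes. Added up, the first two squared, they form one nonnegative sequence converging to 0 in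
  L^1, which gives a common subsequence along which all of them vanish almost surely.\<close>

lemma girsanov_limit:
  assumes st: "0 \<le> s" "s < t" and ab: "0 < b" "b < a"
  obtains r where "strict_mono r"
    "AE w in P0. girsanov_conv a b s t r w"
proof -
  define p where "p n = grid s t (Suc n)" for n
  have p: "0 \<le> p n i" "p n i < p n (Suc i)" for n i
    using st grid_less[OF st(2), of "Suc n" i] grid_ge[of s t "Suc n" i] by (auto simp: p_def)
  have ple: "p n i \<le> t" if "i \<le> Suc n" for n i unfolding p_def using st that by (intro grid_le) auto
  define d where "d n i w = coord (p n (Suc i)) w - coord (p n i) w" for n i w
  define T where "T n w = (\<Sum>i<Suc n. tk (p n i) (p n (Suc i)) w)" for n w
  define h where "h n = (t - s) / real (Suc n)" for n
  define k where "k n i w = kap a b (coord (p n i) w)" for n i w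
  define QV where "QV n w = (\<Sum>i<Suc n. (k n i w)\<^sup>2 * ((d n i w)\<^sup>2 - h n))" for n w
  define CU where "CU n w = (\<Sum>i<Suc n. \<bar>d n i w\<bar>^3)" for n w
  define SC where "SC n w = (\<Sum>i<Suc n. sc (p n i) (p n (Suc i)) w)" for n w
  define R where "R n w = (T n w)\<^sup>2 + (QV n w)\<^sup>2 + CU n w + SC n w" for n w
  have T: "integrable P0 (\<lambda>w. (T n w)\<^sup>2)" "(\<lambda>n. \<integral>w. (T n w)\<^sup>2 \<partial>P0) \<longlonglongrightarrow> 0" for n
    unfolding T_def p_def using tanaka[OF st] by auto
  have QV: "integrable P0 (\<lambda>w. (QV n w)\<^sup>2)" "(\<lambda>n. \<integral>w. (QV n w)\<^sup>2 \<partial>P0) \<longlonglongrightarrow> 0" for n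
    unfolding QV_def k_def d_def h_def p_def using quadratic_variation[OF st kap_measurable kap_bound[OF ab(2)]] by auto
  have cui: "integrable P0 (\<lambda>w. \<bar>d n i w\<bar>^3)" for n i
    unfolding d_def by (rule increment_cubic_integrable[OF p])
  have sci: "integrable P0 (sc (p n i) (p n (Suc i)))" for n i
    by (rule sc_integrable[OF p])
  have CU: "integrable P0 (CU n)" "(\<lambda>n. \<integral>w. CU n w \<partial>P0) \<longlonglongrightarrow> 0" for n
  proof -
    show "integrable P0 (CU n)" unfolding CU_def[abs_def] using cui by (intro Bochner_Integration.integrable_sum)
    have "(\<integral>w. CU n w \<partial>P0) = (\<Sum>i<Suc n. \<integral>w. \<bar>d n i w\<bar>^3 \<partial>P0)" for n
      unfolding CU_def using cui by (intro Bochner_Integration.integral_sum)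
    then show "(\<lambda>n. \<integral>w. CU n w \<partial>P0) \<longlonglongrightarrow> 0"
      using cubic_sum_tendsto[OF st] unfolding d_def p_def by (simp only:)
  qed
  have SC: "integrable P0 (SC n)" "(\<lambda>n. \<integral>w. SC n w \<partial>P0) \<longlonglongrightarrow> 0" for n
  proof -
    show "integrable P0 (SC n)" unfolding SC_def[abs_def] using sci by (intro Bochner_Integration.integrable_sum)
    have "(\<integral>w. SC n w \<partial>P0) = (\<Sum>i<Suc n. \<integral>w. sc (p n i) (p n (Suc i)) w \<partial>P0)" for n
      unfolding SC_def using sci by (intro Bochner_Integration.integral_sum)
    then show "(\<lambda>n. \<integral>w. SC n w \<partial>P0) \<longlonglongrightarrow> 0"
      using sc_sum_tendsto[OF st] unfolding p_def by (simp only:)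
  qed
  have nn: "0 \<le> CU n w" "0 \<le> SC n w" for n w
    unfolding CU_def SC_def by (rule sum_nonneg, simp add: sc_nonneg)+
  have Ri: "integrable P0 (R n)" for n
    unfolding R_def[abs_def] using T QV CU SC by (intro Bochner_Integration.integrable_add)
  have "(\<lambda>n. (\<integral>w. (T n w)\<^sup>2 \<partial>P0) + (\<integral>w. (QV n w)\<^sup>2 \<partial>P0) + (\<integral>w. CU n w \<partial>P0) + (\<integral>w. SC n w \<partial>P0)) \<longlonglongrightarrow> 0 + 0 + 0 + 0"
    by (intro tendsto_add T QV CU SC)
  moreover have "(\<integral>w. norm (R n w) \<partial>P0) = (\<integral>w. (T n w)\<^sup>2 \<partial>P0) + (\<integral>w. (QV n w)\<^sup>2 \<partial>P0) + (\<integral>w. CU n w \<partial>P0) + (\<integral>w. SC n w \<partial>P0)" for n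
  proof -
    have "norm (R n w) = R n w" for w using nn[of n w] by (simp add: R_def)
    then show ?thesis using T QV CU SC by (simp add: R_def)
  qed
  ultimately have "(\<lambda>n. \<integral>w. norm (R n w) \<partial>P0) \<longlonglongrightarrow> 0" by simp
  from tendsto_L1_AE_subseq[OF Ri this] obtain r where r: "strict_mono r" "AE w in P0. (\<lambda>n. R (r n) w) \<longlonglongrightarrow> 0"
    by blast
  show ?thesis
  proof (rule that[OF r(1)])
    show "AE w in P0. girsanov_conv a b s t r w"
      using r(2) zero_set_null AE_space
    proof eventually_elim
      case (elim w)
      then have w: "w \<in> path_space" by simp
      show ?case
      proof
      assume "run_max t w < b"
      then have le: "\<bar>coord u w\<bar> \<le> b" if "0 \<le> u" "u \<le> t" for u
        using abs_coord_le_run_max[OF w that] by simp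
      have sub: "(\<lambda>n. F (r n)) \<longlonglongrightarrow> 0" if "\<And>n. 0 \<le> F n" "\<And>n. F n \<le> R n w" for F
        by (rule tendsto_sandwich[OF _ _ tendsto_const elim(1)]) (use that in auto)
      have sq: "F \<longlonglongrightarrow> 0" if "(\<lambda>n. (F n)\<^sup>2) \<longlonglongrightarrow> 0" for F :: "nat \<Rightarrow> real"
        using tendsto_real_sqrt[OF that] by (simp add: tendsto_rabs_zero_iff)
      have lims: "(\<lambda>n. T (r n) w) \<longlonglongrightarrow> 0" "(\<lambda>n. QV (r n) w) \<longlonglongrightarrow> 0" "(\<lambda>n. CU (r n) w) \<longlonglongrightarrow> 0" "(\<lambda>n. SC (r n) w) \<longlonglongrightarrow> 0"
      proof -
        have pos: "0 \<le> (T n w)\<^sup>2" "0 \<le> (QV n w)\<^sup>2" "0 \<le> CU n w" "0 \<le> SC n w" for n using nn[of n w] by auto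
        have le: "(T n w)\<^sup>2 \<le> R n w" "(QV n w)\<^sup>2 \<le> R n w" "CU n w \<le> R n w" "SC n w \<le> R n w" for n
          using pos[of n] unfolding R_def by linarith+
        show "(\<lambda>n. T (r n) w) \<longlonglongrightarrow> 0" by (rule sq, rule sub[of "\<lambda>n. (T n w)\<^sup>2", OF pos(1) le(1)])
        show "(\<lambda>n. QV (r n) w) \<longlonglongrightarrow> 0" by (rule sq, rule sub[of "\<lambda>n. (QV n w)\<^sup>2", OF pos(2) le(2)])
        show "(\<lambda>n. CU (r n) w) \<longlonglongrightarrow> 0" by (rule sub[of "\<lambda>n. CU n w", OF pos(3) le(3)])
        show "(\<lambda>n. SC (r n) w) \<longlonglongrightarrow> 0" by (rule sub[of "\<lambda>n. SC n w", OF pos(4) le(4)])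
      qed
      define e where "e n i = ln (a - \<bar>coord (p n (Suc i)) w\<bar>) - ln (a - \<bar>coord (p n i) w\<bar>) + k n i w * d n i w + (k n i w)\<^sup>2 * (d n i w)\<^sup>2 / 2
          + (\<bar>coord (p n (Suc i)) w\<bar> - \<bar>coord (p n i) w\<bar> - sg (coord (p n i) w) * d n i w) / a" for n i
      define C where "C = 2 / (a - b)^3 + 2 / (a * (a - b)) + 1 / (a - b)\<^sup>2"
      define \<Delta> where "\<Delta> = ln (a - \<bar>coord t w\<bar>) - ln (a - \<bar>coord s w\<bar>) + (L t w - L s w) / a"
      \<comment> \<open>The sum of \<open>log_expansion\<close> over the cells: the logarithms and
        the local time telescope to \<Delta>, and the exponential of \<Delta> is Y a t / Y a s.
        Everything else is one of the four errors.\<close>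
      have dens: "dens_sum (kap a b) s t (Suc n) (Suc n) w = \<Delta> + QV n w / 2 + T n w / a - (\<Sum>i<Suc n. e n i)" for n
      proof -
        have "e n i = (ln (a - \<bar>coord (p n (Suc i)) w\<bar>) - ln (a - \<bar>coord (p n i) w\<bar>)) + (L (p n (Suc i)) w - L (p n i) w) / a
          + (k n i w)\<^sup>2 * ((d n i w)\<^sup>2 - h n) / 2 + tk (p n i) (p n (Suc i)) w / a
          - (- k n i w * d n i w - (k n i w)\<^sup>2 * h n / 2)" for i
          unfolding e_def tk_def \<beta>_def d_def by (simp add: add_divide_distrib diff_divide_distrib ring_distribs)
        then have "(\<Sum>i<Suc n. e n i) = (\<Sum>i<Suc n. ln (a - \<bar>coord (p n (Suc i)) w\<bar>) - ln (a - \<bar>coord (p n i) w\<bar>)) + (\<Sum>i<Suc n. L (p n (Suc i)) w - L (p n i) w) / a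
          + QV n w / 2 + T n w / a - (\<Sum>i<Suc n. - k n i w * d n i w - (k n i w)\<^sup>2 * h n / 2)"
          unfolding QV_def T_def sum_divide_distrib sum.distrib[symmetric] sum_subtractf[symmetric] by (intro sum.cong) auto
        also have "(\<Sum>i<Suc n. ln (a - \<bar>coord (p n (Suc i)) w\<bar>) - ln (a - \<bar>coord (p n i) w\<bar>)) = ln (a - \<bar>coord t w\<bar>) - ln (a - \<bar>coord s w\<bar>)"
          by (subst sum_lessThan_telescope) (simp add: p_def)
        also have "(\<Sum>i<Suc n. L (p n (Suc i)) w - L (p n i) w) = L t w - L s w"
          by (subst sum_lessThan_telescope) (simp add: p_def)
        also have "(\<Sum>i<Suc n. - k n i w * d n i w - (k n i w)\<^sup>2 * h n / 2) = dens_sum (kap a b) s t (Suc n) (Suc n) w"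
          unfolding dens_sum_def k_def d_def h_def p_def ..
        finally show ?thesis unfolding \<Delta>_def by simp
      qed
      \<comment> \<open>Uniform continuity of the path provides the bound on single increments that
        \<open>log_expansion\<close> requires.\<close>
      obtain N where N: "\<And>n i. N \<le> n \<Longrightarrow> i < Suc n \<Longrightarrow> \<bar>d n i w\<bar> \<le> (a - b) / 2"
        using path_oscillation[OF w st, of "(a - b) / 2"] ab unfolding d_def p_def by auto
      have ebound: "\<bar>\<Sum>i<Suc n. e n i\<bar> \<le> C * (CU n w + SC n w)" if "N \<le> n" for n
      proof -
        have "\<bar>e n i\<bar> \<le> C * (\<bar>d n i w\<bar>^3 + sc (p n i) (p n (Suc i)) w)" if i: "i < Suc n" for i
        proof -
          have li: "\<bar>coord (p n i) w\<bar> \<le> b" "\<bar>coord (p n (Suc i)) w\<bar> \<le> b" using i p ple[of i n] ple[of "Suc i" n] by (auto intro!: le)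
          have sceq: "sc (p n i) (p n (Suc i)) w = (coord (p n (Suc i)) w - coord (p n i) w)\<^sup>2 * indicator {z. coord (p n i) w * z \<le> 0} (coord (p n (Suc i)) w)"
            by (simp add: sc_def indicator_def)
          show ?thesis
            unfolding e_def k_def kap_eq[OF li(1)] C_def d_def sceq
            by (rule log_expansion[OF ab li]) (use N[OF \<open>N \<le> n\<close> i] in \<open>simp add: d_def\<close>)
        qed
        then have "\<bar>\<Sum>i<Suc n. e n i\<bar> \<le> (\<Sum>i<Suc n. C * (\<bar>d n i w\<bar>^3 + sc (p n i) (p n (Suc i)) w))"
          by (intro order_trans[OF sum_abs] sum_mono) auto
        also have "\<dots> = C * (CU n w + SC n w)"
          unfolding CU_def SC_def sum_distrib_left[symmetric] sum.distrib ..
        finally show ?thesis .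
      qed
      have "(\<lambda>n. \<Sum>i<Suc (r n). e (r n) i) \<longlonglongrightarrow> 0"
      proof (rule Lim_null_comparison)
        show "\<forall>\<^sub>F n in sequentially. norm (\<Sum>i<Suc (r n). e (r n) i) \<le> C * (CU (r n) w + SC (r n) w)"
        proof (rule eventually_sequentiallyI[of N])
          fix n assume "N \<le> n"
          then have "N \<le> r n" using seq_suble[OF r(1), of n] by simp
          from ebound[OF this] show "norm (\<Sum>i<Suc (r n). e (r n) i) \<le> C * (CU (r n) w + SC (r n) w)" by simp
        qed
        show "(\<lambda>n. C * (CU (r n) w + SC (r n) w)) \<longlonglongrightarrow> 0"
          using tendsto_mult_right_zero[OF tendsto_add_zero[OF lims(3,4)]] .
      qed
      from tendsto_diff[OF tendsto_add[OF tendsto_add[OF tendsto_const[of \<Delta>] tendsto_divide[OF lims(2) tendsto_const[of 2]]] tendsto_divide[OF lims(1) tendsto_const[of a]]] this]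
      have "(\<lambda>n. dens_sum (kap a b) s t (Suc (r n)) (Suc (r n)) w) \<longlonglongrightarrow> \<Delta>"
        unfolding dens using ab by simp
      then have "(\<lambda>n. Y a s w * exp (dens_sum (kap a b) s t (Suc (r n)) (Suc (r n)) w)) \<longlonglongrightarrow> Y a s w * exp \<Delta>"
        by (intro tendsto_intros)
      also have "Y a s w * exp \<Delta> = Y a t w"
      proof -
        have pos: "0 < a - \<bar>coord t w\<bar>" "0 < a - \<bar>coord s w\<bar>" using le[of t] le[of s] st ab by auto
        have "exp \<Delta> = (a - \<bar>coord t w\<bar>) / (a - \<bar>coord s w\<bar>) * (exp (L t w / a) / exp (L s w / a))"
          unfolding \<Delta>_def diff_divide_distrib[of "L t w"] exp_add exp_diff
          by (simp only: exp_ln[OF pos(1)] exp_ln[OF pos(2)])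
        moreover have "Y a u w = (a - \<bar>coord u w\<bar>) / a * exp (L u w / a)" for u
          unfolding Y_def using ab by (simp add: diff_divide_distrib)
        moreover have "(x / a * y) * (z / x * (w / y)) = z / a * w" if "x \<noteq> 0" "y \<noteq> 0" for x y z w :: real
          using that by simp
        ultimately show ?thesis using pos by (metis exp_not_eq_zero less_irrefl)
      qed
      finally have 1: "(\<lambda>n. Y a s w * exp (dens_sum (kap a b) s t (Suc (r n)) (Suc (r n)) w)) \<longlonglongrightarrow> Y a t w" .
      have "(\<lambda>n. \<Sum>i<Suc n. kap a b (coord (grid s t (Suc n) i) w) * ((t - s) / real (Suc n))) \<longlonglongrightarrow> drift a s t w"
        by (rule drift_riemann[OF w st ab(2)]) (use le st elim in auto)
      from LIMSEQ_subseq_LIMSEQ[OF this r(1)]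
      have "(\<lambda>n. \<Sum>i<Suc (r n). kap a b (coord (grid s t (Suc (r n)) i) w) * ((t - s) / real (Suc (r n)))) \<longlonglongrightarrow> drift a s t w"
        by (simp only: o_def)
      from tendsto_add[OF tendsto_const[of "coord t w - coord s w"] this]
      have 2: "(\<lambda>n. drift_sum (kap a b) s t (Suc (r n)) (Suc (r n)) w) \<longlonglongrightarrow> coord t w - coord s w + drift a s t w"
      proof -
        have "drift_sum (kap a b) s t (Suc n) (Suc n) w = (coord t w - coord s w) + (\<Sum>i<Suc n. kap a b (coord (grid s t (Suc n) i) w) * ((t - s) / real (Suc n)))" for n
        proof -
          have "(\<Sum>i<Suc n. coord (grid s t (Suc n) (Suc i)) w - coord (grid s t (Suc n) i) w) = coord t w - coord s w"
            by (subst sum_lessThan_telescope) simp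
          then show ?thesis unfolding drift_sum_def sum.distrib by simp
        qed
        then show ?thesis using \<open>(\<lambda>n. coord t w - coord s w + _ n) \<longlonglongrightarrow> _\<close> by (simp only:)
      qed
      from 1 2 show "(\<lambda>n. Y a s w * exp (dens_sum (kap a b) s t (Suc (r n)) (Suc (r n)) w)) \<longlonglongrightarrow> Y a t w \<and>
        (\<lambda>n. drift_sum (kap a b) s t (Suc (r n)) (Suc (r n)) w) \<longlonglongrightarrow> coord t w - coord s w + drift a s t w" by simp
      qed
    qed
  qed
qed

end

lemma fraction_tendsto: "(\<lambda>k. a * (real (Suc k) / real (Suc (Suc k)))) \<longlonglongrightarrow> a"
proof -
  have eq: "a * (real (Suc k) / real (Suc (Suc k))) = a - a * inverse (real (Suc (Suc k)))" for k
    by (simp add: field_simps)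
  have "(\<lambda>k. inverse (real (Suc (Suc k)))) \<longlonglongrightarrow> 0"
    by (rule LIMSEQ_Suc[OF LIMSEQ_inverse_real_of_nat])
  from tendsto_diff[OF tendsto_const[of a] tendsto_mult_right_zero[OF this, of a]]
  show ?thesis unfolding eq by simp
qed

lemma integrable_indicator_times:
  fixes f :: "'a \<Rightarrow> real"
  shows "A \<in> sets M \<Longrightarrow> integrable M f \<Longrightarrow> integrable M (\<lambda>x. indicator A x * f x)"
  using integrable_real_mult_indicator[of A M f] by (simp add: mult.commute)

section \<open>Lost mass and the martingale property at a fixed level\<close>

context local_time
begin

abbreviation Z :: "real \<Rightarrow> real \<Rightarrow> real \<Rightarrow> path \<Rightarrow> real" where
  "Z a b t w \<equiv> if run_max t w < b then Y a t w else 0"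

text \<open>Killed when the running maximum reaches a. The boundary is strict here, whereas
  \<open>density_process\<close> includes a = run_max; the strict form makes the density vanish once
  the level has been reached.\<close>

definition M :: "real \<Rightarrow> real \<Rightarrow> path \<Rightarrow> real" where
  "M a t w = Z a a t w"

lemma M_measurable_filt: "0 \<le> s \<Longrightarrow> s \<le> t \<Longrightarrow> M a s \<in> borel_measurable (\<F> t)"
proof -
  assume "0 \<le> s" "s \<le> t"
  then have [measurable]: "run_max s \<in> borel_measurable (\<F> t)" "Y a s \<in> borel_measurable (\<F> t)"
    by (auto intro: Y_measurable_filt measurable_canon_filt_mono[OF _ measurable_run_max])
  show ?thesis unfolding M_def[abs_def] by measurable
qed

lemma Y_pos: "0 < a \<Longrightarrow> w \<in> path_space \<Longrightarrow> 0 \<le> t \<Longrightarrow> run_max t w \<le> a \<Longrightarrow> 0 \<le> Y a t w"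
  using abs_coord_le_run_max[of w t t] by (simp add: Y_def)

lemma Y_le: "0 < a \<Longrightarrow> L t w \<le> K \<Longrightarrow> 0 \<le> Y a t w \<Longrightarrow> Y a t w \<le> exp (K / a)"
proof -
  assume a: "0 < a" and K: "L t w \<le> K"
  have "Y a t w \<le> 1 * exp (L t w / a)" unfolding Y_def using a by (intro mult_right_mono) auto
  also have "\<dots> \<le> exp (K / a)" using a K by (simp add: divide_right_mono)
  finally show ?thesis .
qed

lemma M_nonneg: "0 < a \<Longrightarrow> w \<in> path_space \<Longrightarrow> 0 \<le> t \<Longrightarrow> 0 \<le> M a t w"
  by (simp add: M_def Y_pos)

lemma drift_measurable_filt: "0 \<le> s \<Longrightarrow> s \<le> t \<Longrightarrow> drift a s t \<in> borel_measurable (\<F> t)"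
proof -
  assume "0 \<le> s" "s \<le> t"
  have "(\<lambda>w. (w, a)) \<in> measurable (\<F> t) (\<F> t \<Otimes>\<^sub>M borel)" by measurable
  from measurable_compose[OF this drift_measurable[OF \<open>0 \<le> s\<close> \<open>s \<le> t\<close>]] show ?thesis by simp
qed

text \<open>Comparing the exact discrete identity with its limit on \<open>{run_max t < b}\<close>: the whole error is
  the mass lost on the complement, which does not depend on \<open>u\<close>.\<close>

lemma martingale_defect:
  assumes st: "0 \<le> s" "s < t" and ab: "0 < b" "b < a" and \<Gamma>: "\<Gamma> \<in> sets (\<F> s)"
    and sub: "\<And>w. w \<in> \<Gamma> \<Longrightarrow> run_max s w < b \<and> L s w \<le> K"
  shows "integrable P0 (\<lambda>w. indicator \<Gamma> w * Y a s w)"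
    and "integrable P0 (\<lambda>w. indicator \<Gamma> w * Z a b t w)"
    and "norm (of_real (exp (- u\<^sup>2 * (t - s) / 2) * (\<integral>w. indicator \<Gamma> w * Y a s w \<partial>P0)) -
       (CLINT w|P0. of_real (indicator \<Gamma> w * Z a b t w) * iexp (u * (coord t w - coord s w + drift a s t w))))
     \<le> (\<integral>w. indicator \<Gamma> w * Y a s w \<partial>P0) - (\<integral>w. indicator \<Gamma> w * Z a b t w \<partial>P0)"
proof -
  obtain r where r: "strict_mono r" "AE w in P0. girsanov_conv a b s t r w"
    by (rule girsanov_limit[OF st ab])
  have t0: "0 \<le> t" and a0: "0 < a" using st ab by auto
  define K' where "K' = 1 / (a - b)"
  define E where "E n = exp \<circ> dens_sum (kap a b) s t (Suc (r n)) (Suc (r n))" for n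
  define D where "D n = drift_sum (kap a b) s t (Suc (r n)) (Suc (r n))" for n
  define \<Theta> where "\<Theta> w = coord t w - coord s w + drift a s t w" for w
  define W where "W w = indicator \<Gamma> w * Y a s w" for w
  define g where "g w = indicator \<Gamma> w * Z a b t w" for w
  define f where "f n w = W w * E n w" for n w
  \<comment> \<open>The discrete densities restricted to the event on which they converge; f n
    without the restriction still has exactly the mass of W.\<close>
  define gn where "gn n w = (if run_max t w < b then f n w else 0)" for n w
  have [measurable]: "\<Gamma> \<in> sets P0" using \<Gamma> sets_G_subset[OF st(1)] by blast
  have [measurable]: "Y a s \<in> borel_measurable P0" "Y a t \<in> borel_measurable P0" "run_max t \<in> borel_measurable P0"
    "drift a s t \<in> borel_measurable P0" "coord s \<in> borel_measurable P0" "coord t \<in> borel_measurable P0"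
    using measurable_G_P[OF st(1) Y_measurable_filt[OF st(1) order_refl]] measurable_G_P[OF t0 Y_measurable_filt[OF t0 order_refl]]
      measurable_G_P[OF t0 measurable_run_max[OF t0]] measurable_G_P[OF t0 drift_measurable_filt[of s t a]] st t0
    by auto
  have gr: "grid s t (Suc n) (Suc n) = t" for n by simp
  have [measurable]: "E n \<in> borel_measurable P0" and Dm [measurable]: "D n \<in> borel_measurable P0" for n
    using measurable_G_P[OF t0 dens_sum_measurable[OF kap_measurable kap_bound[OF ab(2)] st, of "Suc (r n)" "Suc (r n)", unfolded gr]]
      measurable_G_P[OF t0 drift_sum_measurable[OF kap_measurable kap_bound[OF ab(2)] st, of "Suc (r n)" "Suc (r n)", unfolded gr]]
    unfolding E_def D_def by auto
  have Wfilt: "W \<in> borel_measurable (\<F> s)"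
    unfolding W_def using \<Gamma> Y_measurable_filt[OF st(1) order_refl, of a] by measurable
  have Wm [measurable]: "W \<in> borel_measurable P0" by (rule measurable_G_P[OF st(1) Wfilt])
  have W: "0 \<le> W w" "W w \<le> exp (K / a)" if "w \<in> path_space" for w
  proof -
    have "0 \<le> Y a s w \<and> Y a s w \<le> exp (K / a)" if "w \<in> \<Gamma>"
      using sub[OF that] Y_pos[OF a0 \<open>w \<in> path_space\<close> st(1)] Y_le[OF a0, of s w K] ab by auto
    then show "0 \<le> W w" "W w \<le> exp (K / a)" unfolding W_def by (auto split: split_indicator)
  qed
  have Wi: "integrable P0 W"
    by (rule integrable_const_bound[of _ "exp (K / a)"]) (use W in auto)
  then show "integrable P0 (\<lambda>w. indicator \<Gamma> w * Y a s w)" unfolding W_def .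
  define c where "c = exp (K / a)"
  have fn0: "0 \<le> f n w" if "w \<in> path_space" for n w unfolding f_def E_def using W(1)[OF that] by simp
  have [measurable]: "f n \<in> borel_measurable P0" "gn n \<in> borel_measurable P0" "g \<in> borel_measurable P0" "\<Theta> \<in> borel_measurable P0" for n
    unfolding f_def[abs_def] gn_def[abs_def] g_def[abs_def] \<Theta>_def[abs_def] by measurable
  \<comment> \<open>The cut-off kernel is bounded by K', so the second moments are bounded in n;
    with almost sure convergence this yields convergence of gn in L^1.\<close>
  have sq: "(\<integral>\<^sup>+w. ennreal ((f n w)\<^sup>2) \<partial>P0) \<le> ennreal (exp (K'\<^sup>2 * (t - s)) * c\<^sup>2)" for n
  proof -
    have "(\<integral>\<^sup>+w. ennreal ((f n w)\<^sup>2) \<partial>P0) \<le> ennreal (exp (K'\<^sup>2 * (real (Suc (r n)) * ((t - s) / real (Suc (r n)))))) * (\<integral>\<^sup>+w. ennreal ((W w)\<^sup>2) \<partial>P0)"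
      unfolding f_def E_def o_def K'_def
      by (rule discrete_girsanov_square[OF kap_measurable kap_bound[OF ab(2)] st _ Wfilt]) simp
    also have "real (Suc (r n)) * ((t - s) / real (Suc (r n))) = t - s" by simp
    also have "ennreal (exp (K'\<^sup>2 * (t - s))) * (\<integral>\<^sup>+w. ennreal ((W w)\<^sup>2) \<partial>P0) \<le> ennreal (exp (K'\<^sup>2 * (t - s))) * (\<integral>\<^sup>+w. ennreal (c\<^sup>2) \<partial>P0)"
      unfolding c_def using W by (intro mult_left_mono nn_integral_mono ennreal_leI power_mono) auto
    also have "\<dots> = ennreal (exp (K'\<^sup>2 * (t - s)) * c\<^sup>2)"
      using emeasure_space_1 by (simp add: ennreal_mult)
    finally show ?thesis .
  qed
  have sqg: "(\<integral>\<^sup>+w. ennreal ((gn n w)\<^sup>2) \<partial>P0) \<le> ennreal (exp (K'\<^sup>2 * (t - s)) * c\<^sup>2)" for n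
    by (rule order_trans[OF nn_integral_mono sq[of n]]) (auto simp: gn_def)
  have gl: "AE w in P0. (\<lambda>n. gn n w) \<longlonglongrightarrow> g w"
    using r(2)
  proof eventually_elim
    case (elim w)
    show ?case
    proof (cases "run_max t w < b")
      case True
      have "(\<lambda>n. indicator \<Gamma> w * (Y a s w * E n w)) \<longlonglongrightarrow> indicator \<Gamma> w * Y a t w"
        using elim True unfolding E_def o_def by (intro tendsto_mult_left) blast
      then show ?thesis using True by (simp add: gn_def f_def W_def g_def mult.assoc)
    qed (simp add: gn_def g_def)
  qed
  note conv = L1_convergence_of_L2_bounded[OF _ _ sqg _ gl]
  have gi: "integrable P0 g" and gni: "integrable P0 (gn n)" and L1: "(\<lambda>n. \<integral>w. \<bar>gn n w - g w\<bar> \<partial>P0) \<longlonglongrightarrow> 0" for n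
    by (rule conv; simp)+
  then show "integrable P0 (\<lambda>w. indicator \<Gamma> w * Z a b t w)" unfolding g_def by simp
  have girs: "complex_integrable P0 (\<lambda>w. of_real (f n w) * iexp (v * D n w))"
     "(CLINT w|P0. of_real (f n w) * iexp (v * D n w)) = of_real (exp (- v\<^sup>2 * (t - s) / 2) * (\<integral>w. W w \<partial>P0))" for n v
  proof -
    have cW: "(\<lambda>w. complex_of_real (W w)) \<in> borel_measurable (\<F> s)" "complex_integrable P0 (\<lambda>w. complex_of_real (W w))"
      using Wfilt Wi by auto
    have eq: "complex_of_real (W w) * (iexp (v * D n w) * of_real (E n w)) = of_real (f n w) * iexp (v * D n w)" for w
      by (simp add: f_def)
    have G': "integrable P0 (\<lambda>w. complex_of_real (W w) * (iexp (v * D n w) * of_real (E n w)))"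
      "(CLINT w|P0. complex_of_real (W w) * (iexp (v * D n w) * of_real (E n w))) = of_real (exp (- v\<^sup>2 * (t - s) / 2)) * (CLINT w|P0. complex_of_real (W w))"
      using discrete_girsanov[OF kap_measurable kap_bound[OF ab(2)] st _ cW, of "Suc (r n)" v "Suc (r n)"]
      unfolding D_def E_def o_def by auto
    from G' show "complex_integrable P0 (\<lambda>w. of_real (f n w) * iexp (v * D n w))"
      "(CLINT w|P0. of_real (f n w) * iexp (v * D n w)) = of_real (exp (- v\<^sup>2 * (t - s) / 2) * (\<integral>w. W w \<partial>P0))"
      unfolding eq by simp_all
  qed
  have fi: "integrable P0 (f n)" and fint: "(\<integral>w. f n w \<partial>P0) = (\<integral>w. W w \<partial>P0)" for n
  proof -
    have "complex_integrable P0 (\<lambda>w. of_real (f n w))" using girs(1)[of n 0] by simp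
    then show "integrable P0 (f n)" by (simp add: complex_of_real_integrable_eq)
    have "of_real (\<integral>w. f n w \<partial>P0) = (of_real (\<integral>w. W w \<partial>P0) :: complex)" using girs(2)[of n 0] by simp
    then show "(\<integral>w. f n w \<partial>P0) = (\<integral>w. W w \<partial>P0)" by (simp only: of_real_eq_iff)
  qed
  let ?c = "complex_of_real (exp (- u\<^sup>2 * (t - s) / 2) * (\<integral>w. W w \<partial>P0))"
  have ci: "complex_integrable P0 (\<lambda>w. of_real (F w) * iexp (u * H w))" if [measurable]: "integrable P0 F" "H \<in> borel_measurable P0" for F H
  proof (rule Bochner_Integration.integrable_bound)
    show "integrable P0 F" by fact
    show "(\<lambda>w. complex_of_real (F w) * iexp (u * H w)) \<in> borel_measurable P0" by measurable
  qed (simp add: norm_mult)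
  \<comment> \<open>f n and gn n differ by the nonnegative part of f n outside {run_max t < b}.
    Characters have modulus 1, so the integral of this part bounds the error for every u.\<close>
  have step: "norm (?c - (CLINT w|P0. of_real (gn n w) * iexp (u * D n w))) \<le> (\<integral>w. W w \<partial>P0) - (\<integral>w. gn n w \<partial>P0)" for n
  proof -
    have "?c - (CLINT w|P0. of_real (gn n w) * iexp (u * D n w)) = (CLINT w|P0. of_real (f n w - gn n w) * iexp (u * D n w))"
      unfolding girs(2)[of n u, symmetric] of_real_diff left_diff_distrib
      by (rule Bochner_Integration.integral_diff[symmetric]) (rule ci[OF fi Dm] ci[OF gni Dm])+
    also have "norm \<dots> \<le> (\<integral>w. norm (of_real (f n w - gn n w) * iexp (u * D n w)) \<partial>P0)"
      by (rule integral_norm_bound)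
    also have "\<dots> = (\<integral>w. f n w - gn n w \<partial>P0)"
      using fn0 by (intro Bochner_Integration.integral_cong) (auto simp: norm_mult gn_def)
    also have "\<dots> = (\<integral>w. W w \<partial>P0) - (\<integral>w. gn n w \<partial>P0)"
      using fi gni fint by simp
    finally show ?thesis .
  qed
  have lim1: "(\<lambda>n. \<integral>w. gn n w \<partial>P0) \<longlonglongrightarrow> (\<integral>w. g w \<partial>P0)"
  proof (rule LIM_zero_cancel, rule Lim_null_comparison[OF _ L1], rule always_eventually, rule allI)
    fix n
    have "(\<integral>w. gn n w \<partial>P0) - (\<integral>w. g w \<partial>P0) = (\<integral>w. gn n w - g w \<partial>P0)" using gni gi by simp
    then show "norm ((\<integral>w. gn n w \<partial>P0) - (\<integral>w. g w \<partial>P0)) \<le> (\<integral>w. \<bar>gn n w - g w\<bar> \<partial>P0)"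
      using integral_norm_bound[of P0 "\<lambda>w. gn n w - g w"] by simp
  qed
  have lim2: "(\<lambda>n. CLINT w|P0. of_real (gn n w) * iexp (u * D n w)) \<longlonglongrightarrow> (CLINT w|P0. of_real (g w) * iexp (u * \<Theta> w))"
  proof -
    have a: "(\<lambda>n. CLINT w|P0. of_real (g w) * iexp (u * D n w)) \<longlonglongrightarrow> (CLINT w|P0. of_real (g w) * iexp (u * \<Theta> w))"
    proof (rule integral_dominated_convergence[where w="\<lambda>w. \<bar>g w\<bar>"])
      show "AE w in P0. (\<lambda>n. complex_of_real (g w) * iexp (u * D n w)) \<longlonglongrightarrow> of_real (g w) * iexp (u * \<Theta> w)"
        using r(2)
      proof eventually_elim
        case (elim w)
        show ?case
        proof (cases "run_max t w < b")
          case True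
          then have "(\<lambda>n. D n w) \<longlonglongrightarrow> \<Theta> w" using elim unfolding D_def \<Theta>_def by blast
          then show ?thesis by (intro tendsto_intros)
        qed (simp add: g_def)
      qed
    qed (use gi in \<open>auto simp: norm_mult\<close>)
    have b: "(\<lambda>n. (CLINT w|P0. of_real (gn n w) * iexp (u * D n w)) - (CLINT w|P0. of_real (g w) * iexp (u * D n w))) \<longlonglongrightarrow> 0"
    proof (rule Lim_null_comparison[OF _ L1], rule always_eventually, rule allI)
      fix n
      have "(CLINT w|P0. of_real (gn n w) * iexp (u * D n w)) - (CLINT w|P0. of_real (g w) * iexp (u * D n w)) =
        (CLINT w|P0. of_real (gn n w - g w) * iexp (u * D n w))"
        unfolding of_real_diff left_diff_distrib
        by (rule Bochner_Integration.integral_diff[symmetric]) (rule ci[OF gni Dm] ci[OF gi Dm])+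
      also have "norm \<dots> \<le> (\<integral>w. norm (of_real (gn n w - g w) * iexp (u * D n w)) \<partial>P0)"
        by (rule integral_norm_bound)
      also have "\<dots> = (\<integral>w. \<bar>gn n w - g w\<bar> \<partial>P0)" by (simp add: norm_mult del: of_real_diff)
      finally show "norm ((CLINT w|P0. of_real (gn n w) * iexp (u * D n w)) - (CLINT w|P0. of_real (g w) * iexp (u * D n w))) \<le> (\<integral>w. \<bar>gn n w - g w\<bar> \<partial>P0)" .
    qed
    from tendsto_add[OF b a] show ?thesis by simp
  qed
  have "norm (?c - (CLINT w|P0. of_real (g w) * iexp (u * \<Theta> w))) \<le> (\<integral>w. W w \<partial>P0) - (\<integral>w. g w \<partial>P0)"
  proof (rule LIMSEQ_le)
    show "(\<lambda>n. norm (?c - (CLINT w|P0. of_real (gn n w) * iexp (u * D n w)))) \<longlonglongrightarrow> norm (?c - (CLINT w|P0. of_real (g w) * iexp (u * \<Theta> w)))"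
      by (intro tendsto_norm tendsto_diff tendsto_const lim2)
    show "(\<lambda>n. (\<integral>w. W w \<partial>P0) - (\<integral>w. gn n w \<partial>P0)) \<longlonglongrightarrow> (\<integral>w. W w \<partial>P0) - (\<integral>w. g w \<partial>P0)"
      by (intro tendsto_diff tendsto_const lim1)
  qed (use step in auto)
  then show "norm (of_real (exp (- u\<^sup>2 * (t - s) / 2) * (\<integral>w. indicator \<Gamma> w * Y a s w \<partial>P0)) -
       (CLINT w|P0. of_real (indicator \<Gamma> w * Z a b t w) * iexp (u * (coord t w - coord s w + drift a s t w))))
     \<le> (\<integral>w. indicator \<Gamma> w * Y a s w \<partial>P0) - (\<integral>w. indicator \<Gamma> w * Z a b t w \<partial>P0)"
    unfolding W_def g_def \<Theta>_def .
qed

text \<open>Cut-offs rising strictly from a / 2 to a: all of them positive and below a, as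
  \<open>martingale_defect\<close> requires of b.\<close>

definition level :: "real \<Rightarrow> nat \<Rightarrow> real" where "level a k = a * (real (Suc k) / real (Suc (Suc k)))"

lemma level: "0 < a \<Longrightarrow> 0 < level a k" "0 < a \<Longrightarrow> level a k < a" "level a \<longlonglongrightarrow> a"
proof -
  show "0 < a \<Longrightarrow> 0 < level a k" unfolding level_def by (intro mult_pos_pos divide_pos_pos) auto
  show "0 < a \<Longrightarrow> level a k < a" by (simp add: level_def field_simps)
  show "level a \<longlonglongrightarrow> a" unfolding level_def[abs_def] by (rule fraction_tendsto)
qed

text \<open>Makes Y a s bounded on the truncated event, by exp(k / a), while exhausting the part of
  \<Gamma> where the running maximum is below a.\<close>

definition trunc :: "real \<Rightarrow> real \<Rightarrow> path set \<Rightarrow> nat \<Rightarrow> path set" where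
  "trunc a s \<Gamma> k = {w \<in> \<Gamma>. run_max s w < level a k \<and> L s w \<le> real k}"

lemma trunc_sets:
  assumes s: "0 \<le> s" and \<Gamma>: "\<Gamma> \<in> sets (\<F> s)"
  shows "trunc a s \<Gamma> k \<in> sets (\<F> s)"
proof -
  have [measurable]: "\<Gamma> \<in> sets (\<F> s)" "run_max s \<in> borel_measurable (\<F> s)" "L s \<in> borel_measurable (\<F> s)"
    using assms measurable_run_max L_measurable_filt by auto
  have "trunc a s \<Gamma> k = {w \<in> space (\<F> s). w \<in> \<Gamma> \<and> run_max s w < level a k \<and> L s w \<le> real k}"
    using sets.sets_into_space[OF \<Gamma>] by (auto simp: trunc_def)
  also have "\<dots> \<in> sets (\<F> s)" by measurable
  finally show ?thesis .
qed

text \<open>For each path both sequences are eventually constant in k and dominated by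
  \<open>M\<close>: the preparation for dominated convergence in k.\<close>

lemma trunc_limits:
  assumes a: "0 < a" and w: "w \<in> path_space" and st: "0 \<le> s" "s \<le> t"
  shows "(\<lambda>k. indicator (trunc a s \<Gamma> k) w * Y a s w) \<longlonglongrightarrow> indicator \<Gamma> w * M a s w"
    and "(\<lambda>k. indicator (trunc a s \<Gamma> k) w * Z a (level a k) t w) \<longlonglongrightarrow> indicator \<Gamma> w * M a t w"
    and "\<bar>indicator (trunc a s \<Gamma> k) w * Y a s w\<bar> \<le> M a s w"
    and "\<bar>indicator (trunc a s \<Gamma> k) w * Z a (level a k) t w\<bar> \<le> M a t w"
proof -
  have t: "0 \<le> t" using st by simp
  have ev: "\<forall>\<^sub>F k in sequentially. x < level a k" if "x < a" for x
    using order_tendstoD(1)[OF level(3)[of a] that] .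
  have evL: "\<forall>\<^sub>F k in sequentially. L s w \<le> real k"
  proof -
    obtain n :: nat where "L s w \<le> real n" using real_arch_simple by blast
    then show ?thesis by (intro eventually_sequentiallyI[of n]) auto
  qed
  note mono = run_max_mono[OF w st]
  show "(\<lambda>k. indicator (trunc a s \<Gamma> k) w * Y a s w) \<longlonglongrightarrow> indicator \<Gamma> w * M a s w"
  proof (cases "run_max s w < a")
    case True
    have "\<forall>\<^sub>F k in sequentially. indicator (trunc a s \<Gamma> k) w * Y a s w = indicator \<Gamma> w * M a s w"
      using ev[OF True] evL by eventually_elim (use True in \<open>auto simp: trunc_def M_def split: split_indicator\<close>)
    then show ?thesis by (rule tendsto_eventually)
  next
    case False
    then have "indicator (trunc a s \<Gamma> k) w * Y a s w = indicator \<Gamma> w * M a s w" for k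
      using level(2)[OF a, of k] by (auto simp: trunc_def M_def split: split_indicator)
    then show ?thesis by (simp only: tendsto_const)
  qed
  show "(\<lambda>k. indicator (trunc a s \<Gamma> k) w * Z a (level a k) t w) \<longlonglongrightarrow> indicator \<Gamma> w * M a t w"
  proof (cases "run_max t w < a")
    case True
    have "\<forall>\<^sub>F k in sequentially. indicator (trunc a s \<Gamma> k) w * Z a (level a k) t w = indicator \<Gamma> w * M a t w"
      using ev[OF True] evL by eventually_elim (use True mono in \<open>auto simp: trunc_def M_def split: split_indicator\<close>)
    then show ?thesis by (rule tendsto_eventually)
  next
    case False
    then have "Z a (level a k) t w = 0" "M a t w = 0" for k
      using level(2)[OF a, of k] by (auto simp: M_def)
    then show ?thesis by simp
  qed
  show "\<bar>indicator (trunc a s \<Gamma> k) w * Y a s w\<bar> \<le> M a s w"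
    using M_nonneg[OF a w st(1)] level(2)[OF a, of k] by (auto simp: trunc_def M_def split: split_indicator if_splits)
  show "\<bar>indicator (trunc a s \<Gamma> k) w * Z a (level a k) t w\<bar> \<le> M a t w"
    using M_nonneg[OF a w t] level(2)[OF a, of k] by (auto simp: trunc_def M_def split: split_indicator if_splits)
qed

lemma trunc_defect:
  assumes st: "0 \<le> s" "s < t" and a: "0 < a" and \<Gamma>: "\<Gamma> \<in> sets (\<F> s)"
  shows "integrable P0 (\<lambda>w. indicator (trunc a s \<Gamma> k) w * Y a s w)"
    and "integrable P0 (\<lambda>w. indicator (trunc a s \<Gamma> k) w * Z a (level a k) t w)"
    and "norm (of_real (exp (- u\<^sup>2 * (t - s) / 2) * (\<integral>w. indicator (trunc a s \<Gamma> k) w * Y a s w \<partial>P0)) -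
       (CLINT w|P0. of_real (indicator (trunc a s \<Gamma> k) w * Z a (level a k) t w) * iexp (u * (coord t w - coord s w + drift a s t w))))
     \<le> (\<integral>w. indicator (trunc a s \<Gamma> k) w * Y a s w \<partial>P0) - (\<integral>w. indicator (trunc a s \<Gamma> k) w * Z a (level a k) t w \<partial>P0)"
  by (rule martingale_defect[OF st level(1,2)[OF a] trunc_sets[OF st(1) \<Gamma>]]; auto simp: trunc_def)+

lemma M_zero: "0 < a \<Longrightarrow> AE w in P0. M a 0 w = 1 \<and> L 0 w = 0 \<and> run_max 0 w = 0"
  using B_zero L_regular
proof eventually_elim
  case (elim w)
  then show ?case by (simp add: M_def Y_def run_max_def)
qed

text \<open>The defect inequality from time 0, where Y is 1 almost surely: its left side is a norm,
  so the truncated masses are at most 1, and Fatou removes the truncation. The case t = 0 is apart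
  because that inequality needs s < t.\<close>

lemma M_expectation_le:
  assumes a: "0 < a" and t: "0 \<le> t"
  shows "(\<integral>\<^sup>+w. ennreal (M a t w) \<partial>P0) \<le> 1"
proof (cases "t = 0")
  case True
  have "(\<integral>\<^sup>+w. ennreal (M a t w) \<partial>P0) = (\<integral>\<^sup>+w. 1 \<partial>P0)"
    unfolding True by (intro nn_integral_cong_AE) (use M_zero[OF a] in \<open>auto elim: eventually_mono\<close>)
  then show ?thesis using emeasure_space_1 by simp
next
  case False
  with t have t: "0 < t" by simp
  let ?\<Gamma> = "path_space"
  have \<Gamma>: "?\<Gamma> \<in> sets (\<F> 0)" using sets.top[of "\<F> 0"] by simp
  note D = trunc_defect[OF order_refl t a \<Gamma>]
  let ?g = "\<lambda>k w. indicator (trunc a 0 ?\<Gamma> k) w * Z a (level a k) t w"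
  have one: "(\<integral>w. indicator (trunc a 0 ?\<Gamma> k) w * Y a 0 w \<partial>P0) = 1" for k
  proof -
    have "(\<integral>w. indicator (trunc a 0 ?\<Gamma> k) w * Y a 0 w \<partial>P0) = (\<integral>w. 1 \<partial>P0)"
    proof (rule integral_cong_AE)
      show "AE w in P0. indicator (trunc a 0 ?\<Gamma> k) w * Y a 0 w = 1"
        using M_zero[OF a] AE_space
      proof eventually_elim
        case (elim w)
        then have "run_max 0 w < a" using a by simp
        then have "M a 0 w = Y a 0 w" by (simp add: M_def)
        then show ?case using elim level(1)[OF a, of k] by (simp add: trunc_def)
      qed
    qed (use D(1) in auto)
    then show ?thesis using prob_space by simp
  qed
  have le: "(\<integral>w. ?g k w \<partial>P0) \<le> 1" for k
  proof -
    have "0 \<le> (\<integral>w. indicator (trunc a 0 ?\<Gamma> k) w * Y a 0 w \<partial>P0) - (\<integral>w. ?g k w \<partial>P0)"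
      using order_trans[OF norm_ge_zero D(3)[of 0 k]] .
    then show ?thesis unfolding one by simp
  qed
  have nn: "0 \<le> ?g k w" if "w \<in> path_space" for k w
    using Y_pos[OF a that, of t] t level(2)[OF a, of k] by (auto split: split_indicator)
  have "(\<integral>\<^sup>+w. ennreal (M a t w) \<partial>P0) = (\<integral>\<^sup>+w. liminf (\<lambda>k. ennreal (?g k w)) \<partial>P0)"
  proof (rule nn_integral_cong)
    fix w assume "w \<in> space P0"
    then have w: "w \<in> path_space" by simp
    have "(\<lambda>k. ennreal (?g k w)) \<longlonglongrightarrow> ennreal (indicator ?\<Gamma> w * M a t w)"
      by (intro tendsto_ennrealI trunc_limits(2) a w) (use t in auto)
    from lim_imp_Liminf[OF _ this] w show "ennreal (M a t w) = liminf (\<lambda>k. ennreal (?g k w))" by simp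
  qed
  also have "\<dots> \<le> liminf (\<lambda>k. \<integral>\<^sup>+w. ennreal (?g k w) \<partial>P0)"
    by (rule nn_integral_liminf) (use D(2) in \<open>auto dest: borel_measurable_integrable\<close>)
  also have "\<dots> \<le> 1"
  proof (rule Liminf_le)
    show "\<forall>\<^sub>F k in sequentially. (\<integral>\<^sup>+w. ennreal (?g k w) \<partial>P0) \<le> 1"
    proof (rule always_eventually, rule allI)
      fix k
      have "(\<integral>\<^sup>+w. ennreal (?g k w) \<partial>P0) = ennreal (\<integral>w. ?g k w \<partial>P0)"
        by (intro nn_integral_eq_integral D(2) AE_I2 nn) simp
      also have "\<dots> \<le> 1" using le[of k] by (simp add: ennreal_le_1)
      finally show "(\<integral>\<^sup>+w. ennreal (?g k w) \<partial>P0) \<le> 1" .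
    qed
  qed simp
  finally show ?thesis .
qed

lemma M_integrable: "0 < a \<Longrightarrow> 0 \<le> t \<Longrightarrow> integrable P0 (M a t)"
proof (rule integrableI_bounded)
  assume a: "0 < a" and t: "0 \<le> t"
  show "M a t \<in> borel_measurable P0" by (rule measurable_G_P[OF t M_measurable_filt[OF t order_refl]])
  have "(\<integral>\<^sup>+w. ennreal (norm (M a t w)) \<partial>P0) = (\<integral>\<^sup>+w. ennreal (M a t w) \<partial>P0)"
    using M_nonneg[OF a _ t] by (intro nn_integral_cong) auto
  also have "\<dots> < \<infinity>" using le_less_trans[OF M_expectation_le[OF a t]] by simp
  finally show "(\<integral>\<^sup>+w. ennreal (norm (M a t w)) \<partial>P0) < \<infinity>" .
qed

text \<open>No loss of total mass forces the martingale property, and then the Girsanov identity.\<close>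

theorem M_girsanov:
  assumes st: "0 \<le> s" "s \<le> t" and a: "0 < a" and \<Gamma>: "\<Gamma> \<in> sets (\<F> s)"
    and mass: "(\<integral>w. M a t w \<partial>P0) = (\<integral>w. M a s w \<partial>P0)"
  shows "(CLINT w|P0. of_real (indicator \<Gamma> w * M a t w) * iexp (u * (coord t w - coord s w + drift a s t w)))
     = of_real (exp (- u\<^sup>2 * (t - s) / 2) * (\<integral>w. indicator \<Gamma> w * M a s w \<partial>P0))" (is ?A)
    and "(\<integral>w. indicator \<Gamma> w * M a t w \<partial>P0) = (\<integral>w. indicator \<Gamma> w * M a s w \<partial>P0)" (is ?C)
proof -
  have main: "?A \<and> ?C"
  proof (cases "s = t")
    case True
    have "drift a t t w = 0" for w
    proof -
      have "AE r in lborel. r \<noteq> t" by (rule AE_lborel_singleton)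
      then show ?thesis
        unfolding drift_def set_lebesgue_integral_def
        by (intro integral_eq_zero_AE) (rule eventually_mono, assumption, simp)
    qed
    then show ?thesis using True by (simp del: of_real_mult)
  next
    case False
    with st have st': "0 \<le> s" "s < t" by auto
    have t: "0 \<le> t" using st by simp
    note Mi = M_integrable[OF a st(1)] M_integrable[OF a t]
    define \<Theta> where "\<Theta> w = coord t w - coord s w + drift a s t w" for w
    have [measurable]: "drift a s t \<in> borel_measurable P0" "coord s \<in> borel_measurable P0" "coord t \<in> borel_measurable P0"
      using measurable_G_P[OF t drift_measurable_filt[of s t a]] st t by auto
    have [measurable]: "\<Theta> \<in> borel_measurable P0" unfolding \<Theta>_def[abs_def] by measurable
    have ineq: "norm (of_real (exp (- u\<^sup>2 * (t - s) / 2) * (\<integral>w. indicator D w * M a s w \<partial>P0)) -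
         (CLINT w|P0. of_real (indicator D w * M a t w) * iexp (u * \<Theta> w)))
       \<le> (\<integral>w. indicator D w * M a s w \<partial>P0) - (\<integral>w. indicator D w * M a t w \<partial>P0)"
      if D: "D \<in> sets (\<F> s)" for D
    proof -
      note TD = trunc_defect[OF st' a D]
      have [measurable]: "D \<in> sets P0" using D sets_G_subset[OF st(1)] by blast
      have m1: "(\<lambda>w. indicator (trunc a s D k) w * Y a s w) \<in> borel_measurable P0"
        "(\<lambda>w. indicator (trunc a s D k) w * Z a (level a k) t w) \<in> borel_measurable P0" for k
        using TD(1,2)[of k] by (auto dest: borel_measurable_integrable)
      have m2: "(\<lambda>w. indicator D w * M a s w) \<in> borel_measurable P0" "(\<lambda>w. indicator D w * M a t w) \<in> borel_measurable P0"
        using Mi by measurable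
      have l1: "(\<lambda>k. \<integral>w. indicator (trunc a s D k) w * Y a s w \<partial>P0) \<longlonglongrightarrow> (\<integral>w. indicator D w * M a s w \<partial>P0)"
        by (rule integral_dominated_convergence[where w="M a s"])
           (use m1 m2 Mi trunc_limits[OF a _ st] in auto)
      have l2: "(\<lambda>k. \<integral>w. indicator (trunc a s D k) w * Z a (level a k) t w \<partial>P0) \<longlonglongrightarrow> (\<integral>w. indicator D w * M a t w \<partial>P0)"
      proof (rule integral_dominated_convergence[where w="M a t"])
        show "AE w in P0. (\<lambda>k. indicator (trunc a s D k) w * Z a (level a k) t w) \<longlonglongrightarrow> indicator D w * M a t w"
          by (intro AE_I2 trunc_limits(2)[OF a _ st]) simp
        show "AE w in P0. norm (indicator (trunc a s D k) w * Z a (level a k) t w) \<le> M a t w" for k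
          unfolding real_norm_def by (intro AE_I2 trunc_limits(4)[OF a _ st]) simp
      qed (fact m2 m1 Mi)+
      have l3: "(\<lambda>k. CLINT w|P0. of_real (indicator (trunc a s D k) w * Z a (level a k) t w) * iexp (u * \<Theta> w))
          \<longlonglongrightarrow> (CLINT w|P0. of_real (indicator D w * M a t w) * iexp (u * \<Theta> w))"
      proof (rule integral_dominated_convergence[where w="M a t"])
        show "(\<lambda>w. complex_of_real (indicator D w * M a t w) * iexp (u * \<Theta> w)) \<in> borel_measurable P0"
          using m2(2) by measurable
        show "(\<lambda>w. complex_of_real (indicator (trunc a s D k) w * Z a (level a k) t w) * iexp (u * \<Theta> w)) \<in> borel_measurable P0" for k
          using m1(2)[of k] by measurable
        show "AE w in P0. (\<lambda>k. complex_of_real (indicator (trunc a s D k) w * Z a (level a k) t w) * iexp (u * \<Theta> w)) \<longlonglongrightarrow> of_real (indicator D w * M a t w) * iexp (u * \<Theta> w)"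
          by (intro AE_I2 tendsto_mult tendsto_of_real tendsto_const trunc_limits(2)[OF a _ st]) simp
        show "AE w in P0. norm (complex_of_real (indicator (trunc a s D k) w * Z a (level a k) t w) * iexp (u * \<Theta> w)) \<le> M a t w" for k
          unfolding norm_mult norm_of_real norm_exp_i_times using trunc_limits(4)[OF a _ st] by (intro AE_I2) simp
      qed (rule Mi)
      show ?thesis
      proof (rule LIMSEQ_le)
        show "(\<lambda>k. norm (complex_of_real (exp (- u\<^sup>2 * (t - s) / 2) * (\<integral>w. indicator (trunc a s D k) w * Y a s w \<partial>P0)) -
           (CLINT w|P0. of_real (indicator (trunc a s D k) w * Z a (level a k) t w) * iexp (u * \<Theta> w)))) \<longlonglongrightarrow>
           norm (complex_of_real (exp (- u\<^sup>2 * (t - s) / 2) * (\<integral>w. indicator D w * M a s w \<partial>P0)) -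
         (CLINT w|P0. of_real (indicator D w * M a t w) * iexp (u * \<Theta> w)))"
          by (intro tendsto_norm tendsto_diff tendsto_of_real tendsto_mult_left l1 l3)
        from tendsto_diff[OF l1 l2]
        show "(\<lambda>k. (\<integral>w. indicator (trunc a s D k) w * Y a s w \<partial>P0) - (\<integral>w. indicator (trunc a s D k) w * Z a (level a k) t w \<partial>P0))
          \<longlonglongrightarrow> (\<integral>w. indicator D w * M a s w \<partial>P0) - (\<integral>w. indicator D w * M a t w \<partial>P0)" .
      qed (use TD(3)[of u] in \<open>auto simp: \<Theta>_def\<close>)
    qed
    \<comment> \<open>By \<open>ineq\<close> the mass cannot increase on \<Gamma> nor on its
      complement. Their sum is preserved, so neither decreases, and the bound in \<open>ineq\<close>
      becomes 0.\<close>
    define \<Gamma>' where "\<Gamma>' = path_space - \<Gamma>"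
    have \<Gamma>': "\<Gamma>' \<in> sets (\<F> s)" unfolding \<Gamma>'_def using sets.compl_sets[OF \<Gamma>] by simp
    have gt: "(\<integral>w. indicator D w * M a t w \<partial>P0) \<le> (\<integral>w. indicator D w * M a s w \<partial>P0)" if "D \<in> sets (\<F> s)" for D
      using order_trans[OF norm_ge_zero ineq[OF that]] by simp
    have gP [measurable]: "\<Gamma> \<in> sets P0" "\<Gamma>' \<in> sets P0" using \<Gamma> \<Gamma>' sets_G_subset[OF st(1)] by blast+
    have split: "(\<integral>w. F w \<partial>P0) = (\<integral>w. indicator \<Gamma> w * F w \<partial>P0) + (\<integral>w. indicator \<Gamma>' w * F w \<partial>P0)" if F: "integrable P0 F" for F :: "path \<Rightarrow> real"
    proof -
      have "integrable P0 (\<lambda>w. indicator \<Gamma> w * F w)" "integrable P0 (\<lambda>w. indicator \<Gamma>' w * F w)"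
        by (rule integrable_indicator_times[OF _ F], fact)+
      then have "(\<integral>w. indicator \<Gamma> w * F w \<partial>P0) + (\<integral>w. indicator \<Gamma>' w * F w \<partial>P0) = (\<integral>w. indicator \<Gamma> w * F w + indicator \<Gamma>' w * F w \<partial>P0)"
        by simp
      also have "\<dots> = (\<integral>w. F w \<partial>P0)"
        by (intro Bochner_Integration.integral_cong) (auto simp: \<Gamma>'_def split: split_indicator)
      finally show ?thesis by simp
    qed
    have eq: "(\<integral>w. indicator \<Gamma> w * M a t w \<partial>P0) = (\<integral>w. indicator \<Gamma> w * M a s w \<partial>P0)"
      using gt[OF \<Gamma>] gt[OF \<Gamma>'] mass split[OF Mi(1)] split[OF Mi(2)] by linarith
    show ?thesis using ineq[OF \<Gamma>] eq unfolding \<Theta>_def by simp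
  qed
  from main show ?A ?C by auto
qed

end

section \<open>The law of the path together with its total maximum\<close>

locale penalised = local_time P0 L for P0 L +
  fixes \<alpha> :: real and \<nu> :: "real measure" and Q :: "path measure"
  assumes \<alpha>: "0 < \<alpha>"
    and prob_\<nu>: "prob_space \<nu>" and sets_\<nu> [measurable_cong]: "sets \<nu> = sets borel" and \<nu>_ge: "AE a in \<nu>. \<alpha> \<le> a"
    and prob_Q: "prob_space Q" and sets_Q [measurable_cong]: "sets Q = sets canon_alg"
    and Q_density: "\<And>t \<Gamma>. 0 \<le> t \<Longrightarrow> \<Gamma> \<in> sets (\<F> t) \<Longrightarrow>
      measure Q \<Gamma> = (\<integral>w. indicator \<Gamma> w * density_process L \<nu> t w \<partial>P0)"

sublocale penalised \<subseteq> N: prob_space \<nu> by (rule prob_\<nu>)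
sublocale penalised \<subseteq> Q: prob_space Q by (rule prob_Q)
sublocale penalised \<subseteq> PN: pair_sigma_finite P0 \<nu> by unfold_locales

context penalised
begin

lemma space_\<nu> [simp]: "space \<nu> = UNIV"
  using sets_eq_imp_space_eq[OF sets_\<nu>] by simp

lemma space_Q [simp]: "space Q = path_space"
  using sets_eq_imp_space_eq[OF sets_Q] by simp

lemma \<nu>_pos: "AE a in \<nu>. 0 < a"
  using \<nu>_ge by eventually_elim (use \<alpha> in auto)

lemma sets_filt_Q: "0 \<le> t \<Longrightarrow> sets (\<F> t) \<subseteq> sets Q"
  using canon_filt_subset_alg[of t] by (simp add: sets_Q)

lemma measurable_filt_Q: "0 \<le> t \<Longrightarrow> f \<in> measurable (\<F> t) N \<Longrightarrow> f \<in> measurable Q N"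
  using measurable_canon_filt_alg[of f t N] measurable_cong_sets[OF sets_Q refl] by blast

lemma M_measurable_joint:
  assumes "0 \<le> t"
  shows "(\<lambda>z. M (snd z) t (fst z)) \<in> borel_measurable (\<F> t \<Otimes>\<^sub>M borel)"
proof -
  have [measurable]: "coord t \<in> borel_measurable (\<F> t)" "L t \<in> borel_measurable (\<F> t)"
    "run_max t \<in> borel_measurable (\<F> t)"
    using assms by (auto intro: measurable_coord_filt L_measurable_filt measurable_run_max)
  show ?thesis unfolding M_def Y_def by measurable
qed

lemma filt_to_P0:
  assumes t: "0 \<le> t" and f: "f \<in> measurable (\<F> t \<Otimes>\<^sub>M borel) N"
  shows "f \<in> measurable (P0 \<Otimes>\<^sub>M \<nu>) N"
proof -
  have "(\<lambda>z. (fst z, snd z)) \<in> measurable (P0 \<Otimes>\<^sub>M \<nu>) (\<F> t \<Otimes>\<^sub>M borel)"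
    using id_measurable_G[OF t] by (intro measurable_Pair measurable_compose[OF measurable_fst]) auto
  from measurable_compose[OF this f] show ?thesis by simp
qed

abbreviation mass :: "path set \<Rightarrow> real \<Rightarrow> real \<Rightarrow> ennreal" where
  "mass D t a \<equiv> \<integral>\<^sup>+w. indicator D w * ennreal (M a t w) \<partial>P0"

lemma mass_measurable:
  assumes t: "0 \<le> t" and D: "D \<in> sets (\<F> t)"
  shows "mass D t \<in> borel_measurable \<nu>"
proof -
  have [measurable]: "D \<in> sets P0" using D sets_G_subset[OF t] by blast
  have "(\<lambda>z. indicator D (fst z) * ennreal (M (snd z) t (fst z))) \<in> borel_measurable (P0 \<Otimes>\<^sub>M \<nu>)"
    using filt_to_P0[OF t M_measurable_joint[OF t]] by measurable
  from measurable_compose[OF measurable_pair_swap' this]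
  have "(\<lambda>z. indicator D (snd z) * ennreal (M (fst z) t (snd z))) \<in> borel_measurable (\<nu> \<Otimes>\<^sub>M P0)" by (simp add: split_beta')
  then show ?thesis by (intro borel_measurable_nn_integral) (simp add: split_beta')
qed

lemma mass_le: "0 < a \<Longrightarrow> 0 \<le> t \<Longrightarrow> mass D t a \<le> 1"
  by (rule order_trans[OF nn_integral_mono M_expectation_le]) (auto split: split_indicator)

lemma Q_mixture:
  assumes t: "0 \<le> t" and \<Gamma>: "\<Gamma> \<in> sets (\<F> t)"
  shows "emeasure Q \<Gamma> = (\<integral>\<^sup>+a. mass \<Gamma> t a \<partial>\<nu>)"
proof -
  define W where "W w a = (if run_max t w \<le> a then Y a t w else 0)" for w a
  have mf [measurable]: "coord t \<in> borel_measurable (\<F> t)" "L t \<in> borel_measurable (\<F> t)"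
    "run_max t \<in> borel_measurable (\<F> t)"
    using t by (auto intro: measurable_coord_filt L_measurable_filt measurable_run_max)
  have "(\<lambda>z. W (fst z) (snd z)) \<in> borel_measurable (\<F> t \<Otimes>\<^sub>M borel)"
    unfolding W_def Y_def by measurable
  from filt_to_P0[OF t this] have Wm [measurable]: "(\<lambda>z. W (fst z) (snd z)) \<in> borel_measurable (P0 \<Otimes>\<^sub>M \<nu>)" .
  have dp: "density_process L \<nu> t w = (\<integral>a. W w a \<partial>\<nu>)" for w
    unfolding density_process_def set_lebesgue_integral_def W_def Y_def
    by (intro Bochner_Integration.integral_cong) auto
  have W: "AE a in \<nu>. 0 \<le> W w a \<and> W w a \<le> exp (\<bar>L t w\<bar> / \<alpha>)" if w: "w \<in> path_space" for w
    using \<nu>_ge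
  proof eventually_elim
    case (elim a)
    then have a: "0 < a" using \<alpha> by simp
    have "\<bar>L t w\<bar> / a \<le> \<bar>L t w\<bar> / \<alpha>" using elim \<alpha> by (intro divide_left_mono) auto
    then have "exp (\<bar>L t w\<bar> / a) \<le> exp (\<bar>L t w\<bar> / \<alpha>)" by simp
    then show ?case using Y_pos[OF a w t] Y_le[OF a, of t w "\<bar>L t w\<bar>", OF abs_ge_self]
      by (auto simp: W_def intro: order_trans)
  qed
  have Wa: "W w \<in> borel_measurable \<nu>" if "w \<in> path_space" for w
    using measurable_compose[OF measurable_Pair1' Wm, of w] that by simp
  have Wi: "integrable \<nu> (W w)" if w: "w \<in> path_space" for w
    by (rule N.integrable_const_bound[of _ "exp (\<bar>L t w\<bar> / \<alpha>)"]) (use W[OF w] Wa[OF w] in auto)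
  have dp0: "0 \<le> density_process L \<nu> t w" if w: "w \<in> path_space" for w
    unfolding dp using W[OF w] by (intro integral_nonneg_AE) auto
  have dpe: "ennreal (density_process L \<nu> t w) = (\<integral>\<^sup>+a. ennreal (W w a) \<partial>\<nu>)" if w: "w \<in> path_space" for w
    unfolding dp using W[OF w] by (intro nn_integral_eq_integral[symmetric] Wi[OF w]) auto
  \<comment> \<open>The integral of a non-integrable function is 0 by convention, which would
    contradict that Q has mass 1.\<close>
  have dpi: "integrable P0 (density_process L \<nu> t)"
  proof (rule ccontr)
    assume *: "\<not> integrable P0 (density_process L \<nu> t)"
    have "1 = measure Q path_space" using Q.prob_space by simp
    also have "\<dots> = (\<integral>w. indicator path_space w * density_process L \<nu> t w \<partial>P0)"
      using Q_density[OF t, of path_space] sets.top[of "\<F> t"] by simp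
    also have "\<dots> = (\<integral>w. density_process L \<nu> t w \<partial>P0)" by (intro Bochner_Integration.integral_cong) auto
    also have "\<dots> = 0" using * by (rule not_integrable_integral_eq)
    finally show False by simp
  qed
  have \<Gamma>P [measurable]: "\<Gamma> \<in> sets P0" using \<Gamma> sets_G_subset[OF t] by blast
  have "emeasure Q \<Gamma> = ennreal (\<integral>w. indicator \<Gamma> w * density_process L \<nu> t w \<partial>P0)"
    using Q_density[OF t \<Gamma>] by (simp add: Q.emeasure_eq_measure)
  also have "\<dots> = (\<integral>\<^sup>+w. ennreal (indicator \<Gamma> w * density_process L \<nu> t w) \<partial>P0)"
  proof (rule nn_integral_eq_integral[symmetric])
    show "integrable P0 (\<lambda>w. indicator \<Gamma> w * density_process L \<nu> t w)"
      by (rule integrable_indicator_times[OF \<Gamma>P dpi])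
  qed (use dp0 in auto)
  also have "\<dots> = (\<integral>\<^sup>+w. (\<integral>\<^sup>+a. indicator \<Gamma> w * ennreal (W w a) \<partial>\<nu>) \<partial>P0)"
  proof (rule nn_integral_cong)
    fix w assume "w \<in> space P0"
    then have w: "w \<in> path_space" by simp
    have "ennreal (indicator \<Gamma> w * density_process L \<nu> t w) = indicator \<Gamma> w * (\<integral>\<^sup>+a. ennreal (W w a) \<partial>\<nu>)"
      unfolding dpe[OF w, symmetric] by (auto split: split_indicator)
    also have "\<dots> = (\<integral>\<^sup>+a. indicator \<Gamma> w * ennreal (W w a) \<partial>\<nu>)"
      by (rule nn_integral_cmult[symmetric]) (use Wa[OF w] in measurable)
    finally show "ennreal (indicator \<Gamma> w * density_process L \<nu> t w) = (\<integral>\<^sup>+a. indicator \<Gamma> w * ennreal (W w a) \<partial>\<nu>)" .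
  qed
  also have "\<dots> = (\<integral>\<^sup>+a. (\<integral>\<^sup>+w. indicator \<Gamma> w * ennreal (W w a) \<partial>P0) \<partial>\<nu>)"
  proof (rule PN.Fubini'[symmetric])
    have "(\<lambda>z. indicator \<Gamma> (fst z) * ennreal (W (fst z) (snd z))) \<in> borel_measurable (P0 \<Otimes>\<^sub>M \<nu>)" by measurable
    then show "(\<lambda>(w, a). indicator \<Gamma> w * ennreal (W w a)) \<in> borel_measurable (P0 \<Otimes>\<^sub>M \<nu>)" by (simp add: split_beta')
  qed
  also have "\<dots> = (\<integral>\<^sup>+a. mass \<Gamma> t a \<partial>\<nu>)"
  proof (rule nn_integral_cong_AE)
    show "AE a in \<nu>. (\<integral>\<^sup>+w. indicator \<Gamma> w * ennreal (W w a) \<partial>P0) = mass \<Gamma> t a"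
      using \<nu>_pos
    proof eventually_elim
      case (elim a)
      \<comment> \<open>The closed boundary a >= run_max of the density is exchanged for the strict
        one of \<open>M\<close>. At t = 0 the running maximum is 0, and the level is
        positive.\<close>
      have "AE w in P0. run_max t w \<noteq> a"
      proof (cases "t = 0")
        case True
        show ?thesis by (rule eventually_mono[OF M_zero[OF elim]]) (use True elim in auto)
      next
        case False
        then show ?thesis using t elim by (intro run_max_ne_const) auto
      qed
      then show ?case
        by (intro nn_integral_cong_AE) (auto elim!: eventually_mono simp: W_def M_def)
    qed
  qed
  finally show ?thesis .
qed

text \<open>Numbers that are at most 1 and average to 1 are equal to 1 almost everywhere.\<close>

lemma M_mass:
  assumes t: "0 \<le> t"
  shows "AE a in \<nu>. (\<integral>\<^sup>+w. ennreal (M a t w) \<partial>P0) = 1"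
proof -
  define I where "I = mass path_space t"
  have ps: "path_space \<in> sets (\<F> t)" using sets.top[of "\<F> t"] by simp
  have [measurable]: "I \<in> borel_measurable \<nu>" unfolding I_def by (rule mass_measurable[OF t ps])
  have eq: "I a = (\<integral>\<^sup>+w. ennreal (M a t w) \<partial>P0)" for a unfolding I_def by (intro nn_integral_cong) auto
  have le: "AE a in \<nu>. I a \<le> 1" using \<nu>_pos by eventually_elim (simp add: I_def mass_le t)
  have one: "(\<integral>\<^sup>+a. I a \<partial>\<nu>) = 1" unfolding I_def Q_mixture[OF t ps, symmetric] using Q.emeasure_space_1 by simp
  have "(\<integral>\<^sup>+a. 1 - I a \<partial>\<nu>) = (\<integral>\<^sup>+a. 1 \<partial>\<nu>) - (\<integral>\<^sup>+a. I a \<partial>\<nu>)"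
    using le one by (intro nn_integral_diff) auto
  also have "\<dots> = 0" using one N.emeasure_space_1 by simp
  finally have "AE a in \<nu>. 1 - I a = 0" by (subst (asm) nn_integral_0_iff_AE) auto
  with le show ?thesis unfolding eq
    by eventually_elim (auto simp: diff_eq_0_iff_ennreal intro: antisym)
qed

lemma M_mass_integral:
  assumes t: "0 \<le> t"
  shows "AE a in \<nu>. (\<integral>w. M a t w \<partial>P0) = 1"
  using M_mass[OF t] \<nu>_pos
proof eventually_elim
  case (elim a)
  have "ennreal (\<integral>w. M a t w \<partial>P0) = (\<integral>\<^sup>+w. ennreal (M a t w) \<partial>P0)"
    using M_nonneg[OF elim(2) _ t] by (intro nn_integral_eq_integral[symmetric] M_integrable elim t) auto
  then show ?case using elim by (simp add: ennreal_eq_1)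
qed

text \<open>The exceptional levels depend on s and t but not on \<Gamma>, because only the total
  masses at these two times enter.\<close>

lemma M_mixed_martingale:
  assumes st: "0 \<le> s" "s \<le> t"
  shows "AE a in \<nu>. \<forall>\<Gamma>\<in>sets (\<F> s). mass \<Gamma> t a = mass \<Gamma> s a"
proof -
  have t: "0 \<le> t" using st by simp
  show ?thesis
    using M_mass_integral[OF st(1)] M_mass_integral[OF t] \<nu>_pos
  proof eventually_elim
    case (elim a)
    show ?case
    proof
      fix \<Gamma> assume \<Gamma>: "\<Gamma> \<in> sets (\<F> s)"
      then have \<Gamma>P [measurable]: "\<Gamma> \<in> sets P0" using sets_G_subset[OF st(1)] by blast
      have "mass \<Gamma> r a = ennreal (\<integral>w. indicator \<Gamma> w * M a r w \<partial>P0)" if r: "0 \<le> r" for r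
      proof -
        have "integrable P0 (\<lambda>w. indicator \<Gamma> w * M a r w)"
          by (rule integrable_indicator_times[OF \<Gamma>P M_integrable[OF elim(3) r]])
        then have "ennreal (\<integral>w. indicator \<Gamma> w * M a r w \<partial>P0) = (\<integral>\<^sup>+w. ennreal (indicator \<Gamma> w * M a r w) \<partial>P0)"
          using M_nonneg[OF elim(3) _ r] by (intro nn_integral_eq_integral[symmetric]) auto
        also have "\<dots> = mass \<Gamma> r a"
          by (intro nn_integral_cong) (auto split: split_indicator)
        finally show ?thesis by simp
      qed
      then show "mass \<Gamma> t a = mass \<Gamma> s a"
        using M_girsanov(2)[OF st elim(3) \<Gamma>] elim st t by simp
    qed
  qed
qed

text \<open>Compare with a level c' strictly between c and a. Where L <= R, the density is at most
  exp(R / a), and |X_n| <= c0 has probability of order n^(-1/2). Where L > R, exp(L / a) <= exp(- R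
  \<theta>) exp(L / c'), and the last factor is at most M c' / \<delta> with M c' of mass at most 1.
  First R is chosen large, then n.\<close>

lemma M_tail:
  assumes a: "0 < a" and c: "c < a"
  shows "(\<lambda>n. \<integral>\<^sup>+w. indicator {w. run_max (real n) w \<le> c} w * ennreal (M a (real n) w) \<partial>P0) \<longlonglongrightarrow> 0"
proof -
  \<comment> \<open>c may be negative, while the small-ball estimate needs a nonnegative
    radius.\<close>
  define c0 where "c0 = max c 0"
  define c' where "c' = (c0 + a) / 2"
  define \<delta> where "\<delta> = 1 - c0 / c'"
  define \<theta> where "\<theta> = 1 / c' - 1 / a"
  have cs: "0 \<le> c0" "c0 < c'" "c' < a" "0 < c'" using a c by (auto simp: c0_def c'_def)
  have \<delta>: "0 < \<delta>" using cs by (simp add: \<delta>_def)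
  have \<theta>: "0 < \<theta>" unfolding \<theta>_def using cs by (simp add: frac_less2)
  define I where "I n = mass {w. run_max (real n) w \<le> c} (real n) a" for n
  have bound: "I n \<le> ennreal (exp (R / a) * (c0 / sqrt (real n)) + exp (- R * \<theta>) / \<delta>)" if R: "0 \<le> R" and n: "0 < n" for R and n :: nat
  proof -
    have n0: "0 \<le> real n" "0 < real n" using n by auto
    have [measurable]: "run_max (real n) \<in> borel_measurable P0" "coord (real n) \<in> borel_measurable P0" "M c' (real n) \<in> borel_measurable P0"
      using measurable_G_P[OF n0(1) measurable_run_max[OF n0(1)]] measurable_G_P[OF n0(1) M_measurable_filt[OF n0(1) order_refl]] n0 by auto
    have "I n \<le> (\<integral>\<^sup>+w. ennreal (exp (R / a)) * indicator {w \<in> space P0. \<bar>coord (real n) w\<bar> \<le> c0} w + ennreal (exp (- R * \<theta>) / \<delta>) * ennreal (M c' (real n) w) \<partial>P0)"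
      unfolding I_def
    proof (rule nn_integral_mono)
      fix w assume "w \<in> space P0"
      then have w: "w \<in> path_space" by simp
      show "indicator {w. run_max (real n) w \<le> c} w * ennreal (M a (real n) w)
        \<le> ennreal (exp (R / a)) * indicator {w \<in> space P0. \<bar>coord (real n) w\<bar> \<le> c0} w + ennreal (exp (- R * \<theta>) / \<delta>) * ennreal (M c' (real n) w)"
      proof (cases "run_max (real n) w \<le> c")
        case True
        define l where "l = L (real n) w"
        have X: "\<bar>coord (real n) w\<bar> \<le> c0" using abs_coord_le_run_max[OF w, of "real n" "real n"] True by (simp add: c0_def)
        have Ma: "M a (real n) w \<le> exp (l / a)"
          using True c Y_le[OF a, of "real n" w l] Y_pos[OF a w, of "real n"] by (simp add: M_def l_def)
        have Mc: "M c' (real n) w = (1 - \<bar>coord (real n) w\<bar> / c') * exp (l / c')"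
          using True cs by (simp add: M_def Y_def l_def c0_def)
        have "\<delta> * exp (l / c') \<le> M c' (real n) w"
          unfolding Mc \<delta>_def using X cs by (intro mult_right_mono diff_left_mono divide_right_mono) auto
        then have Mc': "exp (l / c') \<le> M c' (real n) w / \<delta>" using \<delta> by (simp add: field_simps)
        have "exp (l / a) \<le> exp (R / a) + exp (- R * \<theta>) * exp (l / c')"
        proof (cases "l \<le> R")
          case True
          then have "exp (l / a) \<le> exp (R / a)" using a by (simp add: divide_right_mono)
          then show ?thesis by (simp add: add_increasing2)
        next
          case False
          then have "R * \<theta> \<le> l * \<theta>" using \<theta> by (intro mult_right_mono) auto
          then have "l / a \<le> - R * \<theta> + l / c'" by (simp add: \<theta>_def algebra_simps)
          then have "exp (l / a) \<le> exp (- R * \<theta> + l / c')" by simp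
          then have "exp (l / a) \<le> exp (- R * \<theta>) * exp (l / c')" by (simp only: exp_add)
          then show ?thesis by (simp add: add_increasing)
        qed
        also have "\<dots> \<le> exp (R / a) + exp (- R * \<theta>) * (M c' (real n) w / \<delta>)"
          using Mc' by (intro add_left_mono mult_left_mono) auto
        finally have "M a (real n) w \<le> exp (R / a) + exp (- R * \<theta>) / \<delta> * M c' (real n) w"
          using Ma by simp
        then have "ennreal (M a (real n) w) \<le> ennreal (exp (R / a) + exp (- R * \<theta>) / \<delta> * M c' (real n) w)" by (rule ennreal_leI)
        also have "\<dots> = ennreal (exp (R / a)) + ennreal (exp (- R * \<theta>) / \<delta> * M c' (real n) w)"
          using \<delta> M_nonneg[OF cs(4) w, of "real n"] by (intro ennreal_plus) auto
        also have "\<dots> = ennreal (exp (R / a)) + ennreal (exp (- R * \<theta>) / \<delta>) * ennreal (M c' (real n) w)"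
          using \<delta> M_nonneg[OF cs(4) w, of "real n"] by (subst ennreal_mult) auto
        finally show ?thesis using True X w by simp
      qed simp
    qed
    also have "\<dots> = ennreal (exp (R / a)) * emeasure P0 {w \<in> space P0. \<bar>coord (real n) w\<bar> \<le> c0} + ennreal (exp (- R * \<theta>) / \<delta>) * (\<integral>\<^sup>+w. ennreal (M c' (real n) w) \<partial>P0)"
    proof -
      have "(\<integral>\<^sup>+w. indicator {w \<in> space P0. \<bar>coord (real n) w\<bar> \<le> c0} w \<partial>P0) = emeasure P0 {w \<in> space P0. \<bar>coord (real n) w\<bar> \<le> c0}"
        by (rule nn_integral_indicator) measurable
      then show ?thesis by (simp add: nn_integral_add nn_integral_cmult del: space_P0)
    qed
    also have "\<dots> \<le> ennreal (exp (R / a)) * ennreal (c0 / sqrt (real n)) + ennreal (exp (- R * \<theta>) / \<delta>) * 1"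
      using cs n0 by (intro add_mono mult_left_mono small_ball M_expectation_le) auto
    also have "\<dots> = ennreal (exp (R / a) * (c0 / sqrt (real n)) + exp (- R * \<theta>) / \<delta>)"
      using cs \<delta> by (simp add: ennreal_mult[symmetric] ennreal_plus[symmetric] del: ennreal_plus)
    finally show ?thesis .
  qed
  have small: "\<forall>\<^sub>F n in sequentially. I n < ennreal e" if e: "0 < e" for e :: real
  proof -
    have "((\<lambda>R. exp (- R * \<theta>) / \<delta>) \<longlongrightarrow> 0) at_top"
    proof -
      have "filterlim (\<lambda>R. R * \<theta>) at_top at_top" using \<theta> by (rule filterlim_at_top_mult_tendsto_pos[OF tendsto_const _ filterlim_ident, simplified mult.commute])
      then have "filterlim (\<lambda>R. - R * \<theta>) at_bot at_top" by (simp add: filterlim_uminus_at_bot)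
      from filterlim_compose[OF exp_at_bot this] show ?thesis by (intro tendsto_divide_zero)
    qed
    then have "\<forall>\<^sub>F R in at_top. exp (- R * \<theta>) / \<delta> < e / 2" using e by (intro order_tendstoD) auto
    then have "\<forall>\<^sub>F R in at_top. 0 \<le> R \<and> exp (- R * \<theta>) / \<delta> < e / 2" using eventually_ge_at_top[of 0] by eventually_elim simp
    then obtain R where R: "0 \<le> R" "exp (- R * \<theta>) / \<delta> < e / 2" using eventually_happens'[OF trivial_limit_at_top_linorder] by blast
    have "(\<lambda>n. exp (R / a) * c0 / sqrt (real (Suc n))) \<longlonglongrightarrow> 0" by (rule tendsto_const_div_sqrt_Suc)
    then have "(\<lambda>n. exp (R / a) * c0 / sqrt (real n)) \<longlonglongrightarrow> 0" by (rule LIMSEQ_imp_Suc)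
    then have "\<forall>\<^sub>F n in sequentially. exp (R / a) * c0 / sqrt (real n) < e / 2" using e by (intro order_tendstoD) auto
    then show ?thesis
      using eventually_gt_at_top[of 0]
    proof eventually_elim
      case (elim n)
      have "I n \<le> ennreal (exp (R / a) * (c0 / sqrt (real n)) + exp (- R * \<theta>) / \<delta>)" by (rule bound[OF R(1) elim(2)])
      also have "\<dots> < ennreal e"
      proof (rule ennreal_lessI[OF e])
        show "exp (R / a) * (c0 / sqrt (real n)) + exp (- R * \<theta>) / \<delta> < e"
          using elim(1) R(2) unfolding times_divide_eq_right by linarith
      qed
      finally show ?case .
    qed
  qed
  have "I \<longlonglongrightarrow> 0"
  proof (rule order_tendstoI)
    fix y :: ennreal assume "0 < y"
    then obtain d where d: "0 < d" "d < y" using dense by blast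
    then obtain e where e: "d = ennreal e" "0 \<le> e" by (cases d) auto
    from e d have "0 < e" by simp
    from small[OF this] show "\<forall>\<^sub>F n in sequentially. I n < y" by eventually_elim (use e d in auto)
  qed simp
  then show ?thesis unfolding I_def .
qed

text \<open>\<open>real_of_ereal\<close> sends infinity to 0; this default occurs on a Q-null event
  only, by \<open>total_max_finite\<close>.\<close>

definition tm :: "path \<Rightarrow> real" where "tm w = real_of_ereal (total_max w)"

lemma tm_measurable [measurable]: "tm \<in> borel_measurable Q"
proof -
  have "tm \<in> borel_measurable canon_alg" unfolding tm_def[abs_def] by measurable
  then show ?thesis by simp
qed

text \<open>The event is the decreasing limit of the events that the running maximum at integer
  times is at most c. A component with a <= c lives entirely on all of them, and its mass on
  \<Gamma> is constant in time; a component with a > c dies out there by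
  \<open>M_tail\<close>.\<close>

lemma Q_total_max_le:
  assumes t: "0 \<le> t" and \<Gamma>: "\<Gamma> \<in> sets (\<F> t)"
  shows "emeasure Q (\<Gamma> \<inter> {w \<in> path_space. total_max w \<le> ereal c}) =
    (\<integral>\<^sup>+a. indicator {..c} a * mass \<Gamma> t a \<partial>\<nu>)"
proof -
  obtain m :: nat where m: "t \<le> real m" using real_arch_simple by blast
  define A where "A n = \<Gamma> \<inter> {w \<in> path_space. run_max (real (m + n)) w \<le> c}" for n
  have A: "A n \<in> sets (\<F> (real (m + n)))" for n
  proof -
    have [measurable]: "run_max (real (m + n)) \<in> borel_measurable (\<F> (real (m + n)))" by (intro measurable_run_max) simp
    have "{w \<in> space (\<F> (real (m + n))). run_max (real (m + n)) w \<le> c} \<in> sets (\<F> (real (m + n)))" by measurable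
    moreover have "\<Gamma> \<in> sets (\<F> (real (m + n)))" using canon_filt_mono[of t "real (m + n)"] \<Gamma> m by auto
    ultimately show ?thesis unfolding A_def by auto
  qed
  have dec: "decseq A"
    unfolding decseq_def A_def
  proof (intro allI impI subsetI)
    fix j k x assume jk: "j \<le> k" and x: "x \<in> \<Gamma> \<inter> {w \<in> path_space. run_max (real (m + k)) w \<le> c}"
    have "run_max (real (m + j)) x \<le> run_max (real (m + k)) x" by (rule run_max_mono) (use x jk in auto)
    with x show "x \<in> \<Gamma> \<inter> {w \<in> path_space. run_max (real (m + j)) w \<le> c}" by (auto intro: order_trans)
  qed
  have Int: "(\<Inter>n. A n) = \<Gamma> \<inter> {w \<in> path_space. total_max w \<le> ereal c}"
  proof -
    have "w \<in> path_space \<Longrightarrow> total_max w \<le> ereal c \<longleftrightarrow> (\<forall>n. run_max (real (m + n)) w \<le> c)" for w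
      unfolding total_max_le_iff
    proof safe
      fix n assume w: "w \<in> path_space" and *: "\<forall>n. run_max (real (m + n)) w \<le> c"
      have "run_max (real n) w \<le> run_max (real (m + n)) w" by (rule run_max_mono[OF w]) auto
      with * show "run_max (real n) w \<le> c" by (meson order_trans)
    qed blast
    then show ?thesis unfolding A_def by auto
  qed
  have "(\<lambda>n. emeasure Q (A n)) \<longlonglongrightarrow> emeasure Q (\<Inter>n. A n)"
  proof (rule Lim_emeasure_decseq[OF _ dec])
    have "A n \<in> sets Q" for n by (rule subsetD[OF sets_filt_Q A]) simp
    then show "range A \<subseteq> sets Q" by auto
  qed simp
  moreover have "(\<lambda>n. emeasure Q (A n)) \<longlonglongrightarrow> (\<integral>\<^sup>+a. indicator {..c} a * mass \<Gamma> t a \<partial>\<nu>)"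
  proof -
    define J where "J n a = mass (A n) (real (m + n)) a" for n a
    define J' where "J' a = mass \<Gamma> t a" for a
    have Jm [measurable]: "J n \<in> borel_measurable \<nu>" for n unfolding J_def[abs_def] by (rule mass_measurable[OF _ A]) simp
    have J'm [measurable]: "J' \<in> borel_measurable \<nu>" unfolding J'_def[abs_def] by (rule mass_measurable[OF t \<Gamma>])
    have "(\<lambda>n. \<integral>\<^sup>+a. J n a \<partial>\<nu>) \<longlonglongrightarrow> (\<integral>\<^sup>+a. indicator {..c} a * J' a \<partial>\<nu>)"
    proof (rule nn_integral_dominated_convergence[where w="\<lambda>_. 1"])
      show "(\<integral>\<^sup>+a. 1 \<partial>\<nu>) < \<infinity>" using N.emeasure_space_1 by simp
      show "AE a in \<nu>. J n a \<le> 1" for n using \<nu>_pos by eventually_elim (simp add: J_def mass_le)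
      have "AE a in \<nu>. \<forall>n. \<forall>\<Gamma>\<in>sets (\<F> t). mass \<Gamma> (real (m + n)) a = mass \<Gamma> t a"
        unfolding AE_all_countable using M_mixed_martingale[OF t] m by auto
      then show "AE a in \<nu>. (\<lambda>n. J n a) \<longlonglongrightarrow> indicator {..c} a * J' a"
        using \<nu>_pos
      proof eventually_elim
        case (elim a)
        show ?case
        proof (cases "a \<le> c")
          case True
          have "J n a = J' a" for n
          proof -
            have "J n a = mass \<Gamma> (real (m + n)) a"
              unfolding J_def using True by (intro nn_integral_cong) (auto simp: A_def M_def split: split_indicator)
            also have "\<dots> = J' a" unfolding J'_def using elim(1) \<Gamma> by blast
            finally show ?thesis .
          qed
          then show ?thesis using True by simp
        next
          case False
          have "(\<lambda>n. \<integral>\<^sup>+w. indicator {w. run_max (real (n + m)) w \<le> c} w * ennreal (M a (real (n + m)) w) \<partial>P0) \<longlonglongrightarrow> 0"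
            by (rule LIMSEQ_ignore_initial_segment[OF M_tail[OF elim(2)]]) (use False in simp)
          then have "(\<lambda>n. J n a) \<longlonglongrightarrow> 0"
          proof (rule tendsto_sandwich[OF _ _ tendsto_const, rotated 2])
            show "\<forall>\<^sub>F n in sequentially. J n a \<le> mass {w. run_max (real (n + m)) w \<le> c} (real (n + m)) a"
              unfolding J_def by (intro always_eventually allI nn_integral_mono) (auto simp: A_def add.commute split: split_indicator)
          qed simp
          then show ?thesis using False by simp
        qed
      qed
    qed measurable
    then show ?thesis unfolding J_def J'_def using Q_mixture[OF _ A] by simp
  qed
  ultimately show ?thesis unfolding Int by (rule LIMSEQ_unique)
qed

text \<open>Applied to the whole space, \<open>Q_total_max_le\<close> gives the event that the total
  maximum is at most n the \<nu>-mass of {..n}, which tends to 1.\<close>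

lemma total_max_finite: "AE w in Q. total_max w < \<infinity>"
proof -
  define B where "B n = {w \<in> path_space. total_max w \<le> ereal (real n)}" for n :: nat
  have [measurable]: "total_max \<in> borel_measurable Q" using measurable_total_max by simp
  have B: "B n \<in> sets Q" for n
  proof -
    have "{w \<in> space Q. total_max w \<le> ereal (real n)} \<in> sets Q" by measurable
    then show ?thesis by (simp add: B_def)
  qed
  have eB: "emeasure Q (B n) = emeasure \<nu> {..real n}" for n
  proof -
    have "emeasure Q (B n) = emeasure Q (path_space \<inter> {w \<in> path_space. total_max w \<le> ereal (real n)})"
      unfolding B_def by (intro arg_cong[where f="emeasure Q"]) auto
    also have "\<dots> = (\<integral>\<^sup>+a. indicator {..real n} a * mass path_space 0 a \<partial>\<nu>)"
      using sets.top[of "\<F> 0"] by (intro Q_total_max_le) auto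
    also have "\<dots> = (\<integral>\<^sup>+a. indicator {..real n} a \<partial>\<nu>)"
    proof (rule nn_integral_cong_AE)
      show "AE a in \<nu>. indicator {..real n} a * mass path_space 0 a = indicator {..real n} a"
        using M_mass[OF order_refl]
      proof eventually_elim
        case (elim a)
        have "mass path_space 0 a = (\<integral>\<^sup>+w. ennreal (M a 0 w) \<partial>P0)"
          by (intro nn_integral_cong) auto
        then show ?case using elim by simp
      qed
    qed
    also have "\<dots> = emeasure \<nu> {..real n}" by (rule nn_integral_indicator) (simp add: sets_\<nu>)
    finally show ?thesis .
  qed
  have "(\<lambda>n. emeasure \<nu> {..real n}) \<longlonglongrightarrow> emeasure \<nu> (\<Union>n. {..real n})"
    by (rule Lim_emeasure_incseq) (auto simp: incseq_def sets_\<nu>)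
  also have "(\<Union>n. {..real n}) = UNIV" using real_arch_simple by auto
  finally have "(\<lambda>n. emeasure Q (B n)) \<longlonglongrightarrow> 1" unfolding eB using N.emeasure_space_1 by simp
  moreover have "(\<lambda>n. emeasure Q (B n)) \<longlonglongrightarrow> emeasure Q (\<Union>n. B n)"
    by (rule Lim_emeasure_incseq) (use B in \<open>auto simp: incseq_def B_def intro: order_trans\<close>)
  ultimately have "emeasure Q (\<Union>n. B n) = 1" by (metis LIMSEQ_unique)
  then have "AE w in Q. w \<in> (\<Union>n. B n)"
    using B by (intro Q.AE_prob_1) (simp add: Q.emeasure_eq_measure)
  then show ?thesis
    by eventually_elim (auto simp: B_def intro: le_less_trans)
qed

text \<open>From half-lines to Borel sets: both sides are finite measures in C that agree on the
  half-lines and on the whole line.\<close>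

lemma tm_law:
  assumes t: "0 \<le> t" and \<Gamma>: "\<Gamma> \<in> sets (\<F> t)" and C: "C \<in> sets borel"
  shows "emeasure Q (\<Gamma> \<inter> (tm -` C \<inter> path_space)) = (\<integral>\<^sup>+a. indicator C a * mass \<Gamma> t a \<partial>\<nu>)"
proof -
  have \<Gamma>Q [measurable]: "\<Gamma> \<in> sets Q" using \<Gamma> sets_filt_Q[OF t] by auto
  define J where "J a = mass \<Gamma> t a" for a
  have [measurable]: "J \<in> borel_measurable \<nu>" unfolding J_def[abs_def] by (rule mass_measurable[OF t \<Gamma>])
  define M1 where "M1 = distr (density Q (indicator \<Gamma>)) borel tm"
  define M2 where "M2 = density \<nu> J"
  have s: "sets M1 = sets borel" "sets M2 = sets borel" by (simp_all add: M1_def M2_def sets_\<nu>)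
  have e1: "emeasure M1 A = emeasure Q (\<Gamma> \<inter> (tm -` A \<inter> path_space))" if A: "A \<in> sets borel" for A
    unfolding M1_def using emeasure_distr_density_indicator[OF tm_measurable \<Gamma>Q A] by simp
  have e2: "emeasure M2 A = (\<integral>\<^sup>+a. indicator A a * J a \<partial>\<nu>)" if "A \<in> sets borel" for A
    unfolding M2_def using that by (subst emeasure_density) (auto simp: mult.commute sets_\<nu>)
  have UN: "emeasure M1 UNIV = emeasure M2 UNIV"
  proof -
    have "\<Gamma> \<inter> path_space = \<Gamma>" using sets.sets_into_space[OF \<Gamma>] by auto
    then show ?thesis using e1[of UNIV] e2[of UNIV] Q_mixture[OF t \<Gamma>] by (simp add: J_def)
  qed
  have fin: "emeasure M1 A \<noteq> \<infinity>" if "A \<in> sets borel" for A unfolding e1[OF that] by simp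
  have le: "emeasure M1 {..c} = emeasure M2 {..c}" for c
  proof -
    have m: "\<Gamma> \<inter> {w \<in> path_space. total_max w \<le> ereal c} \<in> sets Q"
    proof -
      have [measurable]: "total_max \<in> borel_measurable Q" using measurable_total_max by simp
      have "{w \<in> space Q. total_max w \<le> ereal c} \<in> sets Q" by measurable
      then show ?thesis using \<Gamma>Q by auto
    qed
    have m2: "\<Gamma> \<inter> (tm -` {..c} \<inter> path_space) \<in> sets Q" using measurable_sets[OF tm_measurable, of "{..c}"] \<Gamma>Q by auto
    have "emeasure Q (\<Gamma> \<inter> (tm -` {..c} \<inter> path_space)) = emeasure Q (\<Gamma> \<inter> {w \<in> path_space. total_max w \<le> ereal c})"
    proof (rule emeasure_eq_AE[OF _ m2 m])
      show "AE w in Q. (w \<in> \<Gamma> \<inter> (tm -` {..c} \<inter> path_space)) = (w \<in> \<Gamma> \<inter> {w \<in> path_space. total_max w \<le> ereal c})"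
        using total_max_finite AE_space
      proof eventually_elim
        case (elim w)
        have "0 \<le> total_max w" unfolding total_max_def by (rule SUP_upper2[of 0]) auto
        with elim(1) obtain r where "total_max w = ereal r" by (cases "total_max w") auto
        then show ?case by (auto simp: tm_def)
      qed
    qed
    then show ?thesis using e1[of "{..c}"] e2[of "{..c}"] Q_total_max_le[OF t \<Gamma>, of c] by (simp add: J_def)
  qed
  have "M1 = M2"
  proof (rule measure_eqI_lessThan[OF s])
    fix x :: real
    show "emeasure M1 {x<..} < \<infinity>" using fin[of "{x<..}"] by (simp add: less_top)
    have "{x<..} = UNIV - {..x}" by auto
    moreover have "emeasure M (UNIV - {..x}) = emeasure M UNIV - emeasure M {..x}" if "sets M = sets borel" "emeasure M {..x} \<noteq> \<infinity>" for M
      using that by (intro emeasure_Diff) auto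
    ultimately show "emeasure M1 {x<..} = emeasure M2 {x<..}"
      using s fin[of "{..x}"] le[of x] UN by simp
  qed
  then show ?thesis using e1[OF C] e2[OF C] by (simp add: J_def)
qed

end

section \<open>Brownian motion through conditional characteristic functions\<close>

lemma (in prob_space) char_tendsto:
  fixes X :: "nat \<Rightarrow> 'a \<Rightarrow> real"
  assumes [measurable]: "\<And>n. X n \<in> borel_measurable M" "Y \<in> borel_measurable M" "\<Gamma> \<in> events"
    and lim: "AE w in M. (\<lambda>n. X n w) \<longlonglongrightarrow> Y w"
  shows "(\<lambda>n. CLINT w|M. indicator \<Gamma> w * iexp (u * X n w)) \<longlonglongrightarrow> (CLINT w|M. indicator \<Gamma> w * iexp (u * Y w))"
proof (rule integral_dominated_convergence[where w="\<lambda>_. 1"])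
  show "AE w in M. (\<lambda>n. indicator \<Gamma> w * iexp (u * X n w)) \<longlonglongrightarrow> indicator \<Gamma> w * iexp (u * Y w)"
    using lim by eventually_elim (intro tendsto_intros)
  show "AE w in M. norm (indicator \<Gamma> w * iexp (u * X n w)) \<le> 1" for n
    by (intro AE_I2) (simp add: norm_mult split: split_indicator)
  show "(\<lambda>w. indicator \<Gamma> w * iexp (u * Y w)) \<in> borel_measurable M" by measurable
  show "(\<lambda>w. indicator \<Gamma> w * iexp (u * X n w)) \<in> borel_measurable M" for n by measurable
qed simp

text \<open>For \<Gamma> of positive probability, P conditioned on \<Gamma> gives the increment a
  Gaussian characteristic function. Levy's uniqueness theorem then identifies its law as the same
  for every \<Gamma>, which contains both the normal law and the independence.\<close>

lemma brownian_motion_from_char: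
  assumes P: "prob_space P" and G: "filtration (space P) G" and sub: "\<And>t. 0 \<le> t \<Longrightarrow> subalgebra P (G t)"
    and meas: "\<And>t. 0 \<le> t \<Longrightarrow> B t \<in> borel_measurable (G t)"
    and cont: "\<And>w. w \<in> space P \<Longrightarrow> continuous_on {0..} (\<lambda>t. B t w)"
    and zero: "AE w in P. B 0 w = 0"
    and chr: "\<And>s t \<Gamma> u. 0 \<le> s \<Longrightarrow> s < t \<Longrightarrow> \<Gamma> \<in> sets (G s) \<Longrightarrow>
      (CLINT w|P. indicator \<Gamma> w * iexp (u * (B t w - B s w))) = of_real (exp (- u\<^sup>2 * (t - s) / 2) * measure P \<Gamma>)"
  shows "brownian_motion_wrt P G B"
proof -
  interpret P: prob_space P by fact
  have Bm [measurable]: "B t \<in> borel_measurable P" if "0 \<le> t" for t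
    by (rule measurable_from_subalg[OF sub[OF that] meas[OF that]])
  have main: "emeasure P (\<Gamma> \<inter> ((\<lambda>w. B t w - B s w) -` C \<inter> space P)) = emeasure P \<Gamma> * emeasure (gauss (t - s)) C"
    if st: "0 \<le> s" "s < t" and \<Gamma>: "\<Gamma> \<in> sets (G s)" and C: "C \<in> sets borel" for s t \<Gamma> C
  proof (cases "emeasure P \<Gamma> = 0")
    case True
    have "\<Gamma> \<in> sets P" using \<Gamma> sub[OF st(1)] by (auto simp: subalgebra_def)
    then have "emeasure P (\<Gamma> \<inter> ((\<lambda>w. B t w - B s w) -` C \<inter> space P)) \<le> emeasure P \<Gamma>" by (intro emeasure_mono) auto
    then show ?thesis using True by simp
  next
    case False
    define X where "X w = B t w - B s w" for w
    have \<Gamma>P [measurable]: "\<Gamma> \<in> sets P" using \<Gamma> sub[OF st(1)] by (auto simp: subalgebra_def)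
    define q where "q = measure P \<Gamma>"
    have q: "0 < q" using False by (simp add: q_def P.emeasure_eq_measure order_less_le)
    have Xm [measurable]: "X \<in> borel_measurable P" unfolding X_def[abs_def] using st by (intro borel_measurable_diff Bm) auto
    define D where "D = density P (\<lambda>w. ennreal (indicator \<Gamma> w / q))"
    have D: "prob_space D"
    proof
      have "emeasure D (space D) = (\<integral>\<^sup>+w. ennreal (1 / q) * indicator \<Gamma> w \<partial>P)"
        unfolding D_def by (subst emeasure_density) (auto intro!: nn_integral_cong split: split_indicator)
      also have "\<dots> = ennreal (1 / q) * emeasure P \<Gamma>" by (rule nn_integral_cmult_indicator) measurable
      also have "\<dots> = 1" using q by (simp add: P.emeasure_eq_measure q_def[symmetric] ennreal_mult[symmetric])
      finally show "emeasure D (space D) = 1" .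
    qed
    interpret D: prob_space D by fact
    have XD: "X \<in> measurable D borel" by (simp add: D_def)
    have r1: "real_distribution (distr D borel X)" using XD by (intro D.real_distribution_distr) simp
    interpret N: prob_space "gauss (t - s)" using st by (intro prob_space_gauss) auto
    have r2: "real_distribution (gauss (t - s))" by (intro real_distribution.intro N.prob_space_axioms) (simp add: real_distribution_axioms_def)
    have "char (distr D borel X) = char (gauss (t - s))"
    proof
      fix u
      have "char (distr D borel X) u = (CLINT w|D. iexp (u * X w))"
        unfolding char_def by (rule integral_distr[OF XD]) measurable
      also have "\<dots> = (CLINT w|P. (indicator \<Gamma> w / q) *\<^sub>R iexp (u * X w))"
        unfolding D_def using q by (intro integral_density) auto
      also have "\<dots> = (CLINT w|P. of_real (1 / q) * (indicator \<Gamma> w * iexp (u * X w)))"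
        by (intro Bochner_Integration.integral_cong) (auto simp: scaleR_conv_of_real split: split_indicator)
      also have "\<dots> = of_real (1 / q) * of_real (exp (- u\<^sup>2 * (t - s) / 2) * q)"
        unfolding X_def by (simp only: integral_mult_right_zero chr[OF st \<Gamma>] q_def)
      also have "\<dots> = of_real (exp (- u\<^sup>2 * (t - s) / 2))" using q by simp
      also have "\<dots> = char (gauss (t - s)) u" unfolding char_def using st by (subst gauss_char) auto
      finally show "char (distr D borel X) u = char (gauss (t - s)) u" .
    qed
    from Levy_uniqueness[OF r1 r2 this] have eq: "distr D borel X = gauss (t - s)" .
    have XC [measurable]: "X -` C \<inter> space P \<in> sets P" using measurable_sets[OF Xm C] .
    have "emeasure (gauss (t - s)) C = emeasure D (X -` C \<inter> space P)"
      unfolding eq[symmetric] using C XD by (subst emeasure_distr) (auto simp: D_def)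
    also have "\<dots> = (\<integral>\<^sup>+w. ennreal (1 / q) * indicator (\<Gamma> \<inter> (X -` C \<inter> space P)) w \<partial>P)"
      unfolding D_def by (subst emeasure_density) (auto intro!: nn_integral_cong split: split_indicator)
    also have "\<dots> = ennreal (1 / q) * emeasure P (\<Gamma> \<inter> (X -` C \<inter> space P))"
      by (rule nn_integral_cmult_indicator) measurable
    finally have "emeasure P \<Gamma> * emeasure (gauss (t - s)) C = (ennreal q * ennreal (1 / q)) * emeasure P (\<Gamma> \<inter> (X -` C \<inter> space P))"
      by (simp add: q_def P.emeasure_eq_measure[of \<Gamma>] mult.assoc)
    also have "ennreal q * ennreal (1 / q) = 1" using q by (simp add: ennreal_mult[symmetric])
    finally show ?thesis by (simp add: X_def)
  qed
  show ?thesis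
    unfolding brownian_motion_wrt_def
  proof (intro conjI allI impI ballI)
    fix s t :: real assume st: "0 \<le> s" "s < t"
    have Xm: "(\<lambda>w. B t w - B s w) \<in> borel_measurable P"
      using st by (intro borel_measurable_diff Bm) auto
    have law: "emeasure P ((\<lambda>w. B t w - B s w) -` C \<inter> space P) = emeasure (gauss (t - s)) C" if "C \<in> sets borel" for C
    proof -
      have "space P \<in> sets (G s)" using sub[OF st(1)] by (metis sets.top subalgebra_def)
      from main[OF st this that] show ?thesis using P.emeasure_space_1 by (simp add: Int_absorb1)
    qed
    have "distr P lborel (\<lambda>w. B t w - B s w) = gauss (t - s)"
    proof (rule measure_eqI)
      fix C assume "C \<in> sets (distr P lborel (\<lambda>w. B t w - B s w))"
      then have "C \<in> sets borel" by simp
      then show "emeasure (distr P lborel (\<lambda>w. B t w - B s w)) C = emeasure (gauss (t - s)) C"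
        using Xm by (subst emeasure_distr) (auto simp: law)
    qed simp
    then show "distributed P lborel (\<lambda>w. B t w - B s w) (\<lambda>x. ennreal (normal_density 0 (sqrt (t - s)) x))"
      using Xm by (auto simp: distributed_def gauss_def)
    show "P.indep_set (sets (G s)) {(\<lambda>w. B t w - B s w) -` A \<inter> space P |A. A \<in> sets borel}"
    proof (rule P.indep_setI)
      show "sets (G s) \<subseteq> P.events" using sub[OF st(1)] by (simp add: subalgebra_def)
      show "{(\<lambda>w. B t w - B s w) -` A \<inter> space P |A. A \<in> sets borel} \<subseteq> P.events" using measurable_sets[OF Xm] by auto
      fix a b assume a: "a \<in> sets (G s)" and "b \<in> {(\<lambda>w. B t w - B s w) -` A \<inter> space P |A. A \<in> sets borel}"
      then obtain C where C: "b = (\<lambda>w. B t w - B s w) -` C \<inter> space P" "C \<in> sets borel" by auto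
      have "emeasure P (a \<inter> b) = emeasure P a * emeasure P b" unfolding C(1) main[OF st a C(2)] law[OF C(2)] ..
      then show "P.prob (a \<inter> b) = P.prob a * P.prob b" by (simp add: measure_def enn2real_mult)
    qed
  qed (use assms in auto)
qed

section \<open>Disintegration of Q over the total maximum\<close>

context penalised
begin

lemma tm_pair_measurable: "0 \<le> t \<Longrightarrow> (\<lambda>w. (w, tm w)) \<in> measurable Q (\<F> t \<Otimes>\<^sub>M borel)"
  by (intro measurable_Pair tm_measurable measurable_filt_Q[of t]) auto

lemma prob_restr: "0 \<le> t \<Longrightarrow> prob_space (restr t)"
  by (rule prob_space_restr)

lemma nn_integral_restr: "0 \<le> t \<Longrightarrow> f \<in> borel_measurable (\<F> t) \<Longrightarrow> (\<integral>\<^sup>+w. f w \<partial>restr t) = (\<integral>\<^sup>+w. f w \<partial>P0)"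
  unfolding restr_def by (subst nn_integral_distr[OF id_measurable_G]) auto

lemma integral_restr:
  fixes f :: "path \<Rightarrow> 'b::{banach, second_countable_topology}"
  shows "0 \<le> t \<Longrightarrow> f \<in> borel_measurable (\<F> t) \<Longrightarrow> (\<integral>w. f w \<partial>restr t) = (\<integral>w. f w \<partial>P0)"
  unfolding restr_def by (rule integral_distr[OF id_measurable_G])

lemma sets_restr_pair: "sets (restr t \<Otimes>\<^sub>M \<nu>) = sets (\<F> t \<Otimes>\<^sub>M borel)"
  by (simp add: sets_\<nu> cong: sets_pair_measure_cong)

text \<open>On rectangles this is \<open>tm_law\<close>. It reduces conditioning on the total
  maximum to freezing the second coordinate of a product.\<close>

theorem joint_law:
  assumes t: "0 \<le> t"
  shows "distr Q (\<F> t \<Otimes>\<^sub>M borel) (\<lambda>w. (w, tm w)) = density (restr t \<Otimes>\<^sub>M \<nu>) (\<lambda>z. ennreal (M (snd z) t (fst z)))"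
proof -
  interpret R: prob_space "restr t" by (rule prob_restr[OF t])
  interpret RN: pair_sigma_finite "restr t" \<nu> by unfold_locales
  have Mm [measurable]: "(\<lambda>z. M (snd z) t (fst z)) \<in> borel_measurable (restr t \<Otimes>\<^sub>M \<nu>)"
    using M_measurable_joint[OF t] measurable_cong_sets[OF sets_restr_pair refl] by blast
  let ?E = "{A \<times> C | A (C :: real set). A \<in> sets (\<F> t) \<and> C \<in> sets borel}"
  show ?thesis
  proof (rule measure_eqI_generator_eq[OF Int_stable_pair_measure_generator, where \<Omega>="space (\<F> t) \<times> space borel" and A="\<lambda>_. space (\<F> t) \<times> space borel"])
    show "?E \<subseteq> Pow (space (\<F> t) \<times> space (borel :: real measure))"
      by (rule pair_measure_closed)
    show "sets (distr Q (\<F> t \<Otimes>\<^sub>M borel) (\<lambda>w. (w, tm w))) = sigma_sets (space (\<F> t) \<times> space borel) ?E"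
      by (simp add: sets_pair_measure)
    show "sets (density (restr t \<Otimes>\<^sub>M \<nu>) (\<lambda>z. ennreal (M (snd z) t (fst z)))) = sigma_sets (space (\<F> t) \<times> space borel) ?E"
      unfolding sets_density sets_restr_pair by (simp add: sets_pair_measure)
    show "range (\<lambda>_::nat. space (\<F> t) \<times> space borel) \<subseteq> ?E" by blast
    show "emeasure (distr Q (\<F> t \<Otimes>\<^sub>M borel) (\<lambda>w. (w, tm w))) (space (\<F> t) \<times> space borel) \<noteq> \<infinity>" for i :: nat
    proof -
      interpret D: prob_space "distr Q (\<F> t \<Otimes>\<^sub>M borel) (\<lambda>w. (w, tm w))" by (rule Q.prob_space_distr[OF tm_pair_measurable[OF t]])
      show ?thesis using D.emeasure_finite by simp
    qed
    fix X assume "X \<in> ?E"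
    then obtain A C where X: "X = A \<times> C" "A \<in> sets (\<F> t)" "C \<in> sets borel" by auto
    have XS: "X \<in> sets (\<F> t \<Otimes>\<^sub>M borel)" using X by auto
    have XR [measurable]: "X \<in> sets (restr t \<Otimes>\<^sub>M \<nu>)" using XS sets_restr_pair by simp
    have "emeasure (distr Q (\<F> t \<Otimes>\<^sub>M borel) (\<lambda>w. (w, tm w))) X = emeasure Q ((\<lambda>w. (w, tm w)) -` X \<inter> space Q)"
      by (rule emeasure_distr[OF tm_pair_measurable[OF t] XS])
    also have "(\<lambda>w. (w, tm w)) -` X \<inter> space Q = A \<inter> (tm -` C \<inter> path_space)" using X by auto
    also have "emeasure Q \<dots> = (\<integral>\<^sup>+a. indicator C a * mass A t a \<partial>\<nu>)"
      by (rule tm_law[OF t X(2,3)])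
    also have "\<dots> = (\<integral>\<^sup>+a. (\<integral>\<^sup>+w. ennreal (M a t w) * indicator X (w, a) \<partial>restr t) \<partial>\<nu>)"
    proof (rule nn_integral_cong)
      fix a
      have [measurable]: "M a t \<in> borel_measurable (\<F> t)" "A \<in> sets (\<F> t)" using X t by (auto intro: M_measurable_filt)
      have m1: "(\<lambda>w. indicator A w * ennreal (M a t w)) \<in> borel_measurable (\<F> t)" by measurable
      have "indicator C a * mass A t a = indicator C a * (\<integral>\<^sup>+w. indicator A w * ennreal (M a t w) \<partial>restr t)"
        unfolding nn_integral_restr[OF t m1] ..
      also have "\<dots> = (\<integral>\<^sup>+w. indicator C a * (indicator A w * ennreal (M a t w)) \<partial>restr t)"
        by (rule nn_integral_cmult[symmetric]) (use m1 in simp)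
      also have "\<dots> = (\<integral>\<^sup>+w. ennreal (M a t w) * indicator X (w, a) \<partial>restr t)"
        by (intro nn_integral_cong) (auto simp: X split: split_indicator)
      finally show "indicator C a * mass A t a = (\<integral>\<^sup>+w. ennreal (M a t w) * indicator X (w, a) \<partial>restr t)" .
    qed
    also have "\<dots> = (\<integral>\<^sup>+z. ennreal (M (snd z) t (fst z)) * indicator X z \<partial>(restr t \<Otimes>\<^sub>M \<nu>))"
    proof -
      have "(\<lambda>z. ennreal (M (snd z) t (fst z)) * indicator X z) \<in> borel_measurable (restr t \<Otimes>\<^sub>M \<nu>)" by measurable
      from RN.nn_integral_snd[OF this] show ?thesis by simp
    qed
    also have "\<dots> = emeasure (density (restr t \<Otimes>\<^sub>M \<nu>) (\<lambda>z. ennreal (M (snd z) t (fst z)))) X"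
      by (rule emeasure_density[symmetric]) measurable
    finally show "emeasure (distr Q (\<F> t \<Otimes>\<^sub>M borel) (\<lambda>w. (w, tm w))) X = emeasure (density (restr t \<Otimes>\<^sub>M \<nu>) (\<lambda>z. ennreal (M (snd z) t (fst z)))) X" .
  qed auto
qed

lemma Q_nn_integral:
  assumes t: "0 \<le> t" and f: "f \<in> borel_measurable (\<F> t \<Otimes>\<^sub>M borel)"
  shows "(\<integral>\<^sup>+w. f (w, tm w) \<partial>Q) = (\<integral>\<^sup>+a. (\<integral>\<^sup>+w. ennreal (M a t w) * f (w, a) \<partial>P0) \<partial>\<nu>)"
proof -
  interpret R: prob_space "restr t" by (rule prob_restr[OF t])
  interpret RN: pair_sigma_finite "restr t" \<nu> by unfold_locales
  have Mm [measurable]: "(\<lambda>z. M (snd z) t (fst z)) \<in> borel_measurable (restr t \<Otimes>\<^sub>M \<nu>)" and fR [measurable]: "f \<in> borel_measurable (restr t \<Otimes>\<^sub>M \<nu>)"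
    using M_measurable_joint[OF t] f measurable_cong_sets[OF sets_restr_pair refl] by blast+
  have "(\<integral>\<^sup>+w. f (w, tm w) \<partial>Q) = (\<integral>\<^sup>+z. f z \<partial>distr Q (\<F> t \<Otimes>\<^sub>M borel) (\<lambda>w. (w, tm w)))"
    by (rule nn_integral_distr[OF tm_pair_measurable[OF t], symmetric]) (use f in simp)
  also have "\<dots> = (\<integral>\<^sup>+z. ennreal (M (snd z) t (fst z)) * f z \<partial>(restr t \<Otimes>\<^sub>M \<nu>))"
    unfolding joint_law[OF t] by (rule nn_integral_density) measurable
  also have "\<dots> = (\<integral>\<^sup>+a. (\<integral>\<^sup>+w. ennreal (M a t w) * f (w, a) \<partial>restr t) \<partial>\<nu>)"
  proof -
    have "(\<lambda>z. ennreal (M (snd z) t (fst z)) * f z) \<in> borel_measurable (restr t \<Otimes>\<^sub>M \<nu>)" by measurable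
    from RN.nn_integral_snd[OF this] show ?thesis by simp
  qed
  also have "\<dots> = (\<integral>\<^sup>+a. (\<integral>\<^sup>+w. ennreal (M a t w) * f (w, a) \<partial>P0) \<partial>\<nu>)"
  proof (intro nn_integral_cong nn_integral_restr[OF t])
    fix a
    have [measurable]: "M a t \<in> borel_measurable (\<F> t)" using t by (auto intro: M_measurable_filt)
    have [measurable]: "(\<lambda>w. f (w, a)) \<in> borel_measurable (\<F> t)"
      by (rule measurable_compose[OF _ f]) measurable
    show "(\<lambda>w. ennreal (M a t w) * f (w, a)) \<in> borel_measurable (\<F> t)" by measurable
  qed
  finally show ?thesis .
qed

lemma Q_integral:
  fixes f :: "path \<times> real \<Rightarrow> complex"
  assumes t: "0 \<le> t" and f: "f \<in> borel_measurable (\<F> t \<Otimes>\<^sub>M borel)"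
    and int: "integrable Q (\<lambda>w. f (w, tm w))"
  shows "(\<integral>w. f (w, tm w) \<partial>Q) = (\<integral>a. (\<integral>w. M a t w *\<^sub>R f (w, a) \<partial>P0) \<partial>\<nu>)"
proof -
  interpret R: prob_space "restr t" by (rule prob_restr[OF t])
  interpret RN: pair_sigma_finite "restr t" \<nu> by unfold_locales
  have Mm [measurable]: "(\<lambda>z. M (snd z) t (fst z)) \<in> borel_measurable (restr t \<Otimes>\<^sub>M \<nu>)" and fR [measurable]: "f \<in> borel_measurable (restr t \<Otimes>\<^sub>M \<nu>)"
    using M_measurable_joint[OF t] f measurable_cong_sets[OF sets_restr_pair refl] by blast+
  have nn: "AE z in restr t \<Otimes>\<^sub>M \<nu>. 0 \<le> M (snd z) t (fst z)"
  proof (rule RN.AE_pair_measure)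
    show "{z \<in> space (restr t \<Otimes>\<^sub>M \<nu>). 0 \<le> M (snd z) t (fst z)} \<in> sets (restr t \<Otimes>\<^sub>M \<nu>)" by measurable
    show "AE x in restr t. AE y in \<nu>. 0 \<le> M (snd (x, y)) t (fst (x, y))"
      using AE_space
    proof eventually_elim
      case (elim x)
      then have "x \<in> path_space" by simp
      from \<nu>_pos show ?case by eventually_elim (simp add: M_nonneg[OF _ \<open>x \<in> path_space\<close> t])
    qed
  qed
  have "integrable (distr Q (\<F> t \<Otimes>\<^sub>M borel) (\<lambda>w. (w, tm w))) f"
    using int by (subst integrable_distr_eq[OF tm_pair_measurable[OF t] f])
  then have i: "integrable (restr t \<Otimes>\<^sub>M \<nu>) (\<lambda>z. M (snd z) t (fst z) *\<^sub>R f z)"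
    unfolding joint_law[OF t] by (subst (asm) integrable_density) (use nn in auto)
  have "(\<integral>w. f (w, tm w) \<partial>Q) = (\<integral>z. f z \<partial>distr Q (\<F> t \<Otimes>\<^sub>M borel) (\<lambda>w. (w, tm w)))"
    by (rule integral_distr[OF tm_pair_measurable[OF t] f, symmetric])
  also have "\<dots> = (\<integral>z. M (snd z) t (fst z) *\<^sub>R f z \<partial>(restr t \<Otimes>\<^sub>M \<nu>))"
    unfolding joint_law[OF t] using nn by (intro integral_density) auto
  also have "\<dots> = (\<integral>a. (\<integral>w. M a t w *\<^sub>R f (w, a) \<partial>restr t) \<partial>\<nu>)"
    using RN.integral_snd[of "\<lambda>x y. M y t x *\<^sub>R f (x, y)"] i by (simp add: split_beta')
  also have "\<dots> = (\<integral>a. (\<integral>w. M a t w *\<^sub>R f (w, a) \<partial>P0) \<partial>\<nu>)"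
  proof (rule Bochner_Integration.integral_cong[OF refl], rule integral_restr[OF t])
    fix a
    have [measurable]: "M a t \<in> borel_measurable (\<F> t)" using t by (auto intro: M_measurable_filt)
    have [measurable]: "(\<lambda>w. f (w, a)) \<in> borel_measurable (\<F> t)"
      by (rule measurable_compose[OF _ f]) measurable
    show "(\<lambda>w. M a t w *\<^sub>R f (w, a)) \<in> borel_measurable (\<F> t)" by measurable
  qed
  finally show ?thesis .
qed

text \<open>The section of C at a level a is an event of \<open>\<F> s\<close>, so
  \<open>M_girsanov\<close> applies for almost every a; integrating over \<nu> puts the random total
  maximum in place of a. Letting C involve the second coordinate is what covers the initial
  enlargement by the total maximum.\<close>

theorem Q_girsanov:
  assumes st: "0 \<le> s" "s \<le> t" and C: "C \<in> sets (\<F> s \<Otimes>\<^sub>M borel)"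
  shows "(CLINT w|Q. indicator C (w, tm w) * iexp (u * (coord t w - coord s w + drift (tm w) s t w)))
    = of_real (exp (- u\<^sup>2 * (t - s) / 2) * measure Q {w \<in> path_space. (w, tm w) \<in> C})"
proof -
  have t: "0 \<le> t" using st by simp
  have sub: "sets (\<F> s \<Otimes>\<^sub>M borel) \<subseteq> sets (\<F> t \<Otimes>\<^sub>M (borel :: real measure))"
    unfolding sets_pair_measure space_canon_filt using canon_filt_mono[OF st(2)] by (intro sigma_sets_mono') auto
  have Ct [measurable]: "C \<in> sets (\<F> t \<Otimes>\<^sub>M borel)" using C sub by auto
  have [measurable]: "coord s \<in> borel_measurable (\<F> t)" "coord t \<in> borel_measurable (\<F> t)"
    using st by (auto intro: measurable_coord_filt)
  have [measurable]: "(\<lambda>z. drift (snd z) s t (fst z)) \<in> borel_measurable (\<F> t \<Otimes>\<^sub>M borel)"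
    by (rule drift_measurable[OF st])
  define f where "f z = indicator C z * iexp (u * (coord t (fst z) - coord s (fst z) + drift (snd z) s t (fst z)))" for z
  have f [measurable]: "f \<in> borel_measurable (\<F> t \<Otimes>\<^sub>M borel)" unfolding f_def by measurable
  have i1: "integrable Q (\<lambda>w. f (w, tm w))"
  proof (rule Q.integrable_const_bound[of _ 1])
    show "AE w in Q. norm (f (w, tm w)) \<le> 1"
      by (intro AE_I2) (simp add: f_def norm_mult indicator_def)
    show "(\<lambda>w. f (w, tm w)) \<in> borel_measurable Q"
      by (rule measurable_compose[OF tm_pair_measurable[OF t] f])
  qed
  have g: "(\<lambda>z. indicator C z :: complex) \<in> borel_measurable (\<F> s \<Otimes>\<^sub>M borel)" using C by measurable
  have i2: "integrable Q (\<lambda>w. indicator C (w, tm w) :: complex)"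
  proof (rule Q.integrable_const_bound[of _ 1])
    show "AE w in Q. norm (indicator C (w, tm w) :: complex) \<le> 1"
      by (intro AE_I2) (simp add: indicator_def)
    show "(\<lambda>w. indicator C (w, tm w) :: complex) \<in> borel_measurable Q"
      by (rule measurable_compose[OF tm_pair_measurable[OF st(1)] g])
  qed
  have "(CLINT w|Q. f (w, tm w)) = (\<integral>a. (\<integral>w. M a t w *\<^sub>R f (w, a) \<partial>P0) \<partial>\<nu>)"
    by (rule Q_integral[OF t f i1])
  also have "\<dots> = (\<integral>a. of_real (exp (- u\<^sup>2 * (t - s) / 2)) * (\<integral>w. M a s w *\<^sub>R indicator C (w, a) \<partial>P0) \<partial>\<nu>)"
  proof (rule integral_cong_AE)
    show "AE a in \<nu>. (\<integral>w. M a t w *\<^sub>R f (w, a) \<partial>P0) = complex_of_real (exp (- u\<^sup>2 * (t - s) / 2)) * (\<integral>w. M a s w *\<^sub>R indicator C (w, a) \<partial>P0)"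
      using M_mass_integral[OF st(1)] M_mass_integral[OF t] \<nu>_pos
    proof eventually_elim
      case (elim a)
      define \<Gamma> where "\<Gamma> = (\<lambda>w. (w, a)) -` C \<inter> space (\<F> s)"
      have \<Gamma>: "\<Gamma> \<in> sets (\<F> s)" unfolding \<Gamma>_def by (rule measurable_sets[OF _ C]) measurable
      have ind: "indicator C (w, a) = indicator \<Gamma> w" if "w \<in> space P0" for w
        using that by (auto simp: \<Gamma>_def split: split_indicator)
      have "(\<integral>w. M a t w *\<^sub>R f (w, a) \<partial>P0) = (CLINT w|P0. of_real (indicator \<Gamma> w * M a t w) * iexp (u * (coord t w - coord s w + drift a s t w)))"
        by (intro Bochner_Integration.integral_cong) (auto simp: f_def ind scaleR_conv_of_real split: split_indicator)
      also have "\<dots> = of_real (exp (- u\<^sup>2 * (t - s) / 2) * (\<integral>w. indicator \<Gamma> w * M a s w \<partial>P0))"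
        using elim by (intro M_girsanov(1)[OF st elim(3) \<Gamma>]) simp
      also have "\<dots> = of_real (exp (- u\<^sup>2 * (t - s) / 2)) * (CLINT w|P0. of_real (indicator \<Gamma> w * M a s w))"
        by (subst of_real_mult) (simp only: integral_complex_of_real)
      also have "(CLINT w|P0. of_real (indicator \<Gamma> w * M a s w)) = (\<integral>w. M a s w *\<^sub>R indicator C (w, a) \<partial>P0)"
        by (intro Bochner_Integration.integral_cong) (auto simp: ind scaleR_conv_of_real split: split_indicator)
      finally show ?case .
    qed
    have fm: "(\<lambda>a. \<integral>w. g (w, a) \<partial>P0) \<in> borel_measurable \<nu>" if "g \<in> borel_measurable (P0 \<Otimes>\<^sub>M \<nu>)" for g :: "path \<times> real \<Rightarrow> complex"
      using measurable_compose[OF measurable_pair_swap' that]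
      by (intro borel_measurable_lebesgue_integral) (simp add: split_beta')
    have [measurable]: "(\<lambda>z. M (snd z) t (fst z)) \<in> borel_measurable (\<F> t \<Otimes>\<^sub>M borel)"
      "(\<lambda>z. M (snd z) s (fst z)) \<in> borel_measurable (\<F> s \<Otimes>\<^sub>M borel)"
      using M_measurable_joint t st by auto
    have "(\<lambda>z. M (snd z) t (fst z) *\<^sub>R f z) \<in> borel_measurable (\<F> t \<Otimes>\<^sub>M borel)" by measurable
    from fm[OF filt_to_P0[OF t this]] show "(\<lambda>a. \<integral>w. M a t w *\<^sub>R f (w, a) \<partial>P0) \<in> borel_measurable \<nu>" by simp
    have "(\<lambda>z. M (snd z) s (fst z) *\<^sub>R (indicator C z :: complex)) \<in> borel_measurable (\<F> s \<Otimes>\<^sub>M borel)" using g by measurable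
    from fm[OF filt_to_P0[OF st(1) this]]
    show "(\<lambda>a. complex_of_real (exp (- u\<^sup>2 * (t - s) / 2)) * (\<integral>w. M a s w *\<^sub>R indicator C (w, a) \<partial>P0)) \<in> borel_measurable \<nu>"
      by (intro borel_measurable_times borel_measurable_const) simp
  qed
  also have "\<dots> = of_real (exp (- u\<^sup>2 * (t - s) / 2)) * (CLINT w|Q. indicator C (w, tm w))"
    unfolding Q_integral[OF st(1) g i2] by simp
  also have "(CLINT w|Q. indicator C (w, tm w)) = (CLINT w|Q. of_real (indicator {w \<in> path_space. (w, tm w) \<in> C} w))"
    by (intro Bochner_Integration.integral_cong) (auto split: split_indicator)
  also have "\<dots> = of_real (measure Q {w \<in> path_space. (w, tm w) \<in> C})"
  proof -
    have "{w \<in> path_space. (w, tm w) \<in> C} = (\<lambda>w. (w, tm w)) -` C \<inter> space Q" by auto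
    also have "\<dots> \<in> sets Q" by (rule measurable_sets[OF tm_pair_measurable[OF st(1)] C])
    moreover have "{w \<in> path_space. (w, tm w) \<in> C} \<inter> path_space = {w \<in> path_space. (w, tm w) \<in> C}" by auto
    ultimately show ?thesis unfolding integral_complex_of_real by simp
  qed
  finally show ?thesis unfolding f_def by simp
qed

subsection \<open>Path properties under the penalised measure\<close>

text \<open>\<open>null_at_time\<close> turns the exceptional set into a null event of
  \<open>\<F> n\<close>, where Q has a density; on \<open>canon_alg\<close> itself a P0-null set may
  have positive Q-measure.\<close>

lemma transfer_AE:
  assumes n: "0 \<le> n" and ae: "AE w in P0. \<Phi> w"
    and dep: "\<And>w w'. w \<in> path_space \<Longrightarrow> w' \<in> path_space \<Longrightarrow>
      (\<And>r. 0 \<le> r \<Longrightarrow> r \<le> n \<Longrightarrow> coord r w = coord r w') \<Longrightarrow> \<Phi> w \<Longrightarrow> \<Phi> w'"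
  shows "AE w in Q. \<Phi> w"
proof -
  have "\<exists>N\<in>sets (\<F> n). emeasure P0 N = 0 \<and> (\<forall>w\<in>path_space. w \<notin> N \<longrightarrow> \<Phi> w)"
    by (rule null_at_time[OF n ae]) (rule dep)
  then obtain N where N: "N \<in> sets (\<F> n)" "emeasure P0 N = 0" "\<forall>w\<in>path_space. w \<notin> N \<longrightarrow> \<Phi> w"
    by (elim bexE conjE)
  have NP: "N \<in> sets P0" using N(1) sets_G_subset[OF n] by blast
  have z: "mass N n a = 0" for a
  proof -
    have "AE w in P0. w \<notin> N" using NP N(2) by (intro AE_not_in) (simp add: null_sets_def)
    then have "mass N n a = (\<integral>\<^sup>+w. 0 \<partial>P0)"
      by (intro nn_integral_cong_AE) (auto elim: eventually_mono)
    then show ?thesis by simp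
  qed
  have "emeasure Q N = 0" unfolding Q_mixture[OF n N(1)] z by simp
  then have "N \<in> null_sets Q" using N(1) sets_filt_Q[OF n] by (auto simp: null_sets_def)
  then show ?thesis using N(3) by (intro AE_I'[of N]) auto
qed

lemma L_cong:
  assumes "w \<in> path_space" "w' \<in> path_space" "\<And>r. 0 \<le> r \<Longrightarrow> r \<le> n \<Longrightarrow> coord r w = coord r w'" "0 \<le> s" "s \<le> n"
  shows "L s w = L s w'"
  by (rule canon_filt_measurable_cong[OF L_measurable_filt[OF \<open>0 \<le> s\<close> order_refl] assms(1,2)]) (use assms in auto)

text \<open>The properties on the window [0, n] depend on the path up to n only, so they can be
  transferred; countably many windows are then reassembled.\<close>

lemma L_regular_Q: "AE w in Q. L 0 w = 0 \<and> continuous_on {0..} (\<lambda>t. L t w) \<and> mono_on {0..} (\<lambda>t. L t w)"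
proof -
  have "AE w in Q. L 0 w = 0 \<and> continuous_on {0..real n} (\<lambda>t. L t w) \<and> mono_on {0..real n} (\<lambda>t. L t w)" for n :: nat
  proof (rule transfer_AE[of "real n"])
    show "AE w in P0. L 0 w = 0 \<and> continuous_on {0..real n} (\<lambda>t. L t w) \<and> mono_on {0..real n} (\<lambda>t. L t w)"
      using L_regular by eventually_elim (auto intro: continuous_on_subset mono_on_subset)
    fix w w' assume w: "w \<in> path_space" "w' \<in> path_space" "\<And>r. 0 \<le> r \<Longrightarrow> r \<le> real n \<Longrightarrow> coord r w = coord r w'"
      and *: "L 0 w = 0 \<and> continuous_on {0..real n} (\<lambda>t. L t w) \<and> mono_on {0..real n} (\<lambda>t. L t w)"
    have eq: "L s w = L s w'" if "0 \<le> s" "s \<le> real n" for s by (rule L_cong[OF w that]) auto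
    have "continuous_on {0..real n} (\<lambda>t. L t w')"
      using * by (subst continuous_on_cong[OF refl, of _ _ "\<lambda>t. L t w"]) (auto simp: eq)
    moreover have "mono_on {0..real n} (\<lambda>t. L t w')"
      using * unfolding mono_on_def by (auto simp: eq[symmetric])
    ultimately show "L 0 w' = 0 \<and> continuous_on {0..real n} (\<lambda>t. L t w') \<and> mono_on {0..real n} (\<lambda>t. L t w')"
      using * eq[of 0] by auto
  qed simp
  then have "AE w in Q. \<forall>n::nat. L 0 w = 0 \<and> continuous_on {0..real n} (\<lambda>t. L t w) \<and> mono_on {0..real n} (\<lambda>t. L t w)"
    unfolding AE_all_countable by blast
  then show ?thesis
  proof eventually_elim
    case (elim w)
    have "continuous_on {0..T} (\<lambda>t. L t w)" for T
    proof -
      obtain n :: nat where "T \<le> real n" using real_arch_simple by blast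
      with elim show ?thesis by (auto intro: continuous_on_subset[of "{0..real n}"])
    qed
    then have "continuous_on {0..} (\<lambda>t. L t w)" by (rule continuous_on_atLeast_of_compacts)
    moreover have "mono_on {0..} (\<lambda>t. L t w)"
    proof (rule mono_onI)
      fix r s :: real assume "r \<in> {0..}" "s \<in> {0..}" "r \<le> s"
      moreover obtain n :: nat where "s \<le> real n" using real_arch_simple by blast
      ultimately show "L r w \<le> L s w" using elim unfolding mono_on_def by (meson atLeastAtMost_iff atLeast_iff order_trans)
    qed
    ultimately show ?case using elim by blast
  qed
qed

lemma zero_set_null_Q: "AE w in Q. AE r in lborel. 0 < r \<longrightarrow> coord r w \<noteq> 0"
proof -
  have "AE w in Q. AE r in lborel. r \<in> {0<..real n} \<longrightarrow> coord r w \<noteq> 0" for n :: nat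
  proof (rule transfer_AE[of "real n"])
    show "AE w in P0. AE r in lborel. r \<in> {0<..real n} \<longrightarrow> coord r w \<noteq> 0"
      using zero_set_null by eventually_elim (auto elim!: eventually_mono)
    fix w w' assume "\<And>r. 0 \<le> r \<Longrightarrow> r \<le> real n \<Longrightarrow> coord r w = coord r w'"
      and "AE r in lborel. r \<in> {0<..real n} \<longrightarrow> coord r w \<noteq> 0"
    then show "AE r in lborel. r \<in> {0<..real n} \<longrightarrow> coord r w' \<noteq> 0"
      by (auto elim!: eventually_mono)
  qed simp
  then have "AE w in Q. \<forall>n::nat. AE r in lborel. r \<in> {0<..real n} \<longrightarrow> coord r w \<noteq> 0"
    unfolding AE_all_countable by blast
  then show ?thesis
  proof eventually_elim
    case (elim w)
    then have "AE r in lborel. \<forall>n::nat. r \<in> {0<..real n} \<longrightarrow> coord r w \<noteq> 0" unfolding AE_all_countable by blast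
    then show ?case
    proof eventually_elim
      case (elim r)
      obtain n :: nat where "r \<le> real n" using real_arch_simple by blast
      with elim show ?case by auto
    qed
  qed
qed

lemma coord_zero_Q: "AE w in Q. coord 0 w = 0"
  by (rule transfer_AE[OF order_refl B_zero]) auto

text \<open>The joint density \<open>M\<close> vanishes where the level is at most the running
  maximum. The strict inequality keeps the denominator tm - |X| away from 0 on bounded time
  intervals.\<close>

lemma run_max_less_tm:
  assumes t: "0 \<le> t"
  shows "AE w in Q. run_max t w < tm w"
proof -
  have [measurable]: "run_max t \<in> borel_measurable (\<F> t)" by (rule measurable_run_max[OF t])
  define f where "f z = (indicator {z. snd z \<le> run_max t (fst z)} z :: ennreal)" for z
  have f: "f \<in> borel_measurable (\<F> t \<Otimes>\<^sub>M borel)" unfolding f_def by measurable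
  have "(\<integral>\<^sup>+w. f (w, tm w) \<partial>Q) = (\<integral>\<^sup>+a. (\<integral>\<^sup>+w. ennreal (M a t w) * f (w, a) \<partial>P0) \<partial>\<nu>)"
    by (rule Q_nn_integral[OF t f])
  also have "\<dots> = (\<integral>\<^sup>+a. (\<integral>\<^sup>+w. 0 \<partial>P0) \<partial>\<nu>)"
    by (intro nn_integral_cong) (auto simp: f_def M_def split: split_indicator)
  finally have "(\<integral>\<^sup>+w. f (w, tm w) \<partial>Q) = 0" by simp
  then have "AE w in Q. f (w, tm w) = 0"
    using measurable_compose[OF tm_pair_measurable[OF t] f] by (subst (asm) nn_integral_0_iff_AE) auto
  then show ?thesis by eventually_elim (auto simp: f_def split: split_indicator_asm)
qed

lemma distr_tm: "distr Q borel tm = \<nu>"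
proof (rule measure_eqI)
  show "sets (distr Q borel tm) = sets \<nu>" by (simp add: sets_\<nu>)
  fix C assume "C \<in> sets (distr Q borel tm)"
  then have C: "C \<in> sets borel" by simp
  have "emeasure (distr Q borel tm) C = emeasure Q (path_space \<inter> (tm -` C \<inter> path_space))"
    using C by (subst emeasure_distr) (auto intro!: arg_cong[where f="emeasure Q"])
  also have "\<dots> = (\<integral>\<^sup>+a. indicator C a * mass path_space 0 a \<partial>\<nu>)"
    using sets.top[of "\<F> 0"] C by (intro tm_law) auto
  also have "\<dots> = (\<integral>\<^sup>+a. indicator C a \<partial>\<nu>)"
  proof (rule nn_integral_cong_AE)
    show "AE a in \<nu>. indicator C a * mass path_space 0 a = indicator C a"
      using M_mass[OF order_refl]
    proof eventually_elim
      case (elim a)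
      have "mass path_space 0 a = (\<integral>\<^sup>+w. ennreal (M a 0 w) \<partial>P0)"
        by (intro nn_integral_cong) auto
      then show ?case using elim by simp
    qed
  qed
  also have "\<dots> = emeasure \<nu> C" using C by (intro nn_integral_indicator) (simp add: sets_\<nu>)
  finally show "emeasure (distr Q borel tm) C = emeasure \<nu> C" .
qed

text \<open>Where L <= K, each component has a bounded density, and it charges only paths with |X_n|
  <= a, an event of P0-probability of order n^(-1/2). So every component loses its mass on L_n <= K,
  and domination by 1 carries this over to the mixture.\<close>

lemma local_time_unbounded: "AE w in Q. \<exists>n::nat. K < L (real n) w"
proof -
  define A where "A n = {w \<in> path_space. L (real n) w \<le> K}" for n :: nat
  have A: "A n \<in> sets (\<F> (real n))" for n
  proof -
    have [measurable]: "L (real n) \<in> borel_measurable (\<F> (real n))" by (intro L_measurable_filt) auto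
    have "{w \<in> space (\<F> (real n)). L (real n) w \<le> K} \<in> sets (\<F> (real n))" by measurable
    then show ?thesis by (simp add: A_def)
  qed
  have AQ: "A n \<in> sets Q" for n by (rule subsetD[OF sets_filt_Q A]) simp
  \<comment> \<open>Bounds exp(L / a) uniformly in the levels a >= \<alpha> as long as L <=
    K.\<close>
  define c where "c = exp (\<bar>K\<bar> / \<alpha>)"
  have "(\<lambda>n. \<integral>\<^sup>+a. mass (A (Suc n)) (real (Suc n)) a \<partial>\<nu>) \<longlonglongrightarrow> (\<integral>\<^sup>+a. 0 \<partial>\<nu>)"
  proof (rule nn_integral_dominated_convergence[where w="\<lambda>_. 1"])
    show "(\<integral>\<^sup>+a. 1 \<partial>\<nu>) < \<infinity>" using N.emeasure_space_1 by simp
    fix n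
    show "mass (A (Suc n)) (real (Suc n)) \<in> borel_measurable \<nu>" by (rule mass_measurable[OF _ A]) simp
    show "AE a in \<nu>. mass (A (Suc n)) (real (Suc n)) a \<le> 1"
      using \<nu>_pos by eventually_elim (rule mass_le, auto)
  next
    show "AE a in \<nu>. (\<lambda>n. \<integral>\<^sup>+w. indicator (A (Suc n)) w * ennreal (M a (real (Suc n)) w) \<partial>P0) \<longlonglongrightarrow> 0"
      using \<nu>_ge
    proof eventually_elim
      case (elim a)
      then have a: "0 < a" using \<alpha> by simp
      have le: "mass (A (Suc n)) (real (Suc n)) a \<le> ennreal (c * a / sqrt (real (Suc n)))" for n
      proof -
        have n: "0 < real (Suc n)" by simp
        have [measurable]: "coord (real (Suc n)) \<in> borel_measurable P0" by (intro B_measurable) simp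
        have "mass (A (Suc n)) (real (Suc n)) a \<le> (\<integral>\<^sup>+w. ennreal c * indicator {w \<in> space P0. \<bar>coord (real (Suc n)) w\<bar> \<le> a} w \<partial>P0)"
        proof (rule nn_integral_mono)
          fix w assume "w \<in> space P0"
          then have w: "w \<in> path_space" by simp
          show "indicator (A (Suc n)) w * ennreal (M a (real (Suc n)) w) \<le> ennreal c * indicator {w \<in> space P0. \<bar>coord (real (Suc n)) w\<bar> \<le> a} w"
          proof (cases "w \<in> A (Suc n) \<and> run_max (real (Suc n)) w < a")
            case True
            have X: "\<bar>coord (real (Suc n)) w\<bar> \<le> a" using abs_coord_le_run_max[OF w, of "real (Suc n)" "real (Suc n)"] True by simp
            have "L (real (Suc n)) w \<le> \<bar>K\<bar>" using True unfolding A_def by auto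
            from Y_le[OF a this] have "Y a (real (Suc n)) w \<le> exp (\<bar>K\<bar> / a)" using Y_pos[OF a w, of "real (Suc n)"] True by simp
            also have "\<dots> \<le> c" unfolding c_def using elim \<alpha> by (simp add: divide_left_mono)
            finally have "ennreal (M a (real (Suc n)) w) \<le> ennreal c" using True by (intro ennreal_leI) (simp add: M_def)
            then show ?thesis using True X w by simp
          next
            case False
            then have "indicator (A (Suc n)) w * ennreal (M a (real (Suc n)) w) = 0" by (auto simp: M_def split: split_indicator)
            then show ?thesis by (simp only: zero_le)
          qed
        qed
        also have "\<dots> = ennreal c * emeasure P0 {w \<in> space P0. \<bar>coord (real (Suc n)) w\<bar> \<le> a}"
          by (rule nn_integral_cmult_indicator) measurable
        also have "\<dots> \<le> ennreal c * ennreal (a / sqrt (real (Suc n)))"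
          using a by (intro mult_left_mono small_ball) auto
        also have "\<dots> = ennreal (c * a / sqrt (real (Suc n)))"
          using a by (subst ennreal_mult[symmetric]) (auto simp: c_def)
        finally show ?thesis .
      qed
      have "(\<lambda>n. ennreal (c * a / sqrt (real (Suc n)))) \<longlonglongrightarrow> ennreal 0"
        by (intro tendsto_ennrealI tendsto_const_div_sqrt_Suc)
      then have u: "(\<lambda>n. ennreal (c * a / sqrt (real (Suc n)))) \<longlonglongrightarrow> 0" by simp
      show ?case
        by (rule tendsto_sandwich[OF _ _ tendsto_const u]) (use le in auto)
    qed
  qed auto
  then have lim: "(\<lambda>n. emeasure Q (A (Suc n))) \<longlonglongrightarrow> 0"
    using Q_mixture[OF _ A] by simp
  have "emeasure Q (\<Inter>n. A (Suc n)) \<le> emeasure Q (A (Suc n))" for n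
    using AQ by (intro emeasure_mono) auto
  then have "emeasure Q (\<Inter>n. A (Suc n)) \<le> 0"
    by (intro LIMSEQ_le_const[OF lim]) auto
  then have "(\<Inter>n. A (Suc n)) \<in> null_sets Q"
    using AQ by (auto simp: null_sets_def intro!: sets.countable_INT)
  from AE_not_in[OF this] AE_space show ?thesis
  proof eventually_elim
    case (elim w)
    then obtain n where "w \<notin> A (Suc n)" by blast
    then have "K < L (real (Suc n)) w" using elim(2) unfolding A_def by auto
    then show ?case by blast
  qed
qed

lemma local_time_infinite: "AE w in Q. filterlim (\<lambda>t. L t w) at_top at_top"
proof -
  have "AE w in Q. \<forall>k::nat. \<exists>n::nat. real k < L (real n) w"
    unfolding AE_all_countable using local_time_unbounded by blast
  with L_regular_Q show ?thesis
  proof eventually_elim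
    case (elim w)
    show ?case unfolding filterlim_at_top
    proof
      fix c :: real
      obtain k :: nat where k: "c \<le> real k" using real_arch_simple by blast
      obtain n :: nat where n: "real k < L (real n) w" using elim by blast
      show "\<forall>\<^sub>F x in at_top. c \<le> L x w"
        using eventually_ge_at_top[of "real n"]
      proof eventually_elim
        case (elim x)
        have "L (real n) w \<le> L x w"
          using \<open>L 0 w = 0 \<and> _ \<and> mono_on {0..} _\<close> elim by (auto simp: mono_on_def)
        then show ?case using k n by simp
      qed
    qed
  qed
qed

end

section \<open>The enlarged filtration\<close>

lemma set_integral_split_at:
  fixes f :: "real \<Rightarrow> real"
  assumes "set_integrable lborel {a..c} f" "a \<le> b" "b \<le> c"
  shows "(LINT r:{a..c}|lborel. f r) = (LINT r:{a..b}|lborel. f r) + (LINT r:{b..c}|lborel. f r)"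
proof -
  have "set_integrable lborel {a..b} f" "set_integrable lborel {b..c} f"
    using assms by (auto intro: set_integrable_subset)
  then show ?thesis
    using assms Henstock_Kurzweil_Integration.integral_combine[of a b c f]
    by (simp add: set_borel_integral_eq_integral)
qed

lemma continuous_set_integral:
  fixes f :: "real \<Rightarrow> real"
  assumes int: "\<And>T. 0 \<le> T \<Longrightarrow> set_integrable lborel {0..T} f"
  shows "continuous_on {0..} (\<lambda>t. LINT r:{0..t}|lborel. f r)"
proof (rule continuous_on_atLeast_of_compacts)
  fix T :: real assume "0 \<le> T"
  have "continuous_on {0..T} (\<lambda>t. integral {0..t} f)"
    by (intro indefinite_integral_continuous_1 set_borel_integral_eq_integral int) fact
  then show "continuous_on {0..T} (\<lambda>t. LINT r:{0..t}|lborel. f r)"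
    by (rule continuous_on_eq) (auto simp: set_borel_integral_eq_integral int)
qed

lemma set_integrable_of_path:
  fixes g :: "real \<Rightarrow> real"
  assumes w: "w \<in> path_space" and s: "0 \<le> s" and g: "g \<in> borel_measurable borel"
    and le: "\<And>r. r \<in> {s..t} \<Longrightarrow> \<bar>g (coord r w)\<bar> \<le> K"
  shows "set_integrable lborel {s..t} (\<lambda>r. g (coord r w))"
proof -
  have [measurable]: "(\<lambda>r. coord (max 0 r) w) \<in> borel_measurable borel" by (rule path_measurable[OF w])
  note [measurable] = g
  have "set_integrable lborel {s..t} (\<lambda>r. g (coord (max 0 r) w))"
  proof (rule set_integrable_bound[where f="\<lambda>_. K"])
    show "set_integrable lborel {s..t} (\<lambda>_. K)" by (intro borel_integrable_atLeastAtMost' continuous_on_const)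
    show "set_borel_measurable lborel {s..t} (\<lambda>r. g (coord (max 0 r) w))"
      unfolding set_borel_measurable_def by measurable
    show "AE r in lborel. r \<in> {s..t} \<longrightarrow> norm (g (coord (max 0 r) w)) \<le> norm K"
      using le s by (intro AE_I2) (force simp: max_def intro: order_trans[OF _ abs_ge_self])
  qed
  then show ?thesis unfolding set_integrable_def
    by (rule Bochner_Integration.integrable_cong[THEN iffD1, rotated -1]) (use s in \<open>auto simp: max_def split: split_indicator\<close>)
qed

section \<open>Good paths and the initially enlarged \<sigma>-algebras\<close>

context penalised
begin

text \<open>A single event of full Q-measure on which all pathwise identities hold. Off it,
  \<open>Bt\<close> and \<open>Bh\<close> are set to 0, so that their paths are continuous
  everywhere, as \<open>brownian_motion_wrt\<close> demands.\<close>

definition good :: "path \<Rightarrow> bool" where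
  "good w \<longleftrightarrow> w \<in> path_space \<and> total_max w < \<infinity> \<and> coord 0 w = 0 \<and> (\<forall>n::nat. run_max (real n) w < tm w) \<and>
     L 0 w = 0 \<and> continuous_on {0..} (\<lambda>t. L t w)"

lemma AE_good: "AE w in Q. good w"
proof -
  have "AE w in Q. \<forall>n::nat. run_max (real n) w < tm w"
    unfolding AE_all_countable using run_max_less_tm by simp
  with AE_space[of Q] total_max_finite coord_zero_Q L_regular_Q show ?thesis
    by eventually_elim (auto simp: good_def)
qed

text \<open>The running maximum at an integer beyond T serves as b; being strictly below tm, it
  bounds the singular kernels on [0, T].\<close>

lemma good_bound:
  assumes "good w"
  obtains b where "b < tm w" "\<And>r. r \<in> {0..T} \<Longrightarrow> \<bar>coord r w\<bar> \<le> b"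
proof -
  obtain n :: nat where n: "T \<le> real n" using real_arch_simple by blast
  show ?thesis
    by (rule that[of "run_max (real n) w"]) (use assms n in \<open>auto simp: good_def intro: abs_coord_le_run_max\<close>)
qed

lemma good_integrable:
  assumes g: "good w" and s: "0 \<le> s"
  shows "set_integrable lborel {s..t} (\<lambda>r. sgn (coord r w) / (tm w - \<bar>coord r w\<bar>))" (is ?A)
    and "set_integrable lborel {s..t} (\<lambda>r. 1 / (tm w - \<bar>coord r w\<bar>))" (is ?B)
proof -
  obtain b where b: "b < tm w" "\<And>r. r \<in> {0..t} \<Longrightarrow> \<bar>coord r w\<bar> \<le> b" using good_bound[OF g, of t] by blast
  have w: "w \<in> path_space" using g by (simp add: good_def)
  have *: "1 / \<bar>tm w - \<bar>coord r w\<bar>\<bar> \<le> 1 / (tm w - b)" if "r \<in> {s..t}" for r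
    using b(1) b(2)[of r] that s by (intro divide_left_mono) auto
  show ?A
    by (rule set_integrable_of_path[OF w s, where g="\<lambda>x. sgn x / (tm w - \<bar>x\<bar>)" and K="1 / (tm w - b)"])
      (use b * in \<open>auto simp: abs_divide abs_sgn_eq\<close>)
  show ?B
    by (rule set_integrable_of_path[OF w s, where g="\<lambda>x. 1 / (tm w - \<bar>x\<bar>)" and K="1 / (tm w - b)"])
      (use b * in \<open>auto simp: abs_divide\<close>)
qed

definition Bt :: "real \<Rightarrow> path \<Rightarrow> real" where
  "Bt t w = (if good w then coord t w + drift (tm w) 0 t w else 0)"

lemma Bt_continuous: "continuous_on {0..} (\<lambda>t. Bt t w)"
proof (cases "good w")
  case True
  then have "w \<in> path_space" by (simp add: good_def)
  then show ?thesis unfolding Bt_def drift_def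
    using True by (simp, intro continuous_on_add path_continuous continuous_set_integral good_integrable) auto
qed (simp add: Bt_def)

lemma Bt_increment:
  assumes "good w" "0 \<le> s" "s \<le> t"
  shows "Bt t w - Bt s w = coord t w - coord s w + drift (tm w) s t w"
  using assms set_integral_split_at[OF good_integrable(1)[OF assms(1) order_refl], of s t]
  by (simp add: Bt_def drift_def)

lemma Bt_zero: "good w \<Longrightarrow> Bt 0 w = 0"
proof -
  assume "good w"
  have "drift (tm w) 0 0 w = 0" using good_integrable(1)[OF \<open>good w\<close>, of 0 0]
    by (simp add: drift_def set_borel_integral_eq_integral)
  then show ?thesis using \<open>good w\<close> by (simp add: Bt_def good_def)
qed

text \<open>\<open>H\<close> is an admissible competitor for the minimal filtration \<open>G\<close>, so \<open>G s \<subseteq> K r\<close> whenever \<open>s < r\<close>.\<close>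

definition K :: "real \<Rightarrow> path measure" where
  "K r = sigma path_space (sets (\<F> r) \<union> sets (vimage_algebra path_space total_max borel) \<union> null_sets (completion Q))"

definition H :: "real \<Rightarrow> path measure" where
  "H t = sigma path_space (\<Inter>r\<in>{max 0 t<..}. sets (K r))"

lemma K_gen: "sets (\<F> r) \<union> sets (vimage_algebra path_space total_max borel) \<union> null_sets (completion Q) \<subseteq> Pow path_space"
proof -
  have "sets (\<F> r) \<subseteq> Pow path_space" using sets.space_closed[of "\<F> r"] by simp
  moreover have "sets (vimage_algebra path_space total_max borel) \<subseteq> Pow path_space"
    using sets.space_closed[of "vimage_algebra path_space total_max borel"] by simp
  moreover have "null_sets (completion Q) \<subseteq> Pow path_space"
    using sets.space_closed[of "completion Q"] null_setsD2 by fastforce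
  ultimately show ?thesis by blast
qed

lemma sets_K: "sets (K r) = sigma_sets path_space (sets (\<F> r) \<union> sets (vimage_algebra path_space total_max borel) \<union> null_sets (completion Q))"
  unfolding K_def by (rule sets_measure_of[OF K_gen])

lemma space_K [simp]: "space (K r) = path_space"
  unfolding K_def by (rule space_measure_of[OF K_gen])

lemma sets_total_max: "sets (vimage_algebra path_space total_max borel) \<subseteq> sets Q"
proof
  fix A assume "A \<in> sets (vimage_algebra path_space total_max borel)"
  then obtain B where B: "B \<in> sets borel" "A = total_max -` B \<inter> path_space"
    by (auto simp: in_vimage_algebra sets_vimage_algebra2)
  have "total_max \<in> borel_measurable Q" using measurable_total_max by simp
  from measurable_sets[OF this B(1)] show "A \<in> sets Q" using B by simp
qed

lemma K_subset: "0 \<le> r \<Longrightarrow> sets (K r) \<subseteq> sets (completion Q)"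
proof -
  assume r: "0 \<le> r"
  have "sigma_sets (space (completion Q)) (sets (\<F> r) \<union> sets (vimage_algebra path_space total_max borel) \<union> null_sets (completion Q)) \<subseteq> sets (completion Q)"
    using sets_filt_Q[OF r] sets_total_max by (intro sets.sigma_sets_subset) auto
  then show ?thesis unfolding sets_K by simp
qed

lemma H_gen: "(\<Inter>r\<in>{max 0 t<..}. sets (K r)) \<subseteq> Pow path_space"
proof -
  have "sets (K (max 0 t + 1)) \<subseteq> Pow path_space" using sets.space_closed[of "K (max 0 t + 1)"] by simp
  then show ?thesis by force
qed

lemma space_H [simp]: "space (H t) = path_space"
  unfolding H_def by (rule space_measure_of[OF H_gen])

lemma sets_H: "sets (H t) = (\<Inter>r\<in>{max 0 t<..}. sets (K r))"
proof -
  have "sigma_sets path_space (\<Inter>r\<in>{max 0 t<..}. sets (K r)) \<subseteq> sets (K r)" if r: "r \<in> {max 0 t<..}" for r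
  proof -
    have "sigma_sets (space (K r)) (\<Inter>r\<in>{max 0 t<..}. sets (K r)) \<subseteq> sets (K r)"
      by (rule sets.sigma_sets_subset) (use r in blast)
    then show ?thesis by simp
  qed
  then have "sigma_sets path_space (\<Inter>r\<in>{max 0 t<..}. sets (K r)) \<subseteq> (\<Inter>r\<in>{max 0 t<..}. sets (K r))" by blast
  then show ?thesis unfolding H_def sets_measure_of[OF H_gen] by (intro antisym) auto
qed

lemma H_usual: "usual_conditions Q H"
  unfolding usual_conditions_def
proof (intro conjI allI impI)
  show "filtration (space Q) H"
  proof
    fix s t :: real assume "s \<le> t"
    then show "sets (H s) \<subseteq> sets (H t)" unfolding sets_H by force
  qed simp
next
  fix t :: real assume t: "0 \<le> t"
  show "subalgebra (completion Q) (H t)"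
    using K_subset[of "t + 1"] t by (auto simp: subalgebra_def sets_H)
  have "null_sets (completion Q) \<subseteq> sets (K r)" for r unfolding sets_K by (auto intro: sigma_sets.Basic)
  then show "null_sets (completion Q) \<subseteq> sets (H t)" unfolding sets_H by blast
  show "(\<Inter>s\<in>{t<..}. sets (H s)) = sets (H t)"
  proof
    show "sets (H t) \<subseteq> (\<Inter>s\<in>{t<..}. sets (H s))" unfolding sets_H by force
    show "(\<Inter>s\<in>{t<..}. sets (H s)) \<subseteq> sets (H t)" unfolding sets_H
    proof (intro subsetI INT_I)
      fix A r assume A: "A \<in> (\<Inter>s\<in>{t<..}. \<Inter>r\<in>{max 0 s<..}. sets (K r))" and r: "r \<in> {max 0 t<..}"
      \<comment> \<open>The midpoint is an intermediate time after t whose own right neighbourhood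
        still contains r.\<close>
      have "(t + r) / 2 \<in> {t<..}" "r \<in> {max 0 ((t + r) / 2)<..}" using r t by auto
      then show "A \<in> sets (K r)" using A by blast
    qed
  qed
qed

text \<open>Induction over the generators: null sets become empty, and total_max is recovered from
  tm on good paths. It brings events of the enlarged filtration into the form that
  \<open>Q_girsanov\<close> handles.\<close>

lemma representation:
  assumes r: "0 \<le> r" and \<Gamma>: "\<Gamma> \<in> sets (K r)"
  shows "\<exists>C\<in>sets (\<F> r \<Otimes>\<^sub>M borel). AE w in Q. w \<in> \<Gamma> \<longleftrightarrow> (w, tm w) \<in> C"
  using \<Gamma> unfolding sets_K
proof (induction rule: sigma_sets.induct)
  case (Basic a)
  then consider "a \<in> sets (\<F> r)" | "a \<in> sets (vimage_algebra path_space total_max borel)" | "a \<in> null_sets (completion Q)" by blast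
  then show ?case
  proof cases
    case 1
    then show ?thesis by (intro bexI[of _ "a \<times> UNIV"]) auto
  next
    case 2
    then obtain B where B: "B \<in> sets borel" "a = total_max -` B \<inter> path_space"
      by (auto simp: sets_vimage_algebra2)
    have "ereal -` B \<in> sets (borel :: real measure)"
      using measurable_sets[OF borel_measurable_ereal[OF measurable_ident_sets[OF refl]] B(1)] by (simp add: vimage_def)
    moreover have "path_space \<in> sets (\<F> r)" using sets.top[of "\<F> r"] by simp
    moreover have "AE w in Q. w \<in> a \<longleftrightarrow> (w, tm w) \<in> path_space \<times> ereal -` B"
      using AE_good
    proof eventually_elim
      case (elim w)
      have "ereal \<bar>coord 0 w\<bar> \<le> total_max w" unfolding total_max_def by (rule SUP_upper) simp
      then have "ereal (tm w) = total_max w" using elim unfolding tm_def good_def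
        by (intro ereal_real') (cases "total_max w", auto)
      then show ?case using B by auto
    qed
    ultimately show ?thesis by (intro bexI[of _ "path_space \<times> ereal -` B"]) auto
  next
    case 3
    then have "AE w in completion Q. w \<notin> a" by (rule AE_not_in)
    then have "AE w in Q. w \<notin> a" by (simp add: AE_completion_iff)
    then show ?thesis by (intro bexI[of _ "{}"]) auto
  qed
next
  case Empty
  show ?case by (intro bexI[of _ "{}"]) auto
next
  case (Compl a)
  then obtain C where C: "C \<in> sets (\<F> r \<Otimes>\<^sub>M borel)" "AE w in Q. w \<in> a \<longleftrightarrow> (w, tm w) \<in> C" by blast
  have "AE w in Q. w \<in> path_space - a \<longleftrightarrow> (w, tm w) \<in> space (\<F> r \<Otimes>\<^sub>M borel) - C"
    using C(2) AE_space by eventually_elim (auto simp: space_pair_measure)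
  then show ?case using sets.compl_sets[OF C(1)] by blast
next
  case (Union a)
  then have "\<forall>i. \<exists>C. C \<in> sets (\<F> r \<Otimes>\<^sub>M borel) \<and> (AE w in Q. w \<in> a i \<longleftrightarrow> (w, tm w) \<in> C)" by blast
  then obtain C where C: "\<And>i. C i \<in> sets (\<F> r \<Otimes>\<^sub>M borel)" "\<And>i. AE w in Q. w \<in> a i \<longleftrightarrow> (w, tm w) \<in> C i"
    by (auto dest!: choice)
  have "AE w in Q. \<forall>i::nat. w \<in> a i \<longleftrightarrow> (w, tm w) \<in> C i" unfolding AE_all_countable using C(2) by blast
  then have "AE w in Q. w \<in> (\<Union>i. a i) \<longleftrightarrow> (w, tm w) \<in> (\<Union>i. C i)" by eventually_elim auto
  moreover have "(\<Union>i. C i) \<in> sets (\<F> r \<Otimes>\<^sub>M borel)" using C(1) by (intro sets.countable_UN) auto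
  ultimately show ?case by blast
qed

end

section \<open>The first Brownian motion in the enlarged filtration\<close>

locale enlarged = penalised P0 L \<alpha> \<nu> Q for P0 L \<alpha> \<nu> Q +
  fixes G :: "real \<Rightarrow> path measure"
  assumes enl: "is_enlarged_filtration Q G"
begin

lemma G_usual: "usual_conditions Q G"
  using enl by (simp add: is_enlarged_filtration_def Let_def)

lemma filtration_G: "filtration path_space G"
  using G_usual by (simp add: usual_conditions_def)

lemma space_EG [simp]: "space (G t) = path_space"
  using filtration.space_F[OF filtration_G] .

lemma subalgebra_EG: "0 \<le> t \<Longrightarrow> subalgebra (completion Q) (G t)"
  using G_usual by (simp add: usual_conditions_def)

lemma null_EG: "0 \<le> t \<Longrightarrow> null_sets (completion Q) \<subseteq> sets (G t)"
  using G_usual by (simp add: usual_conditions_def)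

lemma gen_EG: "0 \<le> t \<Longrightarrow> sigma_sets path_space (sets (\<F> t) \<union> sets (vimage_algebra path_space total_max borel)) \<subseteq> sets (G t)"
  using enl by (simp add: is_enlarged_filtration_def Let_def)

lemma EG_subset_K:
  assumes "0 \<le> s" "s < r"
  shows "sets (G s) \<subseteq> sets (K r)"
proof -
  have "sigma_sets path_space (sets (\<F> t) \<union> sets (vimage_algebra path_space total_max borel)) \<subseteq> sets (H t)" if t: "0 \<le> t" for t
  proof -
    have "sets (\<F> t) \<union> sets (vimage_algebra path_space total_max borel) \<subseteq> sets (K r)" if "t < r" for r
      unfolding sets_K using canon_filt_mono[of t r] that by (auto intro: sigma_sets.Basic)
    then have "sets (\<F> t) \<union> sets (vimage_algebra path_space total_max borel) \<subseteq> sets (H t)"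
      unfolding sets_H using t by (auto simp: subset_iff)
    from sets.sigma_sets_subset[OF this] show ?thesis by simp
  qed
  then have "sets (G s) \<subseteq> sets (H s)"
    using enl assms H_usual unfolding is_enlarged_filtration_def Let_def by blast
  then show ?thesis unfolding sets_H using assms by auto
qed

lemma measurable_filt_EG: "0 \<le> t \<Longrightarrow> f \<in> measurable (\<F> t) N \<Longrightarrow> f \<in> measurable (G t) N"
  using gen_EG[of t] sigma_sets.Basic by (auto simp: measurable_def subset_iff)

lemma measurable_EG_completion: "0 \<le> t \<Longrightarrow> f \<in> measurable (G t) N \<Longrightarrow> f \<in> measurable (completion Q) N"
  using measurable_from_subalg[OF subalgebra_EG] .

lemma tm_pair_EG: "0 \<le> t \<Longrightarrow> (\<lambda>w. (w, tm w)) \<in> measurable (G t) (\<F> t \<Otimes>\<^sub>M borel)"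
proof -
  assume t: "0 \<le> t"
  have "total_max \<in> borel_measurable (G t)"
  proof (rule measurableI)
    fix A :: "ereal set" assume "A \<in> sets borel"
    then have "total_max -` A \<inter> path_space \<in> sets (vimage_algebra path_space total_max borel)"
      by (auto simp: sets_vimage_algebra2)
    then show "total_max -` A \<inter> space (G t) \<in> sets (G t)" using gen_EG[OF t] sigma_sets.Basic by fastforce
  qed simp
  then have "tm \<in> borel_measurable (G t)" unfolding tm_def[abs_def] by measurable
  moreover have "(\<lambda>w. w) \<in> measurable (G t) (\<F> t)" by (rule measurable_filt_EG[OF t]) simp
  ultimately show ?thesis by (intro measurable_Pair) simp_all
qed

text \<open>Each G t contains all subsets of Q-null sets, so changing a function on such a set
  preserves its measurability. This allows the cut to good paths in \<open>Bt\<close> and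
  \<open>Bh\<close>.\<close>

lemma measurable_EG_AE:
  assumes t: "0 \<le> t" and f: "f \<in> borel_measurable (G t)" and ae: "AE w in Q. f w = g w"
  shows "(g :: path \<Rightarrow> real) \<in> borel_measurable (G t)"
proof (rule measurableI)
  fix A :: "real set" assume A: "A \<in> sets borel"
  obtain N where N: "{w \<in> path_space. f w \<noteq> g w} \<subseteq> N" "N \<in> null_sets Q"
    using AE_E[OF ae] by (auto simp: null_sets_def)
  have null: "S \<in> sets (G t)" if "S \<subseteq> {w \<in> path_space. f w \<noteq> g w}" for S
    using null_EG[OF t] null_sets_completion_subset[OF _ null_sets_completionI[OF N(2)]] that N(1) by blast
  have "g -` A \<inter> space (G t) = (f -` A \<inter> space (G t) - (f -` A \<inter> path_space - g -` A)) \<union> (g -` A \<inter> path_space - f -` A)"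
    by auto
  moreover have "f -` A \<inter> path_space - g -` A \<in> sets (G t)" "g -` A \<inter> path_space - f -` A \<in> sets (G t)"
    by (intro null; force)+
  note sets.Un[OF sets.Diff[OF measurable_sets[OF f A] this(1)] this(2)]
  ultimately show "g -` A \<inter> space (G t) \<in> sets (G t)" by (simp only:)
qed simp

lemma Bt_measurable: "0 \<le> t \<Longrightarrow> Bt t \<in> borel_measurable (G t)"
proof -
  assume t: "0 \<le> t"
  have "(\<lambda>z. coord t (fst z) + drift (snd z) 0 t (fst z)) \<in> borel_measurable (\<F> t \<Otimes>\<^sub>M borel)"
    using t by (intro borel_measurable_add drift_measurable measurable_compose[OF measurable_fst measurable_coord_filt]) auto
  from measurable_compose[OF tm_pair_EG[OF t] this]
  have "(\<lambda>w. coord t w + drift (tm w) 0 t w) \<in> borel_measurable (G t)" by simp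
  then show ?thesis
    by (rule measurable_EG_AE[OF t]) (use AE_good in \<open>auto elim!: eventually_mono simp: Bt_def\<close>)
qed

text \<open>The event is replaced by its representative in terms of (path, total maximum) and
  \<open>Bt\<close> by its formula on good paths. Both changes are almost sure, and what remains is
  \<open>Q_girsanov\<close>.\<close>

lemma Bt_char_K:
  assumes rt: "0 \<le> r" "r \<le> t" and \<Gamma>: "\<Gamma> \<in> sets (K r)"
  shows "(CLINT w|completion Q. indicator \<Gamma> w * iexp (u * (Bt t w - Bt r w))) = of_real (exp (- u\<^sup>2 * (t - r) / 2) * measure (completion Q) \<Gamma>)"
proof -
  have t: "0 \<le> t" using rt by simp
  obtain C where C: "C \<in> sets (\<F> r \<Otimes>\<^sub>M borel)" "AE w in Q. w \<in> \<Gamma> \<longleftrightarrow> (w, tm w) \<in> C"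
    using representation[OF rt(1) \<Gamma>] by blast
  define g where "g w = indicator C (w, tm w) * iexp (u * (coord t w - coord r w + drift (tm w) r t w))" for w
  define D where "D = {w \<in> path_space. (w, tm w) \<in> C}"
  have \<Gamma>c [measurable]: "\<Gamma> \<in> sets (completion Q)" using K_subset[OF rt(1)] \<Gamma> by blast
  have D: "D \<in> sets Q"
    using measurable_sets[OF tm_pair_measurable[OF rt(1)] C(1)] by (simp add: D_def vimage_def Int_def conj_commute)
  have [measurable]: "coord t \<in> borel_measurable Q" "coord r \<in> borel_measurable Q"
    "(\<lambda>w. drift (tm w) r t w) \<in> borel_measurable Q"
    using measurable_filt_Q[OF t measurable_coord_filt] rt
      measurable_compose[OF tm_pair_measurable[OF t] drift_measurable[OF rt]] by auto
  have [measurable]: "(\<lambda>w. indicator C (w, tm w) :: complex) \<in> borel_measurable Q"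
    by (rule measurable_compose[OF tm_pair_measurable[OF rt(1)] borel_measurable_indicator[OF C(1)]])
  have gm: "g \<in> borel_measurable Q" unfolding g_def[abs_def] by measurable
  have [measurable]: "Bt t \<in> borel_measurable (completion Q)" "Bt r \<in> borel_measurable (completion Q)"
    using Bt_measurable measurable_EG_completion rt t by blast+
  have "(CLINT w|completion Q. indicator \<Gamma> w * iexp (u * (Bt t w - Bt r w))) = (CLINT w|completion Q. g w)"
  proof (rule integral_cong_AE)
    show "g \<in> borel_measurable (completion Q)" using gm by (rule measurable_completion)
    have "AE w in Q. indicator \<Gamma> w * iexp (u * (Bt t w - Bt r w)) = g w"
      using C(2) AE_good
      by eventually_elim (auto simp: g_def Bt_increment[OF _ rt] split: split_indicator)
    then show "AE w in completion Q. indicator \<Gamma> w * iexp (u * (Bt t w - Bt r w)) = g w" by (rule AE_completion)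
  qed measurable
  also have "\<dots> = (CLINT w|Q. g w)" by (rule integral_completion[OF gm])
  also have "\<dots> = of_real (exp (- u\<^sup>2 * (t - r) / 2) * measure Q D)"
    unfolding g_def D_def by (rule Q_girsanov[OF rt C(1)])
  also have "measure Q D = measure (completion Q) D" using D by simp
  also have "\<dots> = measure (completion Q) \<Gamma>"
  proof (rule measure_eq_AE)
    have "AE w in Q. w \<in> D \<longleftrightarrow> w \<in> \<Gamma>" using C(2) AE_space by eventually_elim (auto simp: D_def)
    then show "AE w in completion Q. w \<in> D \<longleftrightarrow> w \<in> \<Gamma>" by (rule AE_completion)
  qed (use D \<Gamma>c in auto)
  finally show ?thesis .
qed

text \<open>Events of G s are known to lie in K r only for r > s, by right-continuity of the
  filtration. The identity is therefore used at times r decreasing to s, and continuity of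
  \<open>Bt\<close> gives the limit.\<close>

lemma Bt_char:
  assumes st: "0 \<le> s" "s < t" and \<Gamma>: "\<Gamma> \<in> sets (G s)"
  shows "(CLINT w|completion Q. indicator \<Gamma> w * iexp (u * (Bt t w - Bt s w))) = of_real (exp (- u\<^sup>2 * (t - s) / 2) * measure (completion Q) \<Gamma>)"
proof -
  interpret C: prob_space "completion Q" by (rule Q.prob_space_completion)
  define r where "r n = s + (t - s) / real (n + 2)" for n :: nat
  have r: "s < r n" "r n \<le> t" for n
  proof -
    show "s < r n" using st by (simp add: r_def)
    have "(t - s) / real (n + 2) \<le> (t - s) / 1" using st by (intro divide_left_mono) auto
    then show "r n \<le> t" by (simp add: r_def)
  qed
  have r0: "0 \<le> r n" for n using r(1)[of n] st by simp
  have rl: "r \<longlonglongrightarrow> s" unfolding r_def by real_asymp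
  have \<Gamma>c: "\<Gamma> \<in> sets (completion Q)" using \<Gamma> subalgebra_EG[OF st(1)] by (auto simp: subalgebra_def)
  have m: "Bt p \<in> borel_measurable (completion Q)" if "0 \<le> p" for p by (rule measurable_EG_completion[OF that Bt_measurable[OF that]])
  have "(\<lambda>n. Bt (r n) w) \<longlonglongrightarrow> Bt s w" for w
    by (rule continuous_on_tendsto_compose[OF Bt_continuous rl]) (use st r0 in auto)
  then have "(\<lambda>n. CLINT w|completion Q. indicator \<Gamma> w * iexp (u * (Bt t w - Bt (r n) w))) \<longlonglongrightarrow> (CLINT w|completion Q. indicator \<Gamma> w * iexp (u * (Bt t w - Bt s w)))"
    using st r0 by (intro C.char_tendsto \<Gamma>c borel_measurable_diff m AE_I2 tendsto_diff tendsto_const) auto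
  moreover have "(CLINT w|completion Q. indicator \<Gamma> w * iexp (u * (Bt t w - Bt (r n) w))) = of_real (exp (- u\<^sup>2 * (t - r n) / 2) * measure (completion Q) \<Gamma>)" for n
    using EG_subset_K[OF st(1) r(1)] \<Gamma> by (intro Bt_char_K[OF r0 r(2)]) blast
  moreover have "(\<lambda>n. complex_of_real (exp (- u\<^sup>2 * (t - r n) / 2) * measure (completion Q) \<Gamma>)) \<longlonglongrightarrow> of_real (exp (- u\<^sup>2 * (t - s) / 2) * measure (completion Q) \<Gamma>)"
    by (intro tendsto_intros rl) auto
  ultimately show ?thesis using LIMSEQ_unique by force
qed

lemma Bt_brownian: "brownian_motion_wrt (completion Q) G Bt"
proof (rule brownian_motion_from_char[OF Q.prob_space_completion])
  show "AE w in completion Q. Bt 0 w = 0"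
    by (rule AE_completion) (use AE_good in \<open>auto elim!: eventually_mono simp: Bt_zero\<close>)
qed (use filtration_G subalgebra_EG Bt_measurable Bt_continuous Bt_char in auto)

end

section \<open>Stochastic integrals of sign processes\<close>

context brownian
begin

text \<open>A sign known at time s is frozen together with the past, and the Gaussian characteristic
  function depends on (u \<xi>)^2 = u^2 only.\<close>

lemma signed_increment_char:
  fixes f :: "'a \<Rightarrow> complex"
  assumes st: "0 \<le> s" "s < t" and f: "f \<in> borel_measurable (G s)" "\<And>w. norm (f w) \<le> 1"
    and \<xi>: "\<xi> \<in> borel_measurable (G s)" "\<And>w. (\<xi> w)\<^sup>2 = 1"
  shows "(CLINT w|P. f w * iexp (u * (\<xi> w * (B t w - B s w)))) = (CLINT w|P. f w) * of_real (exp (- u\<^sup>2 * (t - s) / 2))"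
proof -
  define \<Phi> where "\<Phi> z = f (fst z) * iexp (u * (\<xi> (fst z) * snd z))" for z
  note [measurable] = f(1) \<xi>(1)
  have \<Phi>: "\<Phi> \<in> borel_measurable (G s \<Otimes>\<^sub>M borel)" unfolding \<Phi>_def by measurable
  have "(\<lambda>w. \<Phi> (w, B t w - B s w)) \<in> borel_measurable P"
    by (rule measurable_compose[OF increment_pair_measurable \<Phi>]) (use st in auto)
  then have "integrable P (\<lambda>w. \<Phi> (w, B t w - B s w))"
    by (intro integrable_const_bound[of _ 1]) (auto intro!: AE_I2 simp: \<Phi>_def norm_mult f(2))
  from freeze_integral[OF st \<Phi> this]
  have "(CLINT w|P. f w * iexp (u * (\<xi> w * (B t w - B s w)))) = (CLINT w|P. (CLINT x|gauss (t - s). f w * iexp ((u * \<xi> w) * x)))"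
    by (simp only: \<Phi>_def fst_conv snd_conv mult.assoc)
  also have "\<dots> = (CLINT w|P. f w * of_real (exp (- u\<^sup>2 * (t - s) / 2)))"
  proof (rule Bochner_Integration.integral_cong[OF refl])
    fix w
    have "(CLINT x|gauss (t - s). f w * iexp ((u * \<xi> w) * x)) = f w * (CLINT x|gauss (t - s). iexp ((u * \<xi> w) * x))"
      by (rule integral_mult_right_zero)
    also have "\<dots> = f w * of_real (exp (- (u * \<xi> w)\<^sup>2 * (t - s) / 2))"
      using st by (subst gauss_char) auto
    finally show "(CLINT x|gauss (t - s). f w * iexp ((u * \<xi> w) * x)) = f w * of_real (exp (- u\<^sup>2 * (t - s) / 2))"
      by (simp only: power_mult_distrib \<xi>(2) mult_1_right)
  qed
  also have "\<dots> = (CLINT w|P. f w) * of_real (exp (- u\<^sup>2 * (t - s) / 2))" by (rule integral_mult_left_zero)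
  finally show ?thesis .
qed

lemma increment_char:
  assumes st: "0 \<le> s" "s < t" and \<Gamma>: "\<Gamma> \<in> sets (G s)"
  shows "(CLINT w|P. indicator \<Gamma> w * iexp (u * (B t w - B s w))) = of_real (measure P \<Gamma>) * of_real (exp (- u\<^sup>2 * (t - s) / 2))"
proof -
  have \<Gamma>P: "\<Gamma> \<in> sets P" using \<Gamma> sets_G_subset[OF st(1)] by blast
  have "(indicator \<Gamma> :: 'a \<Rightarrow> complex) = (\<lambda>w. of_real (indicator \<Gamma> w))" by (auto simp: indicator_def)
  then have "(CLINT w|P. indicator \<Gamma> w) = of_real (measure P \<Gamma>)"
    using \<Gamma>P sets.sets_into_space[OF \<Gamma>P] by (simp add: Int_absorb2)
  then show ?thesis
    using signed_increment_char[OF st, of "indicator \<Gamma>" "\<lambda>_. 1" u] \<Gamma> by (simp add: indicator_def)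
qed

text \<open>The symmetry of Gaussian increments: from time p on, they may be multiplied by a sign
  known at p. An interval that crosses p is split there, and the two Gaussian factors multiply to
  the right one.\<close>

lemma flip:
  assumes p: "0 \<le> p" and \<xi>: "\<xi> \<in> borel_measurable (G p)" "\<And>w. (\<xi> w)\<^sup>2 = 1"
    and B': "\<And>t w. 0 \<le> t \<Longrightarrow> B' t w = B (min t p) w + \<xi> w * (B t w - B (min t p) w)"
  shows "brownian_motion_wrt P G B'"
proof (rule brownian_motion_from_char[OF prob_space_axioms filt subalgebra_G])
  show "B' t \<in> borel_measurable (G t)" if t: "0 \<le> t" for t
  proof (cases "t \<le> p")
    case True
    then have "B' t w = B t w" for w by (simp add: B'[OF t])
    then have "B' t = B t" by blast
    then show ?thesis using B_measurable_G[OF t order_refl] by simp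
  next
    case False
    have [measurable]: "\<xi> \<in> borel_measurable (G t)" "B p \<in> borel_measurable (G t)" "B t \<in> borel_measurable (G t)"
      using False t p measurable_G_mono[OF _ \<xi>(1)] by (auto intro: B_measurable_G)
    have "B' t = (\<lambda>w. B p w + \<xi> w * (B t w - B p w))" using False by (auto simp: B'[OF t] min_def)
    then show ?thesis by simp
  qed
  show "continuous_on {0..} (\<lambda>t. B' t w)" if "w \<in> space P" for w
  proof -
    have "continuous_on {0..} (\<lambda>t. B (min t p) w)"
      by (rule continuous_on_compose2[OF B_continuous[OF that]]) (use p in \<open>auto intro!: continuous_intros\<close>)
    then have "continuous_on {0..} (\<lambda>t. B (min t p) w + \<xi> w * (B t w - B (min t p) w))"
      by (intro continuous_intros B_continuous[OF that])
    then show ?thesis by (rule continuous_on_eq) (simp add: B')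
  qed
  show "AE w in P. B' 0 w = 0" using B_zero by eventually_elim (use p in \<open>simp add: B'\<close>)
next
  fix s t :: real and \<Gamma> u assume st: "0 \<le> s" "s < t" and \<Gamma>: "\<Gamma> \<in> sets (G s)"
  have t: "0 \<le> t" using st by simp
  have \<Gamma>P: "\<Gamma> \<in> sets P" using \<Gamma> sets_G_subset[OF st(1)] by blast
  have \<Gamma>i: "(CLINT w|P. indicator \<Gamma> w) = of_real (measure P \<Gamma>)"
  proof -
    have "(indicator \<Gamma> :: 'a \<Rightarrow> complex) = (\<lambda>w. of_real (indicator \<Gamma> w))" by (auto simp: indicator_def)
    then show ?thesis using \<Gamma>P sets.sets_into_space[OF \<Gamma>P] by (simp add: Int_absorb2)
  qed
  note plain = increment_char[OF st(1) _ \<Gamma>, of _ u]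
  consider "t \<le> p" | "p \<le> s" | "s < p" "p < t" by linarith
  then have "(CLINT w|P. indicator \<Gamma> w * iexp (u * (B' t w - B' s w))) = of_real (measure P \<Gamma>) * of_real (exp (- u\<^sup>2 * (t - s) / 2))"
  proof cases
    case 1
    then show ?thesis using st plain[OF st(2)] by (simp only: B'[OF t] B'[OF st(1)] min_absorb1 diff_self mult_zero_right add_0_right less_imp_le order_trans[of s t p])
  next
    case 2
    have "(CLINT w|P. indicator \<Gamma> w * iexp (u * (\<xi> w * (B t w - B s w)))) = (CLINT w|P. indicator \<Gamma> w) * of_real (exp (- u\<^sup>2 * (t - s) / 2))"
      using \<Gamma> measurable_G_mono[OF 2 \<xi>(1)] by (intro signed_increment_char st \<xi>(2)) (auto simp: indicator_def)
    moreover have "B' t w - B' s w = \<xi> w * (B t w - B s w)" for w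
      using 2 st by (simp add: B' t min_absorb2 algebra_simps)
    ultimately show ?thesis by (simp only: \<Gamma>i)
  next
    case 3
    define f where "f w = indicator \<Gamma> w * iexp (u * (B p w - B s w))" for w
    have [measurable]: "\<Gamma> \<in> sets (G p)" "B p \<in> borel_measurable (G p)" "B s \<in> borel_measurable (G p)"
      using \<Gamma> sets_G_mono[of s p] 3 st p by (auto intro: B_measurable_G)
    have "f \<in> borel_measurable (G p)" unfolding f_def by measurable
    moreover have "norm (f w) \<le> 1" for w by (simp add: f_def norm_mult indicator_def)
    ultimately have "(CLINT w|P. f w * iexp (u * (\<xi> w * (B t w - B p w)))) = (CLINT w|P. f w) * of_real (exp (- u\<^sup>2 * (t - p) / 2))"
      by (intro signed_increment_char p 3 \<xi>)
    moreover have "indicator \<Gamma> w * iexp (u * (B' t w - B' s w)) = f w * iexp (u * (\<xi> w * (B t w - B p w)))" for w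
    proof -
      have "B' t w - B' s w = (B p w - B s w) + \<xi> w * (B t w - B p w)"
        using 3 st by (simp add: B' t min_absorb2)
      then show ?thesis unfolding f_def by (simp only: ring_distribs of_real_add exp_add mult.assoc)
    qed
    moreover have "(CLINT w|P. f w) = of_real (measure P \<Gamma>) * of_real (exp (- u\<^sup>2 * (p - s) / 2))"
      unfolding f_def by (rule plain[OF 3(1)])
    moreover have "exp (- u\<^sup>2 * (p - s) / 2) * exp (- u\<^sup>2 * (t - p) / 2) = exp (- u\<^sup>2 * (t - s) / 2)"
      unfolding exp_add[symmetric] by (simp add: field_simps)
    ultimately show ?thesis by (simp only: mult.assoc of_real_mult[symmetric])
  qed
  then show "(CLINT w|P. indicator \<Gamma> w * iexp (u * (B' t w - B' s w))) = of_real (exp (- u\<^sup>2 * (t - s) / 2) * measure P \<Gamma>)"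
    by (simp only: of_real_mult mult.commute)
qed

text \<open>Beyond the last node the process continues with coefficient 1, so it is a Brownian
  motion on the whole half-line for every n. Adding a cell then amounts to two applications of
  \<open>flip\<close>.\<close>

lemma sign_integral_brownian:
  assumes \<tau>: "\<tau> 0 = 0" "\<And>i. \<tau> i \<le> \<tau> (Suc i)"
    and \<xi>: "\<And>i. \<xi> i \<in> borel_measurable (G (\<tau> i))" "\<And>i w. (\<xi> i w)\<^sup>2 = 1"
  shows "brownian_motion_wrt P G (\<lambda>t w. B 0 w + simple_integral B n \<tau> \<xi> t w + (B t w - B (min t (\<tau> n)) w))"
proof (induction n)
  case 0
  show ?case
    by (rule flip[of 0 "\<lambda>_. 1"]) (simp_all add: simple_integral_def \<tau>(1))
next
  case (Suc n)
  have \<tau>0: "0 \<le> \<tau> i" for i by (induction i) (use \<tau> in \<open>auto intro: order_trans\<close>)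
  define S where "S t w = B 0 w + simple_integral B n \<tau> \<xi> t w + (B t w - B (min t (\<tau> n)) w)" for t w
  have mono: "\<tau> i \<le> \<tau> j" if "i \<le> j" for i j using lift_Suc_mono_le[of \<tau>, OF \<tau>(2) that] .
  have const: "simple_integral B n \<tau> \<xi> t w = simple_integral B n \<tau> \<xi> (\<tau> n) w" if "\<tau> n \<le> t" for t w
  proof -
    have "min t (\<tau> j) = \<tau> j" "min (\<tau> n) (\<tau> j) = \<tau> j" if "j \<le> n" for j
      using mono[OF that] \<open>\<tau> n \<le> t\<close> by auto
    then show ?thesis unfolding simple_integral_def by (intro sum.cong refl) simp
  qed
  define S1 where "S1 t w = S (min t (\<tau> n)) w + \<xi> n w * (S t w - S (min t (\<tau> n)) w)" for t w
  interpret S: brownian P G S by unfold_locales (use Suc in \<open>simp add: S_def[abs_def]\<close>)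
  have "brownian_motion_wrt P G S1" by (rule S.flip[OF \<tau>0 \<xi>]) (simp add: S1_def)
  then interpret S1: brownian P G S1 by unfold_locales
  have \<xi>m: "\<xi> n \<in> borel_measurable (G (\<tau> (Suc n)))" by (rule measurable_G_mono[OF \<tau>(2) \<xi>(1)])
  have sq: "\<xi> n w * (\<xi> n w * x) = x" for w x using \<xi>(2)[of n w] by (simp add: power2_eq_square mult.assoc[symmetric])
  show ?case
  \<comment> \<open>S1 carries the sign of the new cell from \<open>\<tau> n\<close> onwards; the
    second flip by the same sign, at the next node, restores the coefficient 1 because signs square
    to 1.\<close>
  proof (rule S1.flip[OF \<tau>0 \<xi>m \<xi>(2)])
    fix t :: real and w assume t: "0 \<le> t"
    have inc: "S q w - S (\<tau> n) w = B q w - B (\<tau> n) w" if "\<tau> n \<le> q" for q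
      using const[OF that, of w] that by (simp add: S_def min_absorb2)
    consider "t \<le> \<tau> n" | "\<tau> n \<le> t" "t \<le> \<tau> (Suc n)" | "\<tau> (Suc n) \<le> t" by linarith
    then show "B 0 w + simple_integral B (Suc n) \<tau> \<xi> t w + (B t w - B (min t (\<tau> (Suc n))) w) =
      S1 (min t (\<tau> (Suc n))) w + \<xi> n w * (S1 t w - S1 (min t (\<tau> (Suc n))) w)"
    proof cases
      case 1
      then have "t \<le> \<tau> (Suc n)" using \<tau>(2)[of n] by simp
      with 1 show ?thesis by (simp add: S1_def S_def simple_integral_def min_absorb1)
    next
      case 2
      then have "S1 t w = S (\<tau> n) w + \<xi> n w * (B t w - B (\<tau> n) w)" by (simp add: S1_def min_absorb2 inc)
      with 2 const[OF 2(1), of w] show ?thesis by (simp add: S_def simple_integral_def min_absorb1 min_absorb2)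
    next
      case 3
      have n: "\<tau> n \<le> \<tau> (Suc n)" by (rule \<tau>(2))
      with 3 have nt: "\<tau> n \<le> t" by simp
      have "S1 t w = S (\<tau> n) w + \<xi> n w * (B t w - B (\<tau> n) w)"
        "S1 (\<tau> (Suc n)) w = S (\<tau> n) w + \<xi> n w * (B (\<tau> (Suc n)) w - B (\<tau> n) w)"
        using nt n by (simp_all add: S1_def min_absorb2 inc)
      then have "S1 t w - S1 (\<tau> (Suc n)) w = \<xi> n w * (B t w - B (\<tau> (Suc n)) w)"
        "S1 (\<tau> (Suc n)) w = S (\<tau> n) w + \<xi> n w * (B (\<tau> (Suc n)) w - B (\<tau> n) w)" by (simp_all add: ring_distribs)
      with 3 nt n const[OF nt, of w] show ?thesis by (simp add: S_def simple_integral_def min_absorb2 sq)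
    qed
  qed
qed

end

section \<open>Dyadic sign processes\<close>

definition dy :: "nat \<Rightarrow> nat \<Rightarrow> real" where "dy N i = real i / 2 ^ N"

definition sgs :: "nat \<Rightarrow> nat \<Rightarrow> path \<Rightarrow> real" where "sgs N i w = sg (coord (dy N i) w)"

text \<open>With 4^N cells of width 2^(-N) the nodes reach 2^N, so mesh and time horizon improve
  together.\<close>

definition SI :: "(real \<Rightarrow> path \<Rightarrow> real) \<Rightarrow> nat \<Rightarrow> real \<Rightarrow> path \<Rightarrow> real" where
  "SI B N = simple_integral B (4 ^ N) (dy N) (sgs N)"

definition SP :: "nat \<Rightarrow> real \<Rightarrow> path \<Rightarrow> real" where
  "SP N = simple_process (4 ^ N) (dy N) (sgs N)"

text \<open>The positive dyadic times. For such t a fine dyadic mesh cuts [0, t] into equal cells,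
  which is the setting of \<open>tanaka\<close>.\<close>

definition dyadics :: "real set" where "dyadics = range (\<lambda>(m, j). real (Suc m) / 2 ^ j)"

lemma dy_simps: "dy N 0 = 0" "0 \<le> dy N i" "dy N i \<le> dy N (Suc i)" "dy N (4 ^ N) = 2 ^ N"
proof -
  have "(4::real) ^ N = 2 ^ N * 2 ^ N" by (simp add: power_mult_distrib[symmetric])
  then show "dy N (4 ^ N) = 2 ^ N" by (simp add: dy_def)
qed (auto simp: dy_def divide_right_mono)

lemma SP_eq: "SP N s w = (if 0 < s \<and> s \<le> 2 ^ N then sg (coord ((of_int \<lceil>s * 2 ^ N\<rceil> - 1) / 2 ^ N) w) else 0)"
proof -
  \<comment> \<open>Cells are open on the left and closed on the right, so s lies in cell i exactly
    when s 2^N rounds up to i + 1.\<close>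
  have ind: "indicat_real {dy N i<..dy N (Suc i)} s = (if \<lceil>s * 2 ^ N\<rceil> = int i + 1 then 1 else 0)" for i
    by (simp add: dy_def indicator_def ceiling_eq_iff divide_simps) (auto simp: algebra_simps)
  have four: "(4::real) ^ N = 2 ^ N * 2 ^ N" by (simp add: power_mult_distrib[symmetric])
  show ?thesis
  proof (cases "0 < s \<and> s \<le> 2 ^ N")
    case True
    define l where "l = nat (\<lceil>s * 2 ^ N\<rceil> - 1)"
    have c: "0 < \<lceil>s * 2 ^ N\<rceil>" using True by simp
    then have l: "int l + 1 = \<lceil>s * 2 ^ N\<rceil>" by (simp add: l_def)
    have "s * 2 ^ N \<le> 4 ^ N" using True by (simp add: four)
    then have "\<lceil>s * 2 ^ N\<rceil> \<le> 4 ^ N" by (simp add: ceiling_le_iff)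
    then have "int l + 1 \<le> int (4 ^ N)" by (simp only: l of_nat_power of_nat_numeral)
    then have l4: "l < 4 ^ N" by linarith
    have "SP N s w = (\<Sum>i<4 ^ N. if i = l then sgs N l w else 0)"
      unfolding SP_def simple_process_def ind using l by (intro sum.cong refl) auto
    also have "\<dots> = sgs N l w" using l4 by simp
    finally have "SP N s w = sgs N l w" .
    moreover have "dy N l = (of_int \<lceil>s * 2 ^ N\<rceil> - 1) / 2 ^ N" unfolding l[symmetric] by (simp add: dy_def)
    ultimately show ?thesis using True by (simp add: sgs_def)
  next
    case False
    have "\<lceil>s * 2 ^ N\<rceil> \<noteq> int i + 1" if "i < 4 ^ N" for i
    proof
      assume "\<lceil>s * 2 ^ N\<rceil> = int i + 1"
      then have *: "real i < s * 2 ^ N" "s * 2 ^ N \<le> real i + 1" by (auto simp: ceiling_eq_iff)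
      have "0 < s * 2 ^ N" using *(1) of_nat_0_le_iff[of i] by linarith
      then have "0 < s" by (simp add: zero_less_mult_iff)
      have "real (Suc i) \<le> real (4 ^ N)" using that by (intro of_nat_mono) simp
      then have "real i + 1 \<le> 2 ^ N * 2 ^ N" by (simp add: four)
      with *(2) have "s * 2 ^ N \<le> 2 ^ N * 2 ^ N" by (rule order_trans)
      then have "s \<le> 2 ^ N" by simp
      with \<open>0 < s\<close> False show False by simp
    qed
    then have "SP N s w = 0" unfolding SP_def simple_process_def ind by simp
    then show ?thesis using False by auto
  qed
qed

lemma SP_bound: "\<bar>SP N s w\<bar> \<le> 1"
  by (simp add: SP_eq)

text \<open>The left dyadic neighbours of s converge to s, and the sign is locally constant at a
  nonzero value.\<close>

lemma SP_tendsto: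
  assumes w: "w \<in> path_space" and s: "0 < s" and nz: "coord s w \<noteq> 0"
  shows "(\<lambda>N. SP N s w) \<longlonglongrightarrow> sgn (coord s w)"
proof -
  define d where "d N = (of_int \<lceil>s * 2 ^ N\<rceil> - 1) / (2 ^ N :: real)" for N :: nat
  have d: "0 \<le> d N" "s - (1/2) ^ N \<le> d N" "d N \<le> s" for N
  proof -
    have "0 < \<lceil>s * 2 ^ N\<rceil>" using s by simp
    then have "1 \<le> \<lceil>s * 2 ^ N\<rceil>" by linarith
    then show "0 \<le> d N" by (simp add: d_def)
    have "s * 2 ^ N \<le> of_int \<lceil>s * 2 ^ N\<rceil>" "of_int \<lceil>s * 2 ^ N\<rceil> - 1 < s * 2 ^ N" by linarith+
    then show "s - (1/2) ^ N \<le> d N" "d N \<le> s" by (auto simp: d_def field_simps)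
  qed
  have "(\<lambda>N. s - (1/2) ^ N) \<longlonglongrightarrow> s - 0" by (intro tendsto_intros LIMSEQ_power_zero) simp
  then have "d \<longlonglongrightarrow> s" by (intro tendsto_sandwich[of "\<lambda>N. s - (1/2) ^ N" d sequentially "\<lambda>_. s"]) (simp_all add: d)
  then have lim: "(\<lambda>N. coord (d N) w) \<longlonglongrightarrow> coord s w"
    by (rule continuous_on_tendsto_compose[OF path_continuous[OF w]]) (use d s in auto)
  obtain M :: nat where M: "s < 2 ^ M" using real_arch_pow[of 2 s] by auto
  have "eventually (\<lambda>N. sgn (coord (d N) w) = SP N s w) sequentially"
    using tendsto_imp_eventually_ne[OF lim nz] eventually_ge_at_top[of M]
  proof eventually_elim
    case (elim N)
    have "(2::real) ^ M \<le> 2 ^ N" using elim by (intro power_increasing) auto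
    then have "s \<le> 2 ^ N" using M by linarith
    then show ?case using s elim by (simp add: SP_eq d_def sg_eq_sgn)
  qed
  then show ?thesis by (rule Lim_transform_eventually[OF tendsto_sgn[OF lim nz]])
qed

lemma dyadicsE:
  assumes "t \<in> dyadics"
  obtains m j where "t = real (Suc m) / 2 ^ j"
  using assms by (auto simp: dyadics_def)

lemma dyadics_pos: "t \<in> dyadics \<Longrightarrow> 0 < t"
  by (auto elim!: dyadicsE)

text \<open>The approximation is strictly from the right, so that an event known at time t is known
  at every approximating time.\<close>

lemma dyadics_dense:
  assumes "0 \<le> t"
  shows "\<exists>d. d \<longlonglongrightarrow> t \<and> (\<forall>n::nat. t < d n \<and> d n \<in> dyadics)"
proof -
  define d where "d n = of_int (\<lfloor>t * 2 ^ n\<rfloor> + 1) / (2 ^ n :: real)" for n :: nat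
  have d: "t < d n" "d n \<le> t + (1/2) ^ n" for n
  proof -
    have "t * 2 ^ n < of_int (\<lfloor>t * 2 ^ n\<rfloor> + 1)" "of_int \<lfloor>t * 2 ^ n\<rfloor> \<le> t * 2 ^ n" by linarith+
    then show "t < d n" "d n \<le> t + (1/2) ^ n" by (auto simp: d_def field_simps)
  qed
  have "d n \<in> dyadics" for n
  proof -
    have "0 \<le> \<lfloor>t * 2 ^ n\<rfloor>" using assms by simp
    then obtain m where "\<lfloor>t * 2 ^ n\<rfloor> = int m" using nonneg_int_cases by blast
    then have "d n = real (Suc m) / 2 ^ n" by (simp add: d_def)
    then show ?thesis unfolding dyadics_def by (intro image_eqI[of _ _ "(m, n)"]) auto
  qed
  moreover have "(\<lambda>n. t + (1/2) ^ n) \<longlonglongrightarrow> t + 0" by (intro tendsto_intros LIMSEQ_power_zero) simp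
  then have "d \<longlonglongrightarrow> t" by (intro tendsto_sandwich[of "\<lambda>_. t" d sequentially "\<lambda>n. t + (1/2) ^ n"]) (simp_all add: d less_imp_le)
  ultimately show ?thesis using d by blast
qed

text \<open>The series of squares has finite expectation, hence converges almost surely. The bound
  may start at any index i, which will be the rank of a dyadic time in an enumeration.\<close>

lemma AE_tendsto_zero_of_summable:
  fixes f :: "nat \<Rightarrow> 'a \<Rightarrow> real"
  assumes m: "\<And>k. f k \<in> borel_measurable M" and le: "\<And>k. i \<le> k \<Longrightarrow> (\<integral>\<^sup>+x. ennreal ((f k x)\<^sup>2) \<partial>M) \<le> ennreal ((1/2) ^ k)"
  shows "AE x in M. (\<lambda>k. f k x) \<longlonglongrightarrow> 0"
proof -
  note [measurable] = m
  have "(\<integral>\<^sup>+x. (\<Sum>k. ennreal ((f (k + i) x)\<^sup>2)) \<partial>M) = (\<Sum>k. \<integral>\<^sup>+x. ennreal ((f (k + i) x)\<^sup>2) \<partial>M)"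
    by (rule nn_integral_suminf) measurable
  also have "\<dots> \<le> (\<Sum>k. ennreal ((1/2) ^ (k + i)))" by (intro suminf_le le) auto
  also have "\<dots> = ennreal (\<Sum>k. (1/2) ^ (k + i))"
    by (rule suminf_ennreal2) (auto simp: power_add intro!: summable_mult2)
  finally have "(\<integral>\<^sup>+x. (\<Sum>k. ennreal ((f (k + i) x)\<^sup>2)) \<partial>M) \<noteq> \<infinity>" by (auto simp: top_unique)
  then have "AE x in M. (\<Sum>k. ennreal ((f (k + i) x)\<^sup>2)) \<noteq> \<infinity>" by (intro nn_integral_PInf_AE) measurable
  then show ?thesis
  proof eventually_elim
    case (elim x)
    then have "summable (\<lambda>k. (f (k + i) x)\<^sup>2)" by (intro summable_suminf_not_top) auto
    then have "(\<lambda>k. sqrt ((f (k + i) x)\<^sup>2)) \<longlonglongrightarrow> sqrt 0" by (intro tendsto_real_sqrt summable_LIMSEQ_zero)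
    then have "(\<lambda>k. f (k + i) x) \<longlonglongrightarrow> 0" by (simp add: tendsto_rabs_zero_iff)
    then show ?case by (rule LIMSEQ_offset)
  qed
qed

context local_time
begin

text \<open>For dyadic t and a fine mesh, t 2^N is an integer n and the nodes below t form the
  uniform grid with n cells; later cells have increment 0.\<close>

lemma SI_coord_eq:
  assumes t: "t = real (Suc m) / 2 ^ j" and N: "j \<le> N" "t \<le> 2 ^ N"
  defines "n \<equiv> Suc m * 2 ^ (N - j)"
  shows "SI coord N t w = (\<beta> t w - \<beta> 0 w) - (\<Sum>i<n. tk (grid 0 t n i) (grid 0 t n (Suc i)) w)"
proof -
  have n0: "0 < n" by (simp add: n_def)
  have "(2::real) ^ N = 2 ^ (N - j) * 2 ^ j" using N(1) by (simp flip: power_add)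
  then have tn: "t * 2 ^ N = real n" by (simp add: t n_def field_simps)
  have g: "grid 0 t n i = dy N i" for i
  proof -
    have "t / real n = 1 / 2 ^ N" unfolding tn[symmetric] using n0 tn by (auto simp: field_simps)
    moreover have "grid 0 t n i = (t / real n) * real i" by (simp add: grid_def)
    ultimately show ?thesis by (simp add: dy_def)
  qed
  have "real n \<le> 2 ^ N * 2 ^ N" unfolding tn[symmetric] using N(2) by simp
  also have "(2::real) ^ N * 2 ^ N = real (4 ^ N)" by (simp add: power_mult_distrib[symmetric])
  finally have n4: "n \<le> 4 ^ N" by (simp only: of_nat_le_iff)
  have dt: "dy N n = t" using tn by (simp add: dy_def field_simps)
  have mono: "dy N i \<le> dy N k" if "i \<le> k" for i k using that by (simp add: dy_def divide_right_mono)
  have "SI coord N t w = (\<Sum>i<n. sgs N i w * (coord (min t (dy N (Suc i))) w - coord (min t (dy N i)) w))"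
    unfolding SI_def simple_integral_def
  proof (rule sum.mono_neutral_right)
    show "\<forall>i\<in>{..<4 ^ N} - {..<n}. sgs N i w * (coord (min t (dy N (Suc i))) w - coord (min t (dy N i)) w) = 0"
    proof
      fix i assume "i \<in> {..<4 ^ N} - {..<n}"
      then have "t \<le> dy N i" "t \<le> dy N (Suc i)" using mono[of n i] mono[of n "Suc i"] dt by auto
      then show "sgs N i w * (coord (min t (dy N (Suc i))) w - coord (min t (dy N i)) w) = 0" by (simp add: min_absorb1)
    qed
  qed (use n4 in auto)
  also have "\<dots> = (\<Sum>i<n. sg (coord (grid 0 t n i) w) * (coord (grid 0 t n (Suc i)) w - coord (grid 0 t n i) w))"
  proof (intro sum.cong refl)
    fix i assume "i \<in> {..<n}"
    then have "dy N i \<le> t" "dy N (Suc i) \<le> t" using mono[of i n] mono[of "Suc i" n] dt by auto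
    then show "sgs N i w * (coord (min t (dy N (Suc i))) w - coord (min t (dy N i)) w) =
      sg (coord (grid 0 t n i) w) * (coord (grid 0 t n (Suc i)) w - coord (grid 0 t n i) w)"
      by (simp add: g sgs_def min_absorb2)
  qed
  finally show ?thesis using tk_sum_telescope[OF n0, of 0 t w] by simp
qed

lemma SI_coord_L2:
  assumes t: "t \<in> dyadics"
  shows "(\<lambda>N. \<integral>\<^sup>+w. ennreal ((SI coord N t w - (\<beta> t w - \<beta> 0 w))\<^sup>2) \<partial>P0) \<longlonglongrightarrow> 0"
proof -
  obtain m j where mj: "t = real (Suc m) / 2 ^ j" using dyadicsE[OF t] by blast
  obtain J where J: "t < 2 ^ J" using real_arch_pow[of 2 t] by auto
  define T where "T n w = (\<Sum>i<Suc n. tk (grid 0 t (Suc n) i) (grid 0 t (Suc n) (Suc i)) w)" for n w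
  \<comment> \<open>\<open>tanaka\<close> is indexed so that its grids have Suc n cells, hence the
    subtraction of 1.\<close>
  define n where "n N = Suc m * 2 ^ (N - j) - 1" for N
  have n: "Suc (n N) = Suc m * 2 ^ (N - j)" for N by (simp add: n_def)
  have "filterlim (\<lambda>N. N - j) sequentially sequentially" by (rule filterlim_minus_const_nat_at_top)
  moreover have "k \<le> n (k + j)" for k
  proof -
    have "k < 2 ^ k" by (rule less_exp)
    also have "\<dots> \<le> Suc m * 2 ^ k" by simp
    finally show ?thesis using n[of "k + j"] by simp
  qed
  then have "N - j \<le> n N" if "j \<le> N" for N using that by (metis le_add_diff_inverse2)
  then have "eventually (\<lambda>N. N - j \<le> n N) sequentially" by (rule eventually_sequentiallyI)
  ultimately have nl: "filterlim n sequentially sequentially" by (rule filterlim_at_top_mono)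
  have "(\<lambda>N. ennreal (\<integral>w. (T (n N) w)\<^sup>2 \<partial>P0)) \<longlonglongrightarrow> ennreal 0"
    using filterlim_compose[OF tanaka(2)[OF order_refl dyadics_pos[OF t]] nl]
    by (intro tendsto_ennrealI) (simp add: T_def)
  moreover have "eventually (\<lambda>N. ennreal (\<integral>w. (T (n N) w)\<^sup>2 \<partial>P0) = (\<integral>\<^sup>+w. ennreal ((SI coord N t w - (\<beta> t w - \<beta> 0 w))\<^sup>2) \<partial>P0)) sequentially"
    using eventually_ge_at_top[of "max j J"]
  proof eventually_elim
    case (elim N)
    have "(2::real) ^ J \<le> 2 ^ N" using elim by (intro power_increasing) auto
    then have "t \<le> 2 ^ N" using J by linarith
    then have "SI coord N t w - (\<beta> t w - \<beta> 0 w) = - T (n N) w" for w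
      using SI_coord_eq[OF mj, of N w] elim J n[of N] by (simp add: T_def)
    then show ?case
      using tanaka(1)[OF order_refl dyadics_pos[OF t], of "n N"]
      by (simp only: power2_minus) (subst nn_integral_eq_integral, simp_all add: T_def)
  qed
  ultimately show ?thesis using Lim_transform_eventually by fastforce
qed

lemma SI_coord_measurable: "0 \<le> t \<Longrightarrow> SI coord N t \<in> borel_measurable P0"
proof -
  assume t: "0 \<le> t"
  have [measurable]: "coord (min t (dy N i)) \<in> borel_measurable P0" "coord (dy N i) \<in> borel_measurable P0" for i
    using t dy_simps(2)[of N i] by (auto intro!: B_measurable)
  show ?thesis unfolding SI_def simple_integral_def sgs_def by measurable
qed

text \<open>The \<open>k\<close>-th mesh is so fine that the first \<open>k\<close> dyadic times all have error at most \<open>2\<^sup>-\<^sup>k\<close>; the errors are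
  then summable, which makes the convergence almost sure and hence transferable to \<open>Q\<close>.\<close>

lemma SI_coord_AE:
  obtains N where "\<And>k::nat. k \<le> N k"
    and "\<And>t. t \<in> dyadics \<Longrightarrow> AE w in P0. (\<lambda>k. SI coord (N k) t w) \<longlonglongrightarrow> \<beta> t w - \<beta> 0 w"
proof -
  define e where "e N t = (\<integral>\<^sup>+w. ennreal ((SI coord N t w - (\<beta> t w - \<beta> 0 w))\<^sup>2) \<partial>P0)" for N t
  have "countable dyadics" by (simp add: dyadics_def)
  moreover have "dyadics \<noteq> {}" by (simp add: dyadics_def)
  ultimately obtain d :: "nat \<Rightarrow> real" where d: "range d = dyadics" by (metis range_from_nat_into)
  have "\<exists>N\<ge>k. \<forall>i\<in>{..k}. e N (d i) \<le> ennreal ((1/2) ^ k)" for k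
  proof -
    have "eventually (\<lambda>N. e N (d i) < ennreal ((1/2) ^ k)) sequentially" for i
      using d unfolding e_def by (intro order_tendstoD(2)[OF SI_coord_L2]) auto
    then have "eventually (\<lambda>N. \<forall>i\<in>{..k}. e N (d i) < ennreal ((1/2) ^ k)) sequentially"
      by (intro eventually_ball_finite) auto
    with eventually_ge_at_top[of k] have "eventually (\<lambda>N. k \<le> N \<and> (\<forall>i\<in>{..k}. e N (d i) \<le> ennreal ((1/2) ^ k))) sequentially"
      by eventually_elim (auto intro: less_imp_le)
    then show ?thesis using eventually_happens' sequentially_bot by blast
  qed
  then obtain N where N: "\<And>k. k \<le> N k" "\<And>k i. i \<le> k \<Longrightarrow> e (N k) (d i) \<le> ennreal ((1/2) ^ k)" by (metis atMost_iff)
  show ?thesis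
  proof (rule that[OF N(1)])
    fix t assume t: "t \<in> dyadics"
    then obtain i where i: "t = d i" using d by blast
    have "AE w in P0. (\<lambda>k. SI coord (N k) t w - (\<beta> t w - \<beta> 0 w)) \<longlonglongrightarrow> 0"
    proof (rule AE_tendsto_zero_of_summable)
      show "(\<lambda>w. SI coord (N k) t w - (\<beta> t w - \<beta> 0 w)) \<in> borel_measurable P0" for k
        using dyadics_pos[OF t] by (intro borel_measurable_diff SI_coord_measurable measurable_G_P[of t] \<beta>_measurable_filt) auto
      show "(\<integral>\<^sup>+w. ennreal ((SI coord (N k) t w - (\<beta> t w - \<beta> 0 w))\<^sup>2) \<partial>P0) \<le> ennreal ((1/2) ^ k)" if "i \<le> k" for k
        using N(2)[OF that] by (simp add: e_def i)
    qed
    then show "AE w in P0. (\<lambda>k. SI coord (N k) t w) \<longlonglongrightarrow> \<beta> t w - \<beta> 0 w"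
      by eventually_elim (simp add: LIM_zero_iff)
  qed
qed

end

lemma ennreal_mult_add_le:
  assumes "0 \<le> c" "0 \<le> x" "0 \<le> y" "0 \<le> z"
  shows ennreal_mult_add: "ennreal c * (ennreal x + ennreal y + ennreal z) = ennreal (c * (x + y + z))"
    and "a \<le> c * (x + y + z) \<Longrightarrow> ennreal a \<le> ennreal c * (ennreal x + ennreal y + ennreal z)"
proof -
  show "ennreal c * (ennreal x + ennreal y + ennreal z) = ennreal (c * (x + y + z))"
    using assms by (simp flip: ennreal_mult' ennreal_plus)
  then show "a \<le> c * (x + y + z) \<Longrightarrow> ennreal a \<le> ennreal c * (ennreal x + ennreal y + ennreal z)"
    by (simp add: ennreal_leI)
qed

lemma nn_integral_cmult_add3:
  fixes f g h :: "'a \<Rightarrow> ennreal"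
  assumes "f \<in> borel_measurable M" "g \<in> borel_measurable M" "h \<in> borel_measurable M"
  shows "(\<integral>\<^sup>+x. c * (f x + g x + h x) \<partial>M) = c * ((\<integral>\<^sup>+x. f x \<partial>M) + (\<integral>\<^sup>+x. g x \<partial>M) + (\<integral>\<^sup>+x. h x \<partial>M))"
  using assms by (simp add: nn_integral_cmult nn_integral_add)

context brownian
begin

lemma nn_increment_square: "0 \<le> p \<Longrightarrow> p < q \<Longrightarrow> (\<integral>\<^sup>+w. ennreal ((B q w - B p w)\<^sup>2) \<partial>P) = ennreal (q - p)"
  using increment_square[of p q] by (subst nn_integral_eq_integral) auto

lemma nn_fourth_moment: "0 < t \<Longrightarrow> (\<integral>\<^sup>+w. ennreal ((B t w) ^ 4) \<partial>P) = ennreal (3 * t\<^sup>2)"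
proof -
  assume t: "0 < t"
  have "(\<integral>\<^sup>+w. ennreal ((B t w) ^ 4) \<partial>P) = (\<integral>\<^sup>+w. ennreal ((B t w - B 0 w) ^ 4) \<partial>P)"
    by (intro nn_integral_cong_AE) (use B_zero in eventually_elim, simp)
  then show ?thesis
    using increment_integrable[OF order_refl t, of "\<lambda>x. x ^ 4"] gauss_power_integrable[of "t - 0" 4] gauss_power4[of "t - 0"] t
    by (subst (asm) nn_integral_eq_integral) auto
qed

end

text \<open>A limit that is only almost sure and along a dense set of times still determines the law of
  the increments; the fourth moments then upgrade it to convergence in \<open>L\<^sup>2\<close> at every time.\<close>

lemma brownian_limit:
  fixes S :: "nat \<Rightarrow> real \<Rightarrow> 'a \<Rightarrow> real"
  assumes S: "\<And>k. brownian_motion_wrt P G (S k)"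
    and Wm: "\<And>t. 0 \<le> t \<Longrightarrow> W t \<in> borel_measurable (G t)"
    and Wc: "\<And>w. w \<in> space P \<Longrightarrow> continuous_on {0..} (\<lambda>t. W t w)"
    and W0: "AE w in P. W 0 w = 0"
    and D: "\<And>t. 0 \<le> t \<Longrightarrow> \<exists>d. d \<longlonglongrightarrow> t \<and> (\<forall>n::nat. t < d n \<and> d n \<in> D)"
    and lim: "\<And>t. t \<in> D \<Longrightarrow> 0 < t \<Longrightarrow> AE w in P. (\<lambda>k. S k t w) \<longlonglongrightarrow> W t w"
  shows "brownian_motion_wrt P G W"
    and "0 \<le> t \<Longrightarrow> (\<lambda>k. \<integral>\<^sup>+w. ennreal ((S k t w - W t w)\<^sup>2) \<partial>P) \<longlonglongrightarrow> 0"
proof -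
  have Sk: "brownian P G (S k)" for k by unfold_locales (rule S)
  interpret S0: brownian P G "S 0" by (rule Sk)
  have Sm: "0 \<le> t \<Longrightarrow> S k t \<in> borel_measurable P" for k t by (rule brownian.B_measurable[OF Sk])
  have WP: "0 \<le> t \<Longrightarrow> W t \<in> borel_measurable P" for t by (rule S0.measurable_G_P[OF _ Wm])
  have dyad: "(CLINT w|P. indicator \<Gamma> w * iexp (u * (W q w - W p w))) = of_real (measure P \<Gamma>) * of_real (exp (- u\<^sup>2 * (q - p) / 2))"
    if pq: "p \<in> D" "q \<in> D" "0 < p" "p < q" and \<Gamma>: "\<Gamma> \<in> sets (G p)" for p q \<Gamma> u
  proof -
    have \<Gamma>P: "\<Gamma> \<in> sets P" using \<Gamma> S0.sets_G_subset[of p] pq by auto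
    have "AE w in P. (\<lambda>k. S k q w - S k p w) \<longlonglongrightarrow> W q w - W p w"
      using lim[OF pq(1,3)] lim[OF pq(2)] pq by (auto elim!: eventually_elim2 intro: tendsto_diff)
    then have "(\<lambda>k. CLINT w|P. indicator \<Gamma> w * iexp (u * (S k q w - S k p w))) \<longlonglongrightarrow> (CLINT w|P. indicator \<Gamma> w * iexp (u * (W q w - W p w)))"
      using pq \<Gamma>P by (intro S0.char_tendsto borel_measurable_diff Sm WP) auto
    then show ?thesis
      using brownian.increment_char[OF Sk _ pq(4) \<Gamma>] pq by (simp add: LIMSEQ_const_iff)
  qed
  show "brownian_motion_wrt P G W"
  proof (rule brownian_motion_from_char[OF S0.prob_space_axioms S0.filt S0.subalgebra_G Wm Wc W0])
    fix s t :: real and \<Gamma> u assume st: "0 \<le> s" "s < t" and \<Gamma>: "\<Gamma> \<in> sets (G s)"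
    obtain p where p: "p \<longlonglongrightarrow> s" "\<And>n::nat. s < p n \<and> p n \<in> D" using D[OF st(1)] by blast
    obtain q where q: "q \<longlonglongrightarrow> t" "\<And>n::nat. t < q n \<and> q n \<in> D" using D[of t] st by auto
    have pq0: "0 \<le> p n" "0 \<le> q n" for n using p(2)[of n] q(2)[of n] st by auto
    have W: "(\<lambda>n. W (r n) w) \<longlonglongrightarrow> W x w" if "r \<longlonglongrightarrow> x" "0 \<le> x" "\<And>n. 0 \<le> r n" "w \<in> space P" for r x w
      by (rule continuous_on_tendsto_compose[OF Wc[OF that(4)] that(1)]) (use that in auto)
    have "AE w in P. (\<lambda>n. W (q n) w - W (p n) w) \<longlonglongrightarrow> W t w - W s w"
      using st pq0 by (intro AE_I2 tendsto_diff W p q) auto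
    then have A: "(\<lambda>n. CLINT w|P. indicator \<Gamma> w * iexp (u * (W (q n) w - W (p n) w))) \<longlonglongrightarrow> (CLINT w|P. indicator \<Gamma> w * iexp (u * (W t w - W s w)))"
      using st pq0 S0.sets_G_subset[OF st(1)] \<Gamma> by (intro S0.char_tendsto borel_measurable_diff WP) auto
    have E: "eventually (\<lambda>n. of_real (measure P \<Gamma>) * of_real (exp (- u\<^sup>2 * (q n - p n) / 2)) = (CLINT w|P. indicator \<Gamma> w * iexp (u * (W (q n) w - W (p n) w)))) sequentially"
      using order_tendstoD(2)[OF p(1) st(2)]
    proof eventually_elim
      case (elim n)
      have "p n < q n" "0 < p n" using elim q(2)[of n] p(2)[of n] st by auto
      moreover have "\<Gamma> \<in> sets (G (p n))" using \<Gamma> S0.sets_G_mono[of s "p n"] p(2)[of n] by auto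
      ultimately show ?case using p(2) q(2) by (intro dyad[symmetric]) auto
    qed
    have C: "(\<lambda>n. complex_of_real (measure P \<Gamma>) * of_real (exp (- u\<^sup>2 * (q n - p n) / 2))) \<longlonglongrightarrow> of_real (measure P \<Gamma>) * of_real (exp (- u\<^sup>2 * (t - s) / 2))"
      by (intro tendsto_intros p q) auto
    have "(CLINT w|P. indicator \<Gamma> w * iexp (u * (W t w - W s w))) = of_real (measure P \<Gamma>) * of_real (exp (- u\<^sup>2 * (t - s) / 2))"
      by (rule LIMSEQ_unique[OF A Lim_transform_eventually[OF C E]])
    then show "(CLINT w|P. indicator \<Gamma> w * iexp (u * (W t w - W s w))) = of_real (exp (- u\<^sup>2 * (t - s) / 2) * measure P \<Gamma>)"
      by (simp only: of_real_mult mult.commute)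
  qed
  then interpret W: brownian P G W by unfold_locales
  have onD: "(\<lambda>k. \<integral>\<^sup>+w. ennreal ((S k q w - W q w)\<^sup>2) \<partial>P) \<longlonglongrightarrow> 0" if q: "q \<in> D" "0 < q" for q
  proof -
    define g where "g k w = (S k q w - W q w)\<^sup>2" for k w
    have [measurable]: "S k q \<in> borel_measurable P" "W q \<in> borel_measurable P" for k using q by (auto intro: Sm WP)
    have gm [measurable]: "g k \<in> borel_measurable P" for k unfolding g_def by measurable
    \<comment> \<open>g is itself a square. Gaussian fourth moments are 3 q^2, and (x - y)^4 <= 8
      (x^4 + y^4), which gives 8 times 6 q^2.\<close>
    have "(\<integral>\<^sup>+w. ennreal ((g k w)\<^sup>2) \<partial>P) \<le> ennreal (48 * q\<^sup>2)" for k
    proof -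
      have ineq: "((x - y)\<^sup>2)\<^sup>2 \<le> 8 * (x ^ 4 + y ^ 4)" for x y :: real
      proof -
        have "(x - y)\<^sup>2 \<le> 2 * (x\<^sup>2 + y\<^sup>2)" using zero_le_power2[of "x + y"] by (simp add: power2_eq_square algebra_simps)
        then have "((x - y)\<^sup>2)\<^sup>2 \<le> (2 * (x\<^sup>2 + y\<^sup>2))\<^sup>2" by (intro power_mono) auto
        also have "\<dots> \<le> 8 * (x ^ 4 + y ^ 4)" using zero_le_power2[of "x\<^sup>2 - y\<^sup>2"] by (simp add: power2_eq_square power4_eq_xxxx algebra_simps)
        finally show ?thesis .
      qed
      have "(\<integral>\<^sup>+w. ennreal ((g k w)\<^sup>2) \<partial>P) \<le> (\<integral>\<^sup>+w. ennreal 8 * (ennreal ((S k q w) ^ 4) + ennreal ((W q w) ^ 4)) \<partial>P)"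
        unfolding g_def by (intro nn_integral_mono ennreal_mult_add_le(2)[where z=0, simplified ennreal_0 add_0_right] ineq) auto
      also have "\<dots> = ennreal 8 * (ennreal (3 * q\<^sup>2) + ennreal (3 * q\<^sup>2))"
        using brownian.nn_fourth_moment[OF Sk q(2)] W.nn_fourth_moment[OF q(2)] q
        by (subst nn_integral_cmult, measurable, subst nn_integral_add, measurable)
      also have "\<dots> = ennreal (48 * q\<^sup>2)" using ennreal_mult_add[of 8 "3 * q\<^sup>2" "3 * q\<^sup>2" 0] by simp
      finally show ?thesis .
    qed
    moreover have "AE w in P. (\<lambda>k. g k w) \<longlonglongrightarrow> 0"
      using lim[OF q] unfolding g_def by eventually_elim (auto intro!: tendsto_eq_intros)
    ultimately have "(\<lambda>k. \<integral>w. \<bar>g k w - 0\<bar> \<partial>P) \<longlonglongrightarrow> 0" "\<And>k. integrable P (g k)"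
      using S0.L1_convergence_of_L2_bounded[of g "\<lambda>_. 0" "48 * q\<^sup>2"] gm by auto
    moreover from this have "(\<lambda>k. \<integral>w. g k w \<partial>P) \<longlonglongrightarrow> 0" by (simp add: g_def)
    from tendsto_ennrealI[OF this] have "(\<lambda>k. ennreal (\<integral>w. g k w \<partial>P)) \<longlonglongrightarrow> 0" by (simp only: ennreal_0)
    ultimately show ?thesis by (subst (asm) nn_integral_eq_integral[symmetric]) (auto simp: g_def)
  qed
  assume t: "0 \<le> t"
  show "(\<lambda>k. \<integral>\<^sup>+w. ennreal ((S k t w - W t w)\<^sup>2) \<partial>P) \<longlonglongrightarrow> 0"
  proof (rule order_tendstoI)
    fix a :: ennreal assume "0 < a"
    then have "\<exists>e>0. ennreal e \<le> a" by (cases a) (auto intro: exI[of _ 1])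
    then obtain e :: real where e: "0 < e" "ennreal e \<le> a" by blast
    obtain d where d: "d \<longlonglongrightarrow> t" "\<And>n::nat. t < d n \<and> d n \<in> D" using D[OF t] by blast
    \<comment> \<open>The error at t is at most 3 times the sum of the two increments over [t, q]
      and the error at q, each kept within e / 9.\<close>
    have "eventually (\<lambda>n. d n < t + e / 9) sequentially" using e by (intro order_tendstoD(2)[OF d(1)]) auto
    then obtain n where n: "d n < t + e / 9" using eventually_happens' sequentially_bot by blast
    define q where "q = d n"
    have q: "q \<in> D" "t < q" "q < t + e / 9" using d(2)[of n] n by (auto simp: q_def)
    have q0: "0 < q" using q t by simp
    have "eventually (\<lambda>k. (\<integral>\<^sup>+w. ennreal ((S k q w - W q w)\<^sup>2) \<partial>P) < ennreal (e / 9)) sequentially"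
      using e by (intro order_tendstoD(2)[OF onD[OF q(1) q0]]) auto
    then show "eventually (\<lambda>k. (\<integral>\<^sup>+w. ennreal ((S k t w - W t w)\<^sup>2) \<partial>P) < a) sequentially"
    proof eventually_elim
      case (elim k)
      have ineq: "(x - y)\<^sup>2 \<le> 3 * ((x' - x)\<^sup>2 + (x' - y')\<^sup>2 + (y' - y)\<^sup>2)" for x y x' y' :: real
      proof -
        define a b c where "a = x' - x" "b = x' - y'" "c = y' - y"
        have "x - y = b + c - a" by (simp add: a_b_c_def)
        moreover have "(b + c - a)\<^sup>2 \<le> 3 * (a\<^sup>2 + b\<^sup>2 + c\<^sup>2)"
          using zero_le_power2[of "a + b"] zero_le_power2[of "a + c"] zero_le_power2[of "b - c"]
          by (simp add: power2_eq_square algebra_simps)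
        ultimately show ?thesis by (simp add: a_b_c_def)
      qed
      have "(\<integral>\<^sup>+w. ennreal ((S k t w - W t w)\<^sup>2) \<partial>P) \<le> (\<integral>\<^sup>+w. ennreal 3 * (ennreal ((S k q w - S k t w)\<^sup>2) + ennreal ((S k q w - W q w)\<^sup>2) + ennreal ((W q w - W t w)\<^sup>2)) \<partial>P)"
        by (intro nn_integral_mono ennreal_mult_add_le(2) ineq) auto
      also have "\<dots> = ennreal 3 * (ennreal (q - t) + (\<integral>\<^sup>+w. ennreal ((S k q w - W q w)\<^sup>2) \<partial>P) + ennreal (q - t))"
        by (subst nn_integral_cmult_add3, (intro measurable_compose[OF _ measurable_ennreal] borel_measurable_power borel_measurable_diff Sm WP less_imp_le[OF q0] t)+)
          (simp only: W.nn_increment_square[OF t q(2)] brownian.nn_increment_square[OF Sk t q(2)])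
      also have "\<dots> \<le> ennreal 3 * (ennreal (q - t) + ennreal (e / 9) + ennreal (q - t))"
        using elim by (intro mult_left_mono add_mono) auto
      also have "\<dots> = ennreal (3 * ((q - t) + e / 9 + (q - t)))"
        using q e by (intro ennreal_mult_add) auto
      also have "\<dots> < ennreal e" using q e by (intro ennreal_lessI) auto
      finally show ?case using e(2) by (rule less_le_trans)
    qed
  qed simp
qed

section \<open>Sign integrals under Q and the second Brownian motion\<close>

context penalised
begin

text \<open>Signs sampled after t multiply vanishing increments, so only the path up to t enters;
  this permits the transfer to Q.\<close>

lemma SI_cong:
  assumes t: "0 \<le> t" and eq: "\<And>r. 0 \<le> r \<Longrightarrow> r \<le> t \<Longrightarrow> coord r w = coord r w'"
  shows "SI coord N t w = SI coord N t w'"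
  unfolding SI_def simple_integral_def
proof (intro sum.cong refl)
  fix i
  show "sgs N i w * (coord (min t (dy N (Suc i))) w - coord (min t (dy N i)) w) = sgs N i w' * (coord (min t (dy N (Suc i))) w' - coord (min t (dy N i)) w')"
  proof (cases "dy N i \<le> t")
    case True
    then show ?thesis using t dy_simps(2)[of N] by (simp add: sgs_def eq)
  next
    case False
    then have "min t (dy N i) = t" "min t (dy N (Suc i)) = t" using dy_simps(3)[of N i] by auto
    then show ?thesis by simp
  qed
qed

lemma SI_coord_AE_Q:
  obtains N where "\<And>k::nat. k \<le> N k"
    and "\<And>t. t \<in> dyadics \<Longrightarrow> AE w in Q. (\<lambda>k. SI coord (N k) t w) \<longlonglongrightarrow> \<beta> t w - \<beta> 0 w"
proof -
  obtain N where N: "\<And>k::nat. k \<le> N k" "\<And>t. t \<in> dyadics \<Longrightarrow> AE w in P0. (\<lambda>k. SI coord (N k) t w) \<longlonglongrightarrow> \<beta> t w - \<beta> 0 w"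
    using SI_coord_AE by blast
  show ?thesis
  proof (rule that[OF N(1)])
    fix t assume t: "t \<in> dyadics"
    have t0: "0 \<le> t" using dyadics_pos[OF t] by simp
    show "AE w in Q. (\<lambda>k. SI coord (N k) t w) \<longlonglongrightarrow> \<beta> t w - \<beta> 0 w"
    proof (rule transfer_AE[OF t0 N(2)[OF t]])
      fix w w' assume w: "w \<in> path_space" "w' \<in> path_space" "\<And>r. 0 \<le> r \<Longrightarrow> r \<le> t \<Longrightarrow> coord r w = coord r w'"
        and *: "(\<lambda>k. SI coord (N k) t w) \<longlonglongrightarrow> \<beta> t w - \<beta> 0 w"
      have "SI coord (N k) t w = SI coord (N k) t w'" for k by (rule SI_cong[OF t0 w(3)])
      moreover have "\<beta> r w = \<beta> r w'" if "0 \<le> r" "r \<le> t" for r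
        using w(3)[OF that] L_cong[OF w that] by (simp add: \<beta>_def)
      ultimately show "(\<lambda>k. SI coord (N k) t w') \<longlonglongrightarrow> \<beta> t w' - \<beta> 0 w'" using * t0 by simp
    qed
  qed
qed

text \<open>\<open>Bt\<close> differs from the path by an absolutely continuous process, against
  which a simple integral is the Lebesgue integral of the simple process times the density.\<close>

lemma SI_Bt_eq:
  assumes g: "good w" and t: "0 \<le> t"
  shows "SI Bt N t w = SI coord N t w + (LINT r:{0..t}|lborel. SP N r w * (sgn (coord r w) / (tm w - \<bar>coord r w\<bar>)))"
proof -
  define f where "f r = sgn (coord r w) / (tm w - \<bar>coord r w\<bar>)" for r
  define F where "F x = (LINT r:{0..x}|lborel. f r)" for x
  define a where "a i = min t (dy N i)" for i
  have Fi: "integrable lborel (\<lambda>r. indicator {0..x} r *\<^sub>R f r)" for x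
    using good_integrable(1)[OF g order_refl, of x] by (simp add: f_def set_integrable_def)
  have a: "0 \<le> a i" "a i \<le> a (Suc i)" for i using t dy_simps(2,3)[of N i] by (auto simp: a_def)
  have "(LINT r:{0..t}|lborel. SP N r w * f r) = (\<integral>r. (\<Sum>i<4 ^ N. sgs N i w * (indicator {0..a (Suc i)} r *\<^sub>R f r - indicator {0..a i} r *\<^sub>R f r)) \<partial>lborel)"
    unfolding set_lebesgue_integral_def
  proof (rule Bochner_Integration.integral_cong[OF refl])
    fix r :: real
    have "indicator {0..t} r * indicator {dy N i<..dy N (Suc i)} r = (indicator {0..a (Suc i)} r - indicator {0..a i} r :: real)" for i
      using a[of i] dy_simps(2,3)[of N i] t by (auto simp: a_def split: split_indicator)
    then have "indicator {0..t} r * SP N r w = (\<Sum>i<4 ^ N. sgs N i w * (indicator {0..a (Suc i)} r - indicator {0..a i} r))"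
      unfolding SP_def simple_process_def sum_distrib_left by (intro sum.cong refl) (simp add: mult.left_commute)
    then show "indicator {0..t} r *\<^sub>R (SP N r w * f r) = (\<Sum>i<4 ^ N. sgs N i w * (indicator {0..a (Suc i)} r *\<^sub>R f r - indicator {0..a i} r *\<^sub>R f r))"
      by (simp add: mult.assoc[symmetric] sum_distrib_right left_diff_distrib right_diff_distrib)
  qed
  also have "\<dots> = (\<Sum>i<4 ^ N. sgs N i w * (F (a (Suc i)) - F (a i)))"
    using Fi by (subst Bochner_Integration.integral_sum) (auto simp: F_def set_lebesgue_integral_def Bochner_Integration.integral_diff)
  finally have "(LINT r:{0..t}|lborel. SP N r w * f r) = (\<Sum>i<4 ^ N. sgs N i w * (F (a (Suc i)) - F (a i)))" .
  moreover have "Bt x w = coord x w + F x" for x using g by (simp add: Bt_def drift_def F_def f_def)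
  ultimately show ?thesis unfolding SI_def simple_integral_def
    by (simp add: f_def a_def sum.distrib[symmetric] algebra_simps)
qed

definition R :: "real \<Rightarrow> path \<Rightarrow> real" where
  "R t w = (LINT r:{0..t}|lborel. 1 / (tm w - \<bar>coord r w\<bar>))"

text \<open>Off the null set of zeros the limiting sign cancels the sign in the drift, which leaves
  the rate 1 / (tm - |X|).\<close>

lemma SP_integral_tendsto:
  assumes g: "good w" and nz: "AE r in lborel. 0 < r \<longrightarrow> coord r w \<noteq> 0" and t: "0 \<le> t"
  shows "(\<lambda>N. LINT r:{0..t}|lborel. SP N r w * (sgn (coord r w) / (tm w - \<bar>coord r w\<bar>))) \<longlonglongrightarrow> R t w"
proof -
  define f where "f r = sgn (coord r w) / (tm w - \<bar>coord r w\<bar>)" for r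
  have w: "w \<in> path_space" using g by (simp add: good_def)
  have fi: "integrable lborel (\<lambda>r. indicator {0..t} r *\<^sub>R f r)"
    using good_integrable(1)[OF g order_refl, of t] by (simp add: f_def set_integrable_def)
  have [measurable]: "(\<lambda>r. SP N r w) \<in> borel_measurable lborel" for N unfolding SP_def simple_process_def by measurable
  have fm: "(\<lambda>r. indicator {0..t} r *\<^sub>R f r) \<in> borel_measurable lborel" using fi by (rule borel_measurable_integrable)
  show ?thesis unfolding R_def set_lebesgue_integral_def f_def[symmetric]
  proof (rule integral_dominated_convergence[where w="\<lambda>r. norm (indicator {0..t} r *\<^sub>R f r)"])
    show "integrable lborel (\<lambda>r. norm (indicator {0..t} r *\<^sub>R f r))" using fi by (rule integrable_norm)
    show "(\<lambda>r. indicat_real {0..t} r *\<^sub>R (1 / (tm w - \<bar>coord r w\<bar>))) \<in> borel_measurable lborel"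
      using good_integrable(2)[OF g order_refl, of t] unfolding set_integrable_def by (rule borel_measurable_integrable)
    show "(\<lambda>r. indicat_real {0..t} r *\<^sub>R (SP N r w * f r)) \<in> borel_measurable lborel" for N
    proof -
      have "(\<lambda>r. SP N r w * (indicat_real {0..t} r *\<^sub>R f r)) \<in> borel_measurable lborel" using fm by measurable
      then show ?thesis by (simp add: mult.left_commute)
    qed
    show "AE r in lborel. norm (indicat_real {0..t} r *\<^sub>R (SP N r w * f r)) \<le> norm (indicat_real {0..t} r *\<^sub>R f r)" for N
      using SP_bound[of N _ w] by (intro AE_I2) (auto simp: abs_mult mult_left_le_one_le split: split_indicator)
    have "AE r in lborel. r \<noteq> (0::real)" by (rule AE_lborel_singleton)
    then show "AE r in lborel. (\<lambda>N. indicat_real {0..t} r *\<^sub>R (SP N r w * f r)) \<longlonglongrightarrow> indicat_real {0..t} r *\<^sub>R (1 / (tm w - \<bar>coord r w\<bar>))"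
      using nz
    proof eventually_elim
      case (elim r)
      show ?case
      proof (cases "r \<in> {0..t}")
        case True
        then have "(\<lambda>N. SP N r w * f r) \<longlonglongrightarrow> sgn (coord r w) * f r" using elim by (intro tendsto_intros SP_tendsto[OF w]) auto
        moreover have "sgn (coord r w) * f r = 1 / (tm w - \<bar>coord r w\<bar>)" using elim True by (simp add: f_def sgn_if)
        ultimately show ?thesis using True by simp
      qed simp
    qed
  qed
qed

text \<open>The asserted equation for the distance to the total maximum, solved for its Brownian
  part; what remains to be shown is that this is a Brownian motion and minus the stochastic
  integral.\<close>

definition Bh :: "real \<Rightarrow> path \<Rightarrow> real" where
  "Bh t w = (if good w then L t w - \<bar>coord t w\<bar> - R t w else 0)"

lemma SI_Bt_AE:
  obtains N where "\<And>k::nat. k \<le> N k"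
    and "\<And>t. t \<in> dyadics \<Longrightarrow> AE w in Q. (\<lambda>k. SI Bt (N k) t w) \<longlonglongrightarrow> - Bh t w"
proof -
  obtain N where N: "\<And>k::nat. k \<le> N k" "\<And>t. t \<in> dyadics \<Longrightarrow> AE w in Q. (\<lambda>k. SI coord (N k) t w) \<longlonglongrightarrow> \<beta> t w - \<beta> 0 w"
    using SI_coord_AE_Q by blast
  have "filterlim N sequentially sequentially"
    by (rule filterlim_at_top_mono[OF filterlim_ident]) (simp add: N(1))
  note sub = filterlim_compose[OF _ this]
  show ?thesis
  proof (rule that[OF N(1)])
    fix t assume t: "t \<in> dyadics"
    have t0: "0 \<le> t" using dyadics_pos[OF t] by simp
    show "AE w in Q. (\<lambda>k. SI Bt (N k) t w) \<longlonglongrightarrow> - Bh t w"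
      using N(2)[OF t] AE_good zero_set_null_Q
    proof eventually_elim
      case (elim w)
      have "(\<lambda>k. SI Bt (N k) t w) \<longlonglongrightarrow> (\<beta> t w - \<beta> 0 w) + R t w"
        unfolding SI_Bt_eq[OF elim(2) t0] using sub[OF SP_integral_tendsto[OF elim(2,3) t0]] by (intro tendsto_add elim(1))
      moreover have "(\<beta> t w - \<beta> 0 w) + R t w = - Bh t w" using elim(2) by (simp add: Bh_def \<beta>_def good_def)
      ultimately show ?case by simp
    qed
  qed
qed

lemma Bh_continuous: "continuous_on {0..} (\<lambda>t. Bh t w)"
proof (cases "good w")
  case True
  then have "continuous_on {0..} (\<lambda>t. L t w)" "w \<in> path_space" by (auto simp: good_def)
  then show ?thesis unfolding Bh_def R_def using True
    by (simp, intro continuous_on_diff continuous_on_rabs path_continuous continuous_set_integral good_integrable order_refl)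
qed (simp add: Bh_def)

lemma Bh_zero: "good w \<Longrightarrow> Bh 0 w = 0"
  using good_integrable(2)[of w 0 0] by (simp add: Bh_def R_def good_def set_borel_integral_eq_integral)

text \<open>Dominated convergence twice, in time for almost every path and then over the
  paths.\<close>

lemma SP_L2:
  assumes t: "0 \<le> t"
  shows "(\<lambda>N. \<integral>\<^sup>+w. (\<integral>\<^sup>+s\<in>{0..t}. ennreal ((SP N s w - sgn (coord s w))\<^sup>2) \<partial>lborel) \<partial>Q) \<longlonglongrightarrow> 0"
proof -
  define J where "J N w = (\<integral>\<^sup>+s\<in>{0..t}. ennreal ((SP N s w - sgn (coord s w))\<^sup>2) \<partial>lborel)" for N w
  \<comment> \<open>Two numbers between -1 and 1 differ by at most 2, hence the constant 4.\<close>
  have bd: "ennreal ((SP N s w - sgn (coord s w))\<^sup>2) * indicator {0..t} s \<le> 4 * indicator {0..t} s" for N s w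
  proof -
    have "\<bar>SP N s w - sgn (coord s w)\<bar> \<le> 2" using SP_bound[of N s w] by (auto simp: sgn_if)
    then have "\<bar>SP N s w - sgn (coord s w)\<bar>\<^sup>2 \<le> 2\<^sup>2" by (intro power_mono) auto
    then have "ennreal ((SP N s w - sgn (coord s w))\<^sup>2) \<le> ennreal 4" by (intro ennreal_leI) simp
    then show ?thesis by (intro mult_right_mono) auto
  qed
  have c: "(\<integral>\<^sup>+s. 4 * indicator {0..t} s \<partial>lborel) = ennreal (4 * t)"
    using t by (subst nn_integral_cmult_indicator) (auto simp: ennreal_mult)
  have joint: "(\<lambda>z. ennreal ((SP N (snd z) (fst z) - sgn (coord (max 0 (min (snd z) t)) (fst z)))\<^sup>2) * indicator {0..t} (snd z)) \<in> borel_measurable (Q \<Otimes>\<^sub>M lborel)" for N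
  proof -
    have "(\<lambda>z. (snd z, fst z)) \<in> measurable (Q \<Otimes>\<^sub>M lborel) (borel \<Otimes>\<^sub>M \<F> t)"
      by (intro measurable_Pair measurable_compose[OF measurable_fst] measurable_filt_Q[OF t]) auto
    from measurable_compose[OF this measurable_coord_joint[OF t]]
    have [measurable]: "(\<lambda>z. coord (max 0 (min (snd z) t)) (fst z)) \<in> borel_measurable (Q \<Otimes>\<^sub>M lborel)" by (simp add: split_beta')
    have [measurable]: "coord (dy N i) \<in> borel_measurable Q" for i
      by (rule measurable_filt_Q[OF dy_simps(2) measurable_coord_filt[OF dy_simps(2) order_refl]])
    show ?thesis unfolding SP_def simple_process_def sgs_def by measurable
  qed
  have Jm: "J N \<in> borel_measurable Q" for N
  proof -
    have "J N w = (\<integral>\<^sup>+s. ennreal ((SP N s w - sgn (coord (max 0 (min s t)) w))\<^sup>2) * indicator {0..t} s \<partial>lborel)" for w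
      unfolding J_def by (intro nn_integral_cong) (auto split: split_indicator)
    then show ?thesis using lborel.borel_measurable_nn_integral_fst[OF joint[of N]] by (simp add: J_def[abs_def])
  qed
  have "(\<lambda>N. \<integral>\<^sup>+w. J N w \<partial>Q) \<longlonglongrightarrow> (\<integral>\<^sup>+w. 0 \<partial>Q)"
  proof (rule nn_integral_dominated_convergence[where w="\<lambda>_. ennreal (4 * t)", OF Jm])
    show "(\<integral>\<^sup>+w. ennreal (4 * t) \<partial>Q) < \<infinity>" using Q.emeasure_space_1 by simp
    show "AE w in Q. J N w \<le> ennreal (4 * t)" for N
      unfolding J_def c[symmetric] using bd by (intro AE_I2 nn_integral_mono) auto
    show "AE w in Q. (\<lambda>N. J N w) \<longlonglongrightarrow> 0"
      using AE_good zero_set_null_Q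
    proof eventually_elim
      case (elim w)
      then have w: "w \<in> path_space" by (simp add: good_def)
      have [measurable]: "(\<lambda>r. coord (max 0 r) w) \<in> borel_measurable borel" by (rule path_measurable[OF w])
      have "(\<lambda>N. J N w) \<longlonglongrightarrow> (\<integral>\<^sup>+s. 0 \<partial>(lborel :: real measure))" unfolding J_def
      proof (rule nn_integral_dominated_convergence[where w="\<lambda>s. 4 * indicator {0..t} s"])
        have "(\<lambda>s. ennreal ((SP N s w - sgn (coord (max 0 s) w))\<^sup>2) * indicator {0..t} s) \<in> borel_measurable lborel" for N
          unfolding SP_def simple_process_def by measurable
        moreover have "ennreal ((SP N s w - sgn (coord (max 0 s) w))\<^sup>2) * indicator {0..t} s = ennreal ((SP N s w - sgn (coord s w))\<^sup>2) * indicator {0..t} s" for N s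
          by (auto simp: max_def split: split_indicator)
        ultimately show "(\<lambda>s. ennreal ((SP N s w - sgn (coord s w))\<^sup>2) * indicator {0..t} s) \<in> borel_measurable lborel" for N by simp
        show "AE s in lborel. ennreal ((SP N s w - sgn (coord s w))\<^sup>2) * indicator {0..t} s \<le> 4 * indicator {0..t} s" for N
          using bd by simp
        show "(\<integral>\<^sup>+s. 4 * indicator {0..t} s \<partial>lborel) < \<infinity>" unfolding c by simp
        have "AE s in lborel. s \<noteq> (0::real)" by (rule AE_lborel_singleton)
        then show "AE s in lborel. (\<lambda>N. ennreal ((SP N s w - sgn (coord s w))\<^sup>2) * indicator {0..t} s) \<longlonglongrightarrow> 0"
          using elim(2)
        proof eventually_elim
          case (elim s)
          show ?case
          proof (cases "s \<in> {0..t}")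
            case True
            then have "(\<lambda>N. SP N s w) \<longlonglongrightarrow> sgn (coord s w)" using elim by (intro SP_tendsto[OF w]) auto
            then have "(\<lambda>N. (SP N s w - sgn (coord s w))\<^sup>2) \<longlonglongrightarrow> 0" by (auto intro!: tendsto_eq_intros)
            then have "(\<lambda>N. ennreal ((SP N s w - sgn (coord s w))\<^sup>2)) \<longlonglongrightarrow> ennreal 0" by (rule tendsto_ennrealI)
            then show ?thesis using True by simp
          qed simp
        qed
      qed measurable
      then show ?case by simp
    qed
  qed (rule borel_measurable_const)+
  then show ?thesis by (simp add: J_def)
qed

end

context enlarged
begin

lemma Bh_measurable: "0 \<le> t \<Longrightarrow> Bh t \<in> borel_measurable (G t)"
proof -
  assume t: "0 \<le> t"
  have "(\<lambda>z. L t (fst z) - \<bar>coord t (fst z)\<bar> - (LINT r:{0..t}|lborel. 1 / (snd z - \<bar>coord r (fst z)\<bar>))) \<in> borel_measurable (\<F> t \<Otimes>\<^sub>M borel)"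
    using t by (intro borel_measurable_diff borel_measurable_abs path_integral_measurable measurable_compose[OF measurable_fst measurable_coord_filt]
        measurable_compose[OF measurable_fst L_measurable_filt]) auto
  from measurable_compose[OF tm_pair_EG[OF t] this]
  have "(\<lambda>w. L t w - \<bar>coord t w\<bar> - R t w) \<in> borel_measurable (G t)" by (simp add: R_def)
  then show ?thesis
    by (rule measurable_EG_AE[OF t]) (use AE_good in \<open>auto elim!: eventually_mono simp: Bh_def\<close>)
qed

lemma sgn_coord_progressive:
  assumes t: "0 \<le> t"
  shows "(\<lambda>(s, w). sgn (coord s w)) \<in> borel_measurable (restrict_space borel {0..t} \<Otimes>\<^sub>M G t)"
proof -
  have "(\<lambda>z. (fst z, snd z)) \<in> measurable (restrict_space borel {0..t} \<Otimes>\<^sub>M G t) (borel \<Otimes>\<^sub>M \<F> t)"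
    by (intro measurable_Pair measurable_compose[OF measurable_fst] measurable_compose[OF measurable_snd]
        measurable_filt_EG[OF t] measurable_restrict_space1) auto
  from measurable_compose[OF this measurable_coord_joint[OF t]]
  have [measurable]: "(\<lambda>z. coord (max 0 (min (fst z) t)) (snd z)) \<in> borel_measurable (restrict_space borel {0..t} \<Otimes>\<^sub>M G t)" by simp
  have "(\<lambda>z. sgn (coord (max 0 (min (fst z) t)) (snd z))) \<in> borel_measurable (restrict_space borel {0..t} \<Otimes>\<^sub>M G t)" by measurable
  then show ?thesis
    by (rule measurable_cong[THEN iffD1, rotated]) (auto simp: space_pair_measure space_restrict_space)
qed

text \<open>The sign integrals of \<open>Bt\<close> are Brownian motions converging to - Bh almost
  surely at dyadic times. \<open>brownian_limit\<close> then yields both the law of - Bh and the L^2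
  convergence that \<open>is_ito_integral\<close> asks for.\<close>

lemma Bh_ito:
  shows "brownian_motion_wrt (completion Q) G Bh"
    and "is_ito_integral (completion Q) G Bt (\<lambda>s w. sgn (coord s w)) (\<lambda>t w. - Bh t w)"
proof -
  interpret B: brownian "completion Q" G Bt by unfold_locales (rule Bt_brownian)
  obtain N where N: "\<And>k::nat. k \<le> N k" "\<And>t. t \<in> dyadics \<Longrightarrow> AE w in Q. (\<lambda>k. SI Bt (N k) t w) \<longlonglongrightarrow> - Bh t w"
    by (rule SI_Bt_AE) (rule that)
  have sgs: "sgs n i \<in> borel_measurable (G (dy n i))" for n i
    using measurable_compose[OF measurable_filt_EG[OF dy_simps(2) measurable_coord_filt[OF dy_simps(2) order_refl]] sg_measurable]
    by (simp add: sgs_def[abs_def])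
  \<comment> \<open>Continued with coefficient 1 beyond the last node 2^(N k), as in
    \<open>sign_integral_brownian\<close>; at a fixed time this continuation contributes 0 for large
    k.\<close>
  define S where "S k t w = Bt 0 w + simple_integral Bt (4 ^ N k) (dy (N k)) (sgs (N k)) t w + (Bt t w - Bt (min t (dy (N k) (4 ^ N k))) w)" for k t w
  have S: "brownian_motion_wrt (completion Q) G (S k)" for k
    unfolding S_def by (rule B.sign_integral_brownian) (simp_all add: dy_simps sgs, simp add: sgs_def)
  have Bt0: "Bt 0 w = 0" for w by (cases "good w") (simp_all add: Bt_zero, simp add: Bt_def)
  have SI: "eventually (\<lambda>k. \<forall>w. S k t w = SI Bt (N k) t w) sequentially" for t
  proof -
    obtain J where J: "t < 2 ^ J" using real_arch_pow[of 2 t] by auto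
    show ?thesis using eventually_ge_at_top[of J]
    proof eventually_elim
      case (elim k)
      have "(2::real) ^ J \<le> 2 ^ N k" using elim N(1)[of k] by (intro power_increasing) auto
      then have "t \<le> dy (N k) (4 ^ N k)" unfolding dy_simps using J by linarith
      then show ?case by (simp add: S_def SI_def Bt0)
    qed
  qed
  have lim: "AE w in completion Q. (\<lambda>k. S k t w) \<longlonglongrightarrow> - Bh t w" if t: "t \<in> dyadics" "0 < t" for t
  proof (rule AE_completion)
    show "AE w in Q. (\<lambda>k. S k t w) \<longlonglongrightarrow> - Bh t w"
      using N(2)[OF t(1)]
    proof eventually_elim
      case (elim w)
      show ?case by (rule Lim_transform_eventually[OF elim]) (use SI[of t] in \<open>auto elim!: eventually_mono\<close>)
    qed
  qed
  have Wm: "0 \<le> t \<Longrightarrow> (\<lambda>w. - Bh t w) \<in> borel_measurable (G t)" for t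
    by (intro borel_measurable_uminus Bh_measurable)
  have Wc: "continuous_on {0..} (\<lambda>t. - Bh t w)" for w by (intro continuous_on_minus Bh_continuous)
  have W0: "AE w in completion Q. - Bh 0 w = 0"
    by (rule AE_completion) (use AE_good in \<open>auto elim!: eventually_mono simp: Bh_zero\<close>)
  have W1: "brownian_motion_wrt (completion Q) G (\<lambda>t w. - Bh t w)"
    by (rule brownian_limit(1)[OF S Wm Wc W0 dyadics_dense lim])
  have W2: "(\<lambda>k. \<integral>\<^sup>+w. ennreal ((S k t w - - Bh t w)\<^sup>2) \<partial>completion Q) \<longlonglongrightarrow> 0" if "0 \<le> t" for t
    by (rule brownian_limit(2)[OF S Wm Wc W0 dyadics_dense lim that])
  interpret W: brownian "completion Q" G "\<lambda>t w. - Bh t w" by unfold_locales (rule W1)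
  \<comment> \<open>Flipping by the constant sign -1 from time 0 on turns - Bh into Bh.\<close>
  show "brownian_motion_wrt (completion Q) G Bh"
    by (rule W.flip[of 0 "\<lambda>_. - 1"]) (use Bh_zero in \<open>auto simp: Bh_def\<close>)
  show "is_ito_integral (completion Q) G Bt (\<lambda>s w. sgn (coord s w)) (\<lambda>t w. - Bh t w)"
    unfolding is_ito_integral_def
  proof (intro conjI allI impI ballI)
    fix t :: real assume t: "0 \<le> t"
    have "(\<integral>\<^sup>+w. (\<integral>\<^sup>+s\<in>{0..t}. ennreal ((sgn (coord s w))\<^sup>2) \<partial>lborel) \<partial>Q) \<le> (\<integral>\<^sup>+w. (\<integral>\<^sup>+s\<in>{0..t}. 1 \<partial>lborel) \<partial>Q)"
      by (intro nn_integral_mono mult_right_mono) (auto simp: sgn_if)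
    also have "\<dots> < \<infinity>" using t Q.emeasure_space_1 by simp
    finally show "(\<integral>\<^sup>+w. (\<integral>\<^sup>+s\<in>{0..t}. ennreal ((sgn (coord s w))\<^sup>2) \<partial>lborel) \<partial>completion Q) < \<infinity>"
      by (simp add: nn_integral_completion)
  next
    have sub: "filterlim N sequentially sequentially"
      by (rule filterlim_at_top_mono[OF filterlim_ident]) (simp add: N(1))
    have "simple_data G (4 ^ N k) (dy (N k)) (sgs (N k))" for k
      unfolding simple_data_def using sgs by (auto simp: dy_simps sgs_def intro!: exI[of _ 1])
    moreover have "(\<lambda>k. \<integral>\<^sup>+w. (\<integral>\<^sup>+s\<in>{0..t}. ennreal ((simple_process (4 ^ N k) (dy (N k)) (sgs (N k)) s w - sgn (coord s w))\<^sup>2) \<partial>lborel) \<partial>completion Q) \<longlonglongrightarrow> 0"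
      if "0 \<le> t" for t
      using filterlim_compose[OF SP_L2[OF that] sub] by (simp add: nn_integral_completion SP_def)
    moreover have "(\<lambda>k. \<integral>\<^sup>+w. ennreal ((simple_integral Bt (4 ^ N k) (dy (N k)) (sgs (N k)) t w - - Bh t w)\<^sup>2) \<partial>completion Q) \<longlonglongrightarrow> 0"
      if "0 \<le> t" for t
      by (rule Lim_transform_eventually[OF W2[OF that]]) (use SI[of t] in eventually_elim, simp add: SI_def)
    ultimately show "\<exists>n \<tau> \<xi>. (\<forall>k. simple_data G (n k) (\<tau> k) (\<xi> k)) \<and>
        (\<forall>t\<ge>0. (\<lambda>k. \<integral>\<^sup>+w. (\<integral>\<^sup>+s\<in>{0..t}. ennreal ((simple_process (n k) (\<tau> k) (\<xi> k) s w - sgn (coord s w))\<^sup>2) \<partial>lborel) \<partial>completion Q) \<longlonglongrightarrow> 0 \<and>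
           (\<lambda>k. \<integral>\<^sup>+w. ennreal ((simple_integral Bt (n k) (\<tau> k) (\<xi> k) t w - - Bh t w)\<^sup>2) \<partial>completion Q) \<longlonglongrightarrow> 0)"
      by (intro exI[of _ "\<lambda>k. 4 ^ N k"] exI[of _ "\<lambda>k. dy (N k)"] exI[of _ "\<lambda>k. sgs (N k)"]) simp
  qed (use Bt_brownian sgn_coord_progressive Wm Wc in auto)
qed

end

theorem theorem4p9:
  fixes P0 Q :: "path measure" and L :: "real \<Rightarrow> path \<Rightarrow> real"
    and \<alpha> :: real and \<nu> :: "real measure"
  assumes P0: "is_wiener_measure P0"
    and L: "is_local_time_0 P0 L"
    and \<alpha>: "\<alpha> > 0"
    and \<nu>: "prob_space \<nu>" "sets \<nu> = sets borel" "AE a in \<nu>. \<alpha> \<le> a"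
    and Q: "prob_space Q" "sets Q = sets canon_alg"
      "\<forall>t\<ge>0. \<forall>\<Gamma>\<in>sets (canon_filt t).
         measure Q \<Gamma> = (\<integral>\<omega>. indicator \<Gamma> \<omega> * density_process L \<nu> t \<omega> \<partial>P0)"
  shows
    "(AE \<omega> in Q. filterlim (\<lambda>t. L t \<omega>) at_top at_top) \<and>
     total_max \<in> borel_measurable Q \<and>
     (AE \<omega> in Q. total_max \<omega> < \<infinity>) \<and>
     distr Q borel (\<lambda>\<omega>. real_of_ereal (total_max \<omega>)) = \<nu> \<and>
     (\<forall>t>0. AE \<omega> in Q. ereal \<bar>coord t \<omega>\<bar> < total_max \<omega>) \<and>
     (\<forall>G. is_enlarged_filtration Q G \<longrightarrow>
      (\<exists>Bt. brownian_motion_wrt (completion Q) G Bt \<and>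
        (AE \<omega> in Q. \<forall>t\<ge>0.
           set_integrable lborel {0..t}
             (\<lambda>s. sgn (coord s \<omega>) / (real_of_ereal (total_max \<omega>) - \<bar>coord s \<omega>\<bar>)) \<and>
           coord t \<omega> = Bt t \<omega> -
             (LINT s:{0..t}|lborel.
                sgn (coord s \<omega>) / (real_of_ereal (total_max \<omega>) - \<bar>coord s \<omega>\<bar>))) \<and>
        (\<exists>Bh. brownian_motion_wrt (completion Q) G Bh \<and>
          is_ito_integral (completion Q) G Bt (\<lambda>s \<omega>. sgn (coord s \<omega>)) (\<lambda>t \<omega>. - Bh t \<omega>) \<and>
          (AE \<omega> in Q. \<forall>t\<ge>0.
             set_integrable lborel {0..t}
               (\<lambda>s. 1 / (real_of_ereal (total_max \<omega>) - \<bar>coord s \<omega>\<bar>)) \<and>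
             real_of_ereal (total_max \<omega>) - \<bar>coord t \<omega>\<bar> =
               real_of_ereal (total_max \<omega>) + Bh t \<omega> +
               (LINT s:{0..t}|lborel. 1 / (real_of_ereal (total_max \<omega>) - \<bar>coord s \<omega>\<bar>)) -
               L t \<omega>))))"
proof -
  interpret penalised P0 L \<alpha> \<nu> Q
    by (intro penalised.intro penalised_axioms.intro local_time.intro local_time_axioms.intro wiener.intro
        P0 L \<alpha> \<nu> Q(1,2) Q(3)[rule_format])
  show ?thesis
  proof (intro conjI allI impI, goal_cases)
    case 2
    show ?case using measurable_total_max by simp
  next
    case 4
    show ?case using distr_tm by (simp add: tm_def[abs_def])
  next
    case (5 t)
    show ?case using AE_good
    proof eventually_elim
      case (elim w)
      obtain b where b: "b < tm w" "\<And>r. r \<in> {0..t} \<Longrightarrow> \<bar>coord r w\<bar> \<le> b" using good_bound[OF elim, of t] by blast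
      have "\<bar>coord t w\<bar> < tm w" using b(1) b(2)[of t] 5 by simp
      then show ?case using elim unfolding tm_def good_def by (cases "total_max w") auto
    qed
  next
    case (6 G)
    then interpret enlarged P0 L \<alpha> \<nu> Q G by unfold_locales
    have AE1: "AE w in Q. \<forall>t\<ge>0. set_integrable lborel {0..t} (\<lambda>s. sgn (coord s w) / (tm w - \<bar>coord s w\<bar>)) \<and>
           coord t w = Bt t w - (LINT s:{0..t}|lborel. sgn (coord s w) / (tm w - \<bar>coord s w\<bar>))"
        using AE_good by eventually_elim (simp add: good_integrable Bt_def drift_def)
    have AE2: "AE w in Q. \<forall>t\<ge>0. set_integrable lborel {0..t} (\<lambda>s. 1 / (tm w - \<bar>coord s w\<bar>)) \<and>
           tm w - \<bar>coord t w\<bar> = tm w + Bh t w + (LINT s:{0..t}|lborel. 1 / (tm w - \<bar>coord s w\<bar>)) - L t w"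
        using AE_good by eventually_elim (simp add: good_integrable Bh_def R_def)
    show ?case unfolding tm_def[symmetric]
      by (rule exI[of _ Bt], intro conjI Bt_brownian AE1 exI[of _ Bh] Bh_ito AE2)
  qed (rule local_time_infinite total_max_finite)+
qed

end
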